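(* Let $V$ be an $\mathrm{FI}$-module over a commutative ring $\Bbbk$ which is generated in degree $\leqslant k$ and related in degree $\leqslant d$ for some $k,d\in\mathbb{Z}_+$. If $V$ is not $F$-acyclic, then $$\mathrm{hd}_1(V)<\mathrm{hd}_2(V)<\mathrm{hd}_3(V)<\cdots.$$
   Context: $\Bbbk$ is a commutative ring and $\mathbb{Z}_+$ is the set of non-negative integers. $\mathrm{FI}$ is the category whose objects are finite sets and whose morphisms are injective maps. An $\mathrm{FI}$-module is a functor $V$ from $\mathrm{FI}$ to the category of $\Bbbk$-modules; write $V_X$ for $V(X)$ and $f_*$ for the map induced by an injection $f$. FI-modules form an abelian category (exactness computed objectwise); "projective" means projective object in this category. For $n\in\mathbb{Z}_+$, $\mathbf{n}=\{1,\ldots,n\}$ ($\mathbf 0=\emptyset$). The supremum of an empty set is $-\infty$. FI-homology: for an $\mathrm{FI}$-module $V$, let $(JV)_X\subset V_X$ be the span of the images of $f_*:V_Y\to V_X$ for all injections $f:Y\to X$ with $|Y|<|X|$; $F(V):=V/JV$ is a right exact functor on $\mathrm{FI}$-modules, and $H_a$ ($a\in\mathbb{Z}_+$) is its $a$-th left derived functor. $V$ is $F$-acyclic if $H_a(V)=0$ for every $a\geqslant1$. Degrees: $\deg(V):=\sup\{n\in\mathbb{Z}_+\mid V_{\mathbf n}\neq0\}$; $\mathrm{hd}_a(V):=\deg H_a(V)$. $V$ is generated in degree $\leqslant k$ if $\mathrm{hd}_0(V)\leqslant k$. $V$ is generated in degree $\leqslant k$ and related in degree $\leqslant d$ if there is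 a short exact sequence $0\to W\to P\to V\to0$ of $\mathrm{FI}$-modules where $P$ is projective and generated in degree $\leqslant k$ and $W$ is generated in degree $\leqslant d$. *)

theory Defs
  imports "HOL-Algebra.Module" "HOL-Algebra.AbelCoset" "HOL-Library.FuncSet" "HOL-Library.Extended_Real"
begin

section \<open>Modules over a commutative ring\<close>

definition module_hom ::
    "('k, 'r) ring_scheme \<Rightarrow> ('k, 'a) module \<Rightarrow> ('k, 'b) module \<Rightarrow> ('a \<Rightarrow> 'b) \<Rightarrow> bool" where
  "module_hom R M N h \<longleftrightarrow>
     h \<in> carrier M \<rightarrow> carrier N \<and>
     (\<forall>x\<in>carrier M. \<forall>y\<in>carrier M. h (x \<oplus>\<^bsub>M\<^esub> y) = h x \<oplus>\<^bsub>N\<^esub> h y) \<and>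
     (\<forall>c\<in>carrier R. \<forall>x\<in>carrier M. h (c \<odot>\<^bsub>M\<^esub> x) = c \<odot>\<^bsub>N\<^esub> h x)"

definition module_span ::
    "('k, 'r) ring_scheme \<Rightarrow> ('k, 'a) module \<Rightarrow> 'a set \<Rightarrow> 'a set" where
  "module_span R M S = \<Inter>{H. submodule H R M \<and> S \<subseteq> H}"

text \<open>
  The quotient of a module by a submodule, with cosets as elements. The record type
  \<^typ>\<open>('k, 'a) module\<close> extends rings, but the locale \<^locale>\<open>Module.module\<close> ignores the
  fields \<^const>\<open>mult\<close> and \<^const>\<open>one\<close>, so they are left unspecified.
\<close>

definition module_quot :: "('k, 'a) module \<Rightarrow> 'a set \<Rightarrow> ('k, 'a set) module" where
  "module_quot M H =
     \<lparr>carrier = a_rcosets\<^bsub>M\<^esub> H, mult = undefined, one = undefined,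
      zero = H, add = set_add M, smult = (\<lambda>c A. \<Union>x\<in>A. H +>\<^bsub>M\<^esub> (c \<odot>\<^bsub>M\<^esub> x))\<rparr>"


section \<open>The category FI and FI-modules\<close>

text \<open>
  The objects of FI are the finite sets of natural numbers; every finite set is isomorphic to
  one of these. Morphisms are extensional functions, so that equal maps are equal in HOL.
\<close>

definition FI_mor :: "nat set \<Rightarrow> nat set \<Rightarrow> (nat \<Rightarrow> nat) set" where
  "FI_mor X Y = {f \<in> X \<rightarrow>\<^sub>E Y. inj_on f X}"

record ('k, 'a) fi_mod =
  obj :: "nat set \<Rightarrow> ('k, 'a) module"
  mor :: "nat set \<Rightarrow> nat set \<Rightarrow> (nat \<Rightarrow> nat) \<Rightarrow> 'a \<Rightarrow> 'a"

definition fi_module :: "('k, 'r) ring_scheme \<Rightarrow> ('k, 'a) fi_mod \<Rightarrow> bool" where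
  "fi_module R V \<longleftrightarrow>
     (\<forall>X. finite X \<longrightarrow> Module.module R (obj V X)) \<and>
     (\<forall>X Y f. finite X \<and> finite Y \<and> f \<in> FI_mor X Y \<longrightarrow>
        module_hom R (obj V X) (obj V Y) (mor V X Y f)) \<and>
     (\<forall>X. finite X \<longrightarrow> (\<forall>v\<in>carrier (obj V X). mor V X X (restrict id X) v = v)) \<and>
     (\<forall>X Y Z f g. finite X \<and> finite Y \<and> finite Z \<and> f \<in> FI_mor X Y \<and> g \<in> FI_mor Y Z \<longrightarrow>
        (\<forall>v\<in>carrier (obj V X).
           mor V X Z (compose X g f) v = mor V Y Z g (mor V X Y f v)))"

text \<open>Morphisms of FI-modules, that is, natural transformations.\<close>

definition fi_map ::
    "('k, 'r) ring_scheme \<Rightarrow> ('k, 'a) fi_mod \<Rightarrow> ('k, 'b) fi_mod \<Rightarrow> (nat set \<Rightarrow> 'a \<Rightarrow> 'b) \<Rightarrow> bool" where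
  "fi_map R V W \<phi> \<longleftrightarrow>
     (\<forall>X. finite X \<longrightarrow> module_hom R (obj V X) (obj W X) (\<phi> X)) \<and>
     (\<forall>X Y f. finite X \<and> finite Y \<and> f \<in> FI_mor X Y \<longrightarrow>
        (\<forall>v\<in>carrier (obj V X). \<phi> Y (mor V X Y f v) = mor W X Y f (\<phi> X v)))"

definition fi_ker ::
    "('k, 'a) fi_mod \<Rightarrow> ('k, 'b) fi_mod \<Rightarrow> (nat set \<Rightarrow> 'a \<Rightarrow> 'b) \<Rightarrow> nat set \<Rightarrow> 'a set" where
  "fi_ker V W \<phi> X = a_kernel (obj V X) (obj W X) (\<phi> X)"

definition fi_im :: "('k, 'a) fi_mod \<Rightarrow> (nat set \<Rightarrow> 'a \<Rightarrow> 'b) \<Rightarrow> nat set \<Rightarrow> 'b set" where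
  "fi_im V \<phi> X = \<phi> X ` carrier (obj V X)"

definition fi_inj :: "('k, 'a) fi_mod \<Rightarrow> (nat set \<Rightarrow> 'a \<Rightarrow> 'b) \<Rightarrow> bool" where
  "fi_inj V \<phi> \<longleftrightarrow> (\<forall>X. finite X \<longrightarrow> inj_on (\<phi> X) (carrier (obj V X)))"

definition fi_surj ::
    "('k, 'a) fi_mod \<Rightarrow> ('k, 'b) fi_mod \<Rightarrow> (nat set \<Rightarrow> 'a \<Rightarrow> 'b) \<Rightarrow> bool" where
  "fi_surj V W \<phi> \<longleftrightarrow> (\<forall>X. finite X \<longrightarrow> fi_im V \<phi> X = carrier (obj W X))"

definition fi_exact ::
    "('k, 'a) fi_mod \<Rightarrow> ('k, 'b) fi_mod \<Rightarrow> ('k, 'c) fi_mod \<Rightarrow>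
     (nat set \<Rightarrow> 'a \<Rightarrow> 'b) \<Rightarrow> (nat set \<Rightarrow> 'b \<Rightarrow> 'c) \<Rightarrow> bool" where
  "fi_exact U V W \<phi> \<psi> \<longleftrightarrow> (\<forall>X. finite X \<longrightarrow> fi_im U \<phi> X = fi_ker V W \<psi> X)"

definition fi_short_exact ::
    "('k, 'r) ring_scheme \<Rightarrow> ('k, 'a) fi_mod \<Rightarrow> ('k, 'b) fi_mod \<Rightarrow> ('k, 'c) fi_mod \<Rightarrow>
     (nat set \<Rightarrow> 'a \<Rightarrow> 'b) \<Rightarrow> (nat set \<Rightarrow> 'b \<Rightarrow> 'c) \<Rightarrow> bool" where
  "fi_short_exact R U V W \<phi> \<psi> \<longleftrightarrow>
     fi_module R U \<and> fi_module R V \<and> fi_module R W \<and>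
     fi_map R U V \<phi> \<and> fi_map R V W \<psi> \<and>
     fi_inj U \<phi> \<and> fi_exact U V W \<phi> \<psi> \<and> fi_surj V W \<psi>"

text \<open>
  The following two constructions take a family \<open>K\<close> of submodules stable under the maps
  induced by injections.
\<close>

definition fi_sub :: "('k, 'a) fi_mod \<Rightarrow> (nat set \<Rightarrow> 'a set) \<Rightarrow> ('k, 'a) fi_mod" where
  "fi_sub V K = \<lparr>obj = (\<lambda>X. (obj V X)\<lparr>carrier := K X\<rparr>), mor = mor V\<rparr>"

definition fi_quot :: "('k, 'a) fi_mod \<Rightarrow> (nat set \<Rightarrow> 'a set) \<Rightarrow> ('k, 'a set) fi_mod" where
  "fi_quot V K =
     \<lparr>obj = (\<lambda>X. module_quot (obj V X) (K X)),
      mor = (\<lambda>X Y f A. \<Union>x\<in>A. K Y +>\<^bsub>obj V Y\<^esub> mor V X Y f x)\<rparr>"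


section \<open>Projective FI-modules\<close>

text \<open>
  HOL cannot quantify over all types inside a definition, so lifting problems and projective
  resolutions are taken among FI-modules with elements in the type below. Its cardinality is
  the maximum of those of \<open>'k\<close>, \<open>'a\<close> and the natural numbers. Hence, for
  every FI-module \<open>V\<close> with elements in \<open>'a\<close>, it has room for a copy of \<open>V\<close>, for a free
  FI-module mapping onto \<open>V\<close>, and, by iteration, for a whole free resolution of \<open>V\<close>. In
  particular an FI-module that lifts against the epimorphisms in this type is a direct
  summand of a free one, and so lifts against the epimorphisms in all other types too.
\<close>

type_synonym ('k, 'a) fi_univ = "('k \<times> 'a) list"

definition fi_projective :: "('k, 'r) ring_scheme \<Rightarrow> ('k, 'a) fi_mod \<Rightarrow> bool" where
  "fi_projective R P \<longleftrightarrow>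
     fi_module R P \<and>
     (\<forall>(M :: ('k, ('k, 'a) fi_univ) fi_mod) (N :: ('k, ('k, 'a) fi_univ) fi_mod) e h.
        fi_module R M \<and> fi_module R N \<and> fi_map R M N e \<and> fi_surj M N e \<and> fi_map R P N h \<longrightarrow>
        (\<exists>g. fi_map R P M g \<and>
             (\<forall>X. finite X \<longrightarrow> (\<forall>x\<in>carrier (obj P X). e X (g X x) = h X x))))"

definition fi_projective_resolution ::
    "('k, 'r) ring_scheme \<Rightarrow> ('k, 'a) fi_mod \<Rightarrow> (nat \<Rightarrow> ('k, 'p) fi_mod) \<Rightarrow>
     (nat \<Rightarrow> nat set \<Rightarrow> 'p \<Rightarrow> 'p) \<Rightarrow> (nat set \<Rightarrow> 'p \<Rightarrow> 'a) \<Rightarrow> bool" where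
  "fi_projective_resolution R V P D \<epsilon> \<longleftrightarrow>
     (\<forall>n. fi_projective R (P n)) \<and>
     (\<forall>n. fi_map R (P (Suc n)) (P n) (D n)) \<and>
     fi_map R (P 0) V \<epsilon> \<and> fi_surj (P 0) V \<epsilon> \<and>
     fi_exact (P (Suc 0)) (P 0) V (D 0) \<epsilon> \<and>
     (\<forall>n. fi_exact (P (Suc (Suc n))) (P (Suc n)) (P n) (D (Suc n)) (D n))"


section \<open>FI-homology\<close>

definition fi_J :: "('k, 'r) ring_scheme \<Rightarrow> ('k, 'a) fi_mod \<Rightarrow> nat set \<Rightarrow> 'a set" where
  "fi_J R V X =
     module_span R (obj V X)
       (\<Union>{mor V Y X f ` carrier (obj V Y) | Y f. finite Y \<and> card Y < card X \<and> f \<in> FI_mor Y X})"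

definition fi_F :: "('k, 'r) ring_scheme \<Rightarrow> ('k, 'a) fi_mod \<Rightarrow> ('k, 'a set) fi_mod" where
  "fi_F R V = fi_quot V (fi_J R V)"

definition fi_F_map ::
    "('k, 'r) ring_scheme \<Rightarrow> ('k, 'b) fi_mod \<Rightarrow> (nat set \<Rightarrow> 'a \<Rightarrow> 'b) \<Rightarrow>
     nat set \<Rightarrow> 'a set \<Rightarrow> 'b set" where
  "fi_F_map R W \<phi> X A = (\<Union>x\<in>A. fi_J R W X +>\<^bsub>obj W X\<^esub> \<phi> X x)"

definition fi_resolution ::
    "('k, 'r) ring_scheme \<Rightarrow> ('k, 'a) fi_mod \<Rightarrow>
     (nat \<Rightarrow> ('k, ('k, 'a) fi_univ) fi_mod) \<times>
     (nat \<Rightarrow> nat set \<Rightarrow> ('k, 'a) fi_univ \<Rightarrow> ('k, 'a) fi_univ)" where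
  "fi_resolution R V = (SOME (P, D). \<exists>\<epsilon>. fi_projective_resolution R V P D \<epsilon>)"

text \<open>
  The left derived functors of \<^const>\<open>fi_F\<close>, computed from a chosen projective resolution; up
  to isomorphism they do not depend on the choice.
\<close>

definition fi_H ::
    "('k, 'r) ring_scheme \<Rightarrow> nat \<Rightarrow> ('k, 'a) fi_mod \<Rightarrow> ('k, ('k, 'a) fi_univ set set) fi_mod" where
  "fi_H R a V =
     (let (P, D) = fi_resolution R V;
          C = (\<lambda>n. fi_F R (P n));
          \<delta> = (\<lambda>n. fi_F_map R (P n) (D n));
          Z = (case a of 0 \<Rightarrow> (\<lambda>X. carrier (obj (C 0) X)) | Suc b \<Rightarrow> fi_ker (C (Suc b)) (C b) (\<delta> b));
          B = fi_im (C (Suc a)) (\<delta> a)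
      in fi_quot (fi_sub (C a) Z) B)"

definition fi_acyclic :: "('k, 'r) ring_scheme \<Rightarrow> ('k, 'a) fi_mod \<Rightarrow> bool" where
  "fi_acyclic R V \<longleftrightarrow>
     (\<forall>a\<ge>1. \<forall>X. finite X \<longrightarrow> carrier (obj (fi_H R a V) X) = {\<zero>\<^bsub>obj (fi_H R a V) X\<^esub>})"


section \<open>Degrees\<close>

text \<open>In \<^typ>\<open>ereal\<close> the supremum of the empty set is \<open>-\<infinity>\<close>.\<close>

definition fi_deg :: "('k, 'a) fi_mod \<Rightarrow> ereal" where
  "fi_deg V = (SUP n\<in>{n::nat. carrier (obj V {1..n}) \<noteq> {\<zero>\<^bsub>obj V {1..n}\<^esub>}}. ereal (real n))"

definition fi_hd :: "('k, 'r) ring_scheme \<Rightarrow> nat \<Rightarrow> ('k, 'a) fi_mod \<Rightarrow> ereal" where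
  "fi_hd R a V = fi_deg (fi_H R a V)"

definition fi_generated :: "('k, 'r) ring_scheme \<Rightarrow> ('k, 'a) fi_mod \<Rightarrow> nat \<Rightarrow> bool" where
  "fi_generated R V k \<longleftrightarrow> fi_hd R 0 V \<le> ereal (real k)"

text \<open>
  The element types of the presentation are parameters. Under a hypothesis of a theorem, where
  they are free type variables, this amounts to an existential quantification over them.
\<close>

definition fi_generated_related ::
    "'p itself \<Rightarrow> 'w itself \<Rightarrow> ('k, 'r) ring_scheme \<Rightarrow> ('k, 'a) fi_mod \<Rightarrow> nat \<Rightarrow> nat \<Rightarrow> bool" where
  "fi_generated_related _ _ R V k d \<longleftrightarrow>
     (\<exists>(P :: ('k, 'p) fi_mod) (W :: ('k, 'w) fi_mod) \<iota> \<pi>.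
        fi_short_exact R W P V \<iota> \<pi> \<and>
        fi_projective R P \<and> fi_generated R P k \<and> fi_generated R W d)"

end

theory Submission
  imports Defs "HOL-Algebra.Free_Abelian_Groups" "HOL-Combinatorics.Transposition" "HOL-Library.Countable"
begin

text \<open>
  FI-homology at a finite set \<open>X\<close> is the homology of a Koszul complex built from the values at the subsets
  of \<open>X\<close>; the Koszul complex at \<open>X \<union> {x}\<close> is the mapping cone of \<open>K(V) \<rightarrow> K(SV)\<close> at \<open>X\<close>, where \<open>SV\<close> is
  the shift. This gives a long exact sequence
  \<open>H\<^sub>a(V) \<rightarrow> H\<^sub>a(SV) \<rightarrow> S H\<^sub>a(V) \<rightarrow> H\<^sub>a\<^sub>-\<^sub>1(V)\<close>. A large shift of a finitely presented \<open>V\<close> is acyclic (Nagpal):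
  by induction on the generation degree this holds for the derivative \<open>DV = coker(V \<rightarrow> SV)\<close>, it follows that
  \<open>V \<rightarrow> SV\<close> is injective in large degrees, and then \<open>S H\<^sub>a(V) = H\<^sub>a(DV)\<close>. Descending from a large shift along
  the long exact sequence, if \<open>H\<^sub>a(V)\<close> is nonzero at \<open>X\<close> then \<open>H\<^sub>a\<^sub>+\<^sub>1(V)\<close> is nonzero at some strictly larger
  set; \<open>H\<^sub>1(V) = 0\<close> forces \<open>V\<close> to be acyclic; and all \<open>H\<^sub>a(V)\<close> with \<open>a \<ge> 1\<close> have finite degree.
\<close>

section \<open>Koszul homology of functors on finite sets\<close>

text \<open>Only the vanishing of homology is used, so no homology group is formed and exact
  sequences appear as implications between vanishing statements. Strictness between suprema fails if
  both are infinite, hence the bound on the degree of each H_a. Koszul homology computes the derived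
  functors because it vanishes in positive degrees on projectives and is V/JV in degree zero;
  dimension shifting along a resolution does the rest. A projective FI-module is only a retract of a
  free one, so restriction maps are kept for it instead of a decomposition. The size (k + 1)(d + 1)
  of the shift arises as follows: k + 1 derivatives reduce a module generated in degree at most k to
  zero, and each of them costs d + 1 points, enough for the relations to be generated from proper
  subsets. The elements of a record module form a group only on the carrier; formal integer sums of
  them, taken modulo the sums with value zero, live in a type that is an abelian group as a whole.
  Signs depend on the order of the natural numbers, so the dependence of homology on the cardinality
  alone is obtained from monotone bijections.\<close>

definition asubgrp :: "'g::ab_group_add set \<Rightarrow> bool" where
  "asubgrp H \<longleftrightarrow> 0 \<in> H \<and> (\<forall>x\<in>H. \<forall>y\<in>H. x - y \<in> H)"

lemma asubgrp_zero: "asubgrp H \<Longrightarrow> 0 \<in> H"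
  and asubgrp_diff: "asubgrp H \<Longrightarrow> x \<in> H \<Longrightarrow> y \<in> H \<Longrightarrow> x - y \<in> H"
  by (auto simp: asubgrp_def)

lemma asubgrp_uminus: "asubgrp H \<Longrightarrow> x \<in> H \<Longrightarrow> - x \<in> H"
  using asubgrp_diff[of H 0 x] by (simp add: asubgrp_zero)

lemma asubgrp_add: "asubgrp H \<Longrightarrow> x \<in> H \<Longrightarrow> y \<in> H \<Longrightarrow> x + y \<in> H"
  using asubgrp_diff[of H x "- y"] by (simp add: asubgrp_uminus)

lemma asubgrp_sum: "asubgrp H \<Longrightarrow> (\<And>x. x \<in> A \<Longrightarrow> f x \<in> H) \<Longrightarrow> sum f A \<in> H"
  by (induct A rule: infinite_finite_induct) (auto simp: asubgrp_zero asubgrp_add)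

lemma asubgrp_uminus_iff: "asubgrp H \<Longrightarrow> - x \<in> H \<longleftrightarrow> x \<in> H"
  using asubgrp_uminus[of H x] asubgrp_uminus[of H "- x"] by auto

lemma asubgrp_add_cancel_left: "asubgrp H \<Longrightarrow> x \<in> H \<Longrightarrow> x + y \<in> H \<longleftrightarrow> y \<in> H"
  using asubgrp_add[of H x y] asubgrp_diff[of H "x + y" x] by auto

definition asum :: "'g::ab_group_add set \<Rightarrow> 'g set \<Rightarrow> 'g set" where
  "asum H K = {x + y | x y. x \<in> H \<and> y \<in> K}"

lemma asumI: "x \<in> H \<Longrightarrow> y \<in> K \<Longrightarrow> x + y \<in> asum H K"
  by (auto simp: asum_def)

lemma asum_left: "asubgrp K \<Longrightarrow> x \<in> H \<Longrightarrow> x \<in> asum H K"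
  using asumI[of x H 0 K] by (simp add: asubgrp_zero)

lemma asum_right: "asubgrp H \<Longrightarrow> x \<in> K \<Longrightarrow> x \<in> asum H K"
  using asumI[of 0 H x K] by (simp add: asubgrp_zero)

lemma asubgrp_asum:
  assumes "asubgrp H" "asubgrp K"
  shows "asubgrp (asum H K)"
  unfolding asubgrp_def
proof (intro conjI ballI)
  show "0 \<in> asum H K"
    using assms by (auto intro: asum_left asubgrp_zero)
  fix x y assume "x \<in> asum H K" "y \<in> asum H K"
  then obtain a b c d where "x = a + b" "y = c + d" "a \<in> H" "c \<in> H" "b \<in> K" "d \<in> K"
    by (auto simp: asum_def)
  then have "x - y = (a - c) + (b - d)" "a - c \<in> H" "b - d \<in> K"
    using assms by (auto intro: asubgrp_diff)
  then show "x - y \<in> asum H K"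
    by (auto intro: asumI)
qed

lemma asubgrp_image: "additive f \<Longrightarrow> asubgrp H \<Longrightarrow> asubgrp (f ` H)"
  unfolding asubgrp_def by (force simp: additive.diff[symmetric] additive.zero image_iff)

lemma asubgrp_Int: "asubgrp H \<Longrightarrow> asubgrp K \<Longrightarrow> asubgrp (H \<inter> K)"
  by (auto simp: asubgrp_def)

text \<open>The Koszul sign, given by the rank of \<open>x\<close> among the elements of
  \<open>T\<close>, acts on group elements directly: no ring of coefficients is at hand for a factor
  -1.\<close>

definition sg :: "nat \<Rightarrow> nat set \<Rightarrow> 'g::ab_group_add \<Rightarrow> 'g" where
  "sg x T v = (if even (card {t \<in> T. t < x}) then v else - v)"

lemma sg_add: "sg x T (u + v) = sg x T u + sg x T v"
  and sg_diff: "sg x T (u - v) = sg x T u - sg x T v"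
  and sg_minus: "sg x T (- v) = - sg x T v"
  and sg_zero [simp]: "sg x T 0 = 0"
  and sg_empty [simp]: "sg x {} v = v"
  and sg_sg [simp]: "sg x T (sg x T v) = v"
  by (auto simp: sg_def)

lemma sg_sum: "sg x T (sum f A) = (\<Sum>a\<in>A. sg x T (f a))"
  by (auto simp: sg_def sum_negf)

lemma additive_sg: "additive f \<Longrightarrow> f (sg x T v) = sg x T (f v)"
  by (simp add: sg_def additive.minus)

lemma sg_mem: "asubgrp H \<Longrightarrow> sg x T v \<in> H \<longleftrightarrow> v \<in> H"
  by (simp add: sg_def asubgrp_uminus_iff)

lemma sg_comm: "sg x T (sg y S v) = sg y S (sg x T v)"
  by (auto simp: sg_def)

lemma sg_insert:
  assumes "finite T" "x \<notin> T"
  shows "sg y (insert x T) v = (if x < y then - sg y T v else sg y T v)"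
proof -
  have "{t \<in> insert x T. t < y} = (if x < y then insert x {t \<in> T. t < y} else {t \<in> T. t < y})"
    by auto
  with assms show ?thesis
    by (auto simp: sg_def)
qed

lemma sg_swap:
  assumes "finite T" "x \<notin> T" "y \<notin> T" "x \<noteq> y"
  shows "sg x T (sg y (insert x T) v) = - sg y T (sg x (insert y T) v)"
  using assms by (auto simp: sg_insert sg_minus sg_comm)

text \<open>The sum equals its own negative, which is not enough in a group with 2-torsion; so the
  terms are cancelled pairwise, by adding one index at a time.\<close>

lemma sum_antisym_zero:
  fixes g :: "'b \<Rightarrow> 'b \<Rightarrow> 'g::ab_group_add"
  assumes "finite S" "\<And>x y. x \<in> S \<Longrightarrow> y \<in> S \<Longrightarrow> x \<noteq> y \<Longrightarrow> g x y = - g y x"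
  shows "(\<Sum>x\<in>S. \<Sum>y\<in>S - {x}. g x y) = 0"
  using assms
proof (induct S rule: finite_induct)
  case (insert a S)
  note fin = insert.hyps(1,2) and anti = insert.prems
  have IH: "(\<Sum>x\<in>S. \<Sum>y\<in>S - {x}. g x y) = 0"
    using insert.hyps(3) anti by blast
  have "(\<Sum>x\<in>S. \<Sum>y\<in>insert a S - {x}. g x y) = (\<Sum>x\<in>S. g x a + (\<Sum>y\<in>S - {x}. g x y))"
  proof (rule sum.cong)
    fix x assume "x \<in> S"
    then have "insert a S - {x} = insert a (S - {x})"
      using fin by auto
    with fin show "(\<Sum>y\<in>insert a S - {x}. g x y) = g x a + (\<Sum>y\<in>S - {x}. g x y)"
      by simp
  qed simp
  also have "\<dots> = (\<Sum>x\<in>S. g x a)"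
    using IH by (simp add: sum.distrib)
  also have "\<dots> = (\<Sum>x\<in>S. - g a x)"
  proof (rule sum.cong[OF refl])
    fix x assume "x \<in> S"
    then show "g x a = - g a x"
      using anti[of x a] fin by blast
  qed
  finally have "(\<Sum>x\<in>S. \<Sum>y\<in>insert a S - {x}. g x y) = - (\<Sum>x\<in>S. g a x)"
    by (simp add: sum_negf)
  moreover have "insert a S - {a} = S"
    using fin by auto
  ultimately show ?case
    using fin by simp
qed simp

text \<open>
  A module over FI restricts to a functor on the poset of finite subsets of \<open>\<nat>\<close>; the maps are total and
  additive, but functorial only on the carriers \<open>L\<close>. All functors below are subquotients \<open>L / N\<close> with
  \<open>N \<subseteq> L\<close> such subfunctors, which keeps derivatives and quotients within one type.
\<close>

definition poset_functor :: "(nat set \<Rightarrow> nat set \<Rightarrow> 'g::ab_group_add \<Rightarrow> 'g) \<Rightarrow> (nat set \<Rightarrow> 'g set) \<Rightarrow> bool" where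
  "poset_functor i L \<longleftrightarrow> (\<forall>Y X. additive (i Y X)) \<and> (\<forall>X. \<forall>u\<in>L X. i X X u = u) \<and>
     (\<forall>Z Y X. \<forall>u\<in>L Z. Z \<subseteq> Y \<longrightarrow> Y \<subseteq> X \<longrightarrow> i Y X (i Z Y u) = i Z X u)"

definition subfunctor :: "(nat set \<Rightarrow> nat set \<Rightarrow> 'g::ab_group_add \<Rightarrow> 'g) \<Rightarrow> (nat set \<Rightarrow> 'g set) \<Rightarrow> bool" where
  "subfunctor i F \<longleftrightarrow> (\<forall>X. asubgrp (F X)) \<and> (\<forall>Y X. \<forall>u\<in>F Y. Y \<subseteq> X \<longrightarrow> i Y X u \<in> F X)"

lemma poset_functor_additive: "poset_functor i L \<Longrightarrow> additive (i Y X)"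
  and poset_functor_id: "poset_functor i L \<Longrightarrow> u \<in> L X \<Longrightarrow> i X X u = u"
  and poset_functor_comp: "poset_functor i L \<Longrightarrow> u \<in> L Z \<Longrightarrow> Z \<subseteq> Y \<Longrightarrow> Y \<subseteq> X \<Longrightarrow> i Y X (i Z Y u) = i Z X u"
  by (auto simp: poset_functor_def)

lemma subfunctor_asubgrp: "subfunctor i F \<Longrightarrow> asubgrp (F X)"
  and subfunctor_map: "subfunctor i F \<Longrightarrow> u \<in> F Y \<Longrightarrow> Y \<subseteq> X \<Longrightarrow> i Y X u \<in> F X"
  by (auto simp: subfunctor_def)

text \<open>\<open>T\<close> is the set of removed points, so the value of a chain at
  \<open>T\<close> lives at \<open>X - T\<close>, and the differential puts one removed point back.
  Hence homology in degree zero is the quotient by what comes from proper subsets.\<close>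

definition koszul_bd :: "(nat set \<Rightarrow> nat set \<Rightarrow> 'g::ab_group_add \<Rightarrow> 'g) \<Rightarrow> nat set \<Rightarrow> (nat set \<Rightarrow> 'g) \<Rightarrow> nat set \<Rightarrow> 'g" where
  "koszul_bd i X c T = (\<Sum>x\<in>X - T. sg x T (i (X - insert x T) (X - T) (c (insert x T))))"

definition chain :: "(nat set \<Rightarrow> 'g set) \<Rightarrow> nat \<Rightarrow> nat set \<Rightarrow> (nat set \<Rightarrow> 'g) \<Rightarrow> bool" where
  "chain F a X c \<longleftrightarrow> (\<forall>T\<subseteq>X. card T = a \<longrightarrow> c T \<in> F (X - T))"

text \<open>
  \<open>koszul_zero i L N a X\<close> says that the degree \<open>a\<close> homology at \<open>X\<close> of the Koszul complex of \<open>L / N\<close>,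
  whose degree \<open>a\<close> term is the sum of the values at \<open>X - T\<close> over all \<open>T \<subseteq> X\<close> of size \<open>a\<close>, is zero.
\<close>

definition koszul_zero ::
    "(nat set \<Rightarrow> nat set \<Rightarrow> 'g::ab_group_add \<Rightarrow> 'g) \<Rightarrow> (nat set \<Rightarrow> 'g set) \<Rightarrow> (nat set \<Rightarrow> 'g set) \<Rightarrow>
     nat \<Rightarrow> nat set \<Rightarrow> bool" where
  "koszul_zero i L N a X \<longleftrightarrow>
     (\<forall>c. chain L a X c \<and> (\<forall>b. a = Suc b \<longrightarrow> chain N b X (koszul_bd i X c)) \<longrightarrow>
        (\<exists>e. chain L (Suc a) X e \<and> chain N a X (\<lambda>T. c T - koszul_bd i X e T)))"

lemma chainD: "chain F a X c \<Longrightarrow> T \<subseteq> X \<Longrightarrow> card T = a \<Longrightarrow> c T \<in> F (X - T)"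
  by (simp add: chain_def)

lemma chainI: "(\<And>T. T \<subseteq> X \<Longrightarrow> card T = a \<Longrightarrow> c T \<in> F (X - T)) \<Longrightarrow> chain F a X c"
  by (simp add: chain_def)

lemma koszul_zeroE:
  assumes "koszul_zero i L N a X" "chain L a X c" "\<And>b. a = Suc b \<Longrightarrow> chain N b X (koszul_bd i X c)"
  obtains e where "chain L (Suc a) X e" "chain N a X (\<lambda>T. c T - koszul_bd i X e T)"
  using assms unfolding koszul_zero_def by blast

lemma koszul_zeroE_Suc:
  assumes "koszul_zero i L N (Suc a) X" "chain L (Suc a) X c" "chain N a X (koszul_bd i X c)"
  obtains e where "chain L (Suc (Suc a)) X e" "chain N (Suc a) X (\<lambda>T. c T - koszul_bd i X e T)"
  using assms unfolding koszul_zero_def by blast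

lemma koszul_zeroI:
  assumes "\<And>c. chain L a X c \<Longrightarrow> (\<And>b. a = Suc b \<Longrightarrow> chain N b X (koszul_bd i X c)) \<Longrightarrow>
     \<exists>e. chain L (Suc a) X e \<and> chain N a X (\<lambda>T. c T - koszul_bd i X e T)"
  shows "koszul_zero i L N a X"
  using assms unfolding koszul_zero_def by blast

lemma chain_diff: "subfunctor i F \<Longrightarrow> chain F a X c \<Longrightarrow> chain F a X d \<Longrightarrow> chain F a X (\<lambda>T. c T - d T)"
  and chain_add: "subfunctor i F \<Longrightarrow> chain F a X c \<Longrightarrow> chain F a X d \<Longrightarrow> chain F a X (\<lambda>T. c T + d T)"
  and chain_uminus: "subfunctor i F \<Longrightarrow> chain F a X c \<Longrightarrow> chain F a X (\<lambda>T. - c T)"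
  by (auto simp: chain_def intro: asubgrp_diff asubgrp_add asubgrp_uminus subfunctor_asubgrp)

lemma chain_mono: "chain F a X c \<Longrightarrow> (\<And>Y. F Y \<subseteq> G Y) \<Longrightarrow> chain G a X c"
  by (auto simp: chain_def)

lemma koszul_bd_add:
  assumes "\<And>Y X. additive (i Y X)"
  shows "koszul_bd i X (\<lambda>T. c T + d T) T = koszul_bd i X c T + koszul_bd i X d T"
  by (simp add: koszul_bd_def additive.add[OF assms] sg_add sum.distrib)

lemma koszul_bd_diff:
  assumes "\<And>Y X. additive (i Y X)"
  shows "koszul_bd i X (\<lambda>T. c T - d T) T = koszul_bd i X c T - koszul_bd i X d T"
  by (simp add: koszul_bd_def additive.diff[OF assms] sg_diff sum_subtractf)

lemma koszul_bd_uminus: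
  assumes "\<And>Y X. additive (i Y X)"
  shows "koszul_bd i X (\<lambda>T. - c T) T = - koszul_bd i X c T"
  by (simp add: koszul_bd_def additive.minus[OF assms] sg_minus sum_negf)

lemma koszul_bd_chain:
  assumes "finite X" "subfunctor i F" "chain F (Suc a) X c"
  shows "chain F a X (koszul_bd i X c)"
proof (rule chainI)
  fix T assume T: "T \<subseteq> X" "card T = a"
  show "koszul_bd i X c T \<in> F (X - T)"
    unfolding koszul_bd_def
  proof (rule asubgrp_sum)
    show "asubgrp (F (X - T))"
      using assms by (simp add: subfunctor_asubgrp)
    fix x assume x: "x \<in> X - T"
    have "c (insert x T) \<in> F (X - insert x T)"
      using assms(3) T x by (intro chainD) (auto simp: card_insert_if finite_subset[OF T(1) assms(1)])
    then have "i (X - insert x T) (X - T) (c (insert x T)) \<in> F (X - T)"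
      by (rule subfunctor_map[OF assms(2)]) auto
    then show "sg x T (i (X - insert x T) (X - T) (c (insert x T))) \<in> F (X - T)"
      using assms by (simp add: sg_mem subfunctor_asubgrp)
  qed
qed

text \<open>The two orders of putting back points \<open>x\<close> and \<open>y\<close> end in the
  same map by functoriality and carry opposite signs by \<open>sg_swap\<close>. Functoriality holds
  on \<open>L\<close> alone, which is why \<open>c\<close> has to be a chain there.\<close>

lemma koszul_bd_bd:
  assumes "finite X" "poset_functor i L" "chain L (Suc (Suc a)) X c" "T \<subseteq> X" "card T = a"
  shows "koszul_bd i X (koszul_bd i X c) T = 0"
proof -
  have fT: "finite T"
    using assms finite_subset by auto
  define g where "g x y = sg x T (sg y (insert x T)
      (i (X - insert y (insert x T)) (X - T) (c (insert y (insert x T)))))" for x y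
  have "koszul_bd i X (koszul_bd i X c) T = (\<Sum>x\<in>X - T. \<Sum>y\<in>X - T - {x}. g x y)"
    unfolding koszul_bd_def
  proof (rule sum.cong[OF refl])
    fix x assume x: "x \<in> X - T"
    have X: "X - insert x T = X - T - {x}"
      by auto
    have "sg x T (i (X - insert x T) (X - T)
          (\<Sum>y\<in>X - insert x T. sg y (insert x T)
             (i (X - insert y (insert x T)) (X - insert x T) (c (insert y (insert x T)))))) =
        (\<Sum>y\<in>X - insert x T. sg x T (sg y (insert x T) (i (X - insert x T) (X - T)
             (i (X - insert y (insert x T)) (X - insert x T) (c (insert y (insert x T)))))))"
      using poset_functor_additive[OF assms(2)] by (simp add: additive.sum sg_sum additive_sg)
    also have "\<dots> = (\<Sum>y\<in>X - insert x T. g x y)"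
    proof (rule sum.cong[OF refl])
      fix y assume y: "y \<in> X - insert x T"
      have "c (insert y (insert x T)) \<in> L (X - insert y (insert x T))"
        using x y assms fT by (intro chainD[OF assms(3)]) auto
      then have "i (X - insert x T) (X - T) (i (X - insert y (insert x T)) (X - insert x T)
          (c (insert y (insert x T)))) = i (X - insert y (insert x T)) (X - T) (c (insert y (insert x T)))"
        by (rule poset_functor_comp[OF assms(2)]) auto
      then show "sg x T (sg y (insert x T) (i (X - insert x T) (X - T)
             (i (X - insert y (insert x T)) (X - insert x T) (c (insert y (insert x T)))))) = g x y"
        by (simp add: g_def)
    qed
    finally show "sg x T (i (X - insert x T) (X - T)
          (\<Sum>y\<in>X - insert x T. sg y (insert x T)
             (i (X - insert y (insert x T)) (X - insert x T) (c (insert y (insert x T)))))) =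
        (\<Sum>y\<in>X - T - {x}. g x y)"
      by (simp add: X)
  qed
  also have "\<dots> = 0"
  proof (rule sum_antisym_zero)
    show "finite (X - T)"
      using assms by simp
    fix x y assume "x \<in> X - T" "y \<in> X - T" "x \<noteq> y"
    then show "g x y = - g y x"
      unfolding g_def using sg_swap[OF fT, of x y] by (simp add: insert_commute)
  qed
  finally show ?thesis .
qed

text \<open>An isomorphism of \<open>L / N\<close> with \<open>L' / N'\<close> is given as an
  additive correspondence \<open>r\<close>: an isomorphism of subquotients need not lift to an
  additive map on representatives. Chains are moved across by choosing related values, and
  \<open>r\<close> is compatible with the differential because it respects sums and the
  maps.\<close>

lemma koszul_zero_iso:
  fixes i :: "nat set \<Rightarrow> nat set \<Rightarrow> 'g::ab_group_add \<Rightarrow> 'g" and j :: "nat set \<Rightarrow> nat set \<Rightarrow> 'h::ab_group_add \<Rightarrow> 'h"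
  assumes koszul_zero: "koszul_zero i L N a X" and fin: "finite X"
    and zero: "\<And>Z. Z \<subseteq> X \<Longrightarrow> r Z 0 0"
    and diff: "\<And>Z u v u' v'. Z \<subseteq> X \<Longrightarrow> r Z u v \<Longrightarrow> r Z u' v' \<Longrightarrow> r Z (u - u') (v - v')"
    and nat: "\<And>Y Z u v. Z \<subseteq> X \<Longrightarrow> Y \<subseteq> Z \<Longrightarrow> r Y u v \<Longrightarrow> r Z (i Y Z u) (j Y Z v)"
    and left: "\<And>Z u. Z \<subseteq> X \<Longrightarrow> u \<in> L Z \<Longrightarrow> \<exists>v\<in>L' Z. r Z u v"
    and right: "\<And>Z v. Z \<subseteq> X \<Longrightarrow> v \<in> L' Z \<Longrightarrow> \<exists>u\<in>L Z. r Z u v"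
    and N: "\<And>Z u v. Z \<subseteq> X \<Longrightarrow> r Z u v \<Longrightarrow> u \<in> N Z \<longleftrightarrow> v \<in> N' Z"
  shows "koszul_zero j L' N' a X"
proof (rule koszul_zeroI)
  have minus: "r Z (- u) (- v)" if "Z \<subseteq> X" "r Z u v" for Z u v
    using diff[OF that(1) zero[OF that(1)] that(2)] by simp
  have add: "r Z (u + u') (v + v')" if "Z \<subseteq> X" "r Z u v" "r Z u' v'" for Z u v u' v'
    using diff[OF that(1,2) minus[OF that(1,3)]] by simp
  have sum: "r Z (sum f A) (sum g A)" if "Z \<subseteq> X" "\<And>x. x \<in> A \<Longrightarrow> r Z (f x) (g x)" for Z A and f :: "nat \<Rightarrow> 'g" and g :: "nat \<Rightarrow> 'h"
    using that(2)
  proof (induct A rule: infinite_finite_induct)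
    case (insert x F)
    then show ?case
      using add[OF that(1), of "f x" "g x" "sum f F" "sum g F"] by simp
  qed (simp_all add: zero[OF that(1)])
  have koszul_bd: "r (X - T) (koszul_bd i X c T) (koszul_bd j X d T)"
    if "T \<subseteq> X" "card T = b" "\<And>T. T \<subseteq> X \<Longrightarrow> card T = Suc b \<Longrightarrow> r (X - T) (c T) (d T)" for T b c d
    unfolding koszul_bd_def
  proof (rule sum)
    fix x assume x: "x \<in> X - T"
    have "r (X - insert x T) (c (insert x T)) (d (insert x T))"
    proof (rule that(3))
      show "insert x T \<subseteq> X" "card (insert x T) = Suc b"
        using x that(1,2) finite_subset[OF that(1) fin] by auto
    qed
    then have "r (X - T) (i (X - insert x T) (X - T) (c (insert x T))) (j (X - insert x T) (X - T) (d (insert x T)))"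
      by (rule nat[rotated 2]) auto
    then show "r (X - T) (sg x T (i (X - insert x T) (X - T) (c (insert x T)))) (sg x T (j (X - insert x T) (X - T) (d (insert x T))))"
      by (auto simp: sg_def minus)
  qed auto
  fix c' assume c': "chain L' a X c'" and cyc: "\<And>b. a = Suc b \<Longrightarrow> chain N' b X (koszul_bd j X c')"
  have "\<forall>T. \<exists>u. T \<subseteq> X \<longrightarrow> card T = a \<longrightarrow> u \<in> L (X - T) \<and> r (X - T) u (c' T)"
    using right[OF Diff_subset] chainD[OF c'] by metis
  then obtain c where c: "\<And>T. T \<subseteq> X \<Longrightarrow> card T = a \<Longrightarrow> c T \<in> L (X - T) \<and> r (X - T) (c T) (c' T)"
    by metis
  then have "chain L a X c"
    by (auto intro: chainI)
  moreover have "chain N b X (koszul_bd i X c)" if "a = Suc b" for b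
  proof (rule chainI)
    fix T assume T: "T \<subseteq> X" "card T = b"
    have "koszul_bd j X c' T \<in> N' (X - T)"
      using chainD[OF cyc[OF that] T] .
    moreover have "r (X - T) (koszul_bd i X c T) (koszul_bd j X c' T)"
      using c that by (intro koszul_bd[OF T]) simp
    ultimately show "koszul_bd i X c T \<in> N (X - T)"
      using N[OF Diff_subset] by blast
  qed
  ultimately obtain e where e: "chain L (Suc a) X e" "chain N a X (\<lambda>T. c T - koszul_bd i X e T)"
    by (rule koszul_zeroE[OF koszul_zero])
  have "\<forall>T. \<exists>v. T \<subseteq> X \<longrightarrow> card T = Suc a \<longrightarrow> v \<in> L' (X - T) \<and> r (X - T) (e T) v"
    using left[OF Diff_subset] chainD[OF e(1)] by metis
  then obtain e' where e': "\<And>T. T \<subseteq> X \<Longrightarrow> card T = Suc a \<Longrightarrow> e' T \<in> L' (X - T) \<and> r (X - T) (e T) (e' T)"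
    by metis
  then have "chain L' (Suc a) X e'"
    by (auto intro: chainI)
  moreover have "chain N' a X (\<lambda>T. c' T - koszul_bd j X e' T)"
  proof (rule chainI)
    fix T assume T: "T \<subseteq> X" "card T = a"
    have "r (X - T) (c T - koszul_bd i X e T) (c' T - koszul_bd j X e' T)"
    proof (rule diff)
      show "r (X - T) (c T) (c' T)"
        using c[OF T] by simp
      show "r (X - T) (koszul_bd i X e T) (koszul_bd j X e' T)"
        using koszul_bd[OF T, of e e'] e' by simp
    qed auto
    then show "c' T - koszul_bd j X e' T \<in> N' (X - T)"
      using N[OF Diff_subset] chainD[OF e(2) T] by blast
  qed
  ultimately show "\<exists>e. chain L' (Suc a) X e \<and> chain N' a X (\<lambda>T. c' T - koszul_bd j X e T)"
    by blast
qed

text \<open>Exactness of H_{a+1}(L/M) -> H_a(M/N) -> H_a(L/N): if a cycle of M/N is bounded in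
  \<open>L\<close> by \<open>e\<close>, then \<open>e\<close> is a cycle modulo \<open>M\<close>,
  and subtracting a boundary moves \<open>e\<close> into \<open>M\<close> without changing its own
  boundary.\<close>

lemma koszul_zero_les2:
  assumes "finite X" "poset_functor i L" "subfunctor i L" "subfunctor i M" "subfunctor i N"
    and "\<And>Y. N Y \<subseteq> M Y" "\<And>Y. M Y \<subseteq> L Y"
    and LN: "koszul_zero i L N a X" and LM: "koszul_zero i L M (Suc a) X"
  shows "koszul_zero i M N a X"
proof (rule koszul_zeroI)
  note add = poset_functor_additive[OF assms(2)]
  fix c assume c: "chain M a X c" and cyc: "\<And>b. a = Suc b \<Longrightarrow> chain N b X (koszul_bd i X c)"
  obtain e where e: "chain L (Suc a) X e" "chain N a X (\<lambda>T. c T - koszul_bd i X e T)"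
    by (rule koszul_zeroE[OF LN chain_mono[OF c assms(7)] cyc])
  have "chain M a X (\<lambda>T. c T - (c T - koszul_bd i X e T))"
    by (rule chain_diff[OF assms(4) c chain_mono[OF e(2) assms(6)]])
  then have "chain M a X (koszul_bd i X e)"
    by (simp add: chain_def)
  from koszul_zeroE_Suc[OF LM e(1) this] obtain f
    where f: "chain L (Suc (Suc a)) X f" "chain M (Suc a) X (\<lambda>T. e T - koszul_bd i X f T)" .
  have "chain N a X (\<lambda>T. c T - koszul_bd i X (\<lambda>T. e T - koszul_bd i X f T) T)"
  proof (rule chainI)
    fix T assume T: "T \<subseteq> X" "card T = a"
    show "c T - koszul_bd i X (\<lambda>T. e T - koszul_bd i X f T) T \<in> N (X - T)"
      using chainD[OF e(2) T] by (simp add: koszul_bd_diff[OF add] koszul_bd_bd[OF assms(1,2) f(1) T])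
  qed
  with f(2) show "\<exists>e. chain M (Suc a) X e \<and> chain N a X (\<lambda>T. c T - koszul_bd i X e T)"
    by blast
qed

text \<open>Exactness of H_{a+1}(L/N) -> H_{a+1}(L/M) -> H_a(M/N): the boundary of a cycle modulo
  \<open>M\<close> is a cycle of M/N; once it is bounded by some \<open>e\<close> in
  \<open>M\<close>, the difference is a cycle modulo \<open>N\<close>.\<close>

lemma koszul_zero_les3:
  assumes "finite X" "poset_functor i L" "subfunctor i L" "subfunctor i M" "subfunctor i N"
    and "\<And>Y. N Y \<subseteq> M Y" "\<And>Y. M Y \<subseteq> L Y"
    and LN: "koszul_zero i L N (Suc a) X" and MN: "koszul_zero i M N a X"
  shows "koszul_zero i L M (Suc a) X"
proof (rule koszul_zeroI)
  note add = poset_functor_additive[OF assms(2)]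
  fix c assume c: "chain L (Suc a) X c" and cyc: "\<And>b. Suc a = Suc b \<Longrightarrow> chain M b X (koszul_bd i X c)"
  have m: "chain M a X (koszul_bd i X c)"
    using cyc by simp
  have "chain N b X (koszul_bd i X (koszul_bd i X c))" if "a = Suc b" for b
    using koszul_bd_bd[OF assms(1,2), of b] c that subfunctor_asubgrp[OF assms(5)] by (auto simp: chain_def asubgrp_zero)
  from koszul_zeroE[OF MN m this] obtain e
    where e: "chain M (Suc a) X e" "chain N a X (\<lambda>T. koszul_bd i X c T - koszul_bd i X e T)" .
  have "chain L (Suc a) X e"
    using e(1) assms(7) by (rule chain_mono)
  then have "chain L (Suc a) X (\<lambda>T. c T - e T)"
    using c assms(3) by (intro chain_diff)
  moreover have "chain N b X (koszul_bd i X (\<lambda>T. c T - e T))" if "Suc a = Suc b" for b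
    using e(2) that by (simp add: chain_def koszul_bd_diff[OF add])
  ultimately obtain f where f: "chain L (Suc (Suc a)) X f" "chain N (Suc a) X (\<lambda>T. c T - e T - koszul_bd i X f T)"
    by (rule koszul_zeroE[OF LN])
  have "chain M (Suc a) X (\<lambda>T. (c T - e T - koszul_bd i X f T) + e T)"
    using f(2) e(1) assms(6) by (intro chain_add[OF assms(4)]) (auto intro: chain_mono)
  then have "chain M (Suc a) X (\<lambda>T. c T - koszul_bd i X f T)"
    by (simp add: chain_def algebra_simps)
  with f(1) show "\<exists>e. chain L (Suc (Suc a)) X e \<and> chain M (Suc a) X (\<lambda>T. c T - koszul_bd i X e T)"
    by blast
qed

text \<open>If H_1(L/N) vanishes then H_1(L/M) is the kernel of H_0(M/N) -> H_0(L/N), and the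
  right-hand side says that this kernel is zero: boundaries from \<open>L\<close> that fall into
  \<open>M\<close> come, up to \<open>N\<close>, from \<open>M\<close>.\<close>

lemma koszul_zero_one_iff:
  assumes "finite X" "poset_functor i L" "subfunctor i L" "subfunctor i M" "subfunctor i N"
    and "\<And>Y. N Y \<subseteq> M Y" "\<And>Y. M Y \<subseteq> L Y"
    and LN: "koszul_zero i L N (Suc 0) X"
  shows "koszul_zero i L M (Suc 0) X \<longleftrightarrow>
     (\<forall>c. chain L (Suc 0) X c \<longrightarrow> koszul_bd i X c {} \<in> M X \<longrightarrow>
        (\<exists>d. chain M (Suc 0) X d \<and> koszul_bd i X c {} - koszul_bd i X d {} \<in> N X))"
proof
  note add = poset_functor_additive[OF assms(2)]
  assume LM: "koszul_zero i L M (Suc 0) X"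
  show "\<forall>c. chain L (Suc 0) X c \<longrightarrow> koszul_bd i X c {} \<in> M X \<longrightarrow>
        (\<exists>d. chain M (Suc 0) X d \<and> koszul_bd i X c {} - koszul_bd i X d {} \<in> N X)"
  proof (intro allI impI)
    fix c assume c: "chain L (Suc 0) X c" "koszul_bd i X c {} \<in> M X"
    then have "chain M 0 X (koszul_bd i X c)"
      by (auto simp: chain_def card_eq_0_iff finite_subset[OF _ assms(1)])
    from koszul_zeroE_Suc[OF LM c(1) this] obtain e
      where e: "chain L (Suc (Suc 0)) X e" "chain M (Suc 0) X (\<lambda>T. c T - koszul_bd i X e T)" .
    have "koszul_bd i X (koszul_bd i X e) {} = 0"
      by (rule koszul_bd_bd[OF assms(1,2) e(1)]) auto
    then have "koszul_bd i X c {} - koszul_bd i X (\<lambda>T. c T - koszul_bd i X e T) {} = 0"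
      by (simp add: koszul_bd_diff[OF add])
    with e(2) show "\<exists>d. chain M (Suc 0) X d \<and> koszul_bd i X c {} - koszul_bd i X d {} \<in> N X"
      using subfunctor_asubgrp[OF assms(5)] by (auto simp: asubgrp_zero)
  qed
next
  note add = poset_functor_additive[OF assms(2)]
  assume R: "\<forall>c. chain L (Suc 0) X c \<longrightarrow> koszul_bd i X c {} \<in> M X \<longrightarrow>
        (\<exists>d. chain M (Suc 0) X d \<and> koszul_bd i X c {} - koszul_bd i X d {} \<in> N X)"
  show "koszul_zero i L M (Suc 0) X"
  proof (rule koszul_zeroI)
    fix c assume c: "chain L (Suc 0) X c" and "\<And>b. Suc 0 = Suc b \<Longrightarrow> chain M b X (koszul_bd i X c)"
    then have "koszul_bd i X c {} \<in> M X"
      by (auto simp: chain_def)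
    then obtain d where d: "chain M (Suc 0) X d" "koszul_bd i X c {} - koszul_bd i X d {} \<in> N X"
      using R c by blast
    have "chain L (Suc 0) X (\<lambda>T. c T - d T)"
      using c d(1) assms(3,7) by (intro chain_diff[OF assms(3)]) (auto intro: chain_mono)
    moreover have "chain N b X (koszul_bd i X (\<lambda>T. c T - d T))" if "Suc 0 = Suc b" for b
      using d(2) that by (auto simp: chain_def koszul_bd_diff[OF add] card_eq_0_iff finite_subset[OF _ assms(1)])
    ultimately obtain f where f: "chain L (Suc (Suc 0)) X f" "chain N (Suc 0) X (\<lambda>T. c T - d T - koszul_bd i X f T)"
      by (rule koszul_zeroE[OF LN])
    have "chain M (Suc 0) X (\<lambda>T. (c T - d T - koszul_bd i X f T) + d T)"
      using f(2) d(1) assms(6) by (intro chain_add[OF assms(4)]) (auto intro: chain_mono)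
    then have "chain M (Suc 0) X (\<lambda>T. c T - koszul_bd i X f T)"
      by (simp add: chain_def algebra_simps)
    with f(1) show "\<exists>e. chain L (Suc (Suc 0)) X e \<and> chain M (Suc 0) X (\<lambda>T. c T - koszul_bd i X e T)"
      by blast
  qed
qed

lemma koszul_bd_empty: "koszul_bd i X c {} = (\<Sum>x\<in>X. i (X - {x}) X (c {x}))"
  by (simp add: koszul_bd_def)

lemma chain_zero_iff:
  assumes "finite X"
  shows "chain F 0 X c \<longleftrightarrow> c {} \<in> F X"
proof -
  have "T \<subseteq> X \<and> card T = 0 \<longleftrightarrow> T = {}" for T
    using finite_subset[OF _ assms, of T] by auto
  then show ?thesis
    unfolding chain_def by (metis Diff_empty)
qed

lemma koszul_zero_zero_iff:
  fixes L :: "nat set \<Rightarrow> 'a::ab_group_add set"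
  assumes "finite X"
  shows "koszul_zero i L N 0 X \<longleftrightarrow> (\<forall>u\<in>L X. \<exists>c. chain L (Suc 0) X c \<and> u - koszul_bd i X c {} \<in> N X)"
proof
  assume k: "koszul_zero i L N 0 X"
  then have "\<forall>c :: nat set \<Rightarrow> 'a. c {} \<in> L X \<longrightarrow> (\<exists>e. chain L (Suc 0) X e \<and> c {} - koszul_bd i X e {} \<in> N X)"
    unfolding koszul_zero_def chain_zero_iff[OF assms] by simp
  from spec[OF this, of "\<lambda>_. _"] show "\<forall>u\<in>L X. \<exists>c. chain L (Suc 0) X c \<and> u - koszul_bd i X c {} \<in> N X"
    by simp
next
  assume "\<forall>u\<in>L X. \<exists>c. chain L (Suc 0) X c \<and> u - koszul_bd i X c {} \<in> N X"
  then show "koszul_zero i L N 0 X"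
    unfolding koszul_zero_def chain_zero_iff[OF assms] by simp
qed

lemma koszul_zero_zero_quotient:
  assumes "finite X" "koszul_zero i L N 0 X" "\<And>Y. N Y \<subseteq> M Y"
  shows "koszul_zero i L M 0 X"
  using assms(2,3) unfolding koszul_zero_zero_iff[OF assms(1)] by blast

text \<open>No subset of \<open>X\<close> has \<open>a\<close> elements, so every condition on
  chains is vacuous. This starts the inductions on \<open>X\<close> at the empty set in positive
  degree.\<close>

lemma koszul_zero_card_less:
  assumes "finite X" "card X < a"
  shows "koszul_zero i L N a X"
proof (rule koszul_zeroI)
  have no: False if "T \<subseteq> X" "card T \<ge> a" for T
    using card_mono[OF assms(1) that(1)] that(2) assms(2) by simp
  then show "\<exists>e. chain L (Suc a) X e \<and> chain N a X (\<lambda>T. c T - koszul_bd i X e T)" for c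
    by (intro exI[of _ c]) (auto intro!: chainI dest!: no)
qed

section \<open>Shifts, derivatives and the differential at an enlarged set\<close>

definition shift_obj :: "nat set \<Rightarrow> (nat set \<Rightarrow> 'b) \<Rightarrow> nat set \<Rightarrow> 'b" where
  "shift_obj A F X = F (A \<union> X)"

definition shift_map :: "nat set \<Rightarrow> (nat set \<Rightarrow> nat set \<Rightarrow> 'b) \<Rightarrow> nat set \<Rightarrow> nat set \<Rightarrow> 'b" where
  "shift_map A i Y X = i (A \<union> Y) (A \<union> X)"

text \<open>
  The derivative of \<open>L / N\<close> along \<open>x\<close>, that is the cokernel of the map to its shift by \<open>x\<close>, is the quotient
  of \<open>shift_obj {x} L\<close> by \<open>deriv_den x i L N\<close>.
\<close>

definition deriv_den :: "nat \<Rightarrow> (nat set \<Rightarrow> nat set \<Rightarrow> 'g::ab_group_add \<Rightarrow> 'g) \<Rightarrow> (nat set \<Rightarrow> 'g set) \<Rightarrow> (nat set \<Rightarrow> 'g set) \<Rightarrow>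
    nat set \<Rightarrow> 'g set" where
  "deriv_den x i L N X = asum (N (insert x X)) (i X (insert x X) ` L X)"

lemma poset_functor_shift: "poset_functor i L \<Longrightarrow> poset_functor (shift_map A i) (shift_obj A L)"
  unfolding poset_functor_def shift_map_def shift_obj_def by (meson Un_mono subset_refl)

lemma subfunctor_shift: "subfunctor i L \<Longrightarrow> subfunctor (shift_map A i) (shift_obj A L)"
  unfolding subfunctor_def shift_map_def shift_obj_def by (auto intro: Un_mono)

text \<open>Putting back \<open>x\<close> itself is the map from the functor to its shift; putting
  back any other point is the differential of the shift. These are two entries of the cone
  differential.\<close>

lemma koszul_bd_insert:
  assumes "finite X" "x \<notin> X" "T \<subseteq> X"
  shows "koszul_bd i (insert x X) c T =
    koszul_bd (shift_map {x} i) X c T + sg x T (i (X - T) (insert x X - T) (c (insert x T)))"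
proof -
  have "insert x X - T = insert x (X - T)" "x \<notin> X - T" "insert x X - insert x T = X - T"
    using assms by auto
  moreover have "koszul_bd (shift_map {x} i) X c T =
      (\<Sum>y\<in>X - T. sg y T (i (insert x X - insert y T) (insert x X - T) (c (insert y T))))"
    unfolding koszul_bd_def
  proof (rule sum.cong[OF refl])
    fix y assume "y \<in> X - T"
    then have "insert x (X - insert y T) = insert x X - insert y T" "insert x (X - T) = insert x X - T"
      using assms by auto
    then show "sg y T (shift_map {x} i (X - insert y T) (X - T) (c (insert y T))) =
        sg y T (i (insert x X - insert y T) (insert x X - T) (c (insert y T)))"
      by (simp add: shift_map_def)
  qed
  ultimately show ?thesis
    using assms by (simp add: koszul_bd_def add.commute)
qed

text \<open>The third entry of the cone differential. Conjugation by \<open>sg x\<close> moves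
  \<open>x\<close> past the other removed points; in every summand one exchange of two points flips
  the sign by \<open>sg_swap\<close>, which leaves the single minus sign of a mapping cone.\<close>

lemma koszul_bd_insert_insert:
  assumes "finite X" "x \<notin> X" "T \<subseteq> X" "\<And>Y X. additive (i Y X)"
  shows "koszul_bd i (insert x X) c (insert x T) = - sg x T (koszul_bd i X (\<lambda>T. sg x T (c (insert x T))) T)"
proof -
  have fT: "finite T" "x \<notin> T"
    using assms finite_subset by auto
  have "koszul_bd i (insert x X) c (insert x T) =
      (\<Sum>y\<in>X - T. sg y (insert x T) (i (X - insert y T) (X - T) (c (insert y (insert x T)))))"
    unfolding koszul_bd_def
  proof (rule sum.cong)
    show "insert x X - insert x T = X - T"
      using assms by auto
    fix y assume "y \<in> X - T"
    then have "insert x X - insert y (insert x T) = X - insert y T" "insert x X - insert x T = X - T"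
      using assms by auto
    then show "sg y (insert x T) (i (insert x X - insert y (insert x T)) (insert x X - insert x T)
        (c (insert y (insert x T)))) = sg y (insert x T) (i (X - insert y T) (X - T) (c (insert y (insert x T))))"
      by simp
  qed
  also have "\<dots> = (\<Sum>y\<in>X - T. - sg x T (sg y T (i (X - insert y T) (X - T) (sg x (insert y T) (c (insert x (insert y T)))))))"
  proof (rule sum.cong[OF refl])
    fix y assume y: "y \<in> X - T"
    let ?v = "i (X - insert y T) (X - T) (c (insert y (insert x T)))"
    have "x \<noteq> y"
      using assms y by auto
    then have "sg x T (sg y (insert x T) ?v) = - sg y T (sg x (insert y T) ?v)"
      using y fT by (intro sg_swap) auto
    then have "sg x T (sg x T (sg y (insert x T) ?v)) = sg x T (- sg y T (sg x (insert y T) ?v))"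
      by simp
    then show "sg y (insert x T) (i (X - insert y T) (X - T) (c (insert y (insert x T)))) =
       - sg x T (sg y T (i (X - insert y T) (X - T) (sg x (insert y T) (c (insert x (insert y T))))))"
      by (simp add: sg_minus additive_sg[OF assms(4)] insert_commute)
  qed
  finally show ?thesis
    by (simp add: koszul_bd_def sg_sum sum_negf)
qed

section \<open>Mapping cones\<close>

lemma shift_obj_insert [simp]: "shift_obj {x} F X = F (insert x X)"
  by (simp add: shift_obj_def)

lemma shift_map_insert [simp]: "shift_map {x} i Y X = i (insert x Y) (insert x X)"
  by (simp add: shift_map_def)

lemma all_subsets_insert:
  assumes "finite X" "x \<notin> X"
    and "\<And>T. T \<subseteq> X \<Longrightarrow> card T = a \<Longrightarrow> c T \<in> F (insert x (X - T))"
    and "\<And>T b. T \<subseteq> X \<Longrightarrow> a = Suc (card T) \<Longrightarrow> c (insert x T) \<in> F (X - T)"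
  shows "chain F a (insert x X) c"
proof (rule chainI)
  fix T assume T: "T \<subseteq> insert x X" "card T = a"
  show "c T \<in> F (insert x X - T)"
  proof (cases "x \<in> T")
    case True
    let ?T = "T - {x}"
    have eq: "insert x ?T = T"
      using True by auto
    have "finite T"
      using T(1) assms(1) finite_subset by auto
    with True T(2) have "a = Suc (card ?T)"
      by (metis card.remove)
    then have "c (insert x ?T) \<in> F (X - ?T)"
      using T(1) by (intro assms(4)) auto
    moreover have "X - ?T = insert x X - T"
      using True assms(2) by auto
    ultimately show ?thesis
      unfolding eq by metis
  next
    case False
    moreover have "insert x (X - T) = insert x X - T"
      using False by auto
    ultimately show ?thesis
      using assms(3)[of T] T by auto
  qed
qed

lemma chain_insertD1:
  assumes "chain F a (insert x X) c" "x \<notin> X" "T \<subseteq> X" "card T = a"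
  shows "c T \<in> F (insert x (X - T))"
proof -
  have "insert x (X - T) = insert x X - T"
    using assms by auto
  then show ?thesis
    using chainD[OF assms(1) _ assms(4)] assms(3) by auto
qed

lemma chain_insertD2:
  assumes "chain F (Suc a) (insert x X) c" "finite X" "x \<notin> X" "T \<subseteq> X" "card T = a"
  shows "c (insert x T) \<in> F (X - T)"
proof -
  have "insert x X - insert x T = X - T"
    using assms by auto
  moreover have "x \<notin> T"
    using assms(3,4) by auto
  then have "card (insert x T) = Suc a"
    using assms(5) finite_subset[OF assms(4,2)] by simp
  ultimately show ?thesis
    using chainD[OF assms(1), of "insert x T"] assms(4) by auto
qed

lemma insert_diff_eq: "x \<notin> X \<Longrightarrow> T \<subseteq> X \<Longrightarrow> insert x X - T = insert x (X - T)"
  by auto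

text \<open>
  Up to sign, the Koszul complex at \<open>X \<union> {x}\<close> is the mapping cone of the map from the complex at \<open>X\<close> to that
  of the shift by \<open>x\<close>: a chain splits into its values at the \<open>T\<close> with \<open>x \<notin> T\<close> and at those with \<open>x \<in> T\<close>.
\<close>

definition cone_fst :: "nat \<Rightarrow> (nat set \<Rightarrow> 'g::ab_group_add) \<Rightarrow> nat set \<Rightarrow> 'g" where
  "cone_fst x c T = sg x T (c (insert x T))"

text \<open>Builds a cone chain from a component \<open>c\<close> in the shift and a component
  \<open>d\<close> in the functor itself; \<open>sg\<close> is its own inverse, so the twist is the
  same as in \<open>cone_fst\<close>.\<close>

definition cone_glue :: "nat \<Rightarrow> (nat set \<Rightarrow> 'g::ab_group_add) \<Rightarrow> (nat set \<Rightarrow> 'g) \<Rightarrow> nat set \<Rightarrow> 'g" where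
  "cone_glue x c d T = (if x \<in> T then sg x (T - {x}) (d (T - {x})) else c T)"

lemma cone_fst_glu: "x \<notin> T \<Longrightarrow> cone_fst x (cone_glue x c d) T = d T"
  by (simp add: cone_fst_def cone_glue_def insert_absorb)

lemma koszul_bd_cong:
  assumes "finite X" "T \<subseteq> X" "\<And>S. S \<subseteq> X \<Longrightarrow> card S = Suc (card T) \<Longrightarrow> c S = d S"
  shows "koszul_bd i X c T = koszul_bd i X d T"
  unfolding koszul_bd_def
proof (rule sum.cong[OF refl])
  fix x assume "x \<in> X - T"
  then have "c (insert x T) = d (insert x T)"
    using assms finite_subset[OF assms(2,1)] by (intro assms(3)) auto
  then show "sg x T (i (X - insert x T) (X - T) (c (insert x T))) =
      sg x T (i (X - insert x T) (X - T) (d (insert x T)))"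
    by simp
qed

context
  fixes i :: "nat set \<Rightarrow> nat set \<Rightarrow> 'g::ab_group_add \<Rightarrow> 'g" and x :: nat and X :: "nat set"
  assumes X: "finite X" "x \<notin> X"
begin

lemma cone_glue_out: "T \<subseteq> X \<Longrightarrow> cone_glue x c d T = c T"
  using X by (auto simp: cone_glue_def)

lemma cone_glue_in: "T \<subseteq> X \<Longrightarrow> cone_glue x c d (insert x T) = sg x T (d T)"
  using X by (auto simp: cone_glue_def insert_absorb subset_eq)

lemma chain_glu:
  assumes "subfunctor i F"
  shows "chain F (Suc a) (insert x X) (cone_glue x c d) \<longleftrightarrow> chain (shift_obj {x} F) (Suc a) X c \<and> chain F a X d"
proof
  assume c: "chain F (Suc a) (insert x X) (cone_glue x c d)"
  have "chain (shift_obj {x} F) (Suc a) X c"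
  proof (rule chainI)
    fix T assume "T \<subseteq> X" "card T = Suc a"
    then show "c T \<in> shift_obj {x} F (X - T)"
      using chain_insertD1[OF c X(2), of T] by (simp add: cone_glue_out)
  qed
  moreover have "chain F a X d"
  proof (rule chainI)
    fix T assume "T \<subseteq> X" "card T = a"
    then show "d T \<in> F (X - T)"
      using chain_insertD2[OF c X, of T] by (simp add: cone_glue_in sg_mem[OF subfunctor_asubgrp[OF assms]])
  qed
  ultimately show "chain (shift_obj {x} F) (Suc a) X c \<and> chain F a X d" ..
next
  assume "chain (shift_obj {x} F) (Suc a) X c \<and> chain F a X d"
  then show "chain F (Suc a) (insert x X) (cone_glue x c d)"
    by (intro all_subsets_insert X) (auto simp: cone_glue_in cone_glue_out chain_def sg_mem[OF subfunctor_asubgrp[OF assms]])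
qed

lemma chain_glu_zero: "chain F 0 (insert x X) (cone_glue x c d) \<longleftrightarrow> chain (shift_obj {x} F) 0 X c"
  using X by (simp add: chain_zero_iff cone_glue_def)

lemma cone_glue_lft:
  assumes "T \<subseteq> insert x X"
  shows "cone_glue x c (cone_fst x c) T = c T"
  by (simp add: cone_glue_def cone_fst_def insert_absorb)

lemma chain_split:
  assumes "subfunctor i F" "chain F (Suc a) (insert x X) c"
  shows "chain (shift_obj {x} F) (Suc a) X c" "chain F a X (cone_fst x c)"
proof -
  have "chain F (Suc a) (insert x X) (cone_glue x c (cone_fst x c))"
    using assms(2) by (simp add: chain_def cone_glue_lft)
  then show "chain (shift_obj {x} F) (Suc a) X c" "chain F a X (cone_fst x c)"
    by (simp_all add: chain_glu[OF assms(1)])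
qed

lemma koszul_bd_out:
  assumes add: "\<And>Y X. additive (i Y X)" and "T \<subseteq> X"
  shows "koszul_bd i (insert x X) c T = koszul_bd (shift_map {x} i) X c T + i (X - T) (insert x (X - T)) (cone_fst x c T)"
  using koszul_bd_insert[OF X assms(2), of i c] by (simp add: insert_diff_eq[OF X(2) assms(2)] cone_fst_def additive_sg[OF add])

lemma cone_fst_bd: "(\<And>Y X. additive (i Y X)) \<Longrightarrow> T \<subseteq> X \<Longrightarrow> cone_fst x (koszul_bd i (insert x X) c) T = - koszul_bd i X (cone_fst x c) T"
  using koszul_bd_insert_insert[OF X, of T i c] by (simp add: cone_fst_def[abs_def] sg_minus)

end

text \<open>The maps to the shift form a chain map: both composites are the single map from
  \<open>X - insert y T\<close> to \<open>insert x (X - T)\<close>.\<close>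

lemma koszul_bd_shift_i:
  assumes "finite X" "poset_functor i L" "chain L (Suc a) X c" "T \<subseteq> X" "card T = a" "x \<notin> X"
  shows "koszul_bd (shift_map {x} i) X (\<lambda>T. i (X - T) (insert x (X - T)) (c T)) T = i (X - T) (insert x (X - T)) (koszul_bd i X c T)"
proof -
  note add = poset_functor_additive[OF assms(2)]
  have "i (X - T) (insert x (X - T)) (koszul_bd i X c T) =
      (\<Sum>y\<in>X - T. sg y T (i (X - T) (insert x (X - T)) (i (X - insert y T) (X - T) (c (insert y T)))))"
    by (simp add: koszul_bd_def additive.sum[OF add] additive_sg[OF add])
  also have "\<dots> = koszul_bd (shift_map {x} i) X (\<lambda>T. i (X - T) (insert x (X - T)) (c T)) T"
    unfolding koszul_bd_def shift_map_insert
  proof (rule sum.cong[OF refl])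
    fix y assume y: "y \<in> X - T"
    have c: "c (insert y T) \<in> L (X - insert y T)"
      using y assms finite_subset[OF assms(4,1)] by (intro chainD[OF assms(3)]) auto
    have "i (X - T) (insert x (X - T)) (i (X - insert y T) (X - T) (c (insert y T))) =
       i (insert x (X - insert y T)) (insert x (X - T)) (i (X - insert y T) (insert x (X - insert y T)) (c (insert y T)))"
      by (subst (1 2) poset_functor_comp[OF assms(2) c]) auto
    then show "sg y T (i (X - T) (insert x (X - T)) (i (X - insert y T) (X - T) (c (insert y T)))) =
       sg y T (i (insert x (X - insert y T)) (insert x (X - T)) (i (X - insert y T) (insert x (X - insert y T)) (c (insert y T))))"
      by simp
  qed
  finally show ?thesis
    by simp
qed

lemma chain_shift_i:
  assumes "subfunctor i F" "chain F a X c"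
  shows "chain (shift_obj {x} F) a X (\<lambda>T. i (X - T) (insert x (X - T)) (c T))"
proof (rule chainI)
  fix T assume T: "T \<subseteq> X" "card T = a"
  show "i (X - T) (insert x (X - T)) (c T) \<in> shift_obj {x} F (X - T)"
    unfolding shift_obj_insert by (rule subfunctor_map[OF assms(1) chainD[OF assms(2) T]]) auto
qed

text \<open>The cone gives H_a(V)_X -> H_a(SV)_X -> H_a(V)_{X+x} -> H_{a-1}(V)_X, with SV the shift
  by \<open>x\<close>. This lemma and the next two are its exactness at the three kinds of places,
  here at H_a(SV)_X.\<close>

lemma koszul_zero_cone1:
  assumes X: "finite X" "x \<notin> X" and p: "poset_functor i L" and L: "subfunctor i L" and N: "subfunctor i N"
    and V: "koszul_zero i L N a X" "koszul_zero i L N a (insert x X)"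
  shows "koszul_zero (shift_map {x} i) (shift_obj {x} L) (shift_obj {x} N) a X"
proof (rule koszul_zeroI)
  note add = poset_functor_additive[OF p]
  note cone_glue = cone_glue_out[OF X] cone_glue_in[OF X] and chain_glu = chain_glu[OF X] and koszul_bd_out = koszul_bd_out[OF X add]
  fix c assume c: "chain (shift_obj {x} L) a X c"
    and cyc: "\<And>b. a = Suc b \<Longrightarrow> chain (shift_obj {x} N) b X (koszul_bd (shift_map {x} i) X c)"
  \<comment> \<open>The shift sits inside the cone as the chains whose component in the functor
    itself is zero.\<close>
  let ?g = "cone_glue x c (\<lambda>_. 0)"
  have zero: "chain F b X (\<lambda>_. 0)" if "subfunctor i F" for F b
    using that by (simp add: chain_def subfunctor_asubgrp asubgrp_zero)
  have "chain L a (insert x X) ?g"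
    using c zero[OF L] by (cases a) (simp_all add: chain_glu[OF L] chain_glu_zero[OF X])
  moreover have "chain N b (insert x X) (koszul_bd i (insert x X) ?g)" if "a = Suc b" for b
  proof (rule all_subsets_insert[OF X])
    fix T assume T: "T \<subseteq> X" "card T = b"
    have "koszul_bd (shift_map {x} i) X ?g T = koszul_bd (shift_map {x} i) X c T"
      by (rule koszul_bd_cong[OF X(1) T(1)]) (simp add: cone_glue)
    moreover have "x \<notin> T"
      using T X by auto
    ultimately have "koszul_bd i (insert x X) ?g T = koszul_bd (shift_map {x} i) X c T"
      using T(1) by (simp add: koszul_bd_out cone_fst_glu additive.zero[OF add])
    then show "koszul_bd i (insert x X) ?g T \<in> N (insert x (X - T))"
      using chainD[OF cyc[OF that] T] by simp
  next
    fix T b' assume T: "T \<subseteq> X" "b = Suc (card T)"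
    have "cone_fst x (koszul_bd i (insert x X) ?g) T = - koszul_bd i X (cone_fst x ?g) T"
      by (rule cone_fst_bd[OF X add T(1)])
    also have "koszul_bd i X (cone_fst x ?g) T = koszul_bd i X (\<lambda>_. 0) T"
      by (rule koszul_bd_cong[OF X(1) T(1)]) (use X in \<open>auto simp: cone_fst_glu subset_eq\<close>)
    also have "\<dots> = 0"
      by (simp add: koszul_bd_def additive.zero[OF add])
    finally show "koszul_bd i (insert x X) ?g (insert x T) \<in> N (X - T)"
      using subfunctor_asubgrp[OF N] by (simp add: cone_fst_def sg_def asubgrp_zero split: if_splits)
  qed
  ultimately obtain e where e: "chain L (Suc a) (insert x X) e" "chain N a (insert x X) (\<lambda>T. ?g T - koszul_bd i (insert x X) e T)"
    by (rule koszul_zeroE[OF V(2)])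
  note e' = chain_split[OF X L e(1)]
  have "chain N b X (koszul_bd i X (cone_fst x e))" if b: "a = Suc b" for b
  proof (rule chainI)
    fix T assume T: "T \<subseteq> X" "card T = b"
    have "?g (insert x T) - koszul_bd i (insert x X) e (insert x T) \<in> N (X - T)"
      using chain_insertD2[OF e(2)[unfolded b] X T] .
    then have "cone_fst x (koszul_bd i (insert x X) e) T \<in> N (X - T)"
      using T subfunctor_asubgrp[OF N] by (simp add: cone_glue cone_fst_def sg_mem asubgrp_uminus_iff)
    then show "koszul_bd i X (cone_fst x e) T \<in> N (X - T)"
      using T subfunctor_asubgrp[OF N] by (simp add: cone_fst_bd[OF X add] asubgrp_uminus_iff)
  qed
  with e'(2) obtain f where f: "chain L (Suc a) X f" "chain N a X (\<lambda>T. cone_fst x e T - koszul_bd i X f T)"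
    by (rule koszul_zeroE[OF V(1)])
  \<comment> \<open>The component of \<open>e\<close> outside the shift agrees modulo
    \<open>N\<close> with the boundary of \<open>f\<close>, so its image in the shift is, modulo
    \<open>N\<close>, the boundary of \<open>?f\<close> and can be absorbed into the
    filling.\<close>
  let ?f = "\<lambda>T. i (X - T) (insert x (X - T)) (f T)"
  have "chain (shift_obj {x} L) (Suc a) X ?f"
    by (rule chain_shift_i[OF L f(1)])
  then have 1: "chain (shift_obj {x} L) (Suc a) X (\<lambda>T. e T + ?f T)"
    using e'(1) by (intro chain_add[OF subfunctor_shift[OF L]])
  have "chain (shift_obj {x} N) a X (\<lambda>T. c T - koszul_bd (shift_map {x} i) X (\<lambda>T. e T + ?f T) T)"
  proof (rule chainI)
    fix T assume T: "T \<subseteq> X" "card T = a"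
    have "?g T - koszul_bd i (insert x X) e T \<in> N (insert x (X - T))"
      by (rule chain_insertD1[OF e(2) X(2) T])
    then have "c T - (koszul_bd (shift_map {x} i) X e T + i (X - T) (insert x (X - T)) (cone_fst x e T)) \<in> N (insert x (X - T))"
      using T by (simp add: cone_glue koszul_bd_out)
    moreover have "i (X - T) (insert x (X - T)) (cone_fst x e T - koszul_bd i X f T) \<in> N (insert x (X - T))"
      by (rule subfunctor_map[OF N chainD[OF f(2) T]]) auto
    ultimately have "c T - (koszul_bd (shift_map {x} i) X e T + i (X - T) (insert x (X - T)) (cone_fst x e T)) +
        i (X - T) (insert x (X - T)) (cone_fst x e T - koszul_bd i X f T) \<in> N (insert x (X - T))"
      by (rule asubgrp_add[OF subfunctor_asubgrp[OF N]])
    moreover have "koszul_bd (shift_map {x} i) X (\<lambda>T. e T + ?f T) T =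
        koszul_bd (shift_map {x} i) X e T + i (X - T) (insert x (X - T)) (koszul_bd i X f T)"
      using koszul_bd_shift_i[OF X(1) p f(1) T X(2)]
      by (simp add: koszul_bd_add[OF poset_functor_additive[OF poset_functor_shift[OF p]]] del: shift_map_insert)
    ultimately show "c T - koszul_bd (shift_map {x} i) X (\<lambda>T. e T + ?f T) T \<in> shift_obj {x} N (X - T)"
      by (simp add: additive.diff[OF add] algebra_simps)
  qed
  with 1 show "\<exists>e. chain (shift_obj {x} L) (Suc a) X e \<and> chain (shift_obj {x} N) a X (\<lambda>T. c T - koszul_bd (shift_map {x} i) X e T)"
    by blast
qed

text \<open>Exactness at H_a(V)_X: if the image of the cycle \<open>c\<close> in the shift is
  bounded by \<open>e\<close>, the pair of \<open>- e\<close> and \<open>c\<close> is a cycle of the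
  cone; a filling of this pair has a component that fills \<open>c\<close> up to sign.\<close>

lemma koszul_zero_cone2:
  assumes X: "finite X" "x \<notin> X" and p: "poset_functor i L" and L: "subfunctor i L" and N: "subfunctor i N"
    and SV: "koszul_zero (shift_map {x} i) (shift_obj {x} L) (shift_obj {x} N) a X" and V: "koszul_zero i L N (Suc a) (insert x X)"
  shows "koszul_zero i L N a X"
proof (rule koszul_zeroI)
  note add = poset_functor_additive[OF p]
  note cone_glue = cone_glue_out[OF X] cone_glue_in[OF X] and chain_glu = chain_glu[OF X] and koszul_bd_out = koszul_bd_out[OF X add]
  fix c assume c: "chain L a X c" and cyc: "\<And>b. a = Suc b \<Longrightarrow> chain N b X (koszul_bd i X c)"
  let ?c = "\<lambda>T. i (X - T) (insert x (X - T)) (c T)"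
  have "chain (shift_obj {x} N) b X (koszul_bd (shift_map {x} i) X ?c)" if b: "a = Suc b" for b
  proof (rule chainI)
    fix T assume T: "T \<subseteq> X" "card T = b"
    show "koszul_bd (shift_map {x} i) X ?c T \<in> shift_obj {x} N (X - T)"
      using koszul_bd_shift_i[OF X(1) p c[unfolded b] T X(2)] subfunctor_map[OF N chainD[OF cyc[OF b] T]]
      by auto
  qed
  with chain_shift_i[OF L c] obtain e
    where e: "chain (shift_obj {x} L) (Suc a) X e" "chain (shift_obj {x} N) a X (\<lambda>T. ?c T - koszul_bd (shift_map {x} i) X e T)"
    by (rule koszul_zeroE[OF SV])
  let ?g = "cone_glue x (\<lambda>T. - e T) c"
  have "chain L (Suc a) (insert x X) ?g"
    using c chain_uminus[OF subfunctor_shift[OF L] e(1)] by (simp add: chain_glu[OF L])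
  moreover have "chain N a (insert x X) (koszul_bd i (insert x X) ?g)"
  proof (rule all_subsets_insert[OF X])
    fix T assume T: "T \<subseteq> X" "card T = a"
    have "koszul_bd (shift_map {x} i) X ?g T = koszul_bd (shift_map {x} i) X (\<lambda>T. - e T) T"
      by (rule koszul_bd_cong[OF X(1) T(1)]) (simp add: cone_glue)
    moreover have "x \<notin> T"
      using T X by auto
    ultimately have "koszul_bd i (insert x X) ?g T = ?c T - koszul_bd (shift_map {x} i) X e T"
      using T(1) by (simp add: koszul_bd_out cone_fst_glu koszul_bd_uminus[OF poset_functor_additive[OF poset_functor_shift[OF p]]] del: shift_map_insert)
    then show "koszul_bd i (insert x X) ?g T \<in> N (insert x (X - T))"
      using chainD[OF e(2) T] by simp
  next
    fix T b' assume T: "T \<subseteq> X" "a = Suc (card T)"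
    have "cone_fst x (koszul_bd i (insert x X) ?g) T = - koszul_bd i X (cone_fst x ?g) T"
      by (rule cone_fst_bd[OF X add T(1)])
    also have "koszul_bd i X (cone_fst x ?g) T = koszul_bd i X c T"
      by (rule koszul_bd_cong[OF X(1) T(1)]) (use X in \<open>auto simp: cone_fst_glu subset_eq\<close>)
    finally show "koszul_bd i (insert x X) ?g (insert x T) \<in> N (X - T)"
      using subfunctor_asubgrp[OF N] chainD[OF cyc[OF T(2)] T(1)]
      by (metis cone_fst_def sg_mem asubgrp_uminus_iff)
  qed
  ultimately obtain f
    where f: "chain L (Suc (Suc a)) (insert x X) f" "chain N (Suc a) (insert x X) (\<lambda>T. ?g T - koszul_bd i (insert x X) f T)"
    by (rule koszul_zeroE_Suc[OF V])
  note f' = chain_split[OF X L f(1)]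
  have "chain N a X (\<lambda>T. c T - koszul_bd i X (\<lambda>T. - cone_fst x f T) T)"
  proof (rule chainI)
    fix T assume T: "T \<subseteq> X" "card T = a"
    have "?g (insert x T) - koszul_bd i (insert x X) f (insert x T) \<in> N (X - T)"
      by (rule chain_insertD2[OF f(2) X T])
    then have "sg x T (?g (insert x T) - koszul_bd i (insert x X) f (insert x T)) \<in> N (X - T)"
      using subfunctor_asubgrp[OF N] by (simp add: sg_mem)
    moreover have "sg x T (koszul_bd i (insert x X) f (insert x T)) = - koszul_bd i X (cone_fst x f) T"
      using cone_fst_bd[OF X add T(1)] by (simp add: cone_fst_def)
    ultimately show "c T - koszul_bd i X (\<lambda>T. - cone_fst x f T) T \<in> N (X - T)"
      using T by (simp add: cone_glue sg_diff koszul_bd_uminus[OF add])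
  qed
  with chain_uminus[OF L f'(2)]
  show "\<exists>e. chain L (Suc a) X e \<and> chain N a X (\<lambda>T. c T - koszul_bd i X e T)"
    by blast
qed

text \<open>Exactness at H_{a+1}(V)_{X+x}: the component of a cone cycle outside the shift is a
  cycle, bounded by \<open>f\<close>; adding the image of \<open>f\<close> to the other component
  turns that one into a cycle of the shift.\<close>

lemma koszul_zero_cone3:
  assumes X: "finite X" "x \<notin> X" and p: "poset_functor i L" and L: "subfunctor i L" and N: "subfunctor i N"
    and NL: "\<And>Y. N Y \<subseteq> L Y"
    and SV: "koszul_zero (shift_map {x} i) (shift_obj {x} L) (shift_obj {x} N) (Suc a) X" and V: "koszul_zero i L N a X"
  shows "koszul_zero i L N (Suc a) (insert x X)"
proof (rule koszul_zeroI)
  note add = poset_functor_additive[OF p]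
  note adds = poset_functor_additive[OF poset_functor_shift[OF p]]
  note cone_glue = cone_glue_out[OF X] cone_glue_in[OF X] and chain_glu = chain_glu[OF X] and koszul_bd_out = koszul_bd_out[OF X add]
  let ?i = "shift_map {x} i" and ?X = "insert x X"
  fix c assume c: "chain L (Suc a) ?X c" and "\<And>b. Suc a = Suc b \<Longrightarrow> chain N b ?X (koszul_bd i ?X c)"
  then have cyc: "chain N a ?X (koszul_bd i ?X c)"
    by simp
  note c' = chain_split[OF X L c]
  have "chain N b X (koszul_bd i X (cone_fst x c))" if b: "a = Suc b" for b
  proof (rule chainI)
    fix T assume T: "T \<subseteq> X" "card T = b"
    have "cone_fst x (koszul_bd i ?X c) T \<in> N (X - T)"
      unfolding cone_fst_def using chain_insertD2[OF cyc[unfolded b] X T] subfunctor_asubgrp[OF N] by (simp add: sg_mem)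
    then show "koszul_bd i X (cone_fst x c) T \<in> N (X - T)"
      using T subfunctor_asubgrp[OF N] by (simp add: cone_fst_bd[OF X add] asubgrp_uminus_iff)
  qed
  with c'(2) obtain f where f: "chain L (Suc a) X f" "chain N a X (\<lambda>T. cone_fst x c T - koszul_bd i X f T)"
    by (rule koszul_zeroE[OF V])
  let ?f = "\<lambda>T. i (X - T) (insert x (X - T)) (f T)"
  define g where "g T = c T + ?f T" for T
  have g: "chain (shift_obj {x} L) (Suc a) X g"
    unfolding g_def by (intro chain_add[OF subfunctor_shift[OF L]] chain_shift_i L f c')
  have "chain (shift_obj {x} N) a X (koszul_bd ?i X g)"
  proof (rule chainI)
    fix T assume T: "T \<subseteq> X" "card T = a"
    have "koszul_bd i ?X c T \<in> N (insert x (X - T))"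
      by (rule chain_insertD1[OF cyc X(2) T])
    then have "koszul_bd ?i X c T + i (X - T) (insert x (X - T)) (cone_fst x c T) \<in> N (insert x (X - T))"
      using T by (simp add: koszul_bd_out)
    moreover have "i (X - T) (insert x (X - T)) (cone_fst x c T - koszul_bd i X f T) \<in> N (insert x (X - T))"
      by (rule subfunctor_map[OF N chainD[OF f(2) T]]) auto
    ultimately have "koszul_bd ?i X c T + i (X - T) (insert x (X - T)) (cone_fst x c T) -
      i (X - T) (insert x (X - T)) (cone_fst x c T - koszul_bd i X f T) \<in> N (insert x (X - T))"
      by (rule asubgrp_diff[OF subfunctor_asubgrp[OF N]])
    moreover have "koszul_bd ?i X g T = koszul_bd ?i X c T + i (X - T) (insert x (X - T)) (koszul_bd i X f T)"
      using koszul_bd_shift_i[OF X(1) p f(1) T X(2)]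
      by (simp add: g_def[abs_def] koszul_bd_add[OF adds] del: shift_map_insert)
    ultimately show "koszul_bd ?i X g T \<in> shift_obj {x} N (X - T)"
      by (simp add: additive.diff[OF add])
  qed
  with g obtain h where h: "chain (shift_obj {x} L) (Suc (Suc a)) X h" "chain (shift_obj {x} N) (Suc a) X (\<lambda>T. g T - koszul_bd ?i X h T)"
    by (rule koszul_zeroE_Suc[OF SV])
  let ?e = "cone_glue x h (\<lambda>T. - f T)"
  have e: "chain L (Suc (Suc a)) ?X ?e"
    using h(1) chain_uminus[OF L f(1)] by (simp add: chain_glu[OF L])
  have "chain N (Suc a) ?X (\<lambda>T. c T - koszul_bd i ?X ?e T)"
  proof (rule all_subsets_insert[OF X])
    fix T assume T: "T \<subseteq> X" "card T = Suc a"
    have "koszul_bd ?i X ?e T = koszul_bd ?i X h T"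
      by (rule koszul_bd_cong[OF X(1) T(1)]) (simp add: cone_glue)
    moreover have "x \<notin> T"
      using T X by auto
    ultimately have "koszul_bd i ?X ?e T = koszul_bd ?i X h T - ?f T"
      using T(1) by (simp add: koszul_bd_out cone_fst_glu additive.minus[OF add])
    then have "c T - koszul_bd i ?X ?e T = g T - koszul_bd ?i X h T"
      by (simp add: g_def)
    then show "c T - koszul_bd i ?X ?e T \<in> N (insert x (X - T))"
      using chainD[OF h(2) T] by simp
  next
    fix T b' assume T: "T \<subseteq> X" "Suc a = Suc (card T)"
    have "cone_fst x (koszul_bd i ?X ?e) T = - koszul_bd i X (cone_fst x ?e) T"
      by (rule cone_fst_bd[OF X add T(1)])
    also have "koszul_bd i X (cone_fst x ?e) T = koszul_bd i X (\<lambda>T. - f T) T"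
      by (rule koszul_bd_cong[OF X(1) T(1)]) (use X in \<open>auto simp: cone_fst_glu subset_eq\<close>)
    finally have "cone_fst x (koszul_bd i ?X ?e) T = koszul_bd i X f T"
      by (simp add: koszul_bd_uminus[OF add])
    then have "sg x T (c (insert x T) - koszul_bd i ?X ?e (insert x T)) = cone_fst x c T - koszul_bd i X f T"
      by (simp add: cone_fst_def sg_diff)
    then show "c (insert x T) - koszul_bd i ?X ?e (insert x T) \<in> N (X - T)"
      using subfunctor_asubgrp[OF N] chainD[OF f(2) T(1)] T(2) by (metis sg_mem Suc_inject)
  qed
  with e show "\<exists>e. chain L (Suc (Suc a)) ?X e \<and> chain N (Suc a) ?X (\<lambda>T. c T - koszul_bd i ?X e T)"
    by blast
qed

lemma subfunctor_dN:
  assumes "poset_functor i L" "subfunctor i L" "subfunctor i N"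
  shows "subfunctor (shift_map {x} i) (deriv_den x i L N)"
  unfolding subfunctor_def
proof (intro conjI allI ballI impI)
  note add = poset_functor_additive[OF assms(1)]
  fix X show "asubgrp (deriv_den x i L N X)"
    unfolding deriv_den_def by (intro asubgrp_asum asubgrp_image add subfunctor_asubgrp[OF assms(2)] subfunctor_asubgrp[OF assms(3)])
next
  note add = poset_functor_additive[OF assms(1)]
  fix Y X u assume u: "u \<in> deriv_den x i L N Y" and YX: "Y \<subseteq> X"
  then obtain n l where nl: "u = n + i Y (insert x Y) l" "n \<in> N (insert x Y)" "l \<in> L Y"
    by (auto simp: deriv_den_def asum_def)
  have "i (insert x Y) (insert x X) u = i (insert x Y) (insert x X) n + i X (insert x X) (i Y X l)"
    using poset_functor_comp[OF assms(1) nl(3), of "insert x Y" "insert x X"] poset_functor_comp[OF assms(1) nl(3) YX, of "insert x X"] YX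
    by (simp add: nl additive.add[OF add] insert_mono subset_insertI2 subset_insertI)
  moreover have "i (insert x Y) (insert x X) n \<in> N (insert x X)"
    using YX by (intro subfunctor_map[OF assms(3) nl(2)]) auto
  moreover have "i Y X l \<in> L X"
    by (rule subfunctor_map[OF assms(2) nl(3) YX])
  ultimately show "shift_map {x} i Y X u \<in> deriv_den x i L N X"
    by (auto simp: deriv_den_def intro: asumI)
qed

text \<open>
  When the map to the shift is injective, the mapping cone is quasi-isomorphic to the complex of the derivative.
\<close>

lemma koszul_zero_derivative:
  assumes X: "finite X" "x \<notin> X" and p: "poset_functor i L" and L: "subfunctor i L" and N: "subfunctor i N"
    and tf: "\<And>Y u. Y \<subseteq> X \<Longrightarrow> u \<in> L Y \<Longrightarrow> i Y (insert x Y) u \<in> N (insert x Y) \<Longrightarrow> u \<in> N Y"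
    and D: "koszul_zero (shift_map {x} i) (shift_obj {x} L) (deriv_den x i L N) a X"
  shows "koszul_zero i L N a (insert x X)"
proof (rule koszul_zeroI)
  note add = poset_functor_additive[OF p]
  note adds = poset_functor_additive[OF poset_functor_shift[OF p]]
  note cone_glue = cone_glue_out[OF X] cone_glue_in[OF X] and koszul_bd_out = koszul_bd_out[OF X add]
  let ?i = "shift_map {x} i" and ?X = "insert x X"
  fix c assume c: "chain L a ?X c" and cyc: "\<And>b. a = Suc b \<Longrightarrow> chain N b ?X (koszul_bd i ?X c)"
  have cs: "chain (shift_obj {x} L) a X c"
    using chain_insertD1[OF c X(2)] by (auto intro: chainI)
  have "chain (deriv_den x i L N) b X (koszul_bd ?i X c)" if b: "a = Suc b" for b
  proof (rule chainI)
    fix T assume T: "T \<subseteq> X" "card T = b"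
    have "koszul_bd i ?X c T \<in> N (insert x (X - T))"
      by (rule chain_insertD1[OF cyc[OF b] X(2) T])
    moreover have "- cone_fst x c T \<in> L (X - T)"
      using chainD[OF chain_split(2)[OF X L c[unfolded b]] T] subfunctor_asubgrp[OF L] by (simp add: asubgrp_uminus)
    moreover have "koszul_bd ?i X c T = koszul_bd i ?X c T + i (X - T) (insert x (X - T)) (- cone_fst x c T)"
      using T by (simp add: koszul_bd_out additive.minus[OF add])
    ultimately show "koszul_bd ?i X c T \<in> deriv_den x i L N (X - T)"
      by (auto simp: deriv_den_def intro: asumI)
  qed
  with cs obtain e where e: "chain (shift_obj {x} L) (Suc a) X e" "chain (deriv_den x i L N) a X (\<lambda>T. c T - koszul_bd ?i X e T)"
    by (rule koszul_zeroE[OF D])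
  \<comment> \<open>What the derivative leaves over is, modulo \<open>N\<close>, the image of some
    \<open>l\<close>; this \<open>l\<close> serves as the component of the filling outside the
    shift, where the cone differential adds its image.\<close>
  have "\<forall>T. \<exists>l. T \<subseteq> X \<and> card T = a \<longrightarrow>
      l \<in> L (X - T) \<and> c T - koszul_bd ?i X e T - i (X - T) (insert x (X - T)) l \<in> N (insert x (X - T))"
  proof
    fix T
    show "\<exists>l. T \<subseteq> X \<and> card T = a \<longrightarrow>
      l \<in> L (X - T) \<and> c T - koszul_bd ?i X e T - i (X - T) (insert x (X - T)) l \<in> N (insert x (X - T))"
    proof (cases "T \<subseteq> X \<and> card T = a")
      case True
      then have "c T - koszul_bd ?i X e T \<in> deriv_den x i L N (X - T)"
        using chainD[OF e(2)] by blast
      then obtain n l where "c T - koszul_bd ?i X e T = n + i (X - T) (insert x (X - T)) l" "n \<in> N (insert x (X - T))" "l \<in> L (X - T)"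
        by (auto simp: deriv_den_def asum_def)
      then show ?thesis
        by (intro exI[of _ l]) auto
    qed blast
  qed
  then obtain l where l: "\<And>T. T \<subseteq> X \<Longrightarrow> card T = a \<Longrightarrow> l T \<in> L (X - T)"
    "\<And>T. T \<subseteq> X \<Longrightarrow> card T = a \<Longrightarrow> c T - koszul_bd ?i X e T - i (X - T) (insert x (X - T)) (l T) \<in> N (insert x (X - T))"
    by metis
  let ?e = "cone_glue x e l"
  have lc: "chain L a X l"
    using l(1) by (rule chainI)
  have ec: "chain L (Suc a) ?X ?e"
    using e(1) lc by (simp add: chain_glu[OF X L])
  let ?g = "\<lambda>T. c T - koszul_bd i ?X ?e T"
  have gT: "?g T \<in> N (insert x (X - T))" if T: "T \<subseteq> X" "card T = a" for T
  proof -
    have "koszul_bd ?i X ?e T = koszul_bd ?i X e T"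
      by (rule koszul_bd_cong[OF X(1) T(1)]) (simp add: cone_glue)
    moreover have "x \<notin> T"
      using T X by auto
    ultimately have "koszul_bd i ?X ?e T = koszul_bd ?i X e T + i (X - T) (insert x (X - T)) (l T)"
      using T(1) by (simp add: koszul_bd_out cone_fst_glu)
    then show ?thesis
      using l(2)[OF T] by (simp add: algebra_simps)
  qed
  have "chain N a ?X ?g"
  proof (rule all_subsets_insert[OF X])
    show "?g T \<in> N (insert x (X - T))" if "T \<subseteq> X" "card T = a" for T
      by (rule gT[OF that])
    fix T b' assume T: "T \<subseteq> X" "a = Suc (card T)"
    let ?b = "card T"
    have gc: "chain L (Suc ?b) ?X ?g"
      using chain_diff[OF L c koszul_bd_chain[OF _ L ec]] X T by simp
    have gl: "cone_fst x ?g T \<in> L (X - T)"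
      using chainD[OF chain_split(2)[OF X L gc] T(1)] by simp
    \<comment> \<open>Injectivity enters here: \<open>?g\<close> is a cycle modulo \<open>N\<close>
      and its values at sets without \<open>x\<close> lie in \<open>N\<close>, so the image of its
      remaining component lies in \<open>N\<close>, hence so does the component.\<close>
    have "koszul_bd i ?X ?g T = koszul_bd i ?X c T - koszul_bd i ?X (koszul_bd i ?X ?e) T"
      by (rule koszul_bd_diff[OF add])
    also have "koszul_bd i ?X (koszul_bd i ?X ?e) T = 0"
      using T X ec by (intro koszul_bd_bd[OF _ p, of _ ?b]) auto
    finally have "koszul_bd i ?X ?g T \<in> N (insert x (X - T))"
      using chain_insertD1[OF cyc[OF T(2)] X(2) T(1)] by simp
    then have "koszul_bd ?i X ?g T + i (X - T) (insert x (X - T)) (cone_fst x ?g T) \<in> N (insert x (X - T))"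
      using T(1) by (simp add: koszul_bd_out)
    moreover have "koszul_bd ?i X ?g T \<in> shift_obj {x} N (X - T)"
    proof (rule chainD[OF koszul_bd_chain[OF X(1) subfunctor_shift[OF N]] T(1) refl])
      show "chain (shift_obj {x} N) (Suc (card T)) X ?g"
      proof (rule chainI)
        fix S assume "S \<subseteq> X" "card S = Suc (card T)"
        then show "?g S \<in> shift_obj {x} N (X - S)"
          using gT[of S] T(2) by simp
      qed
    qed
    ultimately have "i (X - T) (insert x (X - T)) (cone_fst x ?g T) \<in> N (insert x (X - T))"
      unfolding shift_obj_insert using asubgrp_add_cancel_left[OF subfunctor_asubgrp[OF N]] by blast
    then have "cone_fst x ?g T \<in> N (X - T)"
      by (rule tf[OF Diff_subset gl])
    then show "?g (insert x T) \<in> N (X - T)"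
      using subfunctor_asubgrp[OF N] by (simp add: cone_fst_def sg_mem)
  qed
  with ec show "\<exists>e. chain L (Suc a) ?X e \<and> chain N a ?X (\<lambda>T. c T - koszul_bd i ?X e T)"
    by blast
qed

section \<open>Shifts and derivatives\<close>

definition functor_pair ::
    "(nat set \<Rightarrow> nat set \<Rightarrow> 'g::ab_group_add \<Rightarrow> 'g) \<Rightarrow> (nat set \<Rightarrow> 'g set) \<Rightarrow> (nat set \<Rightarrow> 'g set) \<Rightarrow> bool" where
  "functor_pair i L N \<longleftrightarrow> poset_functor i L \<and> subfunctor i L \<and> subfunctor i N \<and> (\<forall>X. N X \<subseteq> L X)"

lemma functor_pairD:
  assumes "functor_pair i L N"
  shows "poset_functor i L" "subfunctor i L" "subfunctor i N" "N X \<subseteq> L X"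
  using assms by (auto simp: functor_pair_def)

lemma functor_pair_shift: "functor_pair i L N \<Longrightarrow> functor_pair (shift_map A i) (shift_obj A L) (shift_obj A N)"
  by (auto simp: functor_pair_def poset_functor_shift subfunctor_shift) (auto simp: shift_obj_def)

lemma deriv_den_subset:
  assumes "functor_pair i L N" shows "deriv_den x i L N X \<subseteq> L (insert x X)"
proof
  fix u assume "u \<in> deriv_den x i L N X"
  then obtain n l where u: "u = n + i X (insert x X) l" "n \<in> N (insert x X)" "l \<in> L X"
    by (auto simp: deriv_den_def asum_def)
  have "n \<in> L (insert x X)" "i X (insert x X) l \<in> L (insert x X)"
    using u(2) functor_pairD(4)[OF assms] subfunctor_map[OF functor_pairD(2)[OF assms] u(3) subset_insertI] by auto
  then show "u \<in> L (insert x X)"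
    unfolding u(1) by (rule asubgrp_add[OF subfunctor_asubgrp[OF functor_pairD(2)[OF assms]]])
qed

lemma functor_pair_dN:
  assumes "functor_pair i L N"
  shows "functor_pair (shift_map {x} i) (shift_obj {x} L) (deriv_den x i L N)"
  unfolding functor_pair_def
  using functor_pairD[OF assms] deriv_den_subset[OF assms, of x] by (simp add: poset_functor_shift subfunctor_shift subfunctor_dN)

lemma shift_obj_shf: "shift_obj {x} (shift_obj A F) = shift_obj (insert x A) F"
  by (auto simp: shift_obj_def fun_eq_iff)

lemma shift_map_shi: "shift_map {x} (shift_map A i) = shift_map (insert x A) i"
  by (auto simp: shift_map_def fun_eq_iff)

lemma shift_obj_shf': "shift_obj A (shift_obj {x} F) = shift_obj (insert x A) F"
  by (auto simp: shift_obj_def fun_eq_iff)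

lemma shift_map_shi': "shift_map A (shift_map {x} i) = shift_map (insert x A) i"
  by (auto simp: shift_map_def fun_eq_iff)

lemma shift_obj_empty [simp]: "shift_obj {} F = F"
  by (auto simp: shift_obj_def fun_eq_iff)

lemma shift_map_empty [simp]: "shift_map {} i = i"
  by (auto simp: shift_map_def fun_eq_iff)

lemma deriv_den_shift: "deriv_den x (shift_map A i) (shift_obj A L) (shift_obj A N) = shift_obj A (deriv_den x i L N)"
  by (auto simp: deriv_den_def shift_obj_def shift_map_def fun_eq_iff)

text \<open>\<open>koszul_zero_cone1\<close> iterated over the points of \<open>A\<close>: each
  point of the shift requires vanishing both with and without it, which accounts for all sets
  between \<open>X\<close> and \<open>A \<union> X\<close>.\<close>

lemma koszul_zero_shift_set:
  assumes "functor_pair i L N" "finite A"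
  shows "finite X \<Longrightarrow> A \<inter> X = {} \<Longrightarrow> (\<And>Z. X \<subseteq> Z \<Longrightarrow> Z \<subseteq> A \<union> X \<Longrightarrow> koszul_zero i L N a Z) \<Longrightarrow>
    koszul_zero (shift_map A i) (shift_obj A L) (shift_obj A N) a X"
  using assms(2)
proof (induct A arbitrary: X rule: finite_induct)
  case empty
  then show ?case by simp
next
  case (insert x A)
  note p = functor_pair_shift[OF assms(1), of A]
  have xX: "x \<notin> X"
    using insert.prems by auto
  have "koszul_zero (shift_map {x} (shift_map A i)) (shift_obj {x} (shift_obj A L)) (shift_obj {x} (shift_obj A N)) a X"
  proof (rule koszul_zero_cone1[OF insert.prems(1) xX functor_pairD(1,2,3)[OF p]])
    show "koszul_zero (shift_map A i) (shift_obj A L) (shift_obj A N) a X"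
      using insert.prems by (intro insert.hyps(3)) (blast intro: insert.prems)+
    show "koszul_zero (shift_map A i) (shift_obj A L) (shift_obj A N) a (insert x X)"
    proof (rule insert.hyps(3))
      show "finite (insert x X)" "A \<inter> insert x X = {}"
        using insert by auto
      show "koszul_zero i L N a Z" if "insert x X \<subseteq> Z" "Z \<subseteq> A \<union> insert x X" for Z
        using that by (intro insert.prems(3)) auto
    qed
  qed
  then show ?case
    by (simp add: shift_obj_shf shift_map_shi)
qed

section \<open>Functors with restriction maps\<close>

text \<open>
  The part of the structure of an FI\<open>#\<close>-module that retracts inherit. It passes to derivatives and forces
  torsion-freeness, so Koszul homology vanishes in positive degrees.
\<close>

definition retractive ::
    "nat set \<Rightarrow> (nat set \<Rightarrow> nat set \<Rightarrow> 'g::ab_group_add \<Rightarrow> 'g) \<Rightarrow> (nat set \<Rightarrow> nat set \<Rightarrow> 'g \<Rightarrow> 'g) \<Rightarrow>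
     (nat set \<Rightarrow> 'g set) \<Rightarrow> (nat set \<Rightarrow> 'g set) \<Rightarrow> bool" where
  "retractive U i q L N \<longleftrightarrow>
     (\<forall>X Y. additive (q X Y)) \<and>
     (\<forall>X Y. finite X \<longrightarrow> X \<subseteq> U \<longrightarrow> Y \<subseteq> X \<longrightarrow>
        (\<forall>u\<in>L X. q X Y u \<in> L Y) \<and> (\<forall>u\<in>N X. q X Y u \<in> N Y)) \<and>
     (\<forall>X. finite X \<longrightarrow> X \<subseteq> U \<longrightarrow> (\<forall>u\<in>L X. q X X u - u \<in> N X)) \<and>
     (\<forall>X Y Z. finite X \<longrightarrow> X \<subseteq> U \<longrightarrow> Y \<subseteq> X \<longrightarrow> Z \<subseteq> X \<longrightarrow>
        (\<forall>u\<in>L Z. q X Y (i Z X u) - i (Z \<inter> Y) Y (q Z (Z \<inter> Y) u) \<in> N Y))"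

lemma retractiveD:
  assumes "retractive U i q L N"
  shows "additive (q X Y)"
    and "finite X \<Longrightarrow> X \<subseteq> U \<Longrightarrow> Y \<subseteq> X \<Longrightarrow> u \<in> L X \<Longrightarrow> q X Y u \<in> L Y"
    and "finite X \<Longrightarrow> X \<subseteq> U \<Longrightarrow> Y \<subseteq> X \<Longrightarrow> u \<in> N X \<Longrightarrow> q X Y u \<in> N Y"
    and "finite X \<Longrightarrow> X \<subseteq> U \<Longrightarrow> u \<in> L X \<Longrightarrow> q X X u - u \<in> N X"
    and "finite X \<Longrightarrow> X \<subseteq> U \<Longrightarrow> Y \<subseteq> X \<Longrightarrow> Z \<subseteq> X \<Longrightarrow> u \<in> L Z \<Longrightarrow>
      q X Y (i Z X u) - i (Z \<inter> Y) Y (q Z (Z \<inter> Y) u) \<in> N Y"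
  using assms unfolding retractive_def by simp_all

text \<open>Restricting from \<open>insert x X\<close> back to \<open>X\<close> undoes the map up to
  \<open>N\<close>: take both smaller sets equal to \<open>X\<close> in the compatibility with
  maps.\<close>

lemma retractive_torsion_free:
  assumes s: "retractive U i q L N" and p: "functor_pair i L N"
    and X: "finite X" "insert x X \<subseteq> U" and u: "u \<in> L X" and iu: "i X (insert x X) u \<in> N (insert x X)"
  shows "u \<in> N X"
proof -
  note N = subfunctor_asubgrp[OF functor_pairD(3)[OF p]]
  have "q (insert x X) X (i X (insert x X) u) \<in> N X"
    using X iu by (intro retractiveD(3)[OF s]) auto
  moreover have "q (insert x X) X (i X (insert x X) u) - i (X \<inter> X) X (q X (X \<inter> X) u) \<in> N X"
    using X u by (intro retractiveD(5)[OF s]) auto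
  ultimately have "i (X \<inter> X) X (q X (X \<inter> X) u) \<in> N X"
    using asubgrp_diff[OF N] by fastforce
  moreover have "q X X u \<in> L X"
    using X u by (intro retractiveD(2)[OF s]) auto
  ultimately have "q X X u \<in> N X"
    using poset_functor_id[OF functor_pairD(1)[OF p]] by simp
  moreover have "q X X u - u \<in> N X"
    using X u by (intro retractiveD(4)[OF s]) auto
  ultimately show "u \<in> N X"
    using asubgrp_diff[OF N] by fastforce
qed

text \<open>The restrictions keep \<open>x\<close> throughout. They preserve the image of
  \<open>L X\<close>, because restricting it to \<open>insert x Y\<close> gives, up to
  \<open>N\<close>, the image of a restriction to \<open>X \<inter> insert x Y\<close>, and this is
  \<open>Y\<close> since \<open>x\<close> is not in \<open>X\<close>.\<close>

lemma retractive_dN: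
  assumes s: "retractive U i q L N" and p: "functor_pair i L N" and x: "x \<in> U"
  shows "retractive (U - {x}) (shift_map {x} i) (\<lambda>X Y. q (insert x X) (insert x Y)) (shift_obj {x} L) (deriv_den x i L N)"
proof -
  note NN = asum_left[OF asubgrp_image[OF poset_functor_additive[OF functor_pairD(1)[OF p]] subfunctor_asubgrp[OF functor_pairD(2)[OF p]]]]
  show ?thesis
    unfolding retractive_def shift_obj_insert shift_map_insert
  proof (intro conjI allI impI ballI)
    fix X Y show "additive (q (insert x X) (insert x Y))"
      by (rule retractiveD(1)[OF s])
  next
    fix X Y u assume "finite X" "X \<subseteq> U - {x}" "Y \<subseteq> X" "u \<in> L (insert x X)"
    then show "q (insert x X) (insert x Y) u \<in> L (insert x Y)"
      using x by (intro retractiveD(2)[OF s]) auto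
  next
    fix X Y u assume X: "finite X" "X \<subseteq> U - {x}" "Y \<subseteq> X" and "u \<in> deriv_den x i L N X"
    then obtain n l where nl: "u = n + i X (insert x X) l" "n \<in> N (insert x X)" "l \<in> L X"
      by (auto simp: deriv_den_def asum_def)
    have "q (insert x X) (insert x Y) n \<in> N (insert x Y)"
      using X x nl by (intro retractiveD(3)[OF s]) auto
    moreover have XY: "X \<inter> insert x Y = Y"
      using X by auto
    have "q (insert x X) (insert x Y) (i X (insert x X) l) -
        i (X \<inter> insert x Y) (insert x Y) (q X (X \<inter> insert x Y) l) \<in> N (insert x Y)"
      using X x nl by (intro retractiveD(5)[OF s]) auto
    ultimately have "q (insert x X) (insert x Y) n + (q (insert x X) (insert x Y) (i X (insert x X) l) -
        i Y (insert x Y) (q X Y l)) \<in> N (insert x Y)"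
      unfolding XY by (rule asubgrp_add[OF subfunctor_asubgrp[OF functor_pairD(3)[OF p]]])
    moreover have "q X Y l \<in> L Y"
      using X nl by (intro retractiveD(2)[OF s]) auto
    ultimately have "(q (insert x X) (insert x Y) n + (q (insert x X) (insert x Y) (i X (insert x X) l) -
        i Y (insert x Y) (q X Y l))) + i Y (insert x Y) (q X Y l) \<in> deriv_den x i L N Y"
      unfolding deriv_den_def by (intro asumI imageI)
    then show "q (insert x X) (insert x Y) u \<in> deriv_den x i L N Y"
      by (simp add: nl additive.add[OF retractiveD(1)[OF s]])
  next
    fix X u assume X: "finite X" "X \<subseteq> U - {x}" and "u \<in> L (insert x X)"
    then have "q (insert x X) (insert x X) u - u \<in> N (insert x X)"
      using x by (intro retractiveD(4)[OF s]) auto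
    then show "q (insert x X) (insert x X) u - u \<in> deriv_den x i L N X"
      unfolding deriv_den_def by (rule NN)
  next
    fix X Y Z u assume X: "finite X" "X \<subseteq> U - {x}" "Y \<subseteq> X" "Z \<subseteq> X" and "u \<in> L (insert x Z)"
    then have "q (insert x X) (insert x Y) (i (insert x Z) (insert x X) u) -
      i (insert x Z \<inter> insert x Y) (insert x Y) (q (insert x Z) (insert x Z \<inter> insert x Y) u) \<in> N (insert x Y)"
      using x by (intro retractiveD(5)[OF s]) auto
    moreover have "insert x Z \<inter> insert x Y = insert x (Z \<inter> Y)"
      by auto
    ultimately show "q (insert x X) (insert x Y) (i (insert x Z) (insert x X) u) -
      i (insert x (Z \<inter> Y)) (insert x Y) (q (insert x Z) (insert x (Z \<inter> Y)) u) \<in> deriv_den x i L N Y"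
      unfolding deriv_den_def by (intro NN) simp
  qed
qed

text \<open>Each step takes a derivative along a point of \<open>X\<close> and shrinks
  \<open>U\<close> by that point, so the points of later derivatives are new. At the empty set a
  positive degree exceeds the cardinality.\<close>

lemma koszul_zero_retractive:
  assumes "finite X" "retractive U i q L N" "functor_pair i L N" "X \<subseteq> U"
  shows "koszul_zero i L N (Suc a) X"
  using assms
proof (induct X arbitrary: U i q L N rule: finite_induct)
  case empty
  then show ?case by (simp add: koszul_zero_card_less)
next
  case (insert x X)
  note p = insert.prems(2)
  show ?case
  proof (rule koszul_zero_derivative[OF insert.hyps(1,2) functor_pairD(1,2,3)[OF p]])
    show "u \<in> N Y" if "Y \<subseteq> X" "u \<in> L Y" "i Y (insert x Y) u \<in> N (insert x Y)" for Y u
      using that insert finite_subset[OF that(1)]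
      by (intro retractive_torsion_free[OF insert.prems(1) p _ _ that(2,3)]) auto
    show "koszul_zero (shift_map {x} i) (shift_obj {x} L) (deriv_den x i L N) (Suc a) X"
      using insert by (intro insert.hyps(3)[OF retractive_dN functor_pair_dN]) auto
  qed
qed

section \<open>Action of transpositions\<close>

definition transp_action ::
    "nat set \<Rightarrow> (nat set \<Rightarrow> nat set \<Rightarrow> 'g::ab_group_add \<Rightarrow> 'g) \<Rightarrow> (nat \<Rightarrow> nat \<Rightarrow> nat set \<Rightarrow> 'g \<Rightarrow> 'g) \<Rightarrow>
     (nat set \<Rightarrow> 'g set) \<Rightarrow> bool" where
  "transp_action U i s L \<longleftrightarrow> (\<forall>x\<in>U. \<forall>y\<in>U. x \<noteq> y \<longrightarrow>
     (\<forall>Z. additive (s x y Z)) \<and>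
     (\<forall>Z. \<forall>u\<in>L Z. s x y Z u \<in> L (transpose x y ` Z)) \<and>
     (\<forall>Y X. \<forall>u\<in>L Y. Y \<subseteq> X \<longrightarrow> s x y X (i Y X u) = i (transpose x y ` Y) (transpose x y ` X) (s x y Y u)) \<and>
     (\<forall>Z. \<forall>u\<in>L Z. x \<notin> Z \<longrightarrow> y \<notin> Z \<longrightarrow> s x y Z u = u))"

definition transp_inv ::
    "nat set \<Rightarrow> (nat \<Rightarrow> nat \<Rightarrow> nat set \<Rightarrow> 'g \<Rightarrow> 'g) \<Rightarrow> (nat set \<Rightarrow> 'g set) \<Rightarrow> bool" where
  "transp_inv U s M \<longleftrightarrow> (\<forall>x\<in>U. \<forall>y\<in>U. x \<noteq> y \<longrightarrow> (\<forall>Z. \<forall>u\<in>M Z. s x y Z u \<in> M (transpose x y ` Z)))"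

lemma transpose_insert:
  assumes "x \<noteq> z" "y \<noteq> z"
  shows "transpose x y ` insert z Z = insert z (transpose x y ` Z)"
  using assms by (simp add: transpose_def)

lemma transp_actionD:
  assumes "transp_action U i s L" "x \<in> U" "y \<in> U" "x \<noteq> y"
  shows "additive (s x y Z)"
    and "u \<in> L Z \<Longrightarrow> s x y Z u \<in> L (transpose x y ` Z)"
    and "u \<in> L Y \<Longrightarrow> Y \<subseteq> X \<Longrightarrow> s x y X (i Y X u) = i (transpose x y ` Y) (transpose x y ` X) (s x y Y u)"
    and "u \<in> L Z \<Longrightarrow> x \<notin> Z \<Longrightarrow> y \<notin> Z \<Longrightarrow> s x y Z u = u"
  using assms unfolding transp_action_def by simp_all

lemma transp_invD: "transp_inv U s M \<Longrightarrow> x \<in> U \<Longrightarrow> y \<in> U \<Longrightarrow> x \<noteq> y \<Longrightarrow> u \<in> M Z \<Longrightarrow> s x y Z u \<in> M (transpose x y ` Z)"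
  unfolding transp_inv_def by simp

lemma transp_action_shift:
  assumes "transp_action U i s L"
  shows "transp_action (U - {z}) (shift_map {z} i) (\<lambda>x y Z. s x y (insert z Z)) (shift_obj {z} L)"
  unfolding transp_action_def
proof (intro ballI impI)
  fix x y assume xy: "x \<in> U - {z}" "y \<in> U - {z}" "x \<noteq> y"
  then have "x \<in> U" "y \<in> U"
    by auto
  note s = transp_actionD[OF assms this xy(3)]
  have t: "insert z (transpose x y ` Z) = transpose x y ` insert z Z" for Z
    using xy by (intro transpose_insert[symmetric]) auto
  show "(\<forall>Z. additive (s x y (insert z Z))) \<and>
     (\<forall>Z. \<forall>u\<in>shift_obj {z} L Z. s x y (insert z Z) u \<in> shift_obj {z} L (transpose x y ` Z)) \<and>
     (\<forall>Y X. \<forall>u\<in>shift_obj {z} L Y. Y \<subseteq> X \<longrightarrow> s x y (insert z X) (shift_map {z} i Y X u) =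
        shift_map {z} i (transpose x y ` Y) (transpose x y ` X) (s x y (insert z Y) u)) \<and>
     (\<forall>Z. \<forall>u\<in>shift_obj {z} L Z. x \<notin> Z \<longrightarrow> y \<notin> Z \<longrightarrow> s x y (insert z Z) u = u)"
    unfolding shift_obj_insert shift_map_insert t
  proof (intro conjI allI ballI impI)
    fix Y X u assume "u \<in> L (insert z Y)" "Y \<subseteq> X"
    then show "s x y (insert z X) (i (insert z Y) (insert z X) u) =
      i (transpose x y ` insert z Y) (transpose x y ` insert z X) (s x y (insert z Y) u)"
      by (intro s(3)) auto
  next
    fix Z u assume "u \<in> L (insert z Z)" "x \<notin> Z" "y \<notin> Z"
    then show "s x y (insert z Z) u = u"
      using xy by (intro s(4)) auto
  qed (auto intro: s(1) dest: s(2))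
qed

lemma transp_inv_dN:
  assumes "transp_action U i s L" "transp_inv U s M"
  shows "transp_inv (U - {z}) (\<lambda>x y Z. s x y (insert z Z)) (deriv_den z i L M)"
  unfolding transp_inv_def
proof (intro ballI impI allI)
  fix x y Z u assume xy: "x \<in> U - {z}" "y \<in> U - {z}" "x \<noteq> y" and u: "u \<in> deriv_den z i L M Z"
  then have U: "x \<in> U" "y \<in> U"
    by auto
  note s = transp_actionD(1-3)[OF assms(1) U xy(3)] transp_invD[OF assms(2) U xy(3)]
  have t: "insert z (transpose x y ` Z) = transpose x y ` insert z Z" for Z
    using xy by (intro transpose_insert[symmetric]) auto
  from u obtain m l where u: "u = m + i Z (insert z Z) l" "m \<in> M (insert z Z)" "l \<in> L Z"
    by (auto simp: deriv_den_def asum_def)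
  have "s x y (insert z Z) u = s x y (insert z Z) m +
      i (transpose x y ` Z) (insert z (transpose x y ` Z)) (s x y Z l)"
    unfolding u(1) t using u by (simp add: additive.add[OF s(1)] s(3) subset_insertI)
  also have "\<dots> \<in> deriv_den z i L M (transpose x y ` Z)"
    unfolding deriv_den_def t using s(4)[OF u(2)] s(2)[OF u(3)] by (intro asumI imageI)
  finally show "s x y (insert z Z) u \<in> deriv_den z i L M (transpose x y ` Z)" .
qed

text \<open>The transposition of \<open>x\<close> and \<open>y\<close> fixes \<open>u\<close>, as
  neither point lies in \<open>X\<close>, and carries one map to the other. So whether an element
  dies modulo \<open>M\<close> when a point is added does not depend on the point.\<close>

lemma transposition_symmetry:
  assumes "transp_action U i s L" "transp_inv U s M" "x \<in> U" "y \<in> U" "x \<notin> X" "y \<notin> X" "u \<in> L X"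
    and "i X (insert x X) u \<in> M (insert x X)"
  shows "i X (insert y X) u \<in> M (insert y X)"
proof (cases "x = y")
  case False
  have tX: "transpose x y ` X = X"
    using assms(5,6) by (force simp: transpose_def image_iff)
  have tx: "transpose x y ` insert x X = insert y X"
    by (simp add: tX)
  have "s x y (insert x X) (i X (insert x X) u) \<in> M (transpose x y ` insert x X)"
    by (rule transp_invD[OF assms(2-4) False assms(8)])
  moreover have "s x y (insert x X) (i X (insert x X) u) =
      i (transpose x y ` X) (transpose x y ` insert x X) (s x y X u)"
    by (rule transp_actionD(3)[OF assms(1,3,4) False assms(7) subset_insertI])
  moreover have "s x y X u = u"
    by (rule transp_actionD(4)[OF assms(1,3,4) False assms(7,5,6)])
  ultimately show ?thesis
    unfolding tX tx by simp
qed (use assms in simp)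

section \<open>Generation degrees of derivatives\<close>

definition gen_below ::
    "nat set \<Rightarrow> (nat set \<Rightarrow> nat set \<Rightarrow> 'g::ab_group_add \<Rightarrow> 'g) \<Rightarrow> (nat set \<Rightarrow> 'g set) \<Rightarrow>
     (nat set \<Rightarrow> 'g set) \<Rightarrow> nat \<Rightarrow> bool" where
  "gen_below U i L N k \<longleftrightarrow> (\<forall>X. finite X \<longrightarrow> X \<subseteq> U \<longrightarrow> k \<le> card X \<longrightarrow> koszul_zero i L N 0 X)"

text \<open>The bound in \<open>gen_below\<close> is strict, so 0 means no generators at all, even
  at the empty set, and induction on subsets shows the quotient to be zero. This is the base of the
  induction on the generation degree.\<close>

lemma gen_zero:
  assumes "functor_pair i L N" "gen_below U i L N 0" "finite X" "X \<subseteq> U"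
  shows "L X \<subseteq> N X"
  using assms(3,4)
proof (induct X rule: finite_psubset_induct)
  case (psubset X)
  show ?case
  proof
    fix u assume "u \<in> L X"
    moreover have "koszul_zero i L N 0 X"
      using assms(2) psubset by (auto simp: gen_below_def)
    ultimately obtain c where c: "chain L (Suc 0) X c" "u - koszul_bd i X c {} \<in> N X"
      using koszul_zero_zero_iff[OF psubset.hyps(1)] by blast
    have "koszul_bd i X c {} \<in> N X"
      unfolding koszul_bd_empty
    proof (rule asubgrp_sum[OF subfunctor_asubgrp[OF functor_pairD(3)[OF assms(1)]]])
      fix x assume x: "x \<in> X"
      then have "c {x} \<in> L (X - {x})"
        by (intro chainD[OF c(1)]) auto
      moreover have "L (X - {x}) \<subseteq> N (X - {x})"
        using psubset.prems x by (intro psubset.hyps(2)) auto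
      ultimately show "i (X - {x}) X (c {x}) \<in> N X"
        by (intro subfunctor_map[OF functor_pairD(3)[OF assms(1)]]) auto
    qed
    with c(2) show "u \<in> N X"
      using asubgrp_add[OF subfunctor_asubgrp[OF functor_pairD(3)[OF assms(1)]]] by fastforce
  qed
qed

lemma koszul_zero_trivial:
  assumes "poset_functor i L" "subfunctor i L" "subfunctor i N" "\<And>Z. Z \<subseteq> X \<Longrightarrow> L Z \<subseteq> N Z"
  shows "koszul_zero i L N a X"
proof (rule koszul_zeroI)
  fix c assume c: "chain L a X c"
  have "koszul_bd i X (\<lambda>_. 0) T = 0" for T
    by (simp add: koszul_bd_def additive.zero[OF poset_functor_additive[OF assms(1)]])
  moreover have "c T \<in> N (X - T)" if "T \<subseteq> X" "card T = a" for T
    using chainD[OF c that] assms(4)[OF Diff_subset] by blast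
  moreover have "chain L (Suc a) X (\<lambda>_. 0)"
    using subfunctor_asubgrp[OF assms(2)] by (simp add: chain_def asubgrp_zero)
  ultimately show "\<exists>e. chain L (Suc a) X e \<and> chain N a X (\<lambda>T. c T - koszul_bd i X e T)"
    by (intro exI[of _ "\<lambda>_. 0"]) (simp add: chain_def)
qed

text \<open>Among the contributions from \<open>insert y X\<close> with one point removed, the one
  with \<open>y\<close> removed comes from \<open>X\<close> and lies in the denominator of the
  derivative; the others come from the shift at proper subsets of \<open>X\<close>.\<close>

lemma generators_dN:
  assumes p: "functor_pair i L N" and F: "subfunctor i F" "\<And>Y. F Y \<subseteq> L Y" and X: "finite X" "y \<notin> X"
    and k: "koszul_zero i F N 0 (insert y X)" and u: "u \<in> F (insert y X)"
  shows "\<exists>c. chain (shift_obj {y} F) (Suc 0) X c \<and> u - koszul_bd (shift_map {y} i) X c {} \<in> deriv_den y i L N X"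
proof -
  obtain c where c: "chain F (Suc 0) (insert y X) c" "u - koszul_bd i (insert y X) c {} \<in> N (insert y X)"
    using k u koszul_zero_zero_iff[of "insert y X" i F N] X by auto
  note c' = chain_split[OF X F(1) c(1)]
  have l: "cone_fst y c {} \<in> L X"
    using chainD[OF c'(2), of "{}"] F(2) by auto
  have h: "u - koszul_bd (shift_map {y} i) X c {} = (u - koszul_bd i (insert y X) c {}) + i X (insert y X) (cone_fst y c {})"
    by (simp add: koszul_bd_out[OF X poset_functor_additive[OF functor_pairD(1)[OF p]]] del: shift_map_insert)
  have "u - koszul_bd (shift_map {y} i) X c {} \<in> deriv_den y i L N X"
    unfolding deriv_den_def h by (intro asumI imageI c(2) l)
  with c'(1) show ?thesis
    by blast
qed

text \<open>The condition at \<open>X\<close> comes from the one at \<open>insert y X\<close>, which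
  is one larger. This drop by one makes the induction on the generation degree run.\<close>

lemma gen_dN1:
  assumes p: "functor_pair i L N" and g: "gen_below U i L N (Suc k)" and y: "y \<in> U"
  shows "gen_below (U - {y}) (shift_map {y} i) (shift_obj {y} L) (deriv_den y i L N) k"
  unfolding gen_below_def
proof (intro allI impI)
  fix X assume X: "finite X" "X \<subseteq> U - {y}" "k \<le> card X"
  then have "y \<notin> X"
    by auto
  moreover have "koszul_zero i L N 0 (insert y X)"
    using g X y \<open>y \<notin> X\<close> by (auto simp: gen_below_def)
  ultimately have "\<exists>c. chain (shift_obj {y} L) (Suc 0) X c \<and> u - koszul_bd (shift_map {y} i) X c {} \<in> deriv_den y i L N X"
    if "u \<in> L (insert y X)" for u
    using generators_dN[OF p functor_pairD(2)[OF p] subset_refl X(1)] that by blast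
  then show "koszul_zero (shift_map {y} i) (shift_obj {y} L) (deriv_den y i L N) 0 X"
    unfolding koszul_zero_zero_iff[OF X(1)] shift_obj_insert by blast
qed

lemma asubgrp_subset_add: "asubgrp H \<Longrightarrow> x - y \<in> H \<Longrightarrow> y \<in> H \<Longrightarrow> x \<in> H"
  using asubgrp_add[of H "x - y" y] by simp

lemma deriv_den_mono: "(\<And>Y. N Y \<subseteq> M Y) \<Longrightarrow> deriv_den x i L N X \<subseteq> deriv_den x i L M X"
  unfolding deriv_den_def asum_def by blast

text \<open>The relations of the derivative of \<open>L / M\<close> over that of
  \<open>L / N\<close> are the image of the shift of \<open>M\<close>, so generators of
  \<open>M\<close> still generate them. The bound \<open>d\<close> stays the same, so each
  derivative costs the same number of points.\<close>

lemma gen_dN2: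
  assumes p: "functor_pair i L N" and M: "subfunctor i M" "\<And>Y. M Y \<subseteq> L Y" and g: "gen_below U i M N d" and y: "y \<in> U"
  shows "gen_below (U - {y}) (shift_map {y} i) (deriv_den y i L M) (deriv_den y i L N) d"
  unfolding gen_below_def
proof (intro allI impI)
  note pL = functor_pairD(1)[OF p]
  note asubs = asubgrp_image[OF poset_functor_additive[OF pL] subfunctor_asubgrp[OF functor_pairD(2)[OF p]]]
  note sN = subfunctor_asubgrp[OF subfunctor_dN[OF pL functor_pairD(2,3)[OF p]]]
  fix X assume X: "finite X" "X \<subseteq> U - {y}" "d \<le> card X"
  then have yX: "y \<notin> X"
    by auto
  have k: "koszul_zero i M N 0 (insert y X)"
    using g X y yX by (auto simp: gen_below_def)
  show "koszul_zero (shift_map {y} i) (deriv_den y i L M) (deriv_den y i L N) 0 X"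
    unfolding koszul_zero_zero_iff[OF X(1)]
  proof
    fix u assume "u \<in> deriv_den y i L M X"
    then obtain m l where u: "u = m + i X (insert y X) l" "m \<in> M (insert y X)" "l \<in> L X"
      by (auto simp: deriv_den_def asum_def)
    obtain c where c: "chain (shift_obj {y} M) (Suc 0) X c" "m - koszul_bd (shift_map {y} i) X c {} \<in> deriv_den y i L N X"
      using generators_dN[OF p M X(1) yX k u(2)] by blast
    have "chain (deriv_den y i L M) (Suc 0) X c"
      using c(1) by (rule chain_mono) (auto simp: deriv_den_def intro: asum_left[OF asubs])
    moreover have "i X (insert y X) l \<in> deriv_den y i L N X"
      unfolding deriv_den_def using u(3) by (intro asum_right subfunctor_asubgrp[OF functor_pairD(3)[OF p]] imageI)
    with c(2) have "(m - koszul_bd (shift_map {y} i) X c {}) + i X (insert y X) l \<in> deriv_den y i L N X"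
      by (rule asubgrp_add[OF sN])
    then have "u - koszul_bd (shift_map {y} i) X c {} \<in> deriv_den y i L N X"
      by (simp add: u(1) algebra_simps del: shift_map_insert)
    ultimately show "\<exists>c. chain (deriv_den y i L M) (Suc 0) X c \<and> u - koszul_bd (shift_map {y} i) X c {} \<in> deriv_den y i L N X"
      by blast
  qed
qed

section \<open>Acyclicity of large shifts\<close>

lemma deriv_den_mono_ambient: "(\<And>Y. M Y \<subseteq> L Y) \<Longrightarrow> deriv_den x i M N X \<subseteq> deriv_den x i L N X"
  unfolding deriv_den_def asum_def by blast

text \<open>
  With \<open>V = L / M\<close>, \<open>P = L / N\<close>, \<open>W = M / N\<close>, the kernel of \<open>V\<close> mapping to its shift is \<open>E / G\<close>, the kernel
  of the map from the derivative of \<open>W\<close> to that of \<open>P\<close>. All maps between different sets are zero on \<open>E / G\<close>, so it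
  equals its degree zero homology, which embeds into that of the derivative of \<open>W\<close> once the image of the latter
  has no first homology.
\<close>

lemma nagpal_torsion:
  assumes p: "functor_pair i L N" and M: "subfunctor i M" "\<And>Y. N Y \<subseteq> M Y" "\<And>Y. M Y \<subseteq> L Y"
    and q: "retractive U i q L N" and s: "transp_action U i s L" "transp_inv U s M"
    and g: "gen_below U i M N d" and y: "y \<in> U" "y \<notin> B \<union> X"
    and BX: "finite B" "finite X" "B \<union> X \<subseteq> U" "B \<inter> X = {}" "d \<le> card X"
    and IH: "\<And>a. koszul_zero (shift_map B (shift_map {y} i)) (shift_obj B (shift_obj {y} L)) (shift_obj B (deriv_den y i L M)) (Suc a) X"
    and u: "u \<in> L (B \<union> X)" "i (B \<union> X) (insert y (B \<union> X)) u \<in> M (insert y (B \<union> X))"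
  shows "u \<in> M (B \<union> X)"
proof -
  note pL = functor_pairD(1)[OF p] and L = functor_pairD(2)[OF p] and N = functor_pairD(3)[OF p]
  note add = poset_functor_additive[OF pL]
  have pLM: "functor_pair i L M"
    using pL L M by (simp add: functor_pair_def)
  have pMN: "functor_pair i M N"
    using pL N M unfolding functor_pair_def poset_functor_def by (meson subsetD)
  let ?i = "shift_map {y} i"
  define E where "E Z = M (insert y Z) \<inter> deriv_den y i L N Z" for Z
  let ?G = "deriv_den y i M N"
  note pD = functor_pair_dN[OF p, of y] and pG = functor_pair_dN[OF pMN, of y] and pLM' = functor_pair_dN[OF pLM, of y]
  have E: "subfunctor ?i E"
    unfolding subfunctor_def E_def
  proof (intro conjI allI ballI impI)
    fix Y X u assume u: "u \<in> M (insert y Y) \<inter> deriv_den y i L N Y" and YX: "Y \<subseteq> X"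
    have "?i Y X u \<in> M (insert y X)"
      unfolding shift_map_insert using u YX by (intro subfunctor_map[OF M(1)]) auto
    moreover have "?i Y X u \<in> deriv_den y i L N X"
      using u YX by (intro subfunctor_map[OF functor_pairD(3)[OF pD]]) auto
    ultimately show "?i Y X u \<in> M (insert y X) \<inter> deriv_den y i L N X" ..
  qed (intro asubgrp_Int subfunctor_asubgrp[OF M(1)] subfunctor_asubgrp[OF functor_pairD(3)[OF pD]])
  have GE: "?G Z \<subseteq> E Z" for Z
    using deriv_den_subset[OF pMN, of y Z] deriv_den_mono_ambient[where M = M and L = L, OF M(3)] unfolding E_def by blast
  have fyX: "finite (insert y B)" "insert y B \<inter> X = {}"
    using y BX by auto
  have disj: "B \<inter> X = {}" "y \<notin> X"
    using y BX by auto
  have bdd: "functor_pair (shift_map B ?i) (shift_obj B (shift_obj {y} L)) (shift_obj B (deriv_den y i L N))"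
    by (rule functor_pair_shift[OF pD])
  have q': "retractive (U - {y}) ?i (\<lambda>X Y. q (insert y X) (insert y Y)) (shift_obj {y} L) (deriv_den y i L N)"
    by (rule retractive_dN[OF q p y(1)])
  have LN1: "koszul_zero (shift_map B ?i) (shift_obj B (shift_obj {y} L)) (shift_obj B (deriv_den y i L N)) (Suc 0) X"
  proof (rule koszul_zero_shift_set[OF pD BX(1,2,4)])
    fix Z assume Z: "X \<subseteq> Z" "Z \<subseteq> B \<union> X"
    then have "finite Z" "Z \<subseteq> U - {y}"
      using finite_subset[OF Z(2)] BX y by auto
    then show "koszul_zero ?i (shift_obj {y} L) (deriv_den y i L N) (Suc 0) Z"
      by (intro koszul_zero_retractive[OF _ q' pD]) auto
  qed
  have NM: "deriv_den y i L N Z \<subseteq> deriv_den y i L M Z" for Z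
    by (rule deriv_den_mono[OF M(2)])
  \<comment> \<open>H_1 of the relations of the derivative of V lies between H_2 of that derivative,
    zero by \<open>IH\<close>, and H_1 of the derivative of P, zero by \<open>LN1\<close>;
    everything is shifted by \<open>B\<close>.\<close>
  have MN1: "koszul_zero (shift_map B ?i) (shift_obj B (deriv_den y i L M)) (shift_obj B (deriv_den y i L N)) (Suc 0) X"
  proof (rule koszul_zero_les2[OF BX(2) functor_pairD(1,2)[OF bdd] _ functor_pairD(3)[OF bdd] _ _ LN1 IH])
    show "subfunctor (shift_map B ?i) (shift_obj B (deriv_den y i L M))"
      by (rule subfunctor_shift[OF functor_pairD(3)[OF pLM']])
    show "shift_obj B (deriv_den y i L N) Y \<subseteq> shift_obj B (deriv_den y i L M) Y" "shift_obj B (deriv_den y i L M) Y \<subseteq> shift_obj B (shift_obj {y} L) Y" for Y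
      using NM functor_pairD(4)[OF pLM'] by (auto simp: shift_obj_def)
  qed
  \<comment> \<open>Second isomorphism theorem: \<open>deriv_den y i L M\<close> is the sum of the
    shift of \<open>M\<close> and \<open>deriv_den y i L N\<close>, and \<open>E\<close> is the
    intersection of the two. The correspondence relates elements that differ by one of
    \<open>deriv_den y i L N\<close>.\<close>
  have ME1: "koszul_zero (shift_map B ?i) (shift_obj B (shift_obj {y} M)) (shift_obj B E) (Suc 0) X"
  proof (rule koszul_zero_iso[OF MN1 BX(2), where r = "\<lambda>Z u v. u \<in> shift_obj B (deriv_den y i L M) Z \<and> v \<in> M (insert y (B \<union> Z)) \<and> u - v \<in> deriv_den y i L N (B \<union> Z)"])
    note sM = subfunctor_shift[OF functor_pairD(3)[OF pLM'], of B]
    note aN = subfunctor_asubgrp[OF functor_pairD(3)[OF pD]] and aM = subfunctor_asubgrp[OF M(1)] and aM' = subfunctor_asubgrp[OF sM]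
    fix Z
    show "0 \<in> shift_obj B (deriv_den y i L M) Z \<and> 0 \<in> M (insert y (B \<union> Z)) \<and> 0 - 0 \<in> deriv_den y i L N (B \<union> Z)"
      using aN aM aM' by (simp add: asubgrp_zero)
    show "u - u' \<in> shift_obj B (deriv_den y i L M) Z \<and> v - v' \<in> M (insert y (B \<union> Z)) \<and> u - u' - (v - v') \<in> deriv_den y i L N (B \<union> Z)"
      if "u \<in> shift_obj B (deriv_den y i L M) Z \<and> v \<in> M (insert y (B \<union> Z)) \<and> u - v \<in> deriv_den y i L N (B \<union> Z)"
       "u' \<in> shift_obj B (deriv_den y i L M) Z \<and> v' \<in> M (insert y (B \<union> Z)) \<and> u' - v' \<in> deriv_den y i L N (B \<union> Z)" for u v u' v'
    proof -
      have "(u - v) - (u' - v') \<in> deriv_den y i L N (B \<union> Z)"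
        using that by (meson asubgrp_diff[OF aN])
      moreover have "(u - v) - (u' - v') = u - u' - (v - v')"
        by simp
      ultimately have "u - u' - (v - v') \<in> deriv_den y i L N (B \<union> Z)"
        by metis
      then show ?thesis
        using that by (metis asubgrp_diff[OF aM] asubgrp_diff[OF aM'])
    qed
    show "shift_map B ?i Y Z u \<in> shift_obj B (deriv_den y i L M) Z \<and> shift_map B ?i Y Z v \<in> M (insert y (B \<union> Z)) \<and>
        shift_map B ?i Y Z u - shift_map B ?i Y Z v \<in> deriv_den y i L N (B \<union> Z)"
      if "Y \<subseteq> Z" and h: "u \<in> shift_obj B (deriv_den y i L M) Y \<and> v \<in> M (insert y (B \<union> Y)) \<and> u - v \<in> deriv_den y i L N (B \<union> Y)" for Y u v
    proof (intro conjI)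
      show "shift_map B ?i Y Z u \<in> shift_obj B (deriv_den y i L M) Z"
        using h that by (intro subfunctor_map[OF sM]) auto
      show "shift_map B ?i Y Z v \<in> M (insert y (B \<union> Z))"
        unfolding shift_map_def[of B] shift_map_insert using h that by (intro subfunctor_map[OF M(1)]) auto
      have "shift_map B ?i Y Z (u - v) \<in> deriv_den y i L N (B \<union> Z)"
        unfolding shift_map_def[of B] using h that by (intro subfunctor_map[OF functor_pairD(3)[OF pD]]) auto
      then show "shift_map B ?i Y Z u - shift_map B ?i Y Z v \<in> deriv_den y i L N (B \<union> Z)"
        by (simp add: additive.diff[OF poset_functor_additive[OF functor_pairD(1)[OF bdd]]])
    qed
    show "\<exists>v\<in>shift_obj B (shift_obj {y} M) Z. u \<in> shift_obj B (deriv_den y i L M) Z \<and> v \<in> M (insert y (B \<union> Z)) \<and> u - v \<in> deriv_den y i L N (B \<union> Z)"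
      if h: "u \<in> shift_obj B (deriv_den y i L M) Z" for u
    proof -
      obtain m l where ml: "u = m + i (B \<union> Z) (insert y (B \<union> Z)) l" "m \<in> M (insert y (B \<union> Z))" "l \<in> L (B \<union> Z)"
        using h by (auto simp: deriv_den_def asum_def shift_obj_def)
      moreover have "u - m \<in> deriv_den y i L N (B \<union> Z)"
        unfolding ml(1) deriv_den_def using ml(3) by (auto intro: asum_right subfunctor_asubgrp[OF N])
      ultimately show ?thesis
        using h by (intro bexI[of _ m]) (auto simp: shift_obj_def)
    qed
    show "\<exists>u\<in>shift_obj B (deriv_den y i L M) Z. u \<in> shift_obj B (deriv_den y i L M) Z \<and> v \<in> M (insert y (B \<union> Z)) \<and> u - v \<in> deriv_den y i L N (B \<union> Z)"
      if h: "v \<in> shift_obj B (shift_obj {y} M) Z" for v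
    proof -
      have v: "v \<in> M (insert y (B \<union> Z))"
        using h by (simp add: shift_obj_def)
      have "v \<in> shift_obj B (deriv_den y i L M) Z"
        unfolding shift_obj_def deriv_den_def using v by (intro asum_left asubgrp_image add subfunctor_asubgrp[OF L])
      with v show ?thesis
        using asubgrp_zero[OF aN] by (intro bexI[of _ v]) auto
    qed
    show "u \<in> shift_obj B (deriv_den y i L N) Z \<longleftrightarrow> v \<in> shift_obj B E Z"
      if h: "u \<in> shift_obj B (deriv_den y i L M) Z \<and> v \<in> M (insert y (B \<union> Z)) \<and> u - v \<in> deriv_den y i L N (B \<union> Z)" for u v
    proof -
      have "u \<in> deriv_den y i L N (B \<union> Z) \<longleftrightarrow> v \<in> deriv_den y i L N (B \<union> Z)"
        using asubgrp_add_cancel_left[OF aN, of "u - v" "B \<union> Z" v] h by simp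
      then show ?thesis
        using h by (simp add: shift_obj_def E_def)
    qed
  qed
  \<comment> \<open>H_0(E/G) lies between H_1 of the shift of \<open>M\<close> modulo
    \<open>E\<close>, just shown to vanish, and H_0 of the derivative of W. The latter derivative is
    a quotient of a shift of W, and H_0(W) vanishes at all sets involved, because they contain
    \<open>X\<close> and so have at least \<open>d\<close> elements.\<close>
  have EG0: "koszul_zero (shift_map B ?i) (shift_obj B E) (shift_obj B ?G) 0 X"
  proof (rule koszul_zero_les2[OF BX(2) _ _ _ _ _ _ _ ME1])
    note pB = functor_pair_shift[OF pG, of B]
    show "poset_functor (shift_map B ?i) (shift_obj B (shift_obj {y} M))" "subfunctor (shift_map B ?i) (shift_obj B (shift_obj {y} M))" "subfunctor (shift_map B ?i) (shift_obj B ?G)"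
      using functor_pairD[OF pB] by auto
    show "subfunctor (shift_map B ?i) (shift_obj B E)"
      by (rule subfunctor_shift[OF E])
    show "shift_obj B ?G Y \<subseteq> shift_obj B E Y" "shift_obj B E Y \<subseteq> shift_obj B (shift_obj {y} M) Y" for Y
      using GE by (auto simp: shift_obj_def E_def)
    have "koszul_zero (shift_map (insert y B) i) (shift_obj (insert y B) M) (shift_obj (insert y B) N) 0 X"
    proof (rule koszul_zero_shift_set[OF pMN fyX(1) BX(2) fyX(2)])
      fix Z assume Z: "X \<subseteq> Z" "Z \<subseteq> insert y B \<union> X"
      then have fZ: "finite Z" "Z \<subseteq> U"
        using finite_subset[OF Z(2)] BX y by auto
      moreover have "d \<le> card Z"
        using card_mono[OF fZ(1) Z(1)] BX(5) by simp
      ultimately show "koszul_zero i M N 0 Z"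
        using g by (simp add: gen_below_def)
    qed
    then have "koszul_zero (shift_map B ?i) (shift_obj B (shift_obj {y} M)) (shift_obj B (shift_obj {y} N)) 0 X"
      by (simp add: shift_obj_shf' shift_map_shi')
    then show "koszul_zero (shift_map B ?i) (shift_obj B (shift_obj {y} M)) (shift_obj B ?G) 0 X"
    proof (rule koszul_zero_zero_quotient[OF BX(2)])
      show "shift_obj B (shift_obj {y} N) Y \<subseteq> shift_obj B ?G Y" for Y
        unfolding shift_obj_def deriv_den_def by (auto intro: asum_left asubgrp_image add subfunctor_asubgrp[OF M(1)])
    qed
  qed
  \<comment> \<open>An element of \<open>E\<close> is, up to \<open>N\<close>, the image of some
    \<open>l\<close> that dies in V when \<open>y\<close> is added. By symmetry \<open>l\<close>
    dies already when \<open>t\<close> is added, so the image of \<open>e\<close> at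
    \<open>insert t W\<close> is the sum of an element of \<open>N\<close> and the image of an
    element of \<open>M\<close>.\<close>
  have zero_map: "?i W (insert t W) e \<in> ?G (insert t W)"
    if W: "e \<in> E W" "t \<in> U" "t \<notin> W" "t \<noteq> y" "y \<notin> W" for e t W
  proof -
    obtain n l where nl: "e = n + i W (insert y W) l" "n \<in> N (insert y W)" "l \<in> L W"
      using W(1) by (auto simp: E_def deriv_den_def asum_def)
    have "i W (insert y W) l = e - n"
      using nl by simp
    also have "\<dots> \<in> M (insert y W)"
    proof (rule asubgrp_diff[OF subfunctor_asubgrp[OF M(1)]])
      show "e \<in> M (insert y W)" "n \<in> M (insert y W)"
        using W(1) nl(2) M(2) by (auto simp: E_def)
    qed
    finally have "i W (insert t W) l \<in> M (insert t W)"
      by (rule transposition_symmetry[OF s y(1) W(2,5,3) nl(3)])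
    then have "i (insert y W) (insert y (insert t W)) n + i (insert t W) (insert y (insert t W)) (i W (insert t W) l) \<in> ?G (insert t W)"
      unfolding deriv_den_def by (intro asumI imageI subfunctor_map[OF N nl(2)]) auto
    moreover have "i (insert t W) (insert y (insert t W)) (i W (insert t W) l) =
        i (insert y W) (insert y (insert t W)) (i W (insert y W) l)"
      by (subst (1 2) poset_functor_comp[OF pL nl(3)]) auto
    ultimately show ?thesis
      by (simp add: nl(1) additive.add[OF add])
  qed
  have EG: "E (B \<union> X) \<subseteq> ?G (B \<union> X)"
  proof
    note aG = subfunctor_asubgrp[OF functor_pairD(3)[OF pG]]
    fix e assume "e \<in> E (B \<union> X)"
    then have "e \<in> shift_obj B E X"
      by (simp add: shift_obj_def)
    then obtain c where c: "chain (shift_obj B E) (Suc 0) X c" "e - koszul_bd (shift_map B ?i) X c {} \<in> shift_obj B ?G X"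
      using EG0 unfolding koszul_zero_zero_iff[OF BX(2)] by blast
    have "koszul_bd (shift_map B ?i) X c {} \<in> ?G (B \<union> X)"
      unfolding koszul_bd_empty
    proof (rule asubgrp_sum[OF aG])
      fix x assume x: "x \<in> X"
      then have "c {x} \<in> shift_obj B E (X - {x})"
        by (intro chainD[OF c(1)]) auto
      then have "c {x} \<in> E (B \<union> (X - {x}))"
        by (simp add: shift_obj_def)
      then have "?i (B \<union> (X - {x})) (insert x (B \<union> (X - {x}))) (c {x}) \<in> ?G (insert x (B \<union> (X - {x})))"
        using x BX y by (intro zero_map) auto
      moreover have "insert x (B \<union> (X - {x})) = B \<union> X"
        using x by auto
      ultimately show "shift_map B ?i (X - {x}) X (c {x}) \<in> ?G (B \<union> X)"
        unfolding shift_map_def[of B] by simp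
    qed
    with c(2) show "e \<in> ?G (B \<union> X)"
      by (metis shift_obj_def asubgrp_subset_add[OF aG])
  qed
  \<comment> \<open>The image of \<open>u\<close> in the shift lies in \<open>E\<close>, hence in
    \<open>?G\<close>; this yields an \<open>m\<close> in \<open>M\<close> with the same image up to
    \<open>N\<close>, and torsion-freeness of P identifies \<open>u\<close> with \<open>m\<close> up
    to \<open>N\<close>.\<close>
  let ?Z = "B \<union> X"
  have "i ?Z (insert y ?Z) u \<in> deriv_den y i L N ?Z"
    unfolding deriv_den_def using u(1) by (intro asum_right subfunctor_asubgrp[OF N] imageI)
  then have "i ?Z (insert y ?Z) u \<in> ?G ?Z"
    using u(2) EG by (auto simp: E_def)
  then obtain n m where nm: "i ?Z (insert y ?Z) u = n + i ?Z (insert y ?Z) m" "n \<in> N (insert y ?Z)" "m \<in> M ?Z"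
    by (auto simp: deriv_den_def asum_def)
  have "u - m \<in> N ?Z"
  proof (rule retractive_torsion_free[OF q p])
    show "finite ?Z" "insert y ?Z \<subseteq> U"
      using BX y by auto
    show "u - m \<in> L ?Z"
      using u(1) nm(3) M(3) by (auto intro: asubgrp_diff[OF subfunctor_asubgrp[OF L]])
    show "i ?Z (insert y ?Z) (u - m) \<in> N (insert y ?Z)"
      using nm by (simp add: additive.diff[OF add])
  qed
  then show ?thesis
    using nm(3) M(2) by (meson asubgrp_subset_add[OF subfunctor_asubgrp[OF M(1)]] subsetD)
qed

text \<open>Passing to the derivative lowers \<open>k\<close> by one and keeps \<open>d\<close>, and
  the torsion statement asks for \<open>d\<close> further points; \<open>k * d\<close> solves this
  recursion. For \<open>k = 0\<close> the module is zero at all finite subsets of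
  \<open>U\<close>.\<close>

theorem nagpal:
  assumes "functor_pair i L N" "subfunctor i M" "\<And>Y. N Y \<subseteq> M Y" "\<And>Y. M Y \<subseteq> L Y"
    and "retractive U i q L N" "transp_action U i s L" "transp_inv U s M"
    and "gen_below U i L N k" "gen_below U i M N d"
    and "finite A" "A \<subseteq> U" "k * d \<le> card A" "finite X" "X \<subseteq> U" "A \<inter> X = {}"
  shows "koszul_zero (shift_map A i) (shift_obj A L) (shift_obj A M) (Suc a) X"
  using assms
proof (induct k arbitrary: U i q s L M N A X a)
  case 0
  note p = 0(1)
  have LM: "functor_pair i L M"
    using 0 functor_pairD[OF p] by (simp add: functor_pair_def)
  have "L Z \<subseteq> M Z" if "Z \<subseteq> U" "finite Z" for Z
    using gen_zero[OF p 0(8) that(2,1)] 0(3) by blast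
  then have "shift_obj A L Z \<subseteq> shift_obj A M Z" if "Z \<subseteq> X" for Z
    using that finite_subset[OF that] 0 by (simp add: shift_obj_def)
  then show ?case
    using functor_pairD[OF functor_pair_shift[OF LM]] by (intro koszul_zero_trivial) auto
next
  case (Suc k)
  note p = Suc.prems(1) and M = Suc.prems(2-4) and q = Suc.prems(5) and s = Suc.prems(6,7) and g = Suc.prems(8,9)
  note pL = functor_pairD(1)[OF p] and L = functor_pairD(2)[OF p] and N = functor_pairD(3)[OF p]
  have pLM: "functor_pair i L M"
    using pL L M by (simp add: functor_pair_def)
  have IH: "koszul_zero (shift_map B (shift_map {y} i)) (shift_obj B (shift_obj {y} L)) (shift_obj B (deriv_den y i L M)) (Suc a) X"
    if "y \<in> U" "finite B" "B \<subseteq> U - {y}" "k * d \<le> card B" "finite X" "X \<subseteq> U - {y}" "B \<inter> X = {}" for y B X a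
  proof (rule Suc.hyps[OF functor_pair_dN[OF p] functor_pairD(3)[OF functor_pair_dN[OF pLM]] deriv_den_mono[OF M(2)] _ retractive_dN[OF q p that(1)]
        transp_action_shift[OF s(1)] transp_inv_dN[OF s] gen_dN1[OF p g(1) that(1)] gen_dN2[OF p M(1,3) g(2) that(1)] that(2-7)])
    show "deriv_den y i L M Y \<subseteq> shift_obj {y} L Y" for Y
      using deriv_den_subset[OF pLM] by simp
  qed
  \<comment> \<open>Of at least \<open>Suc k * d\<close> points, \<open>k * d\<close> go into
    \<open>B\<close>, whose shift makes the derivative acyclic by induction. The remaining points
    form \<open>W\<close>; there are at least \<open>d\<close> of them, so that the relations are
    generated from smaller sets.\<close>
  have tf: "u \<in> M Z" if Z: "finite Z" "insert y Z \<subseteq> U" "y \<notin> Z" "Suc k * d \<le> card Z"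
    and u: "u \<in> L Z" "i Z (insert y Z) u \<in> M (insert y Z)" for Z y u
  proof -
    have "k * d \<le> card Z"
      using Z(4) by simp
    then obtain B where B: "B \<subseteq> Z" "card B = k * d" "finite B"
      by (rule obtain_subset_with_card_n)
    define W where "W = Z - B"
    have W: "finite W" "B \<inter> W = {}" "B \<union> W = Z"
      using B Z by (auto simp: W_def)
    have "u \<in> M (B \<union> W)"
    proof (rule nagpal_torsion[OF p M q s g(2)])
      show "y \<in> U" "y \<notin> B \<union> W" "finite B" "finite W" "B \<union> W \<subseteq> U" "B \<inter> W = {}"
        using B W Z by auto
      show "d \<le> card W"
        using B Z by (simp add: W_def card_Diff_subset)
      show "koszul_zero (shift_map B (shift_map {y} i)) (shift_obj B (shift_obj {y} L)) (shift_obj B (deriv_den y i L M)) (Suc a) W" for a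
        using B W Z by (intro IH) auto
      show "u \<in> L (B \<union> W)" "i (B \<union> W) (insert y (B \<union> W)) u \<in> M (insert y (B \<union> W))"
        using u W by auto
    qed
    then show ?thesis
      by (simp add: W)
  qed
  show ?case
  proof (cases "X = {}")
    case True
    then show ?thesis by (simp add: koszul_zero_card_less)
  next
    case False
    then obtain x Y where X: "X = insert x Y" "x \<notin> Y"
      by (metis ex_in_conv mk_disjoint_insert)
    have fY: "finite Y"
      using X Suc.prems by simp
    have pA: "functor_pair (shift_map A i) (shift_obj A L) (shift_obj A M)"
      by (rule functor_pair_shift[OF pLM])
    show ?thesis
      unfolding X(1)
    proof (rule koszul_zero_derivative[OF fY X(2) functor_pairD(1-3)[OF pA]])
      fix W u assume W: "W \<subseteq> Y" and u: "u \<in> shift_obj A L W" "shift_map A i W (insert x W) u \<in> shift_obj A M (insert x W)"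
      have fW: "finite (A \<union> W)"
        using W fY finite_subset Suc.prems by auto
      have "u \<in> M (A \<union> W)"
      proof (rule tf[OF fW])
        show "insert x (A \<union> W) \<subseteq> U" "x \<notin> A \<union> W"
          using W X Suc.prems by auto
        have "card A \<le> card (A \<union> W)"
          by (rule card_mono[OF fW]) auto
        then show "Suc k * d \<le> card (A \<union> W)"
          using Suc.prems by linarith
        show "u \<in> L (A \<union> W)" "i (A \<union> W) (insert x (A \<union> W)) u \<in> M (insert x (A \<union> W))"
          using u by (auto simp: shift_obj_def shift_map_def)
      qed
      then show "u \<in> shift_obj A M W"
        by (simp add: shift_obj_def)
    next
      \<comment> \<open>Derivatives commute with shifts, so the derivative of the shift by
        \<open>A\<close> is the shift by \<open>A\<close> of the derivative, to which the induction
        hypothesis applies.\<close>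
      have "koszul_zero (shift_map A (shift_map {x} i)) (shift_obj A (shift_obj {x} L)) (shift_obj A (deriv_den x i L M)) (Suc a) Y"
        using Suc.prems X fY by (intro IH) auto
      then show "koszul_zero (shift_map {x} (shift_map A i)) (shift_obj {x} (shift_obj A L)) (deriv_den x (shift_map A i) (shift_obj A L) (shift_obj A M)) (Suc a) Y"
        by (simp add: deriv_den_shift shift_obj_shf shift_map_shi shift_obj_shf' shift_map_shi')
    qed
  qed
qed

section \<open>Descent from an acyclic shift\<close>

context
  fixes i :: "nat set \<Rightarrow> nat set \<Rightarrow> 'g::ab_group_add \<Rightarrow> 'g" and L M :: "nat set \<Rightarrow> 'g set" and n :: nat
  assumes p: "functor_pair i L M"
    and shifted: "\<And>A X a. finite A \<Longrightarrow> card A = n \<Longrightarrow> finite X \<Longrightarrow> A \<inter> X = {} \<Longrightarrow>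
      koszul_zero (shift_map A i) (shift_obj A L) (shift_obj A M) (Suc a) X"
begin

lemma cones:
  assumes "finite X" "x \<notin> X"
  shows "koszul_zero (shift_map A i) (shift_obj A L) (shift_obj A M) a X \<Longrightarrow> koszul_zero (shift_map A i) (shift_obj A L) (shift_obj A M) a (insert x X) \<Longrightarrow>
      koszul_zero (shift_map (insert x A) i) (shift_obj (insert x A) L) (shift_obj (insert x A) M) a X"
    and "koszul_zero (shift_map (insert x A) i) (shift_obj (insert x A) L) (shift_obj (insert x A) M) a X \<Longrightarrow>
      koszul_zero (shift_map A i) (shift_obj A L) (shift_obj A M) (Suc a) (insert x X) \<Longrightarrow> koszul_zero (shift_map A i) (shift_obj A L) (shift_obj A M) a X"
    and "koszul_zero (shift_map (insert x A) i) (shift_obj (insert x A) L) (shift_obj (insert x A) M) (Suc a) X \<Longrightarrow>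
      koszul_zero (shift_map A i) (shift_obj A L) (shift_obj A M) a X \<Longrightarrow> koszul_zero (shift_map A i) (shift_obj A L) (shift_obj A M) (Suc a) (insert x X)"
  using koszul_zero_cone1[OF assms functor_pairD(1-3)[OF functor_pair_shift[OF p, of A]]]
    koszul_zero_cone2[OF assms functor_pairD(1-3)[OF functor_pair_shift[OF p, of A]]]
    koszul_zero_cone3[OF assms functor_pairD[OF functor_pair_shift[OF p, of A]]]
  unfolding shift_obj_shf shift_map_shi by blast+

text \<open>If H_{a+2} of the shift by \<open>A\<close> vanished at all larger sets, exactness would
  carry the nonzero H_{a+1} over to the shift by one more point \<open>x\<close>. There induction
  yields a larger \<open>Y\<close> with nonzero H_{a+2}, against the vanishing at \<open>Y\<close>
  and \<open>insert x Y\<close>. The induction ends at shifts by \<open>n\<close> points, which have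
  no homology in positive degrees.\<close>

lemma koszul_zero_increase_shifted:
  assumes "finite A" "card A + j = n" "finite X" "A \<inter> X = {}" "\<not> koszul_zero (shift_map A i) (shift_obj A L) (shift_obj A M) (Suc a) X"
  shows "\<exists>Y. finite Y \<and> X \<subset> Y \<and> A \<inter> Y = {} \<and> \<not> koszul_zero (shift_map A i) (shift_obj A L) (shift_obj A M) (Suc (Suc a)) Y"
  using assms
proof (induct j arbitrary: A)
  case 0
  then show ?case
    using shifted by simp
next
  case (Suc j)
  obtain x where x: "x \<notin> A \<union> X"
    using ex_new_if_finite[OF infinite_UNIV_nat, of "A \<union> X"] Suc.prems by auto
  show ?case
  proof (rule ccontr)
    assume "\<not> ?thesis"
    then have V: "koszul_zero (shift_map A i) (shift_obj A L) (shift_obj A M) (Suc (Suc a)) Y" if "finite Y" "X \<subset> Y" "A \<inter> Y = {}" for Y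
      using that by blast
    have "koszul_zero (shift_map A i) (shift_obj A L) (shift_obj A M) (Suc (Suc a)) (insert x X)"
      using x Suc.prems by (intro V) auto
    then have "\<not> koszul_zero (shift_map (insert x A) i) (shift_obj (insert x A) L) (shift_obj (insert x A) M) (Suc a) X"
      using cones(2)[of X x A "Suc a"] Suc.prems x by blast
    then obtain Y where Y: "finite Y" "X \<subset> Y" "insert x A \<inter> Y = {}"
      "\<not> koszul_zero (shift_map (insert x A) i) (shift_obj (insert x A) L) (shift_obj (insert x A) M) (Suc (Suc a)) Y"
      using Suc.hyps[of "insert x A"] Suc.prems x by auto
    have "koszul_zero (shift_map A i) (shift_obj A L) (shift_obj A M) (Suc (Suc a)) Y"
      using Y by (intro V) auto
    moreover have "koszul_zero (shift_map A i) (shift_obj A L) (shift_obj A M) (Suc (Suc a)) (insert x Y)"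
      using Y x by (intro V) auto
    ultimately show False
      using cones(1)[of Y x A] Y by auto
  qed
qed

text \<open>Vanishing of H_1 passes to the shift by one more point, which is then acyclic by
  induction on the number of points missing from \<open>n\<close>. Going back, H_{a+2} at
  \<open>insert x Y\<close> lies between H_{a+2} of that shift and H_{a+1}, both at
  \<open>Y\<close>; so the degrees are settled one after the other.\<close>

lemma koszul_zero_acyclic_shifted:
  assumes "finite A" "card A + j = n" "\<And>X. finite X \<Longrightarrow> A \<inter> X = {} \<Longrightarrow> koszul_zero (shift_map A i) (shift_obj A L) (shift_obj A M) (Suc 0) X"
    and "finite X" "A \<inter> X = {}"
  shows "koszul_zero (shift_map A i) (shift_obj A L) (shift_obj A M) (Suc a) X"
  using assms
proof (induct j arbitrary: A X a)
  case 0
  then show ?case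
    using shifted by simp
next
  case (Suc j)
  have S: "koszul_zero (shift_map (insert x A) i) (shift_obj (insert x A) L) (shift_obj (insert x A) M) (Suc a) X"
    if "finite X" "A \<inter> X = {}" "x \<notin> A" "x \<notin> X" for x X a
  proof (rule Suc.hyps)
    show "finite (insert x A)" "card (insert x A) + j = n" "finite X" "insert x A \<inter> X = {}"
      using Suc.prems that by auto
    show "koszul_zero (shift_map (insert x A) i) (shift_obj (insert x A) L) (shift_obj (insert x A) M) (Suc 0) X"
      if "finite X" "insert x A \<inter> X = {}" for X
      using that \<open>x \<notin> A\<close> by (intro cones(1) Suc.prems(3)) auto
  qed
  show ?case
    using Suc.prems(4,5)
  proof (induct a arbitrary: X)
    case 0
    then show ?case by (rule Suc.prems(3))
  next
    case (Suc a)
    show ?case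
    proof (cases "X = {}")
      case True
      then show ?thesis by (simp add: koszul_zero_card_less)
    next
      case False
      then obtain x Y where X: "X = insert x Y" "x \<notin> Y"
        by (metis ex_in_conv mk_disjoint_insert)
      show ?thesis
        unfolding X(1) using X Suc.prems by (intro cones(3) S Suc.hyps) auto
    qed
  qed
qed

text \<open>Vanishing of H_1 at large sets is inherited by the shift, and from there the bounds go
  up degree by degree. \<open>D\<close> is uniform over all \<open>A\<close> of the same size, since
  the induction passes from \<open>A\<close> to \<open>insert x A\<close> with \<open>x\<close>
  taken from the set under consideration.\<close>

lemma koszul_zero_bounded_shifted:
  "\<exists>D. \<forall>A. finite A \<longrightarrow> card A + j = n \<longrightarrow>
    (\<forall>X. finite X \<longrightarrow> A \<inter> X = {} \<longrightarrow> d \<le> card X \<longrightarrow> koszul_zero (shift_map A i) (shift_obj A L) (shift_obj A M) (Suc 0) X) \<longrightarrow>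
    (\<forall>X. finite X \<longrightarrow> A \<inter> X = {} \<longrightarrow> D \<le> card X \<longrightarrow> koszul_zero (shift_map A i) (shift_obj A L) (shift_obj A M) (Suc a) X)"
proof (induct j arbitrary: a)
  case 0
  then show ?case
    using shifted by simp
next
  case (Suc j)
  note IHj = Suc
  let ?P = "\<lambda>j a D. \<forall>A. finite A \<longrightarrow> card A + j = n \<longrightarrow>
    (\<forall>X. finite X \<longrightarrow> A \<inter> X = {} \<longrightarrow> d \<le> card X \<longrightarrow> koszul_zero (shift_map A i) (shift_obj A L) (shift_obj A M) (Suc 0) X) \<longrightarrow>
    (\<forall>X. finite X \<longrightarrow> A \<inter> X = {} \<longrightarrow> D \<le> card X \<longrightarrow> koszul_zero (shift_map A i) (shift_obj A L) (shift_obj A M) (Suc a) X)"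
  show ?case
  proof (induct a)
    case 0
    then show ?case by blast
  next
    case (Suc a)
    from IHj[of "Suc a"] obtain D1 where D1: "?P j (Suc a) D1" ..
    from Suc obtain D2 where D2: "?P (Suc j) a D2" ..
    show ?case
    \<comment> \<open>One more than both bounds, because the cone relates homology at
      \<open>X\<close> to homology at \<open>X\<close> with one point removed.\<close>
    proof (rule exI[of _ "Suc (max D1 D2)"], intro allI impI)
      fix A X assume A: "finite A" "card A + Suc j = n"
        and V: "\<forall>X. finite X \<longrightarrow> A \<inter> X = {} \<longrightarrow> d \<le> card X \<longrightarrow> koszul_zero (shift_map A i) (shift_obj A L) (shift_obj A M) (Suc 0) X"
        and X: "finite X" "A \<inter> X = {}" "Suc (max D1 D2) \<le> card X"
      have "X \<noteq> {}"
        using X(3) by auto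
      then obtain x Y where Y: "X = insert x Y" "x \<notin> Y"
        by (metis ex_in_conv mk_disjoint_insert)
      have fY: "finite Y" "A \<inter> Y = {}" "x \<notin> A" "D1 \<le> card Y" "D2 \<le> card Y"
        using Y X by auto
      show "koszul_zero (shift_map A i) (shift_obj A L) (shift_obj A M) (Suc (Suc a)) X"
        unfolding Y(1)
      proof (rule cones(3)[OF fY(1) Y(2)])
        show "koszul_zero (shift_map A i) (shift_obj A L) (shift_obj A M) (Suc a) Y"
          using D2 A V fY by blast
        show "koszul_zero (shift_map (insert x A) i) (shift_obj (insert x A) L) (shift_obj (insert x A) M) (Suc (Suc a)) Y"
        proof (rule D1[rule_format])
          show "finite (insert x A)" "card (insert x A) + j = n" "finite Y" "insert x A \<inter> Y = {}" "D1 \<le> card Y"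
            using A fY Y by auto
          fix X assume X: "finite X" "insert x A \<inter> X = {}" "d \<le> card X"
          then have "x \<notin> X"
            by auto
          with X V show "koszul_zero (shift_map (insert x A) i) (shift_obj (insert x A) L) (shift_obj (insert x A) M) (Suc 0) X"
            using fY(3) by (intro cones(1)) auto
        qed
      qed
    qed
  qed
qed

end

section \<open>FI-modules as functors of abelian groups\<close>

lemma module_hom_group_hom:
  assumes "Module.module R M" "Module.module R N" "module_hom R M N f"
  shows "group_hom (add_monoid M) (add_monoid N) f"
proof -
  interpret M: Module.module R M by fact
  interpret N: Module.module R N by fact
  show ?thesis
    by (rule group_hom.intro[OF M.a_group N.a_group])
      (use assms(3) in \<open>auto simp: group_hom_axioms_def hom_def module_hom_def\<close>)
qed

lemma module_homD:
  assumes "module_hom R M N f"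
  shows "x \<in> carrier M \<Longrightarrow> f x \<in> carrier N"
    and "x \<in> carrier M \<Longrightarrow> y \<in> carrier M \<Longrightarrow> f (x \<oplus>\<^bsub>M\<^esub> y) = f x \<oplus>\<^bsub>N\<^esub> f y"
    and "c \<in> carrier R \<Longrightarrow> x \<in> carrier M \<Longrightarrow> f (c \<odot>\<^bsub>M\<^esub> x) = c \<odot>\<^bsub>N\<^esub> f x"
  using assms by (auto simp: module_hom_def)

lemma module_hom_zero:
  assumes "Module.module R M" "Module.module R N" "module_hom R M N f"
  shows "f \<zero>\<^bsub>M\<^esub> = \<zero>\<^bsub>N\<^esub>"
  using group_hom.hom_one[OF module_hom_group_hom[OF assms]] by simp

lemma module_hom_minus:
  assumes "Module.module R M" "Module.module R N" "module_hom R M N f" "x \<in> carrier M" "y \<in> carrier M"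
  shows "f (x \<ominus>\<^bsub>M\<^esub> y) = f x \<ominus>\<^bsub>N\<^esub> f y"
proof -
  interpret M: Module.module R M by fact
  interpret N: Module.module R N by fact
  have "f (\<ominus>\<^bsub>M\<^esub> y) = \<ominus>\<^bsub>N\<^esub> f y"
    using group_hom.hom_inv[OF module_hom_group_hom[OF assms(1-3)], of y] assms(5)
    by (simp add: a_inv_def)
  then show ?thesis
    using assms(4,5) by (simp add: a_minus_def module_homD(2)[OF assms(3)])
qed

section \<open>Formal sums of module elements\<close>

definition frag_eval :: "('k, 'a) module \<Rightarrow> ('a \<Rightarrow>\<^sub>0 int) \<Rightarrow> 'a" where
  "frag_eval M = (SOME h. h \<in> hom (free_Abelian_group (carrier M)) (add_monoid M) \<and>
     (\<forall>x\<in>carrier M. h (frag_of x) = x))"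

lemma frag_eval:
  assumes "abelian_group M"
  shows "frag_eval M \<in> hom (free_Abelian_group (carrier M)) (add_monoid M)"
    and "x \<in> carrier M \<Longrightarrow> frag_eval M (frag_of x) = x"
proof -
  interpret abelian_group M by fact
  obtain h where "h \<in> hom (free_Abelian_group (carrier M)) (add_monoid M)"
    "\<And>x. x \<in> carrier M \<Longrightarrow> h (frag_of x) = x"
    using comm_group.free_Abelian_group_universal[OF a_comm_group, of "\<lambda>x. x" "carrier M"] by auto
  then have ex: "\<exists>h. h \<in> hom (free_Abelian_group (carrier M)) (add_monoid M) \<and>
     (\<forall>x\<in>carrier M. h (frag_of x) = x)"
    by blast
  then show "frag_eval M \<in> hom (free_Abelian_group (carrier M)) (add_monoid M)"
    unfolding frag_eval_def by (rule someI2_ex) simp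
  show "x \<in> carrier M \<Longrightarrow> frag_eval M (frag_of x) = x"
    unfolding frag_eval_def using someI_ex[OF ex] by blast
qed

abbreviation fset :: "'a set \<Rightarrow> ('a \<Rightarrow>\<^sub>0 int) set" where
  "fset S \<equiv> {u. Poly_Mapping.keys u \<subseteq> S}"

lemma fset_diff: "u \<in> fset S \<Longrightarrow> v \<in> fset S \<Longrightarrow> u - v \<in> fset S"
  using keys_diff[of u v] by auto

lemma asubgrp_fset: "asubgrp (fset S)"
  unfolding asubgrp_def by (intro conjI ballI fset_diff) simp_all

lemma frag_eval_closed:
  assumes "abelian_group M" "u \<in> fset (carrier M)"
  shows "frag_eval M u \<in> carrier M"
  using frag_eval(1)[OF assms(1)] assms(2) by (auto simp: hom_def)

lemma frag_eval_add:
  assumes "abelian_group M" "u \<in> fset (carrier M)" "v \<in> fset (carrier M)"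
  shows "frag_eval M (u + v) = frag_eval M u \<oplus>\<^bsub>M\<^esub> frag_eval M v"
  using frag_eval(1)[OF assms(1)] assms by (auto simp: hom_def)

lemma frag_eval_zero:
  assumes "abelian_group M"
  shows "frag_eval M 0 = \<zero>\<^bsub>M\<^esub>"
proof -
  interpret abelian_group M by fact
  have "group_hom (free_Abelian_group (carrier M)) (add_monoid M) (frag_eval M)"
    using frag_eval(1)[OF assms] by (auto simp: group_hom_def group_hom_axioms_def a_group)
  from group_hom.hom_one[OF this] show ?thesis by simp
qed

lemma frag_eval_diff:
  assumes "abelian_group M" "u \<in> fset (carrier M)" "v \<in> fset (carrier M)"
  shows "frag_eval M (u - v) = frag_eval M u \<ominus>\<^bsub>M\<^esub> frag_eval M v"
proof -
  interpret abelian_group M by fact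
  have "frag_eval M u = frag_eval M (u - v) \<oplus>\<^bsub>M\<^esub> frag_eval M v"
    using frag_eval_add[OF assms(1) fset_diff[OF assms(2,3)] assms(3)] by simp
  then show ?thesis
    using frag_eval_closed[OF assms(1,3)] frag_eval_closed[OF assms(1) fset_diff[OF assms(2,3)]]
    by (simp add: a_minus_def a_assoc r_neg)
qed

lemma frag_eval_hom:
  assumes "Module.module R M" "Module.module R N" "module_hom R M N f" "u \<in> fset (carrier M)"
  shows "frag_extend (frag_of \<circ> f) u \<in> fset (carrier N)"
    and "frag_eval N (frag_extend (frag_of \<circ> f) u) = f (frag_eval M u)"
proof -
  interpret M: Module.module R M by fact
  interpret N: Module.module R N by fact
  define Q where "Q u \<longleftrightarrow> frag_extend (frag_of \<circ> f) u \<in> fset (carrier N) \<and> u \<in> fset (carrier M) \<and>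
      frag_eval N (frag_extend (frag_of \<circ> f) u) = f (frag_eval M u)" for u
  have "Q u"
  proof (rule free_Abelian_group_induct[where S = "carrier M"])
    show "Poly_Mapping.keys u \<subseteq> carrier M"
      using assms(4) by simp
  next
    show "Q 0"
      using module_hom_zero[OF assms(1-3)] by (simp add: Q_def frag_eval_zero M.abelian_group_axioms N.abelian_group_axioms)
  next
    fix x y assume xy: "Q x" "Q y"
    then have "frag_extend (frag_of \<circ> f) (x - y) \<in> fset (carrier N)"
      unfolding frag_extend_diff Q_def by (intro fset_diff) auto
    moreover have "x - y \<in> fset (carrier M)"
      using xy unfolding Q_def by (intro fset_diff) auto
    moreover have "frag_eval N (frag_extend (frag_of \<circ> f) (x - y)) = f (frag_eval M (x - y))"
      unfolding frag_extend_diff using xy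
      by (simp add: Q_def frag_eval_diff M.abelian_group_axioms N.abelian_group_axioms frag_eval_closed module_hom_minus[OF assms(1-3)])
    ultimately show "Q (x - y)"
      unfolding Q_def by blast
  next
    fix a assume "a \<in> carrier M"
    then show "Q (frag_of a)"
      using module_homD(1)[OF assms(3)]
      by (simp add: Q_def frag_eval(2) M.abelian_group_axioms N.abelian_group_axioms)
  qed
  then show "frag_extend (frag_of \<circ> f) u \<in> fset (carrier N)"
    and "frag_eval N (frag_extend (frag_of \<circ> f) u) = f (frag_eval M u)"
    by (auto simp: Q_def)
qed

section \<open>FI-modules as quotients of functors of formal sums\<close>

abbreviation inc :: "nat set \<Rightarrow> nat \<Rightarrow> nat" where
  "inc Y \<equiv> restrict id Y"

lemma inc_FI_mor: "Y \<subseteq> X \<Longrightarrow> inc Y \<in> FI_mor Y X"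
  by (auto simp: FI_mor_def inj_on_def)

lemma compose_inc: "Z \<subseteq> Y \<Longrightarrow> compose Z (inc Y) (inc Z) = inc Z"
  by (auto simp: compose_def fun_eq_iff)

lemma fi_moduleD:
  assumes "fi_module R V"
  shows "finite X \<Longrightarrow> Module.module R (obj V X)"
    and "finite X \<Longrightarrow> finite Y \<Longrightarrow> f \<in> FI_mor X Y \<Longrightarrow> module_hom R (obj V X) (obj V Y) (mor V X Y f)"
    and "finite X \<Longrightarrow> v \<in> carrier (obj V X) \<Longrightarrow> mor V X X (inc X) v = v"
    and "finite X \<Longrightarrow> finite Y \<Longrightarrow> finite Z \<Longrightarrow> f \<in> FI_mor X Y \<Longrightarrow> g \<in> FI_mor Y Z \<Longrightarrow>
      v \<in> carrier (obj V X) \<Longrightarrow> mor V X Z (compose X g f) v = mor V Y Z g (mor V X Y f v)"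
     apply (use assms in \<open>simp add: fi_module_def\<close>)
    apply (use assms[unfolded fi_module_def, THEN conjunct2, THEN conjunct1] in blast)
   apply (use assms[unfolded fi_module_def, THEN conjunct2, THEN conjunct2, THEN conjunct1] in blast)
  apply (use assms[unfolded fi_module_def, THEN conjunct2, THEN conjunct2, THEN conjunct2] in blast)
  done

lemma fi_module_abelian:
  assumes "fi_module R V" "finite X"
  shows "abelian_group (obj V X)"
proof -
  interpret Module.module R "obj V X"
    by (rule fi_moduleD(1)[OF assms])
  show ?thesis ..
qed

lemma fi_mapD:
  assumes "fi_map R V W \<phi>"
  shows "finite X \<Longrightarrow> module_hom R (obj V X) (obj W X) (\<phi> X)"
    and "finite X \<Longrightarrow> finite Y \<Longrightarrow> f \<in> FI_mor X Y \<Longrightarrow> v \<in> carrier (obj V X) \<Longrightarrow>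
      \<phi> Y (mor V X Y f v) = mor W X Y f (\<phi> X v)"
   apply (use assms[unfolded fi_map_def, THEN conjunct1] in blast)
  apply (use assms[unfolded fi_map_def, THEN conjunct2] in blast)
  done

text \<open>
  The values at infinite sets are junk; making them zero frees \<^const>\<open>poset_functor\<close> from finiteness conditions.
\<close>

definition frag_map :: "('k, 'a) fi_mod \<Rightarrow> nat set \<Rightarrow> nat set \<Rightarrow> ('a \<Rightarrow>\<^sub>0 int) \<Rightarrow> ('a \<Rightarrow>\<^sub>0 int)" where
  "frag_map V Y X = (if finite X \<and> Y \<subseteq> X then frag_extend (frag_of \<circ> mor V Y X (inc Y)) else (\<lambda>_. 0))"

definition frag_over :: "('k, 'a) fi_mod \<Rightarrow> (nat set \<Rightarrow> 'a set) \<Rightarrow> nat set \<Rightarrow> ('a \<Rightarrow>\<^sub>0 int) set" where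
  "frag_over V K X = (if finite X then {u \<in> fset (carrier (obj V X)). frag_eval (obj V X) u \<in> K X} else {0})"

definition whole_sub :: "('k, 'a) fi_mod \<Rightarrow> nat set \<Rightarrow> 'a set" where
  "whole_sub V X = carrier (obj V X)"

definition zero_sub :: "('k, 'a) fi_mod \<Rightarrow> nat set \<Rightarrow> 'a set" where
  "zero_sub V X = {\<zero>\<^bsub>obj V X\<^esub>}"

text \<open>Stability under all injections, bijections included, is what later makes the
  corresponding families of formal sums invariant under transpositions.\<close>

definition fi_subsys :: "('k, 'a) fi_mod \<Rightarrow> (nat set \<Rightarrow> 'a set) \<Rightarrow> bool" where
  "fi_subsys V K \<longleftrightarrow> (\<forall>X. finite X \<longrightarrow> K X \<subseteq> carrier (obj V X) \<and> \<zero>\<^bsub>obj V X\<^esub> \<in> K X \<and>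
     (\<forall>x\<in>K X. \<forall>y\<in>K X. x \<ominus>\<^bsub>obj V X\<^esub> y \<in> K X) \<and>
     (\<forall>Y f. finite Y \<longrightarrow> f \<in> FI_mor X Y \<longrightarrow> (\<forall>x\<in>K X. mor V X Y f x \<in> K Y)))"

lemma fi_subsysD:
  assumes "fi_subsys V K" "finite X"
  shows "K X \<subseteq> carrier (obj V X)" "\<zero>\<^bsub>obj V X\<^esub> \<in> K X"
    and "x \<in> K X \<Longrightarrow> y \<in> K X \<Longrightarrow> x \<ominus>\<^bsub>obj V X\<^esub> y \<in> K X"
    and "finite Y \<Longrightarrow> f \<in> FI_mor X Y \<Longrightarrow> x \<in> K X \<Longrightarrow> mor V X Y f x \<in> K Y"
  using assms unfolding fi_subsys_def by simp_all

lemma fi_subsys_tot: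
  assumes "fi_module R V"
  shows "fi_subsys V (whole_sub V)"
  unfolding fi_subsys_def whole_sub_def
proof (intro allI impI conjI ballI)
  fix X :: "nat set" assume X: "finite X"
  interpret Module.module R "obj V X"
    by (rule fi_moduleD(1)[OF assms X])
  show "\<zero>\<^bsub>obj V X\<^esub> \<in> carrier (obj V X)"
    by simp
  show "x \<ominus>\<^bsub>obj V X\<^esub> y \<in> carrier (obj V X)" if "x \<in> carrier (obj V X)" "y \<in> carrier (obj V X)" for x y
    using that by simp
  show "mor V X Y f x \<in> carrier (obj V Y)"
    if "finite Y" "f \<in> FI_mor X Y" "x \<in> carrier (obj V X)" for x f Y
    using module_homD(1)[OF fi_moduleD(2)[OF assms X that(1,2)] that(3)] .
qed simp

lemma fi_subsys_triv:
  assumes "fi_module R V"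
  shows "fi_subsys V (zero_sub V)"
  unfolding fi_subsys_def zero_sub_def
proof (intro allI impI conjI ballI)
  fix X :: "nat set" assume X: "finite X"
  interpret Module.module R "obj V X"
    by (rule fi_moduleD(1)[OF assms X])
  show "{\<zero>\<^bsub>obj V X\<^esub>} \<subseteq> carrier (obj V X)"
    by simp
  show "x \<ominus>\<^bsub>obj V X\<^esub> y \<in> {\<zero>\<^bsub>obj V X\<^esub>}" if "x \<in> {\<zero>\<^bsub>obj V X\<^esub>}" "y \<in> {\<zero>\<^bsub>obj V X\<^esub>}" for x y
    using that by (simp add: a_minus_def)
  show "mor V X Y f x \<in> {\<zero>\<^bsub>obj V Y\<^esub>}"
    if "finite Y" "f \<in> FI_mor X Y" "x \<in> {\<zero>\<^bsub>obj V X\<^esub>}" for x f Y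
    using module_hom_zero[OF fi_moduleD(1)[OF assms X] fi_moduleD(1)[OF assms that(1)] fi_moduleD(2)[OF assms X that(1,2)]] that(3)
    by simp
qed simp

lemma frag_over_iff: "finite X \<Longrightarrow> u \<in> frag_over V K X \<longleftrightarrow> u \<in> fset (carrier (obj V X)) \<and> frag_eval (obj V X) u \<in> K X"
  by (simp add: frag_over_def)

lemma frag_over_tot_iff:
  assumes "fi_module R V" "finite X"
  shows "u \<in> frag_over V (whole_sub V) X \<longleftrightarrow> u \<in> fset (carrier (obj V X))"
  using frag_eval_closed[OF fi_module_abelian[OF assms]] by (auto simp: frag_over_def whole_sub_def assms(2))

lemma frag_over_mono: "(\<And>X. finite X \<Longrightarrow> K X \<subseteq> K' X) \<Longrightarrow> frag_over V K X \<subseteq> frag_over V K' X"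
  by (auto simp: frag_over_def)

lemma frag_map_evm:
  assumes "fi_module R V" "finite X" "Y \<subseteq> X" "u \<in> fset (carrier (obj V Y))"
  shows "frag_map V Y X u \<in> fset (carrier (obj V X))"
    and "frag_eval (obj V X) (frag_map V Y X u) = mor V Y X (inc Y) (frag_eval (obj V Y) u)"
  using frag_eval_hom[OF fi_moduleD(1)[OF assms(1) finite_subset[OF assms(3,2)]] fi_moduleD(1)[OF assms(1,2)]
    fi_moduleD(2)[OF assms(1) finite_subset[OF assms(3,2)] assms(2) inc_FI_mor[OF assms(3)]] assms(4)] assms(2,3)
  by (simp_all add: frag_map_def)

lemma frag_extend_of_id: "(\<And>x. x \<in> Poly_Mapping.keys u \<Longrightarrow> f x = x) \<Longrightarrow> frag_extend (frag_of \<circ> f) u = u"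
  using frag_extend_eq[of u "frag_of \<circ> f" frag_of] frag_expansion[of u] by simp

lemma additive_frag_extend: "additive (frag_extend f)"
  by (rule additive.intro) (rule frag_extend_add)

lemma poset_functor_lin:
  assumes "fi_module R V"
  shows "poset_functor (frag_map V) (frag_over V (whole_sub V))"
  unfolding poset_functor_def
proof (intro conjI allI ballI impI)
  show "additive (frag_map V Y X)" for Y X
    by (auto simp: frag_map_def additive_frag_extend intro: additive.intro)
next
  fix X u assume u: "u \<in> frag_over V (whole_sub V) X"
  show "frag_map V X X u = u"
  proof (cases "finite X")
    case True
    then show ?thesis
      using u fi_moduleD(3)[OF assms True]
      by (auto simp: frag_map_def frag_over_def intro!: frag_extend_of_id)
  next
    case False
    then show ?thesis
      using u by (simp add: frag_map_def frag_over_def)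
  qed
next
  fix Z Y X u assume u: "u \<in> frag_over V (whole_sub V) Z" and ZY: "Z \<subseteq> Y" and YX: "Y \<subseteq> X"
  show "frag_map V Y X (frag_map V Z Y u) = frag_map V Z X u"
  proof (cases "finite X")
    case True
    then have fin: "finite Y" "finite Z" "Z \<subseteq> X"
      using ZY YX by (auto intro: finite_subset[of _ X])
    have "frag_map V Y X (frag_map V Z Y u) =
        frag_extend ((frag_of \<circ> mor V Y X (inc Y)) \<circ> mor V Z Y (inc Z)) u"
      using True ZY YX fin by (simp add: frag_map_def frag_extend_compose)
    also have "\<dots> = frag_extend (frag_of \<circ> mor V Z X (inc Z)) u"
    proof (rule frag_extend_eq)
      fix v assume "v \<in> Poly_Mapping.keys u"
      then have "v \<in> carrier (obj V Z)"
        using u fin by (auto simp: frag_over_def)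
      then have "mor V Z X (compose Z (inc Y) (inc Z)) v = mor V Y X (inc Y) (mor V Z Y (inc Z) v)"
        using True fin ZY YX by (intro fi_moduleD(4)[OF assms] inc_FI_mor) auto
      then show "((frag_of \<circ> mor V Y X (inc Y)) \<circ> mor V Z Y (inc Z)) v = (frag_of \<circ> mor V Z X (inc Z)) v"
        by (simp add: compose_inc[OF ZY])
    qed
    also have "\<dots> = frag_map V Z X u"
      using True fin by (simp add: frag_map_def)
    finally show ?thesis .
  next
    case False
    then show ?thesis by (simp add: frag_map_def)
  qed
qed

lemma subfunctor_lift:
  assumes "fi_module R V" "fi_subsys V K"
  shows "subfunctor (frag_map V) (frag_over V K)"
  unfolding subfunctor_def
proof (intro conjI allI ballI impI)
  fix X show "asubgrp (frag_over V K X)"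
  proof (cases "finite X")
    case True
    note ab = fi_module_abelian[OF assms(1) True]
    show ?thesis
      unfolding asubgrp_def
    proof (intro conjI ballI)
      show "0 \<in> frag_over V K X"
        using frag_eval_zero[OF ab] fi_subsysD(2)[OF assms(2) True] by (simp add: frag_over_iff True)
      show "u - v \<in> frag_over V K X" if "u \<in> frag_over V K X" "v \<in> frag_over V K X" for u v
        using that fset_diff[of u _ v] fi_subsysD(3)[OF assms(2) True] by (auto simp: frag_over_iff True frag_eval_diff[OF ab])
    qed
  qed (simp add: frag_over_def asubgrp_def)
next
  fix Y X u assume u: "u \<in> frag_over V K Y" and YX: "Y \<subseteq> X"
  show "frag_map V Y X u \<in> frag_over V K X"
  proof (cases "finite X")
    case True
    then have fY: "finite Y"
      using YX finite_subset by auto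
    then show ?thesis
      using frag_map_evm[OF assms(1) True YX, of u] u fi_subsysD(4)[OF assms(2) fY True inc_FI_mor[OF YX]]
      by (simp add: frag_over_iff True)
  qed (simp add: frag_map_def frag_over_def)
qed

lemma functor_pair_lift:
  assumes "fi_module R V" "fi_subsys V K"
  shows "functor_pair (frag_map V) (frag_over V (whole_sub V)) (frag_over V K)"
  unfolding functor_pair_def
  using poset_functor_lin[OF assms(1)] subfunctor_lift[OF assms(1)] fi_subsys_tot[OF assms(1)] assms(2)
    frag_over_mono[of K "whole_sub V" V] fi_subsysD(1)[OF assms(2)] by (auto simp: whole_sub_def)

text \<open>Koszul vanishing for the quotient of \<open>J\<close> by \<open>K\<close>: when both
  contain zero, both families of formal sums contain the kernel of evaluation, so their quotient is
  that of \<open>J\<close> by \<open>K\<close> itself.\<close>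

definition fi_koszul_zero :: "('k, 'a) fi_mod \<Rightarrow> (nat set \<Rightarrow> 'a set) \<Rightarrow> (nat set \<Rightarrow> 'a set) \<Rightarrow> nat \<Rightarrow> nat set \<Rightarrow> bool" where
  "fi_koszul_zero V J K = koszul_zero (frag_map V) (frag_over V J) (frag_over V K)"

text \<open>The hypotheses \<open>im\<close> and \<open>pre\<close> say that \<open>\<phi>\<close>
  induces an isomorphism of \<open>J\<close> modulo \<open>K\<close> with \<open>J'\<close> modulo
  \<open>K'\<close>. Formal sums correspond if \<open>\<phi>\<close> takes the value of one to the
  value of the other; a single generator represents any element needed.\<close>

lemma fi_koszul_zero_map:
  assumes V: "fi_module R V" and W: "fi_module R W" and phi: "fi_map R V W \<phi>"
    and J: "fi_subsys V J" and J': "fi_subsys W J'" and X: "finite X"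
    and im: "\<And>Z. finite Z \<Longrightarrow> \<phi> Z ` J Z = J' Z"
    and pre: "\<And>Z v. finite Z \<Longrightarrow> v \<in> J Z \<Longrightarrow> \<phi> Z v \<in> K' Z \<longleftrightarrow> v \<in> K Z"
    and K: "\<And>Z. finite Z \<Longrightarrow> K Z \<subseteq> J Z" "\<And>Z. finite Z \<Longrightarrow> K' Z \<subseteq> J' Z"
  shows "fi_koszul_zero V J K a X \<longleftrightarrow> fi_koszul_zero W J' K' a X"
proof -
  define r where "r Z u v \<longleftrightarrow> u \<in> frag_over V J Z \<and> v \<in> frag_over W J' Z \<and>
    \<phi> Z (frag_eval (obj V Z) u) = frag_eval (obj W Z) v" for Z u v
  note sV = subfunctor_lift[OF V J] and sW = subfunctor_lift[OF W J']
  have zero: "r Z 0 0" if "finite Z" for Z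
    unfolding r_def using that asubgrp_zero[OF subfunctor_asubgrp[OF sV]] asubgrp_zero[OF subfunctor_asubgrp[OF sW]]
      module_hom_zero[OF fi_moduleD(1)[OF V that] fi_moduleD(1)[OF W that] fi_mapD(1)[OF phi that]]
    by (simp add: frag_eval_zero fi_module_abelian[OF V] fi_module_abelian[OF W])
  have diff: "r Z (u - u') (v - v')" if "finite Z" "r Z u v" "r Z u' v'" for Z u v u' v'
  proof -
    have c: "u \<in> fset (carrier (obj V Z))" "u' \<in> fset (carrier (obj V Z))"
      "v \<in> fset (carrier (obj W Z))" "v' \<in> fset (carrier (obj W Z))"
      using that by (auto simp: r_def frag_over_iff)
    show ?thesis
      using that(2,3) asubgrp_diff[OF subfunctor_asubgrp[OF sV]] asubgrp_diff[OF subfunctor_asubgrp[OF sW]] c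
      by (simp add: r_def frag_eval_diff fi_module_abelian[OF V that(1)] fi_module_abelian[OF W that(1)] frag_eval_closed
         module_hom_minus[OF fi_moduleD(1)[OF V that(1)] fi_moduleD(1)[OF W that(1)] fi_mapD(1)[OF phi that(1)]])
  qed
  have nat: "r Z (frag_map V Y Z u) (frag_map W Y Z v)" if "finite Z" "Y \<subseteq> Z" "r Y u v" for Y Z u v
  proof -
    have fY: "finite Y"
      using that finite_subset by auto
    have c: "u \<in> fset (carrier (obj V Y))" "v \<in> fset (carrier (obj W Y))"
      using that(3) fY by (auto simp: r_def frag_over_iff)
    have "\<phi> Z (mor V Y Z (inc Y) (frag_eval (obj V Y) u)) = mor W Y Z (inc Y) (\<phi> Y (frag_eval (obj V Y) u))"
      by (rule fi_mapD(2)[OF phi fY that(1) inc_FI_mor[OF that(2)] frag_eval_closed[OF fi_module_abelian[OF V fY] c(1)]])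
    then show ?thesis
      using that(3) subfunctor_map[OF sV _ that(2)] subfunctor_map[OF sW _ that(2)] c
      by (simp add: r_def frag_map_evm[OF V that(1,2)] frag_map_evm[OF W that(1,2)])
  qed
  have left: "\<exists>v\<in>frag_over W J' Z. r Z u v" if Z: "finite Z" and u: "u \<in> frag_over V J Z" for Z u
  proof -
    have "\<phi> Z (frag_eval (obj V Z) u) \<in> J' Z"
      using u im[OF Z] Z by (auto simp: frag_over_iff)
    moreover from this have "\<phi> Z (frag_eval (obj V Z) u) \<in> carrier (obj W Z)"
      using fi_subsysD(1)[OF J' Z] by auto
    ultimately show ?thesis
      using u Z by (intro bexI[of _ "frag_of (\<phi> Z (frag_eval (obj V Z) u))"])
        (auto simp: r_def frag_over_iff frag_eval(2)[OF fi_module_abelian[OF W Z]])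
  qed
  have right: "\<exists>u\<in>frag_over V J Z. r Z u v" if Z: "finite Z" and v: "v \<in> frag_over W J' Z" for Z v
  proof -
    obtain x where x: "x \<in> J Z" "frag_eval (obj W Z) v = \<phi> Z x"
      using v im[OF Z] Z by (auto simp: frag_over_iff)
    moreover from x have "x \<in> carrier (obj V Z)"
      using fi_subsysD(1)[OF J Z] by auto
    ultimately show ?thesis
      using v Z by (intro bexI[of _ "frag_of x"])
        (auto simp: r_def frag_over_iff frag_eval(2)[OF fi_module_abelian[OF V Z]])
  qed
  have N: "u \<in> frag_over V K Z \<longleftrightarrow> v \<in> frag_over W K' Z" if "finite Z" "r Z u v" for Z u v
    using that pre[OF that(1), of "frag_eval (obj V Z) u"] by (auto simp: r_def frag_over_iff)
  have sub: "finite Z" if "Z \<subseteq> X" for Z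
    using that X finite_subset by auto
  show ?thesis
    unfolding fi_koszul_zero_def
  proof
    assume "koszul_zero (frag_map V) (frag_over V J) (frag_over V K) a X"
    then show "koszul_zero (frag_map W) (frag_over W J') (frag_over W K') a X"
      by (rule koszul_zero_iso[where r = r, OF _ X zero[OF sub] diff[OF sub] nat[OF sub] left[OF sub] right[OF sub] N[OF sub]])
  next
    assume "koszul_zero (frag_map W) (frag_over W J') (frag_over W K') a X"
    then show "koszul_zero (frag_map V) (frag_over V J) (frag_over V K) a X"
      by (rule koszul_zero_iso[where r = "\<lambda>Z u v. r Z v u", OF _ X zero[OF sub] diff[OF sub] nat[OF sub] right[OF sub] left[OF sub] N[OF sub, symmetric]])
  qed
qed

section \<open>Koszul homology in degrees zero and one\<close>

lemma frag_eval_sum_hom: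
  assumes "Module.module R M" "Module.module R N" "module_hom R M N f" "finite S"
    and "\<And>x. x \<in> S \<Longrightarrow> u x \<in> fset (carrier M) \<and> w x \<in> fset (carrier N) \<and> f (frag_eval M (u x)) = frag_eval N (w x)"
  shows "sum u S \<in> fset (carrier M) \<and> sum w S \<in> fset (carrier N) \<and> f (frag_eval M (sum u S)) = frag_eval N (sum w S)"
  using assms(4,5)
proof (induct S rule: finite_induct)
  case empty
  interpret M: Module.module R M by fact
  interpret N: Module.module R N by fact
  show ?case
    using module_hom_zero[OF assms(1-3)] by (simp add: frag_eval_zero M.abelian_group_axioms N.abelian_group_axioms)
next
  case (insert x S)
  interpret M: Module.module R M by fact
  interpret N: Module.module R N by fact
  have IH: "sum u S \<in> fset (carrier M)" "sum w S \<in> fset (carrier N)" "f (frag_eval M (sum u S)) = frag_eval N (sum w S)"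
    using insert by auto
  have x: "u x \<in> fset (carrier M)" "w x \<in> fset (carrier N)" "f (frag_eval M (u x)) = frag_eval N (w x)"
    using insert by auto
  have "u x + sum u S \<in> fset (carrier M)"
    by (rule asubgrp_add[OF asubgrp_fset x(1) IH(1)])
  moreover have "w x + sum w S \<in> fset (carrier N)"
    by (rule asubgrp_add[OF asubgrp_fset x(2) IH(2)])
  moreover have "f (frag_eval M (u x + sum u S)) = frag_eval N (w x + sum w S)"
    using x IH by (simp add: frag_eval_add M.abelian_group_axioms N.abelian_group_axioms module_homD(2)[OF assms(3)]
        frag_eval_closed)
  ultimately show ?case
    using insert by simp
qed

text \<open>
  The sum of the images of \<open>K\<close> at the sets \<open>X - {x}\<close> with \<open>x \<in> X\<close>.
\<close>

definition fi_img :: "('k, 'a) fi_mod \<Rightarrow> (nat set \<Rightarrow> 'a set) \<Rightarrow> nat set \<Rightarrow> 'a set" where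
  "fi_img V K X = {frag_eval (obj V X) (koszul_bd (frag_map V) X c {}) | c. chain (frag_over V K) (Suc 0) X c}"

lemma koszul_bd_lift_fset:
  assumes "fi_module R V" "fi_subsys V K" "finite X" "chain (frag_over V K) (Suc 0) X c"
  shows "koszul_bd (frag_map V) X c {} \<in> frag_over V K X"
  by (rule iffD1[OF chain_zero_iff[OF assms(3)] koszul_bd_chain[OF assms(3) subfunctor_lift[OF assms(1,2)] assms(4)]])

lemma fi_img_closed:
  assumes "fi_module R V" "fi_subsys V K" "finite X"
  shows "fi_img V K X \<subseteq> K X"
  using koszul_bd_lift_fset[OF assms] by (auto simp: fi_img_def frag_over_iff[OF assms(3)])

lemma fi_img_diff:
  assumes "fi_module R V" "fi_subsys V K" "finite X" "x \<in> fi_img V K X" "y \<in> fi_img V K X"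
  shows "x \<ominus>\<^bsub>obj V X\<^esub> y \<in> fi_img V K X"
proof -
  obtain c d where c: "chain (frag_over V K) (Suc 0) X c" "x = frag_eval (obj V X) (koszul_bd (frag_map V) X c {})"
    and d: "chain (frag_over V K) (Suc 0) X d" "y = frag_eval (obj V X) (koszul_bd (frag_map V) X d {})"
    using assms(4,5) by (auto simp: fi_img_def)
  have "koszul_bd (frag_map V) X c {} \<in> fset (carrier (obj V X))" "koszul_bd (frag_map V) X d {} \<in> fset (carrier (obj V X))"
    using koszul_bd_lift_fset[OF assms(1-3)] c(1) d(1) by (simp_all add: frag_over_iff[OF assms(3)])
  then have "x \<ominus>\<^bsub>obj V X\<^esub> y = frag_eval (obj V X) (koszul_bd (frag_map V) X (\<lambda>T. c T - d T) {})"
    unfolding c(2) d(2) koszul_bd_diff[OF poset_functor_additive[OF poset_functor_lin[OF assms(1)]]]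
    by (rule frag_eval_diff[OF fi_module_abelian[OF assms(1,3)], symmetric])
  moreover have "chain (frag_over V K) (Suc 0) X (\<lambda>T. c T - d T)"
    by (rule chain_diff[OF subfunctor_lift[OF assms(1,2)] c(1) d(1)])
  ultimately show ?thesis
    unfolding fi_img_def by blast
qed

lemma fi_img_image_subset:
  assumes V: "fi_module R V" and W: "fi_module R W" and J: "fi_subsys V J" and J': "fi_subsys W J'" and X: "finite X"
    and phi: "\<And>Y. Y \<subseteq> X \<Longrightarrow> module_hom R (obj V Y) (obj W Y) (\<phi> Y)"
    and nat: "\<And>Y v. Y \<subseteq> X \<Longrightarrow> v \<in> carrier (obj V Y) \<Longrightarrow> \<phi> X (mor V Y X (inc Y) v) = mor W Y X (inc Y) (\<phi> Y v)"
    and im: "\<And>Z. Z \<subseteq> X \<Longrightarrow> \<phi> Z ` J Z \<subseteq> J' Z"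
  shows "\<phi> X ` fi_img V J X \<subseteq> fi_img W J' X"
proof
  fix z assume "z \<in> \<phi> X ` fi_img V J X"
  then obtain c where c: "chain (frag_over V J) (Suc 0) X c" "z = \<phi> X (frag_eval (obj V X) (koszul_bd (frag_map V) X c {}))"
    by (auto simp: fi_img_def)
  define d where "d T = frag_of (\<phi> (X - T) (frag_eval (obj V (X - T)) (c T)))" for T
  have cT: "c T \<in> fset (carrier (obj V (X - T)))" "frag_eval (obj V (X - T)) (c T) \<in> J (X - T)"
    if "T \<subseteq> X" "card T = Suc 0" for T
    using chainD[OF c(1) that] X by (auto simp: frag_over_iff)
  have dT: "d T \<in> frag_over W J' (X - T)" "frag_eval (obj W (X - T)) (d T) = \<phi> (X - T) (frag_eval (obj V (X - T)) (c T))"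
    if "T \<subseteq> X" "card T = Suc 0" for T
  proof -
    have "\<phi> (X - T) (frag_eval (obj V (X - T)) (c T)) \<in> J' (X - T)"
      using cT(2)[OF that] im[OF Diff_subset] by blast
    moreover from this have "\<phi> (X - T) (frag_eval (obj V (X - T)) (c T)) \<in> carrier (obj W (X - T))"
      using fi_subsysD(1)[OF J'] X by blast
    ultimately show "d T \<in> frag_over W J' (X - T)" "frag_eval (obj W (X - T)) (d T) = \<phi> (X - T) (frag_eval (obj V (X - T)) (c T))"
      using X by (simp_all add: d_def frag_over_iff frag_eval(2)[OF fi_module_abelian[OF W]])
  qed
  have "chain (frag_over W J') (Suc 0) X d"
    using dT(1) by (rule chainI)
  moreover have "z = frag_eval (obj W X) (koszul_bd (frag_map W) X d {})"
    unfolding c(2) koszul_bd_empty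
  proof (rule frag_eval_sum_hom[THEN conjunct2, THEN conjunct2, OF fi_moduleD(1)[OF V X] fi_moduleD(1)[OF W X] phi[OF subset_refl] X])
    fix x assume x: "x \<in> X"
    then have T: "{x} \<subseteq> X" "card {x} = Suc 0"
      by auto
    have dx: "d {x} \<in> fset (carrier (obj W (X - {x})))"
      using dT(1)[OF T] X by (simp add: frag_over_iff)
    have fin: "finite (X - {x})"
      using X by simp
    show "frag_map V (X - {x}) X (c {x}) \<in> fset (carrier (obj V X)) \<and>
        frag_map W (X - {x}) X (d {x}) \<in> fset (carrier (obj W X)) \<and>
        \<phi> X (frag_eval (obj V X) (frag_map V (X - {x}) X (c {x}))) = frag_eval (obj W X) (frag_map W (X - {x}) X (d {x}))"
      using frag_map_evm[OF V X Diff_subset cT(1)[OF T]] frag_map_evm[OF W X Diff_subset dx] dT(2)[OF T]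
        nat[OF Diff_subset frag_eval_closed[OF fi_module_abelian[OF V fin] cT(1)[OF T]]]
      by simp
  qed
  ultimately show "z \<in> fi_img W J' X"
    unfolding fi_img_def by blast
qed

lemma fi_img_image:
  assumes V: "fi_module R V" and W: "fi_module R W" and J: "fi_subsys V J" and J': "fi_subsys W J'" and X: "finite X"
    and phi: "fi_map R V W \<phi>" and im: "\<And>Z. finite Z \<Longrightarrow> \<phi> Z ` J Z = J' Z"
  shows "\<phi> X ` fi_img V J X = fi_img W J' X"
proof
  have fin: "finite Y" if "Y \<subseteq> X" for Y
    using that X finite_subset by blast
  show "\<phi> X ` fi_img V J X \<subseteq> fi_img W J' X"
  proof (rule fi_img_image_subset[OF V W J J' X])
    show "module_hom R (obj V Y) (obj W Y) (\<phi> Y)" if "Y \<subseteq> X" for Y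
      by (rule fi_mapD(1)[OF phi fin[OF that]])
    show "\<phi> X (mor V Y X (inc Y) v) = mor W Y X (inc Y) (\<phi> Y v)" if "Y \<subseteq> X" "v \<in> carrier (obj V Y)" for Y v
      by (rule fi_mapD(2)[OF phi fin[OF that(1)] X inc_FI_mor[OF that(1)] that(2)])
    show "\<phi> Z ` J Z \<subseteq> J' Z" if "Z \<subseteq> X" for Z
      using im[OF fin[OF that]] by simp
  qed
  show "fi_img W J' X \<subseteq> \<phi> X ` fi_img V J X"
  proof
    fix z assume "z \<in> fi_img W J' X"
    then obtain d where d: "chain (frag_over W J') (Suc 0) X d" "z = frag_eval (obj W X) (koszul_bd (frag_map W) X d {})"
      by (auto simp: fi_img_def)
    have "\<exists>v. T \<subseteq> X \<longrightarrow> card T = Suc 0 \<longrightarrow> v \<in> J (X - T) \<and> \<phi> (X - T) v = frag_eval (obj W (X - T)) (d T)" for T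
    proof (cases "T \<subseteq> X \<and> card T = Suc 0")
      case True
      then have "frag_eval (obj W (X - T)) (d T) \<in> J' (X - T)"
        using chainD[OF d(1), of T] X by (simp add: frag_over_iff)
      then have "frag_eval (obj W (X - T)) (d T) \<in> \<phi> (X - T) ` J (X - T)"
        using im[of "X - T"] X by simp
      then show ?thesis
        by auto
    qed blast
    then obtain v where v: "\<And>T. T \<subseteq> X \<Longrightarrow> card T = Suc 0 \<Longrightarrow>
        v T \<in> J (X - T) \<and> \<phi> (X - T) (v T) = frag_eval (obj W (X - T)) (d T)"
      by metis
    have vc: "v T \<in> carrier (obj V (X - T))" if "T \<subseteq> X" "card T = Suc 0" for T
      using v[OF that] fi_subsysD(1)[OF J, of "X - T"] X by auto
    define c where "c T = frag_of (v T)" for T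
    have c: "chain (frag_over V J) (Suc 0) X c"
      using v vc X by (auto intro!: chainI simp: c_def frag_over_iff frag_eval(2)[OF fi_module_abelian[OF V]])
    have "\<phi> X (frag_eval (obj V X) (koszul_bd (frag_map V) X c {})) = frag_eval (obj W X) (koszul_bd (frag_map W) X d {})"
      unfolding koszul_bd_empty
    proof (rule frag_eval_sum_hom[THEN conjunct2, THEN conjunct2, OF fi_moduleD(1)[OF V X] fi_moduleD(1)[OF W X] fi_mapD(1)[OF phi X] X])
      fix x assume x: "x \<in> X"
      then have T: "{x} \<subseteq> X" "card {x} = Suc 0" and f: "finite (X - {x})"
        using X by auto
      have cx: "c {x} \<in> fset (carrier (obj V (X - {x})))" and dx: "d {x} \<in> fset (carrier (obj W (X - {x})))"
        using chainD[OF c T] chainD[OF d(1) T] X by (simp_all add: frag_over_iff)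
      show "frag_map V (X - {x}) X (c {x}) \<in> fset (carrier (obj V X)) \<and>
          frag_map W (X - {x}) X (d {x}) \<in> fset (carrier (obj W X)) \<and>
          \<phi> X (frag_eval (obj V X) (frag_map V (X - {x}) X (c {x}))) = frag_eval (obj W X) (frag_map W (X - {x}) X (d {x}))"
        using frag_map_evm[OF V X Diff_subset cx] frag_map_evm[OF W X Diff_subset dx] v[OF T] vc[OF T]
          fi_mapD(2)[OF phi f X inc_FI_mor[OF Diff_subset] vc[OF T]]
        by (simp add: c_def frag_eval(2)[OF fi_module_abelian[OF V f]])
    qed
    then show "z \<in> \<phi> X ` fi_img V J X"
      using c d(2) by (intro image_eqI[of _ _ "frag_eval (obj V X) (koszul_bd (frag_map V) X c {})"]) (auto simp: fi_img_def)
  qed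
qed

lemma module_hom_smult:
  assumes "Module.module R M" "c \<in> carrier R"
  shows "module_hom R M M (\<lambda>x. c \<odot>\<^bsub>M\<^esub> x)"
proof -
  interpret Module.module R M by fact
  show ?thesis
    using assms(2) by (auto simp: module_hom_def smult_r_distr smult_assoc1[symmetric] R.m_comm)
qed

lemma fi_img_submodule:
  assumes V: "fi_module R V" and X: "finite X"
  shows "submodule (fi_img V (whole_sub V) X) R (obj V X)"
proof -
  interpret Module.module R "obj V X"
    by (rule fi_moduleD(1)[OF V X])
  note T = fi_subsys_tot[OF V]
  have z: "\<zero>\<^bsub>obj V X\<^esub> \<in> fi_img V (whole_sub V) X"
  proof -
    have "chain (frag_over V (whole_sub V)) (Suc 0) X (\<lambda>_. 0)"
      using subfunctor_asubgrp[OF subfunctor_lift[OF V T]] by (auto intro: chainI asubgrp_zero)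
    moreover have "frag_eval (obj V X) (koszul_bd (frag_map V) X (\<lambda>_. 0) {}) = \<zero>\<^bsub>obj V X\<^esub>"
      by (simp add: koszul_bd_def additive.zero[OF poset_functor_additive[OF poset_functor_lin[OF V]]] frag_eval_zero[OF fi_module_abelian[OF V X]])
    ultimately show ?thesis
      unfolding fi_img_def by force
  qed
  have sub: "fi_img V (whole_sub V) X \<subseteq> carrier (obj V X)"
    using fi_img_closed[OF V T X] by (simp add: whole_sub_def)
  have neg: "\<ominus>\<^bsub>obj V X\<^esub> a \<in> fi_img V (whole_sub V) X" if "a \<in> fi_img V (whole_sub V) X" for a
    using fi_img_diff[OF V T X z that] that sub by (simp add: a_minus_def subset_iff)
  show ?thesis
  proof (rule submoduleI[OF sub z neg])
    fix a b assume ab: "a \<in> fi_img V (whole_sub V) X" "b \<in> fi_img V (whole_sub V) X"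
    then show "a \<oplus>\<^bsub>obj V X\<^esub> b \<in> fi_img V (whole_sub V) X"
      using fi_img_diff[OF V T X ab(1) neg[OF ab(2)]] sub by (auto simp: a_minus_def subset_iff)
  next
    fix r a assume r: "r \<in> carrier R" and a: "a \<in> fi_img V (whole_sub V) X"
    have fin: "finite Y" if "Y \<subseteq> X" for Y
      using that X finite_subset by blast
    \<comment> \<open>The ring is commutative, so multiplication by \<open>r\<close> is an
      endomorphism of the FI-module and preserves sums of images.\<close>
    have "(\<lambda>v. r \<odot>\<^bsub>obj V X\<^esub> v) ` fi_img V (whole_sub V) X \<subseteq> fi_img V (whole_sub V) X"
    proof (rule fi_img_image_subset[OF V V T T X, of "\<lambda>Y v. r \<odot>\<^bsub>obj V Y\<^esub> v"])
      show "module_hom R (obj V Y) (obj V Y) (\<lambda>v. r \<odot>\<^bsub>obj V Y\<^esub> v)" if "Y \<subseteq> X" for Y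
        by (rule module_hom_smult[OF fi_moduleD(1)[OF V fin[OF that]] r])
      show "(\<lambda>v. r \<odot>\<^bsub>obj V Z\<^esub> v) ` whole_sub V Z \<subseteq> whole_sub V Z" if "Z \<subseteq> X" for Z
        using module_homD(1)[OF module_hom_smult[OF fi_moduleD(1)[OF V fin[OF that]] r]] by (auto simp: whole_sub_def)
      show "r \<odot>\<^bsub>obj V X\<^esub> mor V Y X (inc Y) v = mor V Y X (inc Y) (r \<odot>\<^bsub>obj V Y\<^esub> v)"
        if "Y \<subseteq> X" "v \<in> carrier (obj V Y)" for Y v
        using module_homD(3)[OF fi_moduleD(2)[OF V fin[OF that(1)] X inc_FI_mor[OF that(1)]] r that(2)] by simp
    qed
    with a show "r \<odot>\<^bsub>obj V X\<^esub> a \<in> fi_img V (whole_sub V) X"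
      by blast
  qed
qed

lemma fi_img_singleton:
  assumes V: "fi_module R V" and X: "finite X" "x \<in> X" and v: "v \<in> carrier (obj V (X - {x}))"
  shows "mor V (X - {x}) X (inc (X - {x})) v \<in> fi_img V (whole_sub V) X"
proof -
  have fin: "finite (X - {x})"
    using X by simp
  let ?c = "\<lambda>T. if T = {x} then frag_of v else 0"
  have "chain (frag_over V (whole_sub V)) (Suc 0) X ?c"
    using v fin subfunctor_asubgrp[OF subfunctor_lift[OF V fi_subsys_tot[OF V]]]
    by (auto intro!: chainI simp: frag_over_tot_iff[OF V] asubgrp_zero)
  moreover have "koszul_bd (frag_map V) X ?c {} = frag_map V (X - {x}) X (frag_of v)"
  proof -
    have "koszul_bd (frag_map V) X ?c {} = (\<Sum>y\<in>X. if y = x then frag_map V (X - {x}) X (frag_of v) else 0)"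
      unfolding koszul_bd_empty
      by (rule sum.cong) (auto simp: additive.zero[OF poset_functor_additive[OF poset_functor_lin[OF V]]])
    then show ?thesis
      using X by simp
  qed
  moreover have "frag_eval (obj V X) (frag_map V (X - {x}) X (frag_of v)) = mor V (X - {x}) X (inc (X - {x})) v"
    using frag_map_evm(2)[OF V X(1) Diff_subset, of "frag_of v" "{x}"] v frag_eval(2)[OF fi_module_abelian[OF V fin] v] by simp
  ultimately show ?thesis
    unfolding fi_img_def by force
qed

text \<open>An injection from a smaller set misses some point \<open>x\<close> of \<open>X\<close>,
  so it factors through \<open>X - {x}\<close>; conversely the sets \<open>X - {x}\<close> are among
  the smaller ones. The sum of images is already a submodule, so taking the span adds
  nothing.\<close>

lemma fi_J_eq:
  assumes V: "fi_module R V" and X: "finite X"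
  shows "fi_J R V X = fi_img V (whole_sub V) X"
proof
  let ?S = "\<Union>{mor V Y X f ` carrier (obj V Y) | Y f. finite Y \<and> card Y < card X \<and> f \<in> FI_mor Y X}"
  have "?S \<subseteq> fi_img V (whole_sub V) X"
  proof clarify
    fix Y f v assume Y: "finite Y" "card Y < card X" "f \<in> FI_mor Y X" and v: "v \<in> carrier (obj V Y)"
    have f: "f \<in> Y \<rightarrow>\<^sub>E X" "inj_on f Y"
      using Y(3) by (auto simp: FI_mor_def)
    have "\<not> X \<subseteq> f ` Y"
      using surj_card_le[OF Y(1), of X f] Y(2) by auto
    then obtain x where x: "x \<in> X" "x \<notin> f ` Y"
      by blast
    then have g: "f \<in> FI_mor Y (X - {x})"
      using f by (auto simp: FI_mor_def PiE_iff)
    have fin: "finite (X - {x})"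
      using X by simp
    have "compose Y (inc (X - {x})) f = f"
      using g by (auto simp: FI_mor_def compose_def fun_eq_iff PiE_iff extensional_def)
    then have "mor V Y X f v = mor V (X - {x}) X (inc (X - {x})) (mor V Y (X - {x}) f v)"
      using fi_moduleD(4)[OF V Y(1) fin X g inc_FI_mor[OF Diff_subset] v] by simp
    moreover have "mor V Y (X - {x}) f v \<in> carrier (obj V (X - {x}))"
      by (rule module_homD(1)[OF fi_moduleD(2)[OF V Y(1) fin g] v])
    ultimately show "mor V Y X f v \<in> fi_img V (whole_sub V) X"
      using fi_img_singleton[OF V X x(1)] by simp
  qed
  then show "fi_J R V X \<subseteq> fi_img V (whole_sub V) X"
    unfolding fi_J_def module_span_def using fi_img_submodule[OF V X] by blast
  show "fi_img V (whole_sub V) X \<subseteq> fi_J R V X"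
    unfolding fi_J_def module_span_def
  proof (rule Inter_greatest)
    fix H assume "H \<in> {H. submodule H R (obj V X) \<and> ?S \<subseteq> H}"
    then have H: "submodule H R (obj V X)" "?S \<subseteq> H"
      by auto
    interpret Module.module R "obj V X"
      by (rule fi_moduleD(1)[OF V X])
    note ab = fi_module_abelian[OF V X]
    show "fi_img V (whole_sub V) X \<subseteq> H"
    proof
      fix z assume "z \<in> fi_img V (whole_sub V) X"
      then obtain c where c: "chain (frag_over V (whole_sub V)) (Suc 0) X c" "z = frag_eval (obj V X) (\<Sum>x\<in>X. frag_map V (X - {x}) X (c {x}))"
        by (auto simp: fi_img_def koszul_bd_empty)
      have summand: "frag_map V (X - {x}) X (c {x}) \<in> fset (carrier (obj V X)) \<and> frag_eval (obj V X) (frag_map V (X - {x}) X (c {x})) \<in> H"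
        if x: "x \<in> X" for x
      proof -
        have fin: "finite (X - {x})"
          using X by simp
        have cx: "c {x} \<in> fset (carrier (obj V (X - {x})))"
          using chainD[OF c(1), of "{x}"] x by (simp add: frag_over_tot_iff[OF V fin])
        have "card (X - {x}) < card X"
          using X x by (meson card_Diff1_less)
        then have "mor V (X - {x}) X (inc (X - {x})) (frag_eval (obj V (X - {x})) (c {x})) \<in> ?S"
          using fin inc_FI_mor[OF Diff_subset] frag_eval_closed[OF fi_module_abelian[OF V fin] cx] by blast
        then show ?thesis
          using H(2) frag_map_evm[OF V X Diff_subset cx] by auto
      qed
      have "sum (\<lambda>x. frag_map V (X - {x}) X (c {x})) A \<in> fset (carrier (obj V X)) \<and>
          frag_eval (obj V X) (sum (\<lambda>x. frag_map V (X - {x}) X (c {x})) A) \<in> H" if "A \<subseteq> X" for A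
        using finite_subset[OF that X] that
      proof (induct A rule: finite_induct)
        case empty
        show ?case
          using frag_eval_zero[OF ab] submoduleE[OF H(1)] subgroup.one_closed[OF submodule.axioms(1)[OF H(1)]] by simp
      next
        case (insert x A)
        have 1: "frag_map V (X - {x}) X (c {x}) \<in> fset (carrier (obj V X))" "frag_eval (obj V X) (frag_map V (X - {x}) X (c {x})) \<in> H"
          using summand insert.prems by auto
        have 2: "sum (\<lambda>x. frag_map V (X - {x}) X (c {x})) A \<in> fset (carrier (obj V X))"
          "frag_eval (obj V X) (sum (\<lambda>x. frag_map V (X - {x}) X (c {x})) A) \<in> H"
          using insert by auto
        show ?case
          using asubgrp_add[OF asubgrp_fset 1(1) 2(1)] submoduleE(5)[OF H(1) 1(2) 2(2)] insert.hyps
          by (simp add: frag_eval_add[OF ab 1(1) 2(1)])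
      qed
      then show "z \<in> H"
        using c(2) by auto
    qed
  qed
qed

lemma fi_koszul_zero_zero_iff:
  assumes V: "fi_module R V" and J: "fi_subsys V J" and K: "fi_subsys V K" and X: "finite X"
  shows "fi_koszul_zero V J K 0 X \<longleftrightarrow> (\<forall>v\<in>J X. \<exists>j\<in>fi_img V J X. v \<ominus>\<^bsub>obj V X\<^esub> j \<in> K X)"
proof -
  note ab = fi_module_abelian[OF V X]
  have bdc: "koszul_bd (frag_map V) X c {} \<in> fset (carrier (obj V X))" if "chain (frag_over V J) (Suc 0) X c" for c
    using koszul_bd_lift_fset[OF V J X that] by (simp add: frag_over_iff X)
  have eq: "u - koszul_bd (frag_map V) X c {} \<in> frag_over V K X \<longleftrightarrow> frag_eval (obj V X) u \<ominus>\<^bsub>obj V X\<^esub> frag_eval (obj V X) (koszul_bd (frag_map V) X c {}) \<in> K X"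
    if "chain (frag_over V J) (Suc 0) X c" "u \<in> fset (carrier (obj V X))" for u c
    using fset_diff[OF that(2) bdc[OF that(1)]] by (simp add: frag_over_iff X frag_eval_diff[OF ab that(2) bdc[OF that(1)]])
  show ?thesis
    unfolding fi_koszul_zero_def koszul_zero_zero_iff[OF X]
  proof
    assume R: "\<forall>u\<in>frag_over V J X. \<exists>c. chain (frag_over V J) (Suc 0) X c \<and> u - koszul_bd (frag_map V) X c {} \<in> frag_over V K X"
    show "\<forall>v\<in>J X. \<exists>j\<in>fi_img V J X. v \<ominus>\<^bsub>obj V X\<^esub> j \<in> K X"
    proof
      fix v assume v: "v \<in> J X"
      then have vc: "v \<in> carrier (obj V X)"
        using fi_subsysD(1)[OF J X] by auto
      then have "frag_of v \<in> frag_over V J X"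
        using v by (simp add: frag_over_iff X frag_eval(2)[OF ab])
      with R obtain c where c: "chain (frag_over V J) (Suc 0) X c" "frag_of v - koszul_bd (frag_map V) X c {} \<in> frag_over V K X"
        by blast
      then have "v \<ominus>\<^bsub>obj V X\<^esub> frag_eval (obj V X) (koszul_bd (frag_map V) X c {}) \<in> K X"
        using eq[OF c(1), of "frag_of v"] vc by (simp add: frag_eval(2)[OF ab])
      with c(1) show "\<exists>j\<in>fi_img V J X. v \<ominus>\<^bsub>obj V X\<^esub> j \<in> K X"
        unfolding fi_img_def by blast
    qed
  next
    assume R: "\<forall>v\<in>J X. \<exists>j\<in>fi_img V J X. v \<ominus>\<^bsub>obj V X\<^esub> j \<in> K X"
    show "\<forall>u\<in>frag_over V J X. \<exists>c. chain (frag_over V J) (Suc 0) X c \<and> u - koszul_bd (frag_map V) X c {} \<in> frag_over V K X"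
    proof
      fix u assume u: "u \<in> frag_over V J X"
      then have "frag_eval (obj V X) u \<in> J X"
        by (simp add: frag_over_iff X)
      with R obtain c where "chain (frag_over V J) (Suc 0) X c"
        "frag_eval (obj V X) u \<ominus>\<^bsub>obj V X\<^esub> frag_eval (obj V X) (koszul_bd (frag_map V) X c {}) \<in> K X"
        unfolding fi_img_def by blast
      then show "\<exists>c. chain (frag_over V J) (Suc 0) X c \<and> u - koszul_bd (frag_map V) X c {} \<in> frag_over V K X"
        using eq u by (auto simp: frag_over_iff X)
    qed
  qed
qed

lemma (in abelian_group) minus_eq_zero_iff:
  "x \<in> carrier G \<Longrightarrow> y \<in> carrier G \<Longrightarrow> x \<ominus> y = \<zero> \<longleftrightarrow> x = y"
  by (metis a_minus_def add.inv_closed minus_equality minus_minus r_neg)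

text \<open>H_1 of V modulo \<open>K\<close> is the kernel of H_0(K) -> H_0(V), as H_1(V) vanishes;
  in terms of elements this kernel is the part of \<open>K\<close> that lies in JV, modulo what
  \<open>K\<close> generates from smaller sets.\<close>

lemma fi_koszul_zero_one_iff:
  assumes V: "fi_module R V" and K: "fi_subsys V K" and X: "finite X"
    and acyc: "fi_koszul_zero V (whole_sub V) (zero_sub V) (Suc 0) X"
  shows "fi_koszul_zero V (whole_sub V) K (Suc 0) X \<longleftrightarrow> K X \<inter> fi_img V (whole_sub V) X \<subseteq> fi_img V K X"
proof -
  interpret Module.module R "obj V X"
    by (rule fi_moduleD(1)[OF V X])
  note ab = fi_module_abelian[OF V X] and T = fi_subsys_tot[OF V] and T0 = fi_subsys_triv[OF V]
  note pK = functor_pair_lift[OF V K] and p0 = functor_pair_lift[OF V T0]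
  have c0: "frag_over V (zero_sub V) Y \<subseteq> frag_over V K Y" for Y
    using fi_subsysD(2)[OF K] by (intro frag_over_mono) (auto simp: zero_sub_def)
  have bdT: "koszul_bd (frag_map V) X c {} \<in> fset (carrier (obj V X))" if "chain (frag_over V (whole_sub V)) (Suc 0) X c" for c
    using koszul_bd_lift_fset[OF V T X that] by (simp add: frag_over_iff X)
  have cT: "chain (frag_over V (whole_sub V)) (Suc 0) X c" if "chain (frag_over V K) (Suc 0) X c" for c
    using that functor_pairD(4)[OF pK] by (rule chain_mono)
  have eq: "koszul_bd (frag_map V) X c {} - koszul_bd (frag_map V) X d {} \<in> frag_over V (zero_sub V) X \<longleftrightarrow>
      frag_eval (obj V X) (koszul_bd (frag_map V) X c {}) = frag_eval (obj V X) (koszul_bd (frag_map V) X d {})"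
    if "chain (frag_over V (whole_sub V)) (Suc 0) X c" "chain (frag_over V K) (Suc 0) X d" for c d
    using fset_diff[OF bdT[OF that(1)] bdT[OF cT[OF that(2)]]]
    by (simp add: frag_over_iff X frag_eval_diff[OF ab bdT[OF that(1)] bdT[OF cT[OF that(2)]]] zero_sub_def
      minus_eq_zero_iff frag_eval_closed[OF ab bdT[OF that(1)]] frag_eval_closed[OF ab bdT[OF cT[OF that(2)]]])
  have "fi_koszul_zero V (whole_sub V) K (Suc 0) X \<longleftrightarrow>
     (\<forall>c. chain (frag_over V (whole_sub V)) (Suc 0) X c \<longrightarrow> koszul_bd (frag_map V) X c {} \<in> frag_over V K X \<longrightarrow>
        (\<exists>d. chain (frag_over V K) (Suc 0) X d \<and> koszul_bd (frag_map V) X c {} - koszul_bd (frag_map V) X d {} \<in> frag_over V (zero_sub V) X))"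
    unfolding fi_koszul_zero_def
    by (rule koszul_zero_one_iff[OF X functor_pairD(1-3)[OF pK] functor_pairD(3)[OF p0] c0 functor_pairD(4)[OF pK] acyc[unfolded fi_koszul_zero_def]])
  also have "\<dots> \<longleftrightarrow> (\<forall>c. chain (frag_over V (whole_sub V)) (Suc 0) X c \<longrightarrow> frag_eval (obj V X) (koszul_bd (frag_map V) X c {}) \<in> K X \<longrightarrow>
        (\<exists>d. chain (frag_over V K) (Suc 0) X d \<and> frag_eval (obj V X) (koszul_bd (frag_map V) X c {}) = frag_eval (obj V X) (koszul_bd (frag_map V) X d {})))"
  proof (intro all_cong1 imp_cong refl)
    fix c assume c: "chain (frag_over V (whole_sub V)) (Suc 0) X c"
    show "koszul_bd (frag_map V) X c {} \<in> frag_over V K X \<longleftrightarrow> frag_eval (obj V X) (koszul_bd (frag_map V) X c {}) \<in> K X"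
      using bdT[OF c] by (simp add: frag_over_iff X)
    show "(\<exists>d. chain (frag_over V K) (Suc 0) X d \<and> koszul_bd (frag_map V) X c {} - koszul_bd (frag_map V) X d {} \<in> frag_over V (zero_sub V) X) \<longleftrightarrow>
      (\<exists>d. chain (frag_over V K) (Suc 0) X d \<and> frag_eval (obj V X) (koszul_bd (frag_map V) X c {}) = frag_eval (obj V X) (koszul_bd (frag_map V) X d {}))"
      using eq[OF c] by blast
  qed
  also have "\<dots> \<longleftrightarrow> K X \<inter> fi_img V (whole_sub V) X \<subseteq> fi_img V K X"
    unfolding fi_img_def by blast
  finally show ?thesis .
qed

section \<open>Comparison with FI-homology\<close>

lemma a_rcosets_eq: "a_rcosets\<^bsub>M\<^esub> H = {H +>\<^bsub>M\<^esub> x | x. x \<in> carrier M}"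
  by (auto simp: A_RCOSETS_def')

lemma abelian_subgroup_submodule:
  assumes "Module.module R M" "submodule H R M"
  shows "abelian_subgroup H M"
proof -
  interpret Module.module R M by fact
  show ?thesis
    by (rule abelian_subgroupI3[OF additive_subgroupI[OF submodule.axioms(1)[OF assms(2)]] abelian_group_axioms])
qed

lemma comm_group_module_quot:
  assumes "abelian_subgroup H M"
  shows "comm_group (add_monoid (module_quot M H))"
proof -
  interpret comm_group "M A_Mod H"
    by (rule abelian_subgroup.a_factorgroup_is_comm_group[OF assms])
  have eq: "carrier (module_quot M H) = carrier (M A_Mod H)" "x \<oplus>\<^bsub>module_quot M H\<^esub> y = x \<otimes>\<^bsub>M A_Mod H\<^esub> y"
    "\<zero>\<^bsub>module_quot M H\<^esub> = \<one>\<^bsub>M A_Mod H\<^esub>" for x y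
    by (simp_all add: module_quot_def A_FactGroup_def')
  show ?thesis
  proof (rule comm_groupI, goal_cases)
    case (3 x y z)
    then show ?case using m_assoc[of x y z] by (simp add: eq)
  next
    case (4 x y)
    then show ?case using m_comm[of x y] by (simp add: eq)
  next
    case (6 x)
    then show ?case using l_inv_ex[of x] by (simp add: eq)
  qed (simp_all add: eq del: add_A_FactGroup)
qed

text \<open>\<open>fi_H\<close> forms cycles modulo boundaries by shrinking the carrier of the
  record. Cosets depend on the addition alone, so they are the same as in the full group.\<close>

lemma module_quot_restrict_trivial_iff:
  assumes G: "group (add_monoid C)" and B: "subgroup B (add_monoid C)" and Z: "\<zero>\<^bsub>C\<^esub> \<in> Z" "Z \<subseteq> carrier C"
  shows "carrier (module_quot (C\<lparr>carrier := Z\<rparr>) B) = {\<zero>\<^bsub>module_quot (C\<lparr>carrier := Z\<rparr>) B\<^esub>} \<longleftrightarrow> Z \<subseteq> B"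
proof -
  interpret group "add_monoid C" by fact
  have coset: "B +>\<^bsub>C\<lparr>carrier := Z\<rparr>\<^esub> z = B #>\<^bsub>add_monoid C\<^esub> z" for z
    by (simp add: a_r_coset_def r_coset_def)
  have 1: "B #>\<^bsub>add_monoid C\<^esub> z = B \<longleftrightarrow> z \<in> B" if "z \<in> Z" for z
    using coset_join1[of B z] coset_join2[of z B] B that Z(2) by auto
  have 2: "carrier (module_quot (C\<lparr>carrier := Z\<rparr>) B) = (\<lambda>z. B #>\<^bsub>add_monoid C\<^esub> z) ` Z"
    by (simp add: module_quot_def a_rcosets_eq coset Setcompr_eq_image)
  have 3: "\<zero>\<^bsub>module_quot (C\<lparr>carrier := Z\<rparr>) B\<^esub> = B"
    by (simp add: module_quot_def)
  have 4: "(\<lambda>z. B #>\<^bsub>add_monoid C\<^esub> z) ` Z = {B} \<longleftrightarrow> (\<forall>z\<in>Z. B #>\<^bsub>add_monoid C\<^esub> z = B)"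
    using Z(1) by blast
  show ?thesis
    unfolding 2 3 4 by (simp add: 1 subset_iff Ball_def)
qed

lemma fi_F_carrier: "carrier (obj (fi_F R P) X) = {fi_J R P X +>\<^bsub>obj P X\<^esub> x | x. x \<in> carrier (obj P X)}"
  by (simp add: fi_F_def fi_quot_def module_quot_def a_rcosets_eq)

lemma fi_F_zero: "\<zero>\<^bsub>obj (fi_F R P) X\<^esub> = fi_J R P X"
  by (simp add: fi_F_def fi_quot_def module_quot_def)

context
  fixes R :: "('k, 'r) ring_scheme" and P :: "('k, 'p) fi_mod" and X :: "nat set"
  assumes P: "fi_module R P" and X: "finite X"
begin

lemma fi_J_sub: "abelian_subgroup (fi_J R P X) (obj P X)"
  unfolding fi_J_eq[OF P X] by (rule abelian_subgroup_submodule[OF fi_moduleD(1)[OF P X] fi_img_submodule[OF P X]])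

lemma fi_F_group: "comm_group (add_monoid (obj (fi_F R P) X))"
  using comm_group_module_quot[OF fi_J_sub] by (simp add: fi_F_def fi_quot_def)

lemma fi_F_coset_eq:
  assumes "x \<in> carrier (obj P X)" "y \<in> carrier (obj P X)"
  shows "fi_J R P X +>\<^bsub>obj P X\<^esub> x = fi_J R P X +>\<^bsub>obj P X\<^esub> y \<longleftrightarrow> x \<ominus>\<^bsub>obj P X\<^esub> y \<in> fi_J R P X"
proof -
  interpret abelian_subgroup "fi_J R P X" "obj P X"
    by (rule fi_J_sub)
  show ?thesis
    using a_rcos_module[OF assms(2,1)] a_rcos_self[OF assms(1)] a_repr_independence[of x "fi_J R P X" y] assms a_subgroup
    by (metis a_minus_def)
qed

lemma fi_F_coset_zero:
  assumes "x \<in> carrier (obj P X)"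
  shows "fi_J R P X +>\<^bsub>obj P X\<^esub> x = fi_J R P X \<longleftrightarrow> x \<in> fi_J R P X"
proof -
  interpret abelian_subgroup "fi_J R P X" "obj P X"
    by (rule fi_J_sub)
  show ?thesis
    using a_rcos_const a_rcos_self[OF assms] by blast
qed

end

lemma fi_J_image:
  assumes P: "fi_module R P" and Q: "fi_module R Q" and phi: "fi_map R P Q \<phi>" and X: "finite X"
  shows "\<phi> X ` fi_J R P X \<subseteq> fi_J R Q X"
  unfolding fi_J_eq[OF P X] fi_J_eq[OF Q X]
proof (rule fi_img_image_subset[OF P Q fi_subsys_tot[OF P] fi_subsys_tot[OF Q] X])
  have fin: "finite Y" if "Y \<subseteq> X" for Y
    using that X finite_subset by blast
  show "module_hom R (obj P Y) (obj Q Y) (\<phi> Y)" if "Y \<subseteq> X" for Y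
    by (rule fi_mapD(1)[OF phi fin[OF that]])
  then show "\<phi> Z ` whole_sub P Z \<subseteq> whole_sub Q Z" if "Z \<subseteq> X" for Z
    using module_homD(1)[OF fi_mapD(1)[OF phi fin[OF that]]] by (auto simp: whole_sub_def)
  show "\<phi> X (mor P Y X (inc Y) v) = mor Q Y X (inc Y) (\<phi> Y v)" if "Y \<subseteq> X" "v \<in> carrier (obj P Y)" for Y v
    by (rule fi_mapD(2)[OF phi fin[OF that(1)] X inc_FI_mor[OF that(1)] that(2)])
qed

text \<open>\<open>fi_F_map\<close> takes a union over all representatives of a coset; as
  \<open>\<phi>\<close> sends JP into JQ, they all give the same coset.\<close>

lemma fi_F_map_coset:
  assumes P: "fi_module R P" and Q: "fi_module R Q" and phi: "fi_map R P Q \<phi>" and X: "finite X"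
    and x: "x \<in> carrier (obj P X)"
  shows "fi_F_map R Q \<phi> X (fi_J R P X +>\<^bsub>obj P X\<^esub> x) = fi_J R Q X +>\<^bsub>obj Q X\<^esub> \<phi> X x"
proof -
  interpret PJ: abelian_subgroup "fi_J R P X" "obj P X"
    by (rule fi_J_sub[OF P X])
  interpret QJ: abelian_subgroup "fi_J R Q X" "obj Q X"
    by (rule fi_J_sub[OF Q X])
  note hom = fi_mapD(1)[OF phi X]
  have eq: "fi_J R Q X +>\<^bsub>obj Q X\<^esub> \<phi> X y = fi_J R Q X +>\<^bsub>obj Q X\<^esub> \<phi> X x"
    if y: "y \<in> fi_J R P X +>\<^bsub>obj P X\<^esub> x" for y
  proof -
    have yc: "y \<in> carrier (obj P X)"
      by (rule PJ.a_elemrcos_carrier[OF x y])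
    have "y \<ominus>\<^bsub>obj P X\<^esub> x \<in> fi_J R P X"
      using PJ.a_rcos_module_imp[OF x y] by (simp add: a_minus_def)
    then have "\<phi> X (y \<ominus>\<^bsub>obj P X\<^esub> x) \<in> fi_J R Q X"
      using fi_J_image[OF P Q phi X] by blast
    then show ?thesis
      by (subst fi_F_coset_eq[OF Q X])
        (use module_homD(1)[OF hom] x yc module_hom_minus[OF fi_moduleD(1)[OF P X] fi_moduleD(1)[OF Q X] hom yc x] in auto)
  qed
  have "x \<in> fi_J R P X +>\<^bsub>obj P X\<^esub> x"
    by (rule PJ.a_rcos_self[OF x])
  then show ?thesis
    unfolding fi_F_map_def using eq by blast
qed

lemma fi_F_map_group_hom:
  assumes P: "fi_module R P" and Q: "fi_module R Q" and phi: "fi_map R P Q \<phi>" and X: "finite X"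
  shows "group_hom (add_monoid (obj (fi_F R P) X)) (add_monoid (obj (fi_F R Q) X)) (fi_F_map R Q \<phi> X)"
proof -
  interpret PJ: abelian_subgroup "fi_J R P X" "obj P X"
    by (rule fi_J_sub[OF P X])
  interpret QJ: abelian_subgroup "fi_J R Q X" "obj Q X"
    by (rule fi_J_sub[OF Q X])
  note hom = fi_mapD(1)[OF phi X]
  have "fi_F_map R Q \<phi> X \<in> hom (add_monoid (obj (fi_F R P) X)) (add_monoid (obj (fi_F R Q) X))"
  proof (rule homI)
    fix A assume "A \<in> carrier (add_monoid (obj (fi_F R P) X))"
    then obtain x where "A = fi_J R P X +>\<^bsub>obj P X\<^esub> x" "x \<in> carrier (obj P X)"
      by (auto simp: fi_F_carrier)
    then show "fi_F_map R Q \<phi> X A \<in> carrier (add_monoid (obj (fi_F R Q) X))"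
      using module_homD(1)[OF hom] by (auto simp: fi_F_carrier fi_F_map_coset[OF assms])
  next
    fix A B assume "A \<in> carrier (add_monoid (obj (fi_F R P) X))" "B \<in> carrier (add_monoid (obj (fi_F R P) X))"
    then obtain x y where "A = fi_J R P X +>\<^bsub>obj P X\<^esub> x" "x \<in> carrier (obj P X)"
      "B = fi_J R P X +>\<^bsub>obj P X\<^esub> y" "y \<in> carrier (obj P X)"
      by (auto simp: fi_F_carrier)
    then show "fi_F_map R Q \<phi> X (A \<otimes>\<^bsub>add_monoid (obj (fi_F R P) X)\<^esub> B) =
        fi_F_map R Q \<phi> X A \<otimes>\<^bsub>add_monoid (obj (fi_F R Q) X)\<^esub> fi_F_map R Q \<phi> X B"
      using module_homD[OF hom]
      by (simp add: fi_F_map_coset[OF assms] PJ.a_rcos_sum QJ.a_rcos_sum fi_F_def fi_quot_def module_quot_def)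
  qed
  then show ?thesis
    using fi_F_group[OF P X] fi_F_group[OF Q X]
    by (simp add: group_hom_def group_hom_axioms_def comm_group_def)
qed

lemma fi_im_F_map:
  assumes P: "fi_module R P" and Q: "fi_module R Q" and phi: "fi_map R P Q \<phi>" and X: "finite X"
  shows "fi_im (fi_F R P) (fi_F_map R Q \<phi>) X = {fi_J R Q X +>\<^bsub>obj Q X\<^esub> \<phi> X y | y. y \<in> carrier (obj P X)}"
    and "subgroup (fi_im (fi_F R P) (fi_F_map R Q \<phi>) X) (add_monoid (obj (fi_F R Q) X))"
  using fi_F_map_coset[OF assms] group_hom.img_is_subgroup[OF fi_F_map_group_hom[OF assms]]
  by (force simp: fi_im_def fi_F_carrier, simp add: fi_im_def)

lemma fi_subsys_image:
  assumes "fi_module R W" "fi_module R W'" "fi_map R W W' \<phi>"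
  shows "fi_subsys W' (\<lambda>X. \<phi> X ` carrier (obj W X))"
  unfolding fi_subsys_def
proof (intro allI impI conjI ballI)
  fix X :: "nat set" assume X: "finite X"
  note hom = fi_mapD(1)[OF assms(3) X]
  interpret W: Module.module R "obj W X"
    by (rule fi_moduleD(1)[OF assms(1) X])
  show "\<phi> X ` carrier (obj W X) \<subseteq> carrier (obj W' X)"
    using module_homD(1)[OF hom] by auto
  show "\<zero>\<^bsub>obj W' X\<^esub> \<in> \<phi> X ` carrier (obj W X)"
    using module_hom_zero[OF fi_moduleD(1)[OF assms(1) X] fi_moduleD(1)[OF assms(2) X] hom]
    by (metis W.zero_closed image_eqI)
  show "x \<ominus>\<^bsub>obj W' X\<^esub> y \<in> \<phi> X ` carrier (obj W X)"
    if "x \<in> \<phi> X ` carrier (obj W X)" "y \<in> \<phi> X ` carrier (obj W X)" for x y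
    using module_hom_minus[OF fi_moduleD(1)[OF assms(1) X] fi_moduleD(1)[OF assms(2) X] hom, symmetric] that by auto
  show "mor W' X Y f x \<in> \<phi> Y ` carrier (obj W Y)"
    if "finite Y" "f \<in> FI_mor X Y" "x \<in> \<phi> X ` carrier (obj W X)" for Y f x
    using fi_mapD(2)[OF assms(3) X that(1,2), symmetric] that(3)
      module_homD(1)[OF fi_moduleD(2)[OF assms(1) X that(1,2)]] by auto
qed

section \<open>Dimension shifting along a projective resolution\<close>

context
  fixes R :: "('k, 'r) ring_scheme" and V :: "('k, 'a) fi_mod"
    and P :: "nat \<Rightarrow> ('k, ('k, 'a) fi_univ) fi_mod" and D and \<epsilon>
  assumes V: "fi_module R V" and res: "fi_projective_resolution R V P D \<epsilon>" and PD: "fi_resolution R V = (P, D)"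
    and acyc: "\<And>n a X. finite X \<Longrightarrow> fi_koszul_zero (P n) (whole_sub (P n)) (zero_sub (P n)) (Suc a) X"
begin

lemma resD:
  shows "fi_module R (P n)" and "fi_map R (P (Suc n)) (P n) (D n)"
    and "fi_map R (P 0) V \<epsilon>"
    and "finite X \<Longrightarrow> \<epsilon> X ` carrier (obj (P 0) X) = carrier (obj V X)"
    and "finite X \<Longrightarrow> x \<in> carrier (obj (P 0) X) \<Longrightarrow> \<epsilon> X x = \<zero>\<^bsub>obj V X\<^esub> \<longleftrightarrow> x \<in> D 0 X ` carrier (obj (P (Suc 0)) X)"
    and "finite X \<Longrightarrow> x \<in> carrier (obj (P (Suc n)) X) \<Longrightarrow>
      D n X x = \<zero>\<^bsub>obj (P n) X\<^esub> \<longleftrightarrow> x \<in> D (Suc n) X ` carrier (obj (P (Suc (Suc n))) X)"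
proof -
  show "fi_module R (P n)" "fi_map R (P (Suc n)) (P n) (D n)" "fi_map R (P 0) V \<epsilon>"
    using res by (simp_all add: fi_projective_resolution_def fi_projective_def)
  show "\<epsilon> X ` carrier (obj (P 0) X) = carrier (obj V X)" if "finite X"
    using res that by (simp add: fi_projective_resolution_def fi_surj_def fi_im_def)
  show "\<epsilon> X x = \<zero>\<^bsub>obj V X\<^esub> \<longleftrightarrow> x \<in> D 0 X ` carrier (obj (P (Suc 0)) X)"
    if "finite X" "x \<in> carrier (obj (P 0) X)"
  proof -
    have "D 0 X ` carrier (obj (P (Suc 0)) X) = {x \<in> carrier (obj (P 0) X). \<epsilon> X x = \<zero>\<^bsub>obj V X\<^esub>}"
      using res that by (simp add: fi_projective_resolution_def fi_exact_def fi_im_def fi_ker_def a_kernel_def')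
    then show ?thesis
      using that by blast
  qed
  show "D n X x = \<zero>\<^bsub>obj (P n) X\<^esub> \<longleftrightarrow> x \<in> D (Suc n) X ` carrier (obj (P (Suc (Suc n))) X)"
    if "finite X" "x \<in> carrier (obj (P (Suc n)) X)"
  proof -
    have "D (Suc n) X ` carrier (obj (P (Suc (Suc n))) X) = {x \<in> carrier (obj (P (Suc n)) X). D n X x = \<zero>\<^bsub>obj (P n) X\<^esub>}"
      using res that by (simp add: fi_projective_resolution_def fi_exact_def fi_im_def fi_ker_def a_kernel_def')
    then show ?thesis
      using that by blast
  qed
qed

text \<open>Exactness cuts the resolution into short pieces: \<open>P 0\<close> modulo
  \<open>syzygy 0\<close> is V, and \<open>P (Suc n)\<close> modulo \<open>syzygy (Suc n)\<close> is
  \<open>syzygy n\<close>.\<close>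

definition syzygy :: "nat \<Rightarrow> nat set \<Rightarrow> ('k, 'a) fi_univ set" where
  "syzygy n X = D n X ` carrier (obj (P (Suc n)) X)"

lemma syzygy_subset: "finite X \<Longrightarrow> syzygy n X \<subseteq> carrier (obj (P n) X)"
  using module_homD(1)[OF fi_mapD(1)[OF resD(2)]] by (auto simp: syzygy_def)

lemma fi_subsys_syz: "fi_subsys (P n) (syzygy n)"
  using fi_subsys_image[OF resD(1) resD(1) resD(2)] by (simp add: syzygy_def[abs_def])

text \<open>H_{b+2} of \<open>P n\<close> modulo \<open>syzygy n\<close> vanishes together with
  H_{b+1} of \<open>syzygy n\<close>, by the exact sequence and the acyclicity of
  \<open>P n\<close>; and \<open>syzygy n\<close> is the next quotient in the resolution.\<close>

lemma fi_koszul_zero_shift: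
  assumes X: "finite X"
  shows "fi_koszul_zero (P n) (whole_sub (P n)) (syzygy n) (Suc (Suc b)) X \<longleftrightarrow> fi_koszul_zero (P (Suc n)) (whole_sub (P (Suc n))) (syzygy (Suc n)) (Suc b) X"
proof -
  note Pn = resD(1)[of n] and S = fi_subsys_syz[of n]
  note p = functor_pair_lift[OF Pn S] and p0 = functor_pair_lift[OF Pn fi_subsys_triv[OF Pn]]
  have c0: "frag_over (P n) (zero_sub (P n)) Y \<subseteq> frag_over (P n) (syzygy n) Y" for Y
    using fi_subsysD(2)[OF S] by (intro frag_over_mono) (auto simp: zero_sub_def)
  have "fi_koszul_zero (P n) (whole_sub (P n)) (syzygy n) (Suc (Suc b)) X \<longleftrightarrow> fi_koszul_zero (P n) (syzygy n) (zero_sub (P n)) (Suc b) X"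
    using koszul_zero_les2[OF X functor_pairD(1-3)[OF p] functor_pairD(3)[OF p0] c0 functor_pairD(4)[OF p] acyc[OF X, unfolded fi_koszul_zero_def]]
      koszul_zero_les3[OF X functor_pairD(1-3)[OF p] functor_pairD(3)[OF p0] c0 functor_pairD(4)[OF p] acyc[OF X, unfolded fi_koszul_zero_def]]
    unfolding fi_koszul_zero_def by blast
  also have "\<dots> \<longleftrightarrow> fi_koszul_zero (P (Suc n)) (whole_sub (P (Suc n))) (syzygy (Suc n)) (Suc b) X"
  proof (rule fi_koszul_zero_map[OF resD(1) Pn resD(2) fi_subsys_tot[OF resD(1)] S X, symmetric])
    fix Z :: "nat set" assume Z: "finite Z"
    show "D n Z ` whole_sub (P (Suc n)) Z = syzygy n Z"
      by (simp add: syzygy_def whole_sub_def)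
    show "D n Z v \<in> zero_sub (P n) Z \<longleftrightarrow> v \<in> syzygy (Suc n) Z" if "v \<in> whole_sub (P (Suc n)) Z" for v
      using resD(6)[OF Z, of v n] that by (simp add: syzygy_def whole_sub_def zero_sub_def)
    show "syzygy (Suc n) Z \<subseteq> whole_sub (P (Suc n)) Z"
      using syzygy_subset[OF Z] by (simp add: whole_sub_def)
    show "zero_sub (P n) Z \<subseteq> syzygy n Z"
      using fi_subsysD(2)[OF S Z] by (simp add: zero_sub_def)
  qed
  finally show ?thesis .
qed

lemma fi_koszul_zero_first:
  assumes X: "finite X"
  shows "fi_koszul_zero V (whole_sub V) (zero_sub V) a X \<longleftrightarrow> fi_koszul_zero (P 0) (whole_sub (P 0)) (syzygy 0) a X"
proof (rule fi_koszul_zero_map[OF resD(1) V resD(3) fi_subsys_tot[OF resD(1)] fi_subsys_tot[OF V] X, symmetric])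
  fix Z :: "nat set" assume Z: "finite Z"
  show "\<epsilon> Z ` whole_sub (P 0) Z = whole_sub V Z"
    using resD(4)[OF Z] by (simp add: whole_sub_def)
  show "\<epsilon> Z v \<in> zero_sub V Z \<longleftrightarrow> v \<in> syzygy 0 Z" if "v \<in> whole_sub (P 0) Z" for v
    using resD(5)[OF Z, of v] that by (simp add: syzygy_def whole_sub_def zero_sub_def)
  show "syzygy 0 Z \<subseteq> whole_sub (P 0) Z"
    using syzygy_subset[OF Z] by (simp add: whole_sub_def)
  show "zero_sub V Z \<subseteq> whole_sub V Z"
    using fi_subsysD(2)[OF fi_subsys_tot[OF V] Z] by (simp add: zero_sub_def)
qed

text \<open>Shifting \<open>a\<close> times reduces to H_1 of \<open>P a\<close> modulo
  \<open>syzygy a\<close>, which is a kernel on H_0 as \<open>P a\<close> is acyclic. What the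
  syzygy generates from smaller sets is the image of J of the next term.\<close>

lemma fi_koszul_zero_syzygy:
  assumes X: "finite X"
  shows "fi_koszul_zero V (whole_sub V) (zero_sub V) (Suc a) X \<longleftrightarrow> syzygy a X \<inter> fi_J R (P a) X \<subseteq> D a X ` fi_J R (P (Suc a)) X"
proof -
  have "fi_koszul_zero (P n) (whole_sub (P n)) (syzygy n) (Suc b) X \<longleftrightarrow> fi_koszul_zero (P (n + b)) (whole_sub (P (n + b))) (syzygy (n + b)) (Suc 0) X" for n b
    by (induct b arbitrary: n) (simp_all add: fi_koszul_zero_shift[OF X])
  from this[of 0 a] have "fi_koszul_zero V (whole_sub V) (zero_sub V) (Suc a) X \<longleftrightarrow> fi_koszul_zero (P a) (whole_sub (P a)) (syzygy a) (Suc 0) X"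
    by (simp add: fi_koszul_zero_first[OF X])
  also have "\<dots> \<longleftrightarrow> syzygy a X \<inter> fi_img (P a) (whole_sub (P a)) X \<subseteq> fi_img (P a) (syzygy a) X"
    by (rule fi_koszul_zero_one_iff[OF resD(1) fi_subsys_syz X acyc[OF X]])
  also have "fi_img (P a) (syzygy a) X = D a X ` fi_img (P (Suc a)) (whole_sub (P (Suc a))) X"
    by (rule fi_img_image[OF resD(1) resD(1) fi_subsys_tot[OF resD(1)] fi_subsys_syz X resD(2), symmetric]) (simp add: syzygy_def whole_sub_def)
  finally show ?thesis
    by (simp add: fi_J_eq[OF resD(1) X])
qed

lemma fi_H_trivial_iff_subset:
  fixes Z :: "nat set \<Rightarrow> ('k, 'a) fi_univ set set"
  assumes X: "finite X" and Z: "Z = (case a of 0 \<Rightarrow> (\<lambda>X. carrier (obj (fi_F R (P 0)) X))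
      | Suc b \<Rightarrow> fi_ker (fi_F R (P (Suc b))) (fi_F R (P b)) (fi_F_map R (P b) (D b)))"
  shows "carrier (obj (fi_H R a V) X) = {\<zero>\<^bsub>obj (fi_H R a V) X\<^esub>} \<longleftrightarrow>
    Z X \<subseteq> fi_im (fi_F R (P (Suc a))) (fi_F_map R (P a) (D a)) X"
proof -
  let ?C = "obj (fi_F R (P a)) X" and ?B = "fi_im (fi_F R (P (Suc a))) (fi_F_map R (P a) (D a)) X"
  have "obj (fi_H R a V) X = module_quot (?C\<lparr>carrier := Z X\<rparr>) ?B"
    by (simp add: fi_H_def PD Z fi_quot_def fi_sub_def Let_def)
  moreover have "Z X \<subseteq> carrier ?C"
    by (cases a) (auto simp: Z fi_ker_def a_kernel_def')
  moreover have "\<zero>\<^bsub>?C\<^esub> \<in> Z X"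
  proof (cases a)
    case 0
    then show ?thesis
      using comm_group.axioms(2)[OF fi_F_group[OF resD(1) X], of 0] group.is_monoid monoid.one_closed
      by (fastforce simp: Z)
  next
    case (Suc b)
    note gh = fi_F_map_group_hom[OF resD(1) resD(1) resD(2) X, of b]
    show ?thesis
      using group_hom.hom_one[OF gh] monoid.one_closed[OF group.is_monoid[OF group_hom.axioms(1)[OF gh]]]
      by (simp add: Z Suc fi_ker_def a_kernel_def')
  qed
  ultimately show ?thesis
    using module_quot_restrict_trivial_iff[OF comm_group.axioms(2)[OF fi_F_group[OF resD(1) X]] fi_im_F_map(2)[OF resD(1) resD(1) resD(2) X]]
    by simp
qed

text \<open>A cycle is the class of an \<open>x\<close> whose image under \<open>D a\<close> lies in
  J of \<open>P a\<close>, and it is a boundary when \<open>x\<close> is in the image of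
  \<open>D (Suc a)\<close> up to J. As that image is the kernel of \<open>D a\<close>, both
  conditions can be read off after applying \<open>D a\<close>.\<close>

lemma fi_H_Suc_trivial_iff:
  assumes X: "finite X"
  shows "carrier (obj (fi_H R (Suc a) V) X) = {\<zero>\<^bsub>obj (fi_H R (Suc a) V) X\<^esub>} \<longleftrightarrow> fi_koszul_zero V (whole_sub V) (zero_sub V) (Suc a) X"
proof -
  let ?P = "obj (P (Suc a)) X" and ?J = "fi_J R (P (Suc a)) X" and ?K = "fi_J R (P a) X"
  note homa = fi_mapD(1)[OF resD(2)[of a] X] and homS = fi_mapD(1)[OF resD(2)[of "Suc a"] X]
  note mod = fi_moduleD(1)[OF resD(1) X]
  interpret S: Module.module R ?P by (rule mod)
  interpret A: Module.module R "obj (P a) X" by (rule mod)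
  have Jc: "?J \<subseteq> carrier ?P"
    using abelian_subgroup.axioms(1)[OF fi_J_sub[OF resD(1) X]] by (rule additive_subgroup.a_subset)
  have ker: "(A \<in> fi_ker (fi_F R (P (Suc a))) (fi_F R (P a)) (fi_F_map R (P a) (D a)) X) \<longleftrightarrow>
      (\<exists>x\<in>carrier ?P. A = ?J +>\<^bsub>?P\<^esub> x \<and> D a X x \<in> ?K)" for A
    using fi_F_map_coset[OF resD(1) resD(1) resD(2) X, of _ a] fi_F_coset_zero[OF resD(1) X, of _ a]
      module_homD(1)[OF homa]
    by (auto simp: fi_ker_def a_kernel_def' fi_F_carrier fi_F_zero)
  have im: "(?J +>\<^bsub>?P\<^esub> x \<in> fi_im (fi_F R (P (Suc (Suc a)))) (fi_F_map R (P (Suc a)) (D (Suc a))) X) \<longleftrightarrow>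
      (\<exists>y\<in>carrier (obj (P (Suc (Suc a))) X). x \<ominus>\<^bsub>?P\<^esub> D (Suc a) X y \<in> ?J)" if "x \<in> carrier ?P" for x
    using fi_F_coset_eq[OF resD(1) X that] module_homD(1)[OF homS]
    by (auto simp: fi_im_F_map(1)[OF resD(1) resD(1) resD(2) X])
  have "carrier (obj (fi_H R (Suc a) V) X) = {\<zero>\<^bsub>obj (fi_H R (Suc a) V) X\<^esub>} \<longleftrightarrow>
      (\<forall>x\<in>carrier ?P. D a X x \<in> ?K \<longrightarrow> (\<exists>y\<in>carrier (obj (P (Suc (Suc a))) X). x \<ominus>\<^bsub>?P\<^esub> D (Suc a) X y \<in> ?J))"
    unfolding fi_H_trivial_iff_subset[OF X refl] subset_iff using ker im by auto
  also have "\<dots> \<longleftrightarrow> syzygy a X \<inter> ?K \<subseteq> D a X ` ?J"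
  proof
    assume L: "\<forall>x\<in>carrier ?P. D a X x \<in> ?K \<longrightarrow> (\<exists>y\<in>carrier (obj (P (Suc (Suc a))) X). x \<ominus>\<^bsub>?P\<^esub> D (Suc a) X y \<in> ?J)"
    show "syzygy a X \<inter> ?K \<subseteq> D a X ` ?J"
    proof
      fix z assume "z \<in> syzygy a X \<inter> ?K"
      then obtain x where x: "z = D a X x" "x \<in> carrier ?P" "D a X x \<in> ?K"
        by (auto simp: syzygy_def)
      with L obtain y where y: "y \<in> carrier (obj (P (Suc (Suc a))) X)" "x \<ominus>\<^bsub>?P\<^esub> D (Suc a) X y \<in> ?J"
        by blast
      have Dy: "D (Suc a) X y \<in> carrier ?P"
        by (rule module_homD(1)[OF homS y(1)])
      have "D a X (D (Suc a) X y) = \<zero>\<^bsub>obj (P a) X\<^esub>"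
        using resD(6)[OF X Dy] y(1) by blast
      then have "D a X (x \<ominus>\<^bsub>?P\<^esub> D (Suc a) X y) = z"
        using module_hom_minus[OF mod mod homa x(2) Dy] x module_homD(1)[OF homa x(2)] by (simp add: a_minus_def)
      with y(2) show "z \<in> D a X ` ?J"
        by blast
    qed
  next
    assume R: "syzygy a X \<inter> ?K \<subseteq> D a X ` ?J"
    show "\<forall>x\<in>carrier ?P. D a X x \<in> ?K \<longrightarrow> (\<exists>y\<in>carrier (obj (P (Suc (Suc a))) X). x \<ominus>\<^bsub>?P\<^esub> D (Suc a) X y \<in> ?J)"
    proof (intro ballI impI)
      fix x assume x: "x \<in> carrier ?P" "D a X x \<in> ?K"
      then have "D a X x \<in> syzygy a X \<inter> ?K"
        by (auto simp: syzygy_def)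
      then obtain w where w: "w \<in> ?J" "D a X x = D a X w"
        using R by blast
      have wc: "w \<in> carrier ?P"
        using w Jc by auto
      have "D a X (x \<ominus>\<^bsub>?P\<^esub> w) = \<zero>\<^bsub>obj (P a) X\<^esub>"
        using module_hom_minus[OF mod mod homa x(1) wc] w module_homD(1)[OF homa wc] by (simp add: a_minus_def A.r_neg)
      moreover have "x \<ominus>\<^bsub>?P\<^esub> w \<in> carrier ?P"
        using x wc by simp
      ultimately obtain y where y: "y \<in> carrier (obj (P (Suc (Suc a))) X)" "x \<ominus>\<^bsub>?P\<^esub> w = D (Suc a) X y"
        using resD(6)[OF X, of "x \<ominus>\<^bsub>?P\<^esub> w" a] by auto
      have "x \<ominus>\<^bsub>?P\<^esub> (x \<ominus>\<^bsub>?P\<^esub> w) = w"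
        using x(1) wc by (simp add: a_minus_def S.minus_add S.r_neg S.a_assoc[symmetric])
      then show "\<exists>y\<in>carrier (obj (P (Suc (Suc a))) X). x \<ominus>\<^bsub>?P\<^esub> D (Suc a) X y \<in> ?J"
        using y w by auto
    qed
  qed
  also have "\<dots> \<longleftrightarrow> fi_koszul_zero V (whole_sub V) (zero_sub V) (Suc a) X"
    by (rule fi_koszul_zero_syzygy[OF X, symmetric])
  finally show ?thesis .
qed

text \<open>Both sides say that, at \<open>X\<close>, \<open>P 0\<close> is the sum of its J and of
  \<open>syzygy 0\<close>; they differ in which of the two summands is subtracted.\<close>

lemma fi_H_0_trivial_iff:
  assumes X: "finite X"
  shows "carrier (obj (fi_H R 0 V) X) = {\<zero>\<^bsub>obj (fi_H R 0 V) X\<^esub>} \<longleftrightarrow> fi_koszul_zero V (whole_sub V) (zero_sub V) 0 X"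
proof -
  let ?P = "obj (P 0) X" and ?J = "fi_J R (P 0) X"
  note hom = fi_mapD(1)[OF resD(2)[of 0] X]
  interpret S: Module.module R ?P by (rule fi_moduleD(1)[OF resD(1) X])
  have Jc: "?J \<subseteq> carrier ?P"
    using abelian_subgroup.axioms(1)[OF fi_J_sub[OF resD(1) X]] by (rule additive_subgroup.a_subset)
  have flip: "x \<ominus>\<^bsub>?P\<^esub> (x \<ominus>\<^bsub>?P\<^esub> w) = w" if "x \<in> carrier ?P" "w \<in> carrier ?P" for x w
    using that by (simp add: a_minus_def S.minus_add S.r_neg S.a_assoc[symmetric])
  have im: "(?J +>\<^bsub>?P\<^esub> x \<in> fi_im (fi_F R (P (Suc 0))) (fi_F_map R (P 0) (D 0)) X) \<longleftrightarrow>
      (\<exists>y\<in>syzygy 0 X. x \<ominus>\<^bsub>?P\<^esub> y \<in> ?J)" if "x \<in> carrier ?P" for x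
    using fi_F_coset_eq[OF resD(1) X that] module_homD(1)[OF hom]
    by (auto simp: fi_im_F_map(1)[OF resD(1) resD(1) resD(2) X] syzygy_def)
  have "carrier (obj (fi_H R 0 V) X) = {\<zero>\<^bsub>obj (fi_H R 0 V) X\<^esub>} \<longleftrightarrow>
      (\<forall>x\<in>carrier ?P. \<exists>y\<in>syzygy 0 X. x \<ominus>\<^bsub>?P\<^esub> y \<in> ?J)"
    unfolding fi_H_trivial_iff_subset[OF X refl] by (simp add: fi_F_carrier Setcompr_eq_image image_subset_iff im)
  also have "\<dots> \<longleftrightarrow> (\<forall>x\<in>carrier ?P. \<exists>j\<in>?J. x \<ominus>\<^bsub>?P\<^esub> j \<in> syzygy 0 X)"
  proof (intro ball_cong refl)
    fix x assume x: "x \<in> carrier ?P"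
    show "(\<exists>y\<in>syzygy 0 X. x \<ominus>\<^bsub>?P\<^esub> y \<in> ?J) \<longleftrightarrow> (\<exists>j\<in>?J. x \<ominus>\<^bsub>?P\<^esub> j \<in> syzygy 0 X)"
    proof
      assume "\<exists>y\<in>syzygy 0 X. x \<ominus>\<^bsub>?P\<^esub> y \<in> ?J"
      then obtain y where "y \<in> syzygy 0 X" "x \<ominus>\<^bsub>?P\<^esub> y \<in> ?J" by blast
      then show "\<exists>j\<in>?J. x \<ominus>\<^bsub>?P\<^esub> j \<in> syzygy 0 X"
        using flip[OF x, of y] syzygy_subset[OF X, of 0] by (intro bexI[of _ "x \<ominus>\<^bsub>?P\<^esub> y"]) auto
    next
      assume "\<exists>j\<in>?J. x \<ominus>\<^bsub>?P\<^esub> j \<in> syzygy 0 X"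
      then obtain y where "y \<in> ?J" "x \<ominus>\<^bsub>?P\<^esub> y \<in> syzygy 0 X" by blast
      then show "\<exists>y\<in>syzygy 0 X. x \<ominus>\<^bsub>?P\<^esub> y \<in> ?J"
        using flip[OF x, of y] Jc by (intro bexI[of _ "x \<ominus>\<^bsub>?P\<^esub> y"]) auto
    qed
  qed
  also have "\<dots> \<longleftrightarrow> fi_koszul_zero (P 0) (whole_sub (P 0)) (syzygy 0) 0 X"
    by (simp add: fi_koszul_zero_zero_iff[OF resD(1) fi_subsys_tot[OF resD(1)] fi_subsys_syz X] fi_J_eq[OF resD(1) X] whole_sub_def)
  also have "\<dots> \<longleftrightarrow> fi_koszul_zero V (whole_sub V) (zero_sub V) 0 X"
    by (rule fi_koszul_zero_first[OF X, symmetric])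
  finally show ?thesis .
qed

end

section \<open>Free FI-modules\<close>

definition free_carrier :: "('k, 'r) ring_scheme \<Rightarrow> 'b set \<Rightarrow> ('b \<Rightarrow> 'k) set" where
  "free_carrier R S = {c. (\<forall>b. c b \<in> carrier R) \<and> (\<forall>b. b \<notin> S \<longrightarrow> c b = \<zero>\<^bsub>R\<^esub>) \<and> finite {b. c b \<noteq> \<zero>\<^bsub>R\<^esub>}}"

definition free_module :: "('k, 'r) ring_scheme \<Rightarrow> 'b set \<Rightarrow> ('k, 'b \<Rightarrow> 'k) module" where
  "free_module R S = \<lparr>carrier = free_carrier R S, mult = undefined, one = undefined, ring.zero = (\<lambda>_. \<zero>\<^bsub>R\<^esub>),
     add = (\<lambda>c d b. c b \<oplus>\<^bsub>R\<^esub> d b), smult = (\<lambda>r c b. r \<otimes>\<^bsub>R\<^esub> c b)\<rparr>"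

definition free_gen :: "('k, 'r) ring_scheme \<Rightarrow> 'b \<Rightarrow> 'b \<Rightarrow> 'k" where
  "free_gen R b x = (if x = b then \<one>\<^bsub>R\<^esub> else \<zero>\<^bsub>R\<^esub>)"

lemma free_module_simps [simp]:
  "carrier (free_module R S) = free_carrier R S" "\<zero>\<^bsub>free_module R S\<^esub> = (\<lambda>_. \<zero>\<^bsub>R\<^esub>)"
  "c \<oplus>\<^bsub>free_module R S\<^esub> d = (\<lambda>b. c b \<oplus>\<^bsub>R\<^esub> d b)" "r \<odot>\<^bsub>free_module R S\<^esub> c = (\<lambda>b. r \<otimes>\<^bsub>R\<^esub> c b)"
  by (simp_all add: free_module_def)

lemma free_carrierD:
  assumes "c \<in> free_carrier R S"
  shows "c b \<in> carrier R" "b \<notin> S \<Longrightarrow> c b = \<zero>\<^bsub>R\<^esub>" "finite {b. c b \<noteq> \<zero>\<^bsub>R\<^esub>}" "{b. c b \<noteq> \<zero>\<^bsub>R\<^esub>} \<subseteq> S"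
  using assms by (auto simp: free_carrier_def)

lemma free_carrierI:
  assumes "\<And>b. c b \<in> carrier R" "\<And>b. b \<notin> S \<Longrightarrow> c b = \<zero>\<^bsub>R\<^esub>" "finite {b. c b \<noteq> \<zero>\<^bsub>R\<^esub>}"
  shows "c \<in> free_carrier R S"
  using assms by (simp add: free_carrier_def)

context cring
begin

lemma free_carrier_add: "c \<in> free_carrier R S \<Longrightarrow> d \<in> free_carrier R S \<Longrightarrow> (\<lambda>b. c b \<oplus> d b) \<in> free_carrier R S"
proof (rule free_carrierI)
  assume c: "c \<in> free_carrier R S" and d: "d \<in> free_carrier R S"
  show "c b \<oplus> d b \<in> carrier R" for b
    using free_carrierD(1)[OF c] free_carrierD(1)[OF d] by simp
  show "c b \<oplus> d b = \<zero>" if "b \<notin> S" for b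
    using free_carrierD(2)[OF c that] free_carrierD(2)[OF d that] by simp
  show "finite {b. c b \<oplus> d b \<noteq> \<zero>}"
    by (rule finite_subset[OF _ finite_UnI[OF free_carrierD(3)[OF c] free_carrierD(3)[OF d]]]) auto
qed

lemma free_carrier_smult: "r \<in> carrier R \<Longrightarrow> c \<in> free_carrier R S \<Longrightarrow> (\<lambda>b. r \<otimes> c b) \<in> free_carrier R S"
proof (rule free_carrierI)
  assume r: "r \<in> carrier R" and c: "c \<in> free_carrier R S"
  show "r \<otimes> c b \<in> carrier R" for b
    using free_carrierD(1)[OF c] r by simp
  show "r \<otimes> c b = \<zero>" if "b \<notin> S" for b
    using free_carrierD(2)[OF c that] r by simp
  show "finite {b. r \<otimes> c b \<noteq> \<zero>}"
    by (rule finite_subset[OF _ free_carrierD(3)[OF c]]) (use r in auto)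
qed

lemma free_carrier_uminus: "c \<in> free_carrier R S \<Longrightarrow> (\<lambda>b. \<ominus> c b) \<in> free_carrier R S"
proof (rule free_carrierI)
  assume c: "c \<in> free_carrier R S"
  show "\<ominus> c b \<in> carrier R" for b
    using free_carrierD(1)[OF c] by simp
  show "\<ominus> c b = \<zero>" if "b \<notin> S" for b
    using free_carrierD(2)[OF c that] by simp
  show "finite {b. \<ominus> c b \<noteq> \<zero>}"
    by (rule finite_subset[OF _ free_carrierD(3)[OF c]]) auto
qed

lemma free_carrier_zero: "(\<lambda>_. \<zero>) \<in> free_carrier R S"
  by (rule free_carrierI) auto

lemma free_carrier_dlt: "b \<in> S \<Longrightarrow> free_gen R b \<in> free_carrier R S"
proof (rule free_carrierI)
  show "finite {x. free_gen R b x \<noteq> \<zero>}"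
    by (rule finite_subset[of _ "{b}"]) (auto simp: free_gen_def)
qed (auto simp: free_gen_def)

lemma free_module_module: "Module.module R (free_module R S)"
proof (rule moduleI)
  show "cring R" ..
  show "abelian_group (free_module R S)"
  proof (rule abelian_groupI)
    show "\<exists>y\<in>carrier (free_module R S). y \<oplus>\<^bsub>free_module R S\<^esub> x = \<zero>\<^bsub>free_module R S\<^esub>" if "x \<in> carrier (free_module R S)" for x
      using that free_carrier_uminus[of x S] free_carrierD(1)[of x R S]
      by (intro bexI[of _ "\<lambda>b. \<ominus> x b"]) (auto simp: l_neg)
  qed (auto simp: free_carrier_add free_carrier_zero fun_eq_iff a_ac free_carrierD(1)[where S = S])
qed (auto simp: free_carrier_smult fun_eq_iff l_distr r_distr m_assoc free_carrierD(1)[where S = S])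

text \<open>Induction on the size of the support, splitting off one term. Equalities of maps out of
  free modules are reduced to generators by this.\<close>

lemma free_module_hom_eqI:
  assumes M: "Module.module R M" and g: "module_hom R (free_module R S) M g" and h: "module_hom R (free_module R S) M h"
    and eq: "\<And>b. b \<in> S \<Longrightarrow> g (free_gen R b) = h (free_gen R b)" and c: "c \<in> free_carrier R S"
  shows "g c = h c"
  using c
proof (induct "card {b. c b \<noteq> \<zero>}" arbitrary: c)
  case 0
  then have "c = (\<lambda>_. \<zero>)"
    using free_carrierD(3)[OF 0(2)] by auto
  then show ?case
    using module_hom_zero[OF free_module_module M g] module_hom_zero[OF free_module_module M h] by simp
next
  case (Suc n)
  note fin = free_carrierD(3)[OF Suc(3)]
  have "{b. c b \<noteq> \<zero>} \<noteq> {}"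
    using Suc(2) by (metis card.empty nat.distinct(1))
  then obtain b where b: "c b \<noteq> \<zero>"
    by blast
  then have bS: "b \<in> S"
    using free_carrierD(2)[OF Suc(3)] by auto
  let ?d = "\<lambda>x. if x = b then \<zero> else c x"
  have supp: "{x. ?d x \<noteq> \<zero>} = {b. c b \<noteq> \<zero>} - {b}"
    by auto
  have d: "?d \<in> free_carrier R S"
    using free_carrierD[OF Suc(3)] fin by (intro free_carrierI) (auto simp: supp)
  have "n = card {x. ?d x \<noteq> \<zero>}"
    using Suc(2) b fin by (simp add: supp)
  then have IH: "g ?d = h ?d"
    by (rule Suc(1)[OF _ d])
  have cb: "c b \<in> carrier R"
    by (rule free_carrierD(1)[OF Suc(3)])
  have dl: "free_gen R b \<in> free_carrier R S"
    by (rule free_carrier_dlt[OF bS])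
  have sm: "(\<lambda>x. c b \<otimes> free_gen R b x) \<in> free_carrier R S"
    by (rule free_carrier_smult[OF cb dl])
  have dec: "c = (c b \<odot>\<^bsub>free_module R S\<^esub> free_gen R b) \<oplus>\<^bsub>free_module R S\<^esub> ?d"
    using free_carrierD(1)[OF Suc(3)] by (auto simp: fun_eq_iff free_gen_def)
  have val: "f c = (c b \<odot>\<^bsub>M\<^esub> f (free_gen R b)) \<oplus>\<^bsub>M\<^esub> f ?d" if f: "module_hom R (free_module R S) M f" for f
  proof -
    have "f c = f ((c b \<odot>\<^bsub>free_module R S\<^esub> free_gen R b) \<oplus>\<^bsub>free_module R S\<^esub> ?d)"
      using dec by metis
    also have "\<dots> = f (c b \<odot>\<^bsub>free_module R S\<^esub> free_gen R b) \<oplus>\<^bsub>M\<^esub> f ?d"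
      by (rule module_homD(2)[OF f]) (use sm d in simp_all)
    also have "f (c b \<odot>\<^bsub>free_module R S\<^esub> free_gen R b) = c b \<odot>\<^bsub>M\<^esub> f (free_gen R b)"
      by (rule module_homD(3)[OF f cb]) (use dl in simp)
    finally show ?thesis .
  qed
  show ?case
    unfolding val[OF g] val[OF h] using IH eq[OF bS] by simp
qed

end

definition free_eval :: "('k, 'r) ring_scheme \<Rightarrow> ('k, 'm) module \<Rightarrow> ('b \<Rightarrow> 'm) \<Rightarrow> ('b \<Rightarrow> 'k) \<Rightarrow> 'm" where
  "free_eval R M \<phi> c = finsum M (\<lambda>b. c b \<odot>\<^bsub>M\<^esub> \<phi> b) {b. c b \<noteq> \<zero>\<^bsub>R\<^esub>}"

context
  fixes R :: "('k, 'r) ring_scheme" and M :: "('k, 'm) module" and \<phi> :: "'b \<Rightarrow> 'm" and S :: "'b set"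
  assumes M: "Module.module R M" and phi: "\<And>b. b \<in> S \<Longrightarrow> \<phi> b \<in> carrier M"
begin

lemma free_eval_eq:
  assumes c: "c \<in> free_carrier R S" and T: "finite T" "{b. c b \<noteq> \<zero>\<^bsub>R\<^esub>} \<subseteq> T" "T \<subseteq> S"
  shows "free_eval R M \<phi> c = finsum M (\<lambda>b. c b \<odot>\<^bsub>M\<^esub> \<phi> b) T"
proof -
  interpret M: Module.module R M by (rule M)
  show ?thesis
    unfolding free_eval_def
  proof (rule M.add.finprod_mono_neutral_cong_left)
    show "c i \<odot>\<^bsub>M\<^esub> \<phi> i = \<zero>\<^bsub>M\<^esub>" if "i \<in> T - {b. c b \<noteq> \<zero>\<^bsub>R\<^esub>}" for i
      using that T(3) phi by auto
    show "(\<lambda>b. c b \<odot>\<^bsub>M\<^esub> \<phi> b) \<in> T \<rightarrow> carrier M"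
      using free_carrierD(1)[OF c] T(3) phi by auto
  qed (use T in auto)
qed

lemma free_eval_dlt:
  assumes b: "b \<in> S"
  shows "free_eval R M \<phi> (free_gen R b) = \<phi> b"
proof -
  interpret M: Module.module R M by (rule M)
  have "free_eval R M \<phi> (free_gen R b) = finsum M (\<lambda>x. free_gen R b x \<odot>\<^bsub>M\<^esub> \<phi> x) {b}"
    by (rule free_eval_eq[OF M.free_carrier_dlt[OF b]]) (use b in \<open>auto simp: free_gen_def\<close>)
  also have "\<dots> = \<phi> b"
    using phi[OF b] by (simp add: free_gen_def)
  finally show ?thesis .
qed

lemma free_eval_hom: "module_hom R (free_module R S) M (free_eval R M \<phi>)"
  unfolding module_hom_def
proof (intro conjI ballI)
  interpret M: Module.module R M by (rule M)
  have mem: "(\<lambda>b. c b \<odot>\<^bsub>M\<^esub> \<phi> b) \<in> T \<rightarrow> carrier M" if "c \<in> free_carrier R S" "T \<subseteq> S" for c T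
    using free_carrierD(1)[OF that(1)] that(2) phi by auto
  show "free_eval R M \<phi> \<in> carrier (free_module R S) \<rightarrow> carrier M"
    using mem free_carrierD(4) by (force simp: free_eval_def)
  show "free_eval R M \<phi> (c \<oplus>\<^bsub>free_module R S\<^esub> d) = free_eval R M \<phi> c \<oplus>\<^bsub>M\<^esub> free_eval R M \<phi> d"
    if "c \<in> carrier (free_module R S)" "d \<in> carrier (free_module R S)" for c d
  proof -
    have c: "c \<in> free_carrier R S" and d: "d \<in> free_carrier R S"
      using that by auto
    let ?T = "{b. c b \<noteq> \<zero>\<^bsub>R\<^esub>} \<union> {b. d b \<noteq> \<zero>\<^bsub>R\<^esub>}"
    have T: "finite ?T" "?T \<subseteq> S"
      using free_carrierD(3,4)[OF c] free_carrierD(3,4)[OF d] by auto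
    have "free_eval R M \<phi> (\<lambda>b. c b \<oplus>\<^bsub>R\<^esub> d b) = finsum M (\<lambda>b. (c b \<oplus>\<^bsub>R\<^esub> d b) \<odot>\<^bsub>M\<^esub> \<phi> b) ?T"
      by (rule free_eval_eq[OF M.free_carrier_add[OF c d] T(1) _ T(2)]) auto
    also have "\<dots> = finsum M (\<lambda>b. c b \<odot>\<^bsub>M\<^esub> \<phi> b \<oplus>\<^bsub>M\<^esub> d b \<odot>\<^bsub>M\<^esub> \<phi> b) ?T"
    proof (rule M.finsum_cong')
      show "(\<lambda>b. c b \<odot>\<^bsub>M\<^esub> \<phi> b \<oplus>\<^bsub>M\<^esub> d b \<odot>\<^bsub>M\<^esub> \<phi> b) \<in> ?T \<rightarrow> carrier M"
        using mem[OF c T(2)] mem[OF d T(2)] by (intro Pi_I M.add.m_closed) (auto simp only: Pi_iff)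
      show "(c b \<oplus>\<^bsub>R\<^esub> d b) \<odot>\<^bsub>M\<^esub> \<phi> b = c b \<odot>\<^bsub>M\<^esub> \<phi> b \<oplus>\<^bsub>M\<^esub> d b \<odot>\<^bsub>M\<^esub> \<phi> b" if "b \<in> ?T" for b
        using M.smult_l_distr[OF free_carrierD(1)[OF c] free_carrierD(1)[OF d] phi] that T(2) by blast
    qed simp
    also have "\<dots> = finsum M (\<lambda>b. c b \<odot>\<^bsub>M\<^esub> \<phi> b) ?T \<oplus>\<^bsub>M\<^esub> finsum M (\<lambda>b. d b \<odot>\<^bsub>M\<^esub> \<phi> b) ?T"
      by (rule M.finsum_addf[OF mem[OF c T(2)] mem[OF d T(2)]])
    also have "finsum M (\<lambda>b. c b \<odot>\<^bsub>M\<^esub> \<phi> b) ?T = free_eval R M \<phi> c"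
      by (rule free_eval_eq[OF c T(1) _ T(2), symmetric]) auto
    also have "finsum M (\<lambda>b. d b \<odot>\<^bsub>M\<^esub> \<phi> b) ?T = free_eval R M \<phi> d"
      by (rule free_eval_eq[OF d T(1) _ T(2), symmetric]) auto
    finally show ?thesis by simp
  qed
  show "free_eval R M \<phi> (r \<odot>\<^bsub>free_module R S\<^esub> c) = r \<odot>\<^bsub>M\<^esub> free_eval R M \<phi> c" if "r \<in> carrier R" "c \<in> carrier (free_module R S)" for r c
  proof -
    have c: "c \<in> free_carrier R S"
      using that by auto
    let ?T = "{b. c b \<noteq> \<zero>\<^bsub>R\<^esub>}"
    note T = free_carrierD(3,4)[OF c]
    have "free_eval R M \<phi> (\<lambda>b. r \<otimes>\<^bsub>R\<^esub> c b) = finsum M (\<lambda>b. (r \<otimes>\<^bsub>R\<^esub> c b) \<odot>\<^bsub>M\<^esub> \<phi> b) ?T"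
      by (rule free_eval_eq[OF M.free_carrier_smult[OF that(1) c] T(1) _ T(2)]) (use that in auto)
    also have "\<dots> = finsum M (\<lambda>b. r \<odot>\<^bsub>M\<^esub> (c b \<odot>\<^bsub>M\<^esub> \<phi> b)) ?T"
    proof (rule M.finsum_cong')
      show "(\<lambda>b. r \<odot>\<^bsub>M\<^esub> (c b \<odot>\<^bsub>M\<^esub> \<phi> b)) \<in> ?T \<rightarrow> carrier M"
        by (rule Pi_I, rule M.smult_closed[OF that(1)], rule Pi_mem[OF mem[OF c T(2)]])
      show "(r \<otimes>\<^bsub>R\<^esub> c b) \<odot>\<^bsub>M\<^esub> \<phi> b = r \<odot>\<^bsub>M\<^esub> (c b \<odot>\<^bsub>M\<^esub> \<phi> b)" if "b \<in> ?T" for b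
        using M.smult_assoc1[OF \<open>r \<in> carrier R\<close> free_carrierD(1)[OF c] phi] that T(2) by blast
    qed simp
    also have "\<dots> = r \<odot>\<^bsub>M\<^esub> finsum M (\<lambda>b. c b \<odot>\<^bsub>M\<^esub> \<phi> b) ?T"
      by (rule M.finsum_smult_ldistr[OF T(1) that(1) mem[OF c T(2)], symmetric])
    finally show ?thesis
      by (simp add: free_eval_def)
  qed
qed

end

lemma module_hom_compose:
  assumes "module_hom R L M f" "module_hom R M N g"
  shows "module_hom R L N (\<lambda>x. g (f x))"
  using assms by (auto simp: module_hom_def Pi_iff)

text \<open>Relabels the basis along an injective \<open>F\<close>; injectivity allows reading off
  the coefficient at \<open>y\<close> from its only preimage, with no sum over fibres.\<close>

definition push :: "('k, 'r) ring_scheme \<Rightarrow> 'b set \<Rightarrow> ('b \<Rightarrow> 'c) \<Rightarrow> ('b \<Rightarrow> 'k) \<Rightarrow> 'c \<Rightarrow> 'k" where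
  "push R S F c y = (if y \<in> F ` S then c (inv_into S F y) else \<zero>\<^bsub>R\<^esub>)"

lemma push_hom:
  assumes "cring R" "inj_on F S" "F ` S \<subseteq> S'"
  shows "module_hom R (free_module R S) (free_module R S') (push R S F)"
proof -
  interpret cring R by fact
  have "push R S F c \<in> free_carrier R S'" if c: "c \<in> free_carrier R S" for c
  proof (rule free_carrierI)
    show "push R S F c b \<in> carrier R" for b
      using free_carrierD(1)[OF c] by (simp add: push_def)
    show "push R S F c b = \<zero>\<^bsub>R\<^esub>" if "b \<notin> S'" for b
      using that assms(3) by (auto simp: push_def)
    show "finite {b. push R S F c b \<noteq> \<zero>\<^bsub>R\<^esub>}"
    proof (rule finite_subset[OF _ finite_imageI[OF free_carrierD(3)[OF c], of F]])
      show "{b. push R S F c b \<noteq> \<zero>\<^bsub>R\<^esub>} \<subseteq> F ` {b. c b \<noteq> \<zero>\<^bsub>R\<^esub>}"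
      proof
        fix y assume "y \<in> {b. push R S F c b \<noteq> \<zero>\<^bsub>R\<^esub>}"
        then have "y \<in> F ` S" "c (inv_into S F y) \<noteq> \<zero>\<^bsub>R\<^esub>"
          by (auto simp: push_def split: if_splits)
        then show "y \<in> F ` {b. c b \<noteq> \<zero>\<^bsub>R\<^esub>}"
          by (intro image_eqI[of _ _ "inv_into S F y"]) (simp_all add: f_inv_into_f)
      qed
    qed
  qed
  then show ?thesis
    by (auto simp: module_hom_def push_def fun_eq_iff)
qed

lemma push_dlt:
  assumes "inj_on F S" "b \<in> S"
  shows "push R S F (free_gen R b) = free_gen R (F b)"
  using assms by (auto simp: push_def free_gen_def fun_eq_iff inv_into_f_f)

section \<open>The free FI-module on all elements of a given one\<close>

text \<open>
  A distinct list \<open>l\<close> encodes the injection \<open>i \<mapsto> l ! i\<close> from \<open>{..<length l}\<close>, so \<open>free_fi R V\<close> is the sum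
  of the representable FI-modules indexed by all elements of \<open>V\<close> at the sets \<open>{..<n}\<close>.
\<close>

definition basis :: "('k, 'b) fi_mod \<Rightarrow> nat set \<Rightarrow> (nat list \<times> 'b) set" where
  "basis V X = {(l, v). distinct l \<and> set l \<subseteq> X \<and> v \<in> carrier (obj V {..<length l})}"

definition basis_map :: "(nat \<Rightarrow> nat) \<Rightarrow> nat list \<times> 'b \<Rightarrow> nat list \<times> 'b" where
  "basis_map f b = (map f (fst b), snd b)"

definition free_fi :: "('k, 'r) ring_scheme \<Rightarrow> ('k, 'b) fi_mod \<Rightarrow> ('k, nat list \<times> 'b \<Rightarrow> 'k) fi_mod" where
  "free_fi R V = \<lparr>obj = (\<lambda>X. free_module R (basis V X)), mor = (\<lambda>X Y f. push R (basis V X) (basis_map f))\<rparr>"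

lemma free_fi_simps [simp]:
  "obj (free_fi R V) X = free_module R (basis V X)" "mor (free_fi R V) X Y f = push R (basis V X) (basis_map f)"
  by (simp_all add: free_fi_def)

lemma basis_map_basis:
  assumes "f \<in> FI_mor X Y"
  shows "inj_on (basis_map f) (basis V X)" "basis_map f ` basis V X \<subseteq> basis V Y"
proof -
  have f: "inj_on f X" "f ` X \<subseteq> Y"
    using assms by (auto simp: FI_mor_def)
  show "inj_on (basis_map f) (basis V X)"
  proof (rule inj_onI)
    fix a b assume ab: "a \<in> basis V X" "b \<in> basis V X" "basis_map f a = basis_map f b"
    then have "set (fst a) \<union> set (fst b) \<subseteq> X" "map f (fst a) = map f (fst b)"
      by (auto simp: basis_def basis_map_def)
    then have "fst a = fst b"
      using inj_on_map_eq_map[OF inj_on_subset[OF f(1)]] by blast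
    then show "a = b"
      using ab(3) by (simp add: basis_map_def prod_eq_iff)
  qed
  show "basis_map f ` basis V X \<subseteq> basis V Y"
    using f by (force simp: basis_def basis_map_def distinct_map inj_on_subset)
qed

lemma free_fi_mor_dlt:
  assumes "f \<in> FI_mor X Y" "(l, v) \<in> basis V X"
  shows "mor (free_fi R V) X Y f (free_gen R (l, v)) = free_gen R (map f l, v)"
  using push_dlt[OF basis_map_basis(1)[OF assms(1), of V] assms(2), of R] by (simp add: basis_map_def)

lemma free_fi_mor_hom:
  assumes "cring R" "f \<in> FI_mor X Y"
  shows "module_hom R (obj (free_fi R V) X) (obj (free_fi R V) Y) (mor (free_fi R V) X Y f)"
  using push_hom[OF assms(1) basis_map_basis[OF assms(2), of V]] by simp

lemma compose_FI_mor: "f \<in> FI_mor X Y \<Longrightarrow> g \<in> FI_mor Y Z \<Longrightarrow> compose X g f \<in> FI_mor X Z"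
  by (auto simp: FI_mor_def compose_def inj_on_def PiE_iff extensional_def)

lemma free_fi_fi_module:
  assumes R: "cring R"
  shows "fi_module R (free_fi R V)"
  unfolding fi_module_def
proof (intro conjI allI impI ballI)
  interpret cring R by fact
  fix X :: "nat set"
  show "Module.module R (obj (free_fi R V) X)"
    by (simp add: free_module_module)
  fix v assume v: "v \<in> carrier (obj (free_fi R V) X)"
  show "mor (free_fi R V) X X (restrict id X) v = v"
  proof (rule free_module_hom_eqI[OF _ free_fi_mor_hom[OF R inc_FI_mor[OF subset_refl], of V X, unfolded free_fi_simps(1)], of "\<lambda>v. v"])
    show "Module.module R (free_module R (basis V X))"
      by (rule free_module_module)
    show "module_hom R (free_module R (basis V X)) (free_module R (basis V X)) (\<lambda>v. v)"
      by (simp add: module_hom_def)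
    show "mor (free_fi R V) X X (restrict id X) (free_gen R b) = free_gen R b" if b: "b \<in> basis V X" for b
    proof -
      obtain l w where lw: "b = (l, w)" by force
      have "map (inc X) l = l"
        using b by (intro map_idI) (auto simp: lw basis_def)
      then show ?thesis
        using free_fi_mor_dlt[OF inc_FI_mor[OF subset_refl], of l w V X R] b lw by simp
    qed
  qed (use v in simp)
next
  fix X Y f assume "finite X \<and> finite Y \<and> f \<in> FI_mor X Y"
  then show "module_hom R (obj (free_fi R V) X) (obj (free_fi R V) Y) (mor (free_fi R V) X Y f)"
    by (intro free_fi_mor_hom R) auto
next
  interpret cring R by fact
  fix X Y Z f g v
  assume h: "finite X \<and> finite Y \<and> finite Z \<and> f \<in> FI_mor X Y \<and> g \<in> FI_mor Y Z" and v: "v \<in> carrier (obj (free_fi R V) X)"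
  then have f: "f \<in> FI_mor X Y" and g: "g \<in> FI_mor Y Z" by auto
  note hf = free_fi_mor_hom[OF R f, of V] and hg = free_fi_mor_hom[OF R g, of V]
  show "mor (free_fi R V) X Z (compose X g f) v = mor (free_fi R V) Y Z g (mor (free_fi R V) X Y f v)"
  proof (rule free_module_hom_eqI[OF free_module_module free_fi_mor_hom[OF R compose_FI_mor[OF f g], of V, unfolded free_fi_simps(1)]
        module_hom_compose[OF hf hg, unfolded free_fi_simps(1)]])
    show "mor (free_fi R V) X Z (compose X g f) (free_gen R b) = mor (free_fi R V) Y Z g (mor (free_fi R V) X Y f (free_gen R b))"
      if b: "b \<in> basis V X" for b
    proof -
      obtain l w where lw: "b = (l, w)" by force
      have "map (compose X g f) l = map g (map f l)"
        using b by (auto simp: lw basis_def compose_def)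
      moreover have "(map f l, w) \<in> basis V Y"
        using basis_map_basis(2)[OF f, of V] b by (auto simp: lw basis_map_def)
      ultimately show ?thesis
        using b lw free_fi_mor_dlt[OF f, of l w V R] free_fi_mor_dlt[OF g, of "map f l" w V R]
          free_fi_mor_dlt[OF compose_FI_mor[OF f g], of l w V R] by (simp del: map_map map_eq_conv)
    qed
  qed (use v in simp)
qed

definition lfun :: "nat list \<Rightarrow> nat \<Rightarrow> nat" where
  "lfun l = restrict (\<lambda>i. l ! i) {..<length l}"

lemma lfun_FI_mor: "distinct l \<Longrightarrow> set l \<subseteq> X \<Longrightarrow> lfun l \<in> FI_mor {..<length l} X"
  by (auto simp: FI_mor_def lfun_def inj_on_def nth_eq_iff_index_eq subset_iff)

lemma compose_lfun: "compose {..<length l} f (lfun l) = lfun (map f l)"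
  by (auto simp: compose_def lfun_def fun_eq_iff)

lemma map_lfun: "map (lfun l) [0..<length l] = l"
  by (auto simp: lfun_def intro: nth_equalityI)

text \<open>The map given by the Yoneda lemma: \<open>m n v\<close> is the intended image of the
  generator \<open>([0..<n], v)\<close>, and the generator \<open>(l, v)\<close> arises from such a
  one along the injection \<open>lfun l\<close>.\<close>

definition free_fi_lift :: "('k, 'r) ring_scheme \<Rightarrow> ('k, 'm) fi_mod \<Rightarrow> (nat \<Rightarrow> 'b \<Rightarrow> 'm) \<Rightarrow> nat set \<Rightarrow> (nat list \<times> 'b \<Rightarrow> 'k) \<Rightarrow> 'm" where
  "free_fi_lift R M m X = free_eval R (obj M X) (\<lambda>(l, v). mor M {..<length l} X (lfun l) (m (length l) v))"

context
  fixes R :: "('k, 'r) ring_scheme" and M :: "('k, 'm) fi_mod" and V :: "('k, 'b) fi_mod" and m :: "nat \<Rightarrow> 'b \<Rightarrow> 'm"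
  assumes M: "fi_module R M" and R: "cring R"
    and m: "\<And>n v. v \<in> carrier (obj V {..<n}) \<Longrightarrow> m n v \<in> carrier (obj M {..<n})"
begin

lemma free_fi_lift_basis_closed:
  assumes "finite X" "b \<in> basis V X"
  shows "(\<lambda>(l, v). mor M {..<length l} X (lfun l) (m (length l) v)) b \<in> carrier (obj M X)"
  using assms module_homD(1)[OF fi_moduleD(2)[OF M finite_lessThan assms(1) lfun_FI_mor] m]
  by (auto simp: basis_def)

lemma free_fi_lift_hom:
  assumes "finite X"
  shows "module_hom R (free_module R (basis V X)) (obj M X) (free_fi_lift R M m X)"
  unfolding free_fi_lift_def by (rule free_eval_hom[OF fi_moduleD(1)[OF M assms] free_fi_lift_basis_closed[OF assms]])

lemma free_fi_lift_dlt:
  assumes "finite X" "(l, v) \<in> basis V X"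
  shows "free_fi_lift R M m X (free_gen R (l, v)) = mor M {..<length l} X (lfun l) (m (length l) v)"
  unfolding free_fi_lift_def
  using free_eval_dlt[OF fi_moduleD(1)[OF M assms(1)] free_fi_lift_basis_closed[OF assms(1)] assms(2)] by simp

lemma free_fi_lift_fi_map: "fi_map R (free_fi R V) M (free_fi_lift R M m)"
  unfolding fi_map_def
proof (intro conjI allI impI ballI)
  fix X :: "nat set" assume "finite X"
  then show "module_hom R (obj (free_fi R V) X) (obj M X) (free_fi_lift R M m X)"
    using free_fi_lift_hom by simp
next
  interpret cring R by (rule R)
  fix X Y f v assume h: "finite X \<and> finite Y \<and> f \<in> FI_mor X Y" and v: "v \<in> carrier (obj (free_fi R V) X)"
  then have X: "finite X" and Y: "finite Y" and f: "f \<in> FI_mor X Y" by auto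
  note hf = free_fi_mor_hom[OF R f, of V, unfolded free_fi_simps(1)]
  show "free_fi_lift R M m Y (mor (free_fi R V) X Y f v) = mor M X Y f (free_fi_lift R M m X v)"
  proof (rule free_module_hom_eqI[OF fi_moduleD(1)[OF M Y] module_hom_compose[OF hf free_fi_lift_hom[OF Y]]
        module_hom_compose[OF free_fi_lift_hom[OF X] fi_moduleD(2)[OF M X Y f]]])
    fix b assume b: "b \<in> basis V X"
    obtain l w where lw: "b = (l, w)" by force
    have l: "distinct l" "set l \<subseteq> X" "w \<in> carrier (obj V {..<length l})"
      using b lw by (auto simp: basis_def)
    have b': "(map f l, w) \<in> basis V Y"
      using basis_map_basis(2)[OF f, of V] b by (auto simp: lw basis_map_def)
    have "mor M {..<length l} Y (compose {..<length l} f (lfun l)) (m (length l) w) =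
        mor M X Y f (mor M {..<length l} X (lfun l) (m (length l) w))"
      by (rule fi_moduleD(4)[OF M finite_lessThan X Y lfun_FI_mor[OF l(1,2)] f m[OF l(3)]])
    then show "free_fi_lift R M m Y (mor (free_fi R V) X Y f (free_gen R b)) = mor M X Y f (free_fi_lift R M m X (free_gen R b))"
      using b lw free_fi_lift_dlt[OF X, of l w] free_fi_lift_dlt[OF Y b'] free_fi_mor_dlt[OF f, of l w V R]
      by (simp add: compose_lfun)
  qed (use v in simp)
qed

end

text \<open>A preimage under \<open>e\<close> is chosen for the image of each generator
  \<open>([0..<n], v)\<close>; agreement at all other generators follows by naturality along
  \<open>lfun l\<close>. The element types of \<open>M\<close> and \<open>N\<close> are arbitrary
  here.\<close>

lemma free_fi_lifting:
  assumes R: "cring R" and M: "fi_module R M" and N: "fi_module R N" and e: "fi_map R M N e" "fi_surj M N e"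
    and h: "fi_map R (free_fi R V) N h"
  shows "\<exists>g. fi_map R (free_fi R V) M g \<and> (\<forall>X. finite X \<longrightarrow> (\<forall>x\<in>carrier (obj (free_fi R V) X). e X (g X x) = h X x))"
proof -
  interpret cring R by fact
  have b0: "([0..<n], v) \<in> basis V {..<n}" if "v \<in> carrier (obj V {..<n})" for n v
    using that by (auto simp: basis_def)
  have "\<exists>x. v \<in> carrier (obj V {..<n}) \<longrightarrow> x \<in> carrier (obj M {..<n}) \<and> e {..<n} x = h {..<n} (free_gen R ([0..<n], v))" for n v
  proof (cases "v \<in> carrier (obj V {..<n})")
    case True
    then have "h {..<n} (free_gen R ([0..<n], v)) \<in> carrier (obj N {..<n})"
      using b0 by (intro module_homD(1)[OF fi_mapD(1)[OF h finite_lessThan]]) (simp add: free_carrier_dlt)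
    also have "\<dots> = e {..<n} ` carrier (obj M {..<n})"
      using e(2) by (simp add: fi_surj_def fi_im_def)
    finally show ?thesis
      by auto
  qed blast
  note ex = this
  define m where "m n v = (SOME x. v \<in> carrier (obj V {..<n}) \<longrightarrow> x \<in> carrier (obj M {..<n}) \<and>
      e {..<n} x = h {..<n} (free_gen R ([0..<n], v)))" for n v
  have m: "m n v \<in> carrier (obj M {..<n}) \<and> e {..<n} (m n v) = h {..<n} (free_gen R ([0..<n], v))"
    if "v \<in> carrier (obj V {..<n})" for n v
    using someI_ex[OF ex[of v n]] that unfolding m_def by blast
  have fm: "fi_map R (free_fi R V) M (free_fi_lift R M m)"
    by (rule free_fi_lift_fi_map[OF M R]) (use m in blast)
  have fh: "module_hom R (free_module R (basis V X)) (obj M X) (free_fi_lift R M m X)" if "finite X" for X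
    by (rule free_fi_lift_hom[OF M R _ that]) (use m in blast)
  have fd: "free_fi_lift R M m X (free_gen R (l, v)) = mor M {..<length l} X (lfun l) (m (length l) v)"
    if "finite X" "(l, v) \<in> basis V X" for X l v
    by (rule free_fi_lift_dlt[OF M R _ that]) (use m in blast)
  have "e X (free_fi_lift R M m X x) = h X x" if X: "finite X" and x: "x \<in> carrier (obj (free_fi R V) X)" for X x
  proof (rule free_module_hom_eqI[OF fi_moduleD(1)[OF N X] module_hom_compose[OF fh[OF X] fi_mapD(1)[OF e(1) X]]
        fi_mapD(1)[OF h X, unfolded free_fi_simps(1)]])
    fix b assume b: "b \<in> basis V X"
    obtain l w where lw: "b = (l, w)" by force
    have l: "distinct l" "set l \<subseteq> X" "w \<in> carrier (obj V {..<length l})"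
      using b lw by (auto simp: basis_def)
    note lf = lfun_FI_mor[OF l(1,2)] and ml = m[OF l(3)]
    have "e X (free_fi_lift R M m X (free_gen R b)) = e X (mor M {..<length l} X (lfun l) (m (length l) w))"
      using fd[OF X, of l w] b lw by simp
    also have "\<dots> = mor N {..<length l} X (lfun l) (h {..<length l} (free_gen R ([0..<length l], w)))"
      using fi_mapD(2)[OF e(1) finite_lessThan X lf conjunct1[OF ml]] ml by simp
    also have "\<dots> = h X (mor (free_fi R V) {..<length l} X (lfun l) (free_gen R ([0..<length l], w)))"
      using fi_mapD(2)[OF h finite_lessThan X lf] b0[OF l(3)] by (simp add: free_carrier_dlt)
    also have "mor (free_fi R V) {..<length l} X (lfun l) (free_gen R ([0..<length l], w)) = free_gen R b"
      using free_fi_mor_dlt[OF lf b0[OF l(3)], of R] by (simp add: map_lfun lw)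
    finally show "e X (free_fi_lift R M m X (free_gen R b)) = h X (free_gen R b)" .
  qed (use x in simp)
  then show ?thesis
    using fm by blast
qed

definition counit :: "('k, 'r) ring_scheme \<Rightarrow> ('k, 'b) fi_mod \<Rightarrow> nat set \<Rightarrow> (nat list \<times> 'b \<Rightarrow> 'k) \<Rightarrow> 'b" where
  "counit R V = free_fi_lift R V (\<lambda>_ v. v)"

lemma counit:
  assumes R: "cring R" and V: "fi_module R V"
  shows "fi_map R (free_fi R V) V (counit R V)" "fi_surj (free_fi R V) V (counit R V)"
proof -
  interpret cring R by fact
  show fm: "fi_map R (free_fi R V) V (counit R V)"
    unfolding counit_def by (rule free_fi_lift_fi_map[OF V R])
  show "fi_surj (free_fi R V) V (counit R V)"
    unfolding fi_surj_def fi_im_def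
  proof (intro allI impI equalityI)
    fix X :: "nat set" assume X: "finite X"
    show "counit R V X ` carrier (obj (free_fi R V) X) \<subseteq> carrier (obj V X)"
      using module_homD(1)[OF fi_mapD(1)[OF fm X]] by auto
    show "carrier (obj V X) \<subseteq> counit R V X ` carrier (obj (free_fi R V) X)"
    proof
      fix v assume v: "v \<in> carrier (obj V X)"
      \<comment> \<open>A listing of \<open>X\<close> identifies it with an initial segment. There
        \<open>v\<close> has a counterpart \<open>?w\<close>, and the generator given by the list
        and \<open>?w\<close> is mapped back to \<open>v\<close>.\<close>
      define l where "l = sorted_list_of_set X"
      have l: "distinct l" "set l = X"
        using X by (simp_all add: l_def)
      let ?n = "length l"
      have lf: "lfun l \<in> FI_mor {..<?n} X"
        using l by (intro lfun_FI_mor) auto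
      have inj: "inj_on (lfun l) {..<?n}" and im: "lfun l ` {..<?n} = X"
        using lf l by (auto simp: FI_mor_def lfun_def in_set_conv_nth image_iff)
      define g where "g = restrict (inv_into {..<?n} (lfun l)) X"
      have g: "g \<in> FI_mor X {..<?n}"
        unfolding FI_mor_def
      proof (intro CollectI conjI)
        show "g \<in> X \<rightarrow>\<^sub>E {..<?n}"
          using inv_into_into[of _ "lfun l" "{..<?n}"] im by (auto simp: g_def)
        have "inj_on (inv_into {..<?n} (lfun l)) X"
          using im by (intro inj_on_inv_into) simp
        then show "inj_on g X"
          by (simp add: g_def inj_on_def)
      qed
      have c: "compose X (lfun l) g = inc X"
        using im f_inv_into_f[of _ "lfun l" "{..<?n}"] by (auto simp: g_def compose_def fun_eq_iff)
      let ?w = "mor V X {..<?n} g v"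
      have w: "?w \<in> carrier (obj V {..<?n})"
        by (rule module_homD(1)[OF fi_moduleD(2)[OF V X finite_lessThan g] v])
      have b: "(l, ?w) \<in> basis V X"
        using l w by (simp add: basis_def)
      have "counit R V X (free_gen R (l, ?w)) = mor V {..<?n} X (lfun l) ?w"
        unfolding counit_def by (rule free_fi_lift_dlt[OF V R _ X b])
      also have "\<dots> = v"
        using fi_moduleD(4)[OF V X finite_lessThan X g lf v] fi_moduleD(3)[OF V X v] c by simp
      finally show "v \<in> counit R V X ` carrier (obj (free_fi R V) X)"
        using b by (intro image_eqI[of _ _ "free_gen R (l, ?w)"]) (simp_all add: free_carrier_dlt)
    qed
  qed
qed

text \<open>The restriction maps of a free FI-module: generators whose list leaves \<open>Y\<close>
  are discarded. Compatibility with inclusions comes from the fact that generators at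
  \<open>Z\<close> which are also generators at \<open>Y\<close> are those at
  \<open>Z \<inter> Y\<close>.\<close>

definition free_fi_proj :: "('k, 'r) ring_scheme \<Rightarrow> ('k, 'b) fi_mod \<Rightarrow> nat set \<Rightarrow> (nat list \<times> 'b \<Rightarrow> 'k) \<Rightarrow> nat list \<times> 'b \<Rightarrow> 'k" where
  "free_fi_proj R V Y c b = (if b \<in> basis V Y then c b else \<zero>\<^bsub>R\<^esub>)"

lemma free_fi_proj_hom:
  assumes "cring R"
  shows "module_hom R (free_module R (basis V X)) (free_module R (basis V Y)) (free_fi_proj R V Y)"
proof -
  interpret cring R by fact
  have "free_fi_proj R V Y c \<in> free_carrier R (basis V Y)" if c: "c \<in> free_carrier R (basis V X)" for c
  proof (rule free_carrierI)
    show "finite {b. free_fi_proj R V Y c b \<noteq> \<zero>\<^bsub>R\<^esub>}"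
      by (rule finite_subset[OF _ free_carrierD(3)[OF c]]) (auto simp: free_fi_proj_def)
  qed (use free_carrierD(1)[OF c] in \<open>auto simp: free_fi_proj_def\<close>)
  then show ?thesis
    by (auto simp: module_hom_def free_fi_proj_def fun_eq_iff)
qed

lemma free_fi_mor_inc:
  assumes "cring R" "Y \<subseteq> X" "c \<in> free_carrier R (basis V Y)"
  shows "mor (free_fi R V) Y X (inc Y) c = c"
proof
  fix b
  have id: "basis_map (inc Y) a = a" if "a \<in> basis V Y" for a
  proof -
    have "map (inc Y) (fst a) = fst a"
      using that by (intro map_idI) (auto simp: basis_def)
    then show ?thesis
      by (simp add: basis_map_def)
  qed
  show "mor (free_fi R V) Y X (inc Y) c b = c b"
  proof (cases "b \<in> basis V Y")
    case True
    then have "inv_into (basis V Y) (basis_map (inc Y)) b = b"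
      using inv_into_f_f[OF basis_map_basis(1)[OF inc_FI_mor[OF assms(2)], of V] True] id[OF True] by simp
    then show ?thesis
      using True id by (auto simp: push_def image_iff)
  next
    case False
    then show ?thesis
      using id free_carrierD(2)[OF assms(3) False] by (auto simp: push_def image_iff)
  qed
qed

lemma basis_Int: "b \<in> basis V X \<and> b \<in> basis V Y \<longleftrightarrow> b \<in> basis V (X \<inter> Y)"
  by (auto simp: basis_def)

section \<open>Projective FI-modules and resolutions\<close>

text \<open>Lists over any type form an infinite set, and an infinite set is equinumerous with its
  square. All encodings into \<open>fi_univ\<close> are built from such a pairing.\<close>

lemma ex_list_pairing: "\<exists>pr :: 'x list \<times> 'x list \<Rightarrow> 'x list. inj pr"
proof -
  have "infinite (UNIV :: 'x list set)"
    by (rule infinite_UNIV_listI)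
  then obtain f where "bij_betw f ((UNIV :: 'x list set) \<times> (UNIV :: 'x list set)) (UNIV :: 'x list set)"
    using card_of_Times_same_infinite card_of_ordIso by metis
  then show ?thesis
    by (auto simp: bij_betw_def)
qed

text \<open>Folding with pairs alone need not separate lists of different lengths, as
  \<open>[]\<close> may itself be the code of a pair; so the length is recorded in unary.\<close>

definition lcode :: "('x list \<times> 'x list \<Rightarrow> 'x list) \<Rightarrow> 'x list list \<Rightarrow> 'x list" where
  "lcode pr xs = pr (replicate (length xs) undefined, foldr (\<lambda>x y. pr (x, y)) xs [])"

lemma inj_lcode:
  assumes "inj pr"
  shows "inj (lcode pr)"
proof (rule injI)
  fix xs ys assume "lcode pr xs = lcode pr ys"
  then have len: "length xs = length ys" and f: "foldr (\<lambda>x y. pr (x, y)) xs [] = foldr (\<lambda>x y. pr (x, y)) ys []"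
    using injD[OF assms] unfolding lcode_def by (metis length_replicate prod.inject)+
  from len f show "xs = ys"
    by (induct xs ys rule: list_induct2) (auto dest: injD[OF assms])
qed

text \<open>A function with finitely many values other than \<open>z\<close> is determined by its
  graph over these places, and a finite graph is encoded by a list of its points. The countable
  index \<open>l\<close> enters a point in unary, \<open>b\<close> through \<open>i\<close> and the
  coefficient as a list of length one.\<close>

lemma ex_encoding:
  fixes z :: 'k and i :: "'b \<Rightarrow> ('k \<times> 'a) list"
  assumes i: "inj i"
  shows "\<exists>j :: (nat list \<times> 'b \<Rightarrow> 'k) \<Rightarrow> ('k \<times> 'a) list. inj_on j {c. finite {b. c b \<noteq> z}}"
proof -
  obtain pr :: "('k \<times> 'a) list \<times> ('k \<times> 'a) list \<Rightarrow> ('k \<times> 'a) list" where pr: "inj pr"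
    using ex_list_pairing by blast
  define el :: "(nat list \<times> 'b) \<times> 'k \<Rightarrow> ('k \<times> 'a) list" where
    "el = (\<lambda>((l, b), k). pr (replicate (to_nat l) undefined, pr (i b, [(k, undefined)])))"
  have el: "inj el"
  proof (rule injI)
    fix p q assume eq: "el p = el q"
    obtain l b k l' b' k' where pq: "p = ((l, b), k)" "q = ((l', b'), k')"
      by (metis prod.exhaust)
    have eq1: "pr (replicate (to_nat l) undefined, pr (i b, [(k, undefined)])) =
        pr (replicate (to_nat l') undefined, pr (i b', [(k', undefined)]))"
      using eq by (simp add: pq el_def)
    note eq2 = injD[OF pr eq1]
    then have "pr (i b, [(k, undefined)]) = pr (i b', [(k', undefined)])"
      by (rule Pair_inject)
    note eq3 = injD[OF pr this]
    have "to_nat l = to_nat l'"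
      using arg_cong[OF eq2, of "\<lambda>x. length (fst x)"] by simp
    moreover have "i b = i b'" "k = k'"
      using eq3 by simp_all
    ultimately have "l = l'" "b = b'" "k = k'"
      using injD[OF i] by (auto dest: injD[OF inj_to_nat])
    then show "p = q"
      by (simp add: pq)
  qed
  define sl where "sl c = (SOME xs. set xs = {b. c b \<noteq> z})" for c :: "nat list \<times> 'b \<Rightarrow> 'k"
  have sl: "set (sl c) = {b. c b \<noteq> z}" if "finite {b. c b \<noteq> z}" for c
    using someI_ex[OF finite_list[OF that]] by (simp add: sl_def)
  have "inj_on (\<lambda>c. lcode pr (map (\<lambda>b. el (b, c b)) (sl c))) {c. finite {b. c b \<noteq> z}}"
  proof (rule inj_onI)
    fix c d :: "nat list \<times> 'b \<Rightarrow> 'k"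
    assume cd: "c \<in> {c. finite {b. c b \<noteq> z}}" "d \<in> {c. finite {b. c b \<noteq> z}}"
      and eq: "lcode pr (map (\<lambda>b. el (b, c b)) (sl c)) = lcode pr (map (\<lambda>b. el (b, d b)) (sl d))"
    have "map (\<lambda>b. el (b, c b)) (sl c) = map (\<lambda>b. el (b, d b)) (sl d)"
      by (rule injD[OF inj_lcode[OF pr] eq])
    then have "set (map (\<lambda>b. el (b, c b)) (sl c)) = set (map (\<lambda>b. el (b, d b)) (sl d))"
      by simp
    then have "el ` (\<lambda>b. (b, c b)) ` {b. c b \<noteq> z} = el ` (\<lambda>b. (b, d b)) ` {b. d b \<noteq> z}"
      using sl cd by (simp add: image_image)
    then have graph: "(\<lambda>b. (b, c b)) ` {b. c b \<noteq> z} = (\<lambda>b. (b, d b)) ` {b. d b \<noteq> z}"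
      by (simp add: inj_image_eq_iff[OF el])
    show "c = d"
    proof
      fix b show "c b = d b"
      proof (cases "c b = z \<and> d b = z")
        case False
        then have "(b, c b) \<in> (\<lambda>b. (b, c b)) ` {b. c b \<noteq> z} \<or> (b, d b) \<in> (\<lambda>b. (b, d b)) ` {b. d b \<noteq> z}"
          by auto
        then have "(b, c b) \<in> (\<lambda>b. (b, d b)) ` {b. d b \<noteq> z} \<or> (b, d b) \<in> (\<lambda>b. (b, c b)) ` {b. c b \<noteq> z}"
          using graph by simp
        then show ?thesis by auto
      qed simp
    qed
  qed
  then show ?thesis
    by blast
qed

section \<open>Change of the element type\<close>

text \<open>
  Carries an FI-module over to another element type along \<open>j\<close>, which has to be injective only on the carriers.
\<close>

definition transport :: "('b \<Rightarrow> 'c) \<Rightarrow> ('c \<Rightarrow> 'b) \<Rightarrow> ('k, 'b) fi_mod \<Rightarrow> ('k, 'c) fi_mod" where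
  "transport j g V = \<lparr>obj = (\<lambda>X. \<lparr>carrier = j ` carrier (obj V X), mult = undefined, one = undefined,
       ring.zero = j \<zero>\<^bsub>obj V X\<^esub>, add = (\<lambda>x y. j (g x \<oplus>\<^bsub>obj V X\<^esub> g y)), smult = (\<lambda>c x. j (c \<odot>\<^bsub>obj V X\<^esub> g x))\<rparr>),
     mor = (\<lambda>X Y f x. j (mor V X Y f (g x)))\<rparr>"

lemma transport_simps [simp]:
  "carrier (obj (transport j g V) X) = j ` carrier (obj V X)"
  "\<zero>\<^bsub>obj (transport j g V) X\<^esub> = j \<zero>\<^bsub>obj V X\<^esub>"
  "x \<oplus>\<^bsub>obj (transport j g V) X\<^esub> y = j (g x \<oplus>\<^bsub>obj V X\<^esub> g y)"
  "c \<odot>\<^bsub>obj (transport j g V) X\<^esub> x = j (c \<odot>\<^bsub>obj V X\<^esub> g x)"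
  "mor (transport j g V) X Y f x = j (mor V X Y f (g x))"
  by (simp_all add: transport_def)

context
  fixes R :: "('k, 'r) ring_scheme" and V :: "('k, 'b) fi_mod" and j :: "'b \<Rightarrow> 'c" and g :: "'c \<Rightarrow> 'b"
  assumes V: "fi_module R V" and gj: "\<And>X x. finite X \<Longrightarrow> x \<in> carrier (obj V X) \<Longrightarrow> g (j x) = x"
begin

lemma transport_module:
  assumes X: "finite X"
  shows "Module.module R (obj (transport j g V) X)"
proof -
  interpret M: Module.module R "obj V X"
    by (rule fi_moduleD(1)[OF V X])
  note [simp] = gj[OF X]
  show ?thesis
  proof (rule moduleI)
    show "abelian_group (obj (transport j g V) X)"
    proof (rule abelian_groupI)
      show "\<exists>y\<in>carrier (obj (transport j g V) X). y \<oplus>\<^bsub>obj (transport j g V) X\<^esub> x = \<zero>\<^bsub>obj (transport j g V) X\<^esub>"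
        if x: "x \<in> carrier (obj (transport j g V) X)" for x
      proof -
        obtain x' where "x = j x'" "x' \<in> carrier (obj V X)"
          using x by auto
        then show ?thesis
          by (intro bexI[of _ "j (\<ominus>\<^bsub>obj V X\<^esub> x')"]) (auto simp: M.l_neg)
      qed
    qed (auto simp: M.a_ac)
  qed (auto simp: M.smult_l_distr M.smult_r_distr M.smult_assoc1 M.R.is_cring intro: M.R.is_cring)
qed

lemma transport_fi_module: "fi_module R (transport j g V)"
  unfolding fi_module_def
proof (intro conjI allI impI ballI)
  fix X :: "nat set" assume X: "finite X"
  show "Module.module R (obj (transport j g V) X)"
    by (rule transport_module[OF X])
  show "mor (transport j g V) X X (restrict id X) v = v" if "v \<in> carrier (obj (transport j g V) X)" for v
    using that fi_moduleD(3)[OF V X] gj[OF X] by auto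
next
  fix X Y f assume "finite X \<and> finite Y \<and> f \<in> FI_mor X Y"
  then have X: "finite X" and Y: "finite Y" and f: "f \<in> FI_mor X Y" by auto
  interpret M: Module.module R "obj V X"
    by (rule fi_moduleD(1)[OF V X])
  note hom = module_homD[OF fi_moduleD(2)[OF V X Y f]]
  show "module_hom R (obj (transport j g V) X) (obj (transport j g V) Y) (mor (transport j g V) X Y f)"
    by (auto simp: module_hom_def hom gj[OF X] gj[OF Y])
next
  fix X Y Z f h v assume "finite X \<and> finite Y \<and> finite Z \<and> f \<in> FI_mor X Y \<and> h \<in> FI_mor Y Z"
    and v: "v \<in> carrier (obj (transport j g V) X)"
  then have X: "finite X" and Y: "finite Y" and Z: "finite Z" and f: "f \<in> FI_mor X Y" and h: "h \<in> FI_mor Y Z"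
    by auto
  obtain w where w: "v = j w" "w \<in> carrier (obj V X)"
    using v by auto
  show "mor (transport j g V) X Z (compose X h f) v = mor (transport j g V) Y Z h (mor (transport j g V) X Y f v)"
    using w fi_moduleD(4)[OF V X Y Z f h w(2)] gj[OF X w(2)] gj[OF Y module_homD(1)[OF fi_moduleD(2)[OF V X Y f] w(2)]]
    by simp
qed

lemma transport_to: "fi_map R V (transport j g V) (\<lambda>X. j)"
  unfolding fi_map_def
proof (intro conjI allI impI ballI)
  fix X :: "nat set" assume X: "finite X"
  show "module_hom R (obj V X) (obj (transport j g V) X) j"
    by (auto simp: module_hom_def gj[OF X])
qed (auto simp: gj)

lemma transport_from: "fi_map R (transport j g V) V (\<lambda>X. g)"
  unfolding fi_map_def
proof (intro conjI allI impI ballI)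
  fix X :: "nat set" assume X: "finite X"
  interpret M: Module.module R "obj V X"
    by (rule fi_moduleD(1)[OF V X])
  show "module_hom R (obj (transport j g V) X) (obj V X) g"
    by (auto simp: module_hom_def gj[OF X])
next
  fix X Y f v assume "finite X \<and> finite Y \<and> f \<in> FI_mor X Y" "v \<in> carrier (obj (transport j g V) X)"
  then show "g (mor (transport j g V) X Y f v) = mor V X Y f (g v)"
    using module_homD(1)[OF fi_moduleD(2)[OF V]] by (auto simp: gj)
qed

end

lemma fi_map_compose:
  assumes "fi_map R U V \<phi>" "fi_map R V W \<psi>"
  shows "fi_map R U W (\<lambda>X x. \<psi> X (\<phi> X x))"
  unfolding fi_map_def
proof (intro conjI allI impI ballI)
  fix X :: "nat set" assume X: "finite X"
  show "module_hom R (obj U X) (obj W X) (\<lambda>x. \<psi> X (\<phi> X x))"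
    by (rule module_hom_compose[OF fi_mapD(1)[OF assms(1) X] fi_mapD(1)[OF assms(2) X]])
next
  fix X Y f v assume "finite X \<and> finite Y \<and> f \<in> FI_mor X Y" and v: "v \<in> carrier (obj U X)"
  then have X: "finite X" and Y: "finite Y" and f: "f \<in> FI_mor X Y" by auto
  show "\<psi> Y (\<phi> Y (mor U X Y f v)) = mor W X Y f (\<psi> X (\<phi> X v))"
    using fi_mapD(2)[OF assms(1) X Y f v] fi_mapD(2)[OF assms(2) X Y f module_homD(1)[OF fi_mapD(1)[OF assms(1) X] v]]
    by simp
qed

definition wrap :: "'a \<Rightarrow> ('k \<times> 'a) list" where
  "wrap a = [(undefined, a)]"

definition unwrap :: "('k \<times> 'a) list \<Rightarrow> 'a" where
  "unwrap x = snd (hd x)"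

lemma unwrap_wrap [simp]: "unwrap (wrap a) = a"
  by (simp add: wrap_def unwrap_def)

lemma inj_wrap: "inj wrap"
  by (metis injI unwrap_wrap)

text \<open>One encoding serves all FI-modules over the same element type, because the carriers of
  their free FI-modules all consist of finitely supported functions.\<close>

lemma ex_ffree_encoding:
  fixes R :: "('k, 'r) ring_scheme" and i :: "'b \<Rightarrow> ('k \<times> 'a) list"
  assumes "inj i"
  shows "\<exists>(j :: (nat list \<times> 'b \<Rightarrow> 'k) \<Rightarrow> ('k, 'a) fi_univ) g.
    \<forall>(V :: ('k, 'b) fi_mod) X x. x \<in> carrier (obj (free_fi R V) X) \<longrightarrow> g (j x) = x"
proof -
  obtain j :: "(nat list \<times> 'b \<Rightarrow> 'k) \<Rightarrow> ('k \<times> 'a) list" where j: "inj_on j {c. finite {b. c b \<noteq> \<zero>\<^bsub>R\<^esub>}}"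
    using ex_encoding[OF assms] by blast
  have "inv_into {c. finite {b. c b \<noteq> \<zero>\<^bsub>R\<^esub>}} j (j x) = x" if "x \<in> carrier (obj (free_fi R V) X)"
    for x X and V :: "('k, 'b) fi_mod"
    using that free_carrierD(3)[of x R "basis V X"] by (intro inv_into_f_f[OF j]) simp
  then show ?thesis
    by blast
qed

text \<open>Projectivity is stated for targets in \<open>fi_univ\<close>, so \<open>P\<close> and
  the free FI-module covering it are both copied into that type; lifting the identification of
  \<open>P\<close> with its copy gives the section.\<close>

lemma projective_section:
  fixes P :: "('k, 'p) fi_mod"
  assumes R: "cring R" and P: "fi_projective R P"
  shows "\<exists>s. fi_map R P (free_fi R P) s \<and> (\<forall>X. finite X \<longrightarrow> (\<forall>x\<in>carrier (obj P X). counit R P X (s X x) = x))"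
proof -
  have Pm: "fi_module R P"
    using P by (simp add: fi_projective_def)
  note Fm = free_fi_fi_module[OF R, of P] and co = counit[OF R Pm]
  obtain j :: "(nat list \<times> 'p \<Rightarrow> 'k) \<Rightarrow> ('k, 'p) fi_univ" and g
    where jg: "\<And>(V :: ('k, 'p) fi_mod) X x. x \<in> carrier (obj (free_fi R V) X) \<Longrightarrow> g (j x) = x"
    using ex_ffree_encoding[of "wrap :: 'p \<Rightarrow> ('k, 'p) fi_univ" R] inj_wrap by blast
  let ?M = "transport j g (free_fi R P)" and ?N = "transport wrap unwrap P :: ('k, ('k, 'p) fi_univ) fi_mod"
  let ?e = "\<lambda>X x. wrap (counit R P X (g x)) :: ('k, 'p) fi_univ"
  have M: "fi_module R ?M" and Mg: "fi_map R ?M (free_fi R P) (\<lambda>X. g)"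
    using transport_fi_module[OF Fm, of g j] transport_from[OF Fm, of g j] jg by blast+
  have N: "fi_module R ?N" and Nw: "fi_map R P ?N (\<lambda>X. wrap)"
    using transport_fi_module[OF Pm, of unwrap wrap] transport_to[OF Pm, of unwrap wrap] by simp_all
  have e: "fi_map R ?M ?N ?e"
    by (rule fi_map_compose[OF fi_map_compose[OF Mg co(1)] Nw])
  have es: "fi_surj ?M ?N ?e"
    unfolding fi_surj_def fi_im_def
  proof (intro allI impI)
    fix X :: "nat set" assume X: "finite X"
    have "?e X ` carrier (obj ?M X) = wrap ` counit R P X ` g ` j ` carrier (obj (free_fi R P) X)"
      by (simp only: transport_simps image_image)
    also have "g ` j ` carrier (obj (free_fi R P) X) = carrier (obj (free_fi R P) X)"
      using jg by (force simp: image_image)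
    also have "counit R P X ` carrier (obj (free_fi R P) X) = carrier (obj P X)"
      using co(2) X by (simp only: fi_surj_def fi_im_def)
    finally show "?e X ` carrier (obj ?M X) = carrier (obj ?N X)"
      by simp
  qed
  obtain s where s: "fi_map R P ?M s" "\<And>X x. finite X \<Longrightarrow> x \<in> carrier (obj P X) \<Longrightarrow> ?e X (s X x) = wrap x"
    using P[unfolded fi_projective_def, THEN conjunct2, rule_format, of ?M ?N ?e "\<lambda>X. wrap"] M N e es Nw by blast
  have "counit R P X (g (s X x)) = x" if "finite X" "x \<in> carrier (obj P X)" for X x
    using arg_cong[OF s(2)[OF that], of unwrap] by simp
  then show ?thesis
    using fi_map_compose[OF s(1) Mg] by (intro exI[of _ "\<lambda>X x. g (s X x)"]) blast
qed

text \<open>A section of the \<open>counit\<close> makes \<open>P\<close> a retract of a free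
  FI-module: a restriction goes up by the section, discards generators and comes back. Section and
  counit are natural, so compatibility with inclusions is inherited from the free FI-module.\<close>

lemma projective_retractive:
  assumes R: "cring R" and P: "fi_projective R P"
  shows "\<exists>q. retractive UNIV (frag_map P) q (frag_over P (whole_sub P)) (frag_over P (zero_sub P))"
proof -
  have Pm: "fi_module R P"
    using P by (simp add: fi_projective_def)
  note Fm = free_fi_fi_module[OF R, of P] and co = counit[OF R Pm]
  obtain s where s: "fi_map R P (free_fi R P) s" "\<And>X x. finite X \<Longrightarrow> x \<in> carrier (obj P X) \<Longrightarrow> counit R P X (s X x) = x"
    using projective_section[OF R P] by blast
  define f where "f X Y v = counit R P Y (free_fi_proj R P Y (s X v))" for X Y v
  define q where "q X Y = (if finite X \<and> Y \<subseteq> X then frag_extend (frag_of \<circ> f X Y) else (\<lambda>_. 0))" for X Y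
  have f: "module_hom R (obj P X) (obj P Y) (f X Y)" if "finite X" "finite Y" for X Y
    unfolding f_def
    by (rule module_hom_compose[OF module_hom_compose[OF fi_mapD(1)[OF s(1) that(1), unfolded free_fi_simps(1)] free_fi_proj_hom[OF R]]
        fi_mapD(1)[OF co(1) that(2), unfolded free_fi_simps(1)]])
  have fin: "finite Y" if "finite X" "Y \<subseteq> X" for X Y :: "nat set"
    using that finite_subset by blast
  have q_evm: "q X Y u \<in> fset (carrier (obj P Y))" "frag_eval (obj P Y) (q X Y u) = f X Y (frag_eval (obj P X) u)"
    if "finite X" "Y \<subseteq> X" "u \<in> fset (carrier (obj P X))" for X Y u
    using frag_eval_hom[OF fi_moduleD(1)[OF Pm that(1)] fi_moduleD(1)[OF Pm fin[OF that(1,2)]] f[OF that(1) fin[OF that(1,2)]] that(3)] that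
    by (simp_all add: q_def)
  have s_car: "s X v \<in> free_carrier R (basis P X)" if "finite X" "v \<in> carrier (obj P X)" for X v
    using module_homD(1)[OF fi_mapD(1)[OF s(1) that(1)] that(2)] by simp
  have proj_id: "free_fi_proj R P X c = c" if "c \<in> free_carrier R (basis P X)" for X c
    using free_carrierD(2)[OF that] by (auto simp: free_fi_proj_def fun_eq_iff)
  have f_inc: "f X Y (mor P Z X (inc Z) v) = mor P (Z \<inter> Y) Y (inc (Z \<inter> Y)) (f Z (Z \<inter> Y) v)"
    if X: "finite X" "Y \<subseteq> X" "Z \<subseteq> X" and v: "v \<in> carrier (obj P Z)" for X Y Z v
  proof -
    note fZ = fin[OF X(1,3)] and fY = fin[OF X(1,2)]
    have fZY: "finite (Z \<inter> Y)"
      using fZ by simp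
    have "s X (mor P Z X (inc Z) v) = s Z v"
      using fi_mapD(2)[OF s(1) fZ X(1) inc_FI_mor[OF X(3)] v] free_fi_mor_inc[OF R X(3) s_car[OF fZ v]] by simp
    moreover have "free_fi_proj R P Y (s Z v) = free_fi_proj R P (Z \<inter> Y) (s Z v)"
      using free_carrierD(2)[OF s_car[OF fZ v]] basis_Int[of _ P Z Y] by (auto simp: free_fi_proj_def fun_eq_iff)
    moreover have pc: "free_fi_proj R P (Z \<inter> Y) (s Z v) \<in> free_carrier R (basis P (Z \<inter> Y))"
      using module_homD(1)[OF free_fi_proj_hom[OF R, of P Z "Z \<inter> Y"]] s_car[OF fZ v] by simp
    moreover have "mor P (Z \<inter> Y) Y (inc (Z \<inter> Y)) (counit R P (Z \<inter> Y) (free_fi_proj R P (Z \<inter> Y) (s Z v))) =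
        counit R P Y (mor (free_fi R P) (Z \<inter> Y) Y (inc (Z \<inter> Y)) (free_fi_proj R P (Z \<inter> Y) (s Z v)))"
      by (rule fi_mapD(2)[OF co(1) fZY fY inc_FI_mor[OF Int_lower2], symmetric]) (use pc in simp)
    moreover have "mor (free_fi R P) (Z \<inter> Y) Y (inc (Z \<inter> Y)) (free_fi_proj R P (Z \<inter> Y) (s Z v)) = free_fi_proj R P (Z \<inter> Y) (s Z v)"
      by (rule free_fi_mor_inc[OF R Int_lower2 pc])
    ultimately show ?thesis
      unfolding f_def by simp
  qed
  have car: "u \<in> fset (carrier (obj P X))" if "finite X" "u \<in> frag_over P (whole_sub P) X" for X u
    using that by (simp add: frag_over_iff)
  have "retractive UNIV (frag_map P) q (frag_over P (whole_sub P)) (frag_over P (zero_sub P))"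
    unfolding retractive_def
  proof (intro conjI allI impI ballI)
    show "additive (q X Y)" for X Y
      by (auto simp: q_def additive_frag_extend intro: additive.intro)
  next
    fix X Y :: "nat set" and u assume X: "finite X" "Y \<subseteq> X"
    note fY = fin[OF X]
    show "q X Y u \<in> frag_over P (whole_sub P) Y" if "u \<in> frag_over P (whole_sub P) X"
      using q_evm(1)[OF X car[OF X(1) that]] frag_over_tot_iff[OF Pm fY] by blast
    show "q X Y u \<in> frag_over P (zero_sub P) Y" if u: "u \<in> frag_over P (zero_sub P) X"
    proof -
      have "u \<in> fset (carrier (obj P X))" "frag_eval (obj P X) u = \<zero>\<^bsub>obj P X\<^esub>"
        using u X(1) by (simp_all add: frag_over_iff zero_sub_def)
      then show ?thesis
        using q_evm[OF X] module_hom_zero[OF fi_moduleD(1)[OF Pm X(1)] fi_moduleD(1)[OF Pm fY] f[OF X(1) fY]]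
        by (simp add: frag_over_iff fY zero_sub_def)
    qed
  next
    fix X :: "nat set" and u assume X: "finite X" and u: "u \<in> frag_over P (whole_sub P) X"
    note uc = car[OF X u] and ab = fi_module_abelian[OF Pm X]
    note ec = frag_eval_closed[OF ab uc]
    interpret M: Module.module R "obj P X"
      by (rule fi_moduleD(1)[OF Pm X])
    have "f X X (frag_eval (obj P X) u) = frag_eval (obj P X) u"
      using s(2)[OF X ec] proj_id[OF s_car[OF X ec]] by (simp add: f_def)
    then have "frag_eval (obj P X) (q X X u - u) = \<zero>\<^bsub>obj P X\<^esub>"
      using q_evm[OF X subset_refl uc] ec by (simp add: frag_eval_diff[OF ab _ uc] a_minus_def M.r_neg)
    then show "q X X u - u \<in> frag_over P (zero_sub P) X"
      using fset_diff[OF q_evm(1)[OF X subset_refl uc] uc] X by (simp add: frag_over_iff zero_sub_def)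
  next
    fix X Y Z :: "nat set" and u assume X: "finite X" "Y \<subseteq> X" "Z \<subseteq> X" and u: "u \<in> frag_over P (whole_sub P) Z"
    note fZ = fin[OF X(1,3)] and fY = fin[OF X(1,2)]
    note uc = car[OF fZ u] and ab = fi_module_abelian[OF Pm fY]
    interpret M: Module.module R "obj P Y"
      by (rule fi_moduleD(1)[OF Pm fY])
    note l1 = frag_map_evm[OF Pm X(1,3) uc] and q1 = q_evm[OF fZ Int_lower1 uc, of Y]
    note q2 = q_evm[OF X(1,2) l1(1)] and l2 = frag_map_evm[OF Pm fY Int_lower2 q1(1)]
    have "frag_eval (obj P Y) (q X Y (frag_map P Z X u)) = frag_eval (obj P Y) (frag_map P (Z \<inter> Y) Y (q Z (Z \<inter> Y) u))"
      using f_inc[OF X frag_eval_closed[OF fi_module_abelian[OF Pm fZ] uc]] q2(2) l2(2) l1(2) q1(2) by simp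
    then have "frag_eval (obj P Y) (q X Y (frag_map P Z X u) - frag_map P (Z \<inter> Y) Y (q Z (Z \<inter> Y) u)) = \<zero>\<^bsub>obj P Y\<^esub>"
      using frag_eval_closed[OF ab l2(1)] by (simp add: frag_eval_diff[OF ab q2(1) l2(1)] a_minus_def M.r_neg)
    then show "q X Y (frag_map P Z X u) - frag_map P (Z \<inter> Y) Y (q Z (Z \<inter> Y) u) \<in> frag_over P (zero_sub P) Y"
      using fset_diff[OF q2(1) l2(1)] fY by (simp add: frag_over_iff zero_sub_def)
  qed
  then show ?thesis by blast
qed

lemma projective_acyclic:
  assumes "cring R" "fi_projective R P" "finite X"
  shows "fi_koszul_zero P (whole_sub P) (zero_sub P) (Suc a) X"
proof -
  have P: "fi_module R P"
    using assms(2) by (simp add: fi_projective_def)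
  obtain q where "retractive UNIV (frag_map P) q (frag_over P (whole_sub P)) (frag_over P (zero_sub P))"
    using projective_retractive[OF assms(1,2)] by blast
  then show ?thesis
    unfolding fi_koszul_zero_def using functor_pair_lift[OF P fi_subsys_triv[OF P]] by (intro koszul_zero_retractive[OF assms(3)]) auto
qed

section \<open>Existence of projective resolutions\<close>

lemma fi_ker_submodule:
  assumes "fi_module R P" "fi_module R W" "fi_map R P W \<phi>" "finite X"
  shows "submodule (fi_ker P W \<phi> X) R (obj P X)"
proof -
  interpret P: Module.module R "obj P X"
    by (rule fi_moduleD(1)[OF assms(1,4)])
  interpret W: Module.module R "obj W X"
    by (rule fi_moduleD(1)[OF assms(2,4)])
  note hom = fi_mapD(1)[OF assms(3,4)]
  note mm = module_hom_minus[OF P.module_axioms W.module_axioms hom]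
  have z: "\<phi> X \<zero>\<^bsub>obj P X\<^esub> = \<zero>\<^bsub>obj W X\<^esub>"
    by (rule module_hom_zero[OF P.module_axioms W.module_axioms hom])
  show ?thesis
  proof (rule P.submoduleI)
    show "\<ominus>\<^bsub>obj P X\<^esub> a \<in> fi_ker P W \<phi> X" if "a \<in> fi_ker P W \<phi> X" for a
      using that mm[of "\<zero>\<^bsub>obj P X\<^esub>" a] z by (auto simp: fi_ker_def a_kernel_def' a_minus_def)
  qed (auto simp: fi_ker_def a_kernel_def' z module_homD[OF hom])
qed

lemma fi_sub_ker_module:
  assumes P: "fi_module R P" and W: "fi_module R W" and phi: "fi_map R P W \<phi>"
  shows "fi_module R (fi_sub P (fi_ker P W \<phi>))"
proof -
  have kc: "fi_ker P W \<phi> X \<subseteq> carrier (obj P X)" for X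
    by (auto simp: fi_ker_def a_kernel_def')
  show ?thesis
    unfolding fi_module_def
  proof (intro conjI allI impI ballI)
    fix X :: "nat set" assume X: "finite X"
    show "Module.module R (obj (fi_sub P (fi_ker P W \<phi>)) X)"
      using submodule.submodule_is_module[OF fi_ker_submodule[OF assms X] fi_moduleD(1)[OF P X]] by (simp add: fi_sub_def)
    show "mor (fi_sub P (fi_ker P W \<phi>)) X X (restrict id X) v = v"
      if "v \<in> carrier (obj (fi_sub P (fi_ker P W \<phi>)) X)" for v
      using that kc fi_moduleD(3)[OF P X] by (auto simp: fi_sub_def)
  next
    fix X Y f assume "finite X \<and> finite Y \<and> f \<in> FI_mor X Y"
    then have X: "finite X" and Y: "finite Y" and f: "f \<in> FI_mor X Y" by auto
    note hom = module_homD[OF fi_moduleD(2)[OF P X Y f]]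
    have "mor P X Y f v \<in> fi_ker P W \<phi> Y" if "v \<in> fi_ker P W \<phi> X" for v
      using that hom(1) fi_mapD(2)[OF phi X Y f, of v]
        module_hom_zero[OF fi_moduleD(1)[OF W X] fi_moduleD(1)[OF W Y] fi_moduleD(2)[OF W X Y f]]
      by (auto simp: fi_ker_def a_kernel_def')
    then show "module_hom R (obj (fi_sub P (fi_ker P W \<phi>)) X) (obj (fi_sub P (fi_ker P W \<phi>)) Y)
        (mor (fi_sub P (fi_ker P W \<phi>)) X Y f)"
      using kc hom(2,3) by (auto simp: module_hom_def fi_sub_def subset_iff)
  next
    fix X Y Z f g v assume "finite X \<and> finite Y \<and> finite Z \<and> f \<in> FI_mor X Y \<and> g \<in> FI_mor Y Z"
      "v \<in> carrier (obj (fi_sub P (fi_ker P W \<phi>)) X)"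
    then show "mor (fi_sub P (fi_ker P W \<phi>)) X Z (compose X g f) v =
        mor (fi_sub P (fi_ker P W \<phi>)) Y Z g (mor (fi_sub P (fi_ker P W \<phi>)) X Y f v)"
      using kc fi_moduleD(4)[OF P, of X Y Z f g v] by (auto simp: fi_sub_def)
  qed
qed

text \<open>The cover is the free FI-module on \<open>W\<close>, copied into \<open>fi_univ\<close>.
  Its projectivity refers to the universe over its own, larger element type; this does no harm, as
  free FI-modules lift against epimorphisms in every type.\<close>

lemma ex_projective_cover:
  fixes W :: "('k, 'b) fi_mod"
  assumes R: "cring R" and W: "fi_module R W" and i: "inj (i :: 'b \<Rightarrow> ('k, 'a) fi_univ)"
  shows "\<exists>(Q :: ('k, ('k, 'a) fi_univ) fi_mod) p. fi_projective R Q \<and> fi_map R Q W p \<and> fi_surj Q W p"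
proof -
  obtain j :: "(nat list \<times> 'b \<Rightarrow> 'k) \<Rightarrow> ('k, 'a) fi_univ" and g
    where jg: "\<And>(V :: ('k, 'b) fi_mod) X x. x \<in> carrier (obj (free_fi R V) X) \<Longrightarrow> g (j x) = x"
    using ex_ffree_encoding[OF i, of R] by blast
  note Fm = free_fi_fi_module[OF R, of W] and co = counit[OF R W]
  let ?Q = "transport j g (free_fi R W)"
  have Q: "fi_module R ?Q" and Qg: "fi_map R ?Q (free_fi R W) (\<lambda>X. g)" and Qj: "fi_map R (free_fi R W) ?Q (\<lambda>X. j)"
    using transport_fi_module[OF Fm, of g j] transport_from[OF Fm, of g j] transport_to[OF Fm, of g j] jg by blast+
  have gj: "g ` j ` carrier (obj (free_fi R W) X) = carrier (obj (free_fi R W) X)" for X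
    using jg by (force simp: image_image)
  have "fi_projective R ?Q"
    unfolding fi_projective_def
  proof (intro conjI Q allI impI)
    fix M N :: "('k, ('k, ('k, 'a) fi_univ) fi_univ) fi_mod" and e h
    assume a: "fi_module R M \<and> fi_module R N \<and> fi_map R M N e \<and> fi_surj M N e \<and> fi_map R ?Q N h"
    then have M: "fi_module R M" and N: "fi_module R N" and e: "fi_map R M N e" "fi_surj M N e"
      and h: "fi_map R ?Q N h"
      by auto
    from free_fi_lifting[OF R M N e fi_map_compose[OF Qj h]] obtain t
      where t1: "fi_map R (free_fi R W) M t" and
        t2: "\<forall>X. finite X \<longrightarrow> (\<forall>x\<in>carrier (obj (free_fi R W) X). e X (t X x) = h X (j x))"
      by (elim exE conjE)
    have "e X (t X (g x)) = h X x" if X: "finite X" and x: "x \<in> carrier (obj ?Q X)" for X x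
    proof -
      obtain y where y: "x = j y" "y \<in> carrier (obj (free_fi R W) X)"
        using x by auto
      then show ?thesis
        using t2 X jg[OF y(2)] by simp
    qed
    then show "\<exists>g'. fi_map R ?Q M g' \<and> (\<forall>X. finite X \<longrightarrow> (\<forall>x\<in>carrier (obj ?Q X). e X (g' X x) = h X x))"
      using fi_map_compose[OF Qg t1] by (intro exI[of _ "\<lambda>X x. t X (g x)"]) blast
  qed
  moreover have "fi_map R ?Q W (\<lambda>X x. counit R W X (g x))"
    by (rule fi_map_compose[OF Qg co(1)])
  moreover have "fi_surj ?Q W (\<lambda>X x. counit R W X (g x))"
    unfolding fi_surj_def fi_im_def
  proof (intro allI impI)
    fix X :: "nat set" assume "finite X"
    have "(\<lambda>x. counit R W X (g x)) ` carrier (obj ?Q X) = counit R W X ` g ` j ` carrier (obj (free_fi R W) X)"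
      by (simp only: transport_simps image_image)
    also have "\<dots> = carrier (obj W X)"
      unfolding gj using co(2) \<open>finite X\<close> by (simp only: fi_surj_def fi_im_def)
    finally show "(\<lambda>x. counit R W X (g x)) ` carrier (obj ?Q X) = carrier (obj W X)" .
  qed
  ultimately show ?thesis
    by blast
qed

text \<open>Every kernel has its elements again in \<open>fi_univ\<close>, so the identity serves as
  the encoding for all covers after the first, and the type does not grow along the
  resolution.\<close>

lemma ex_projective_resolution:
  fixes V :: "('k, 'a) fi_mod"
  assumes R: "cring R" and V: "fi_module R V"
  shows "\<exists>(P :: nat \<Rightarrow> ('k, ('k, 'a) fi_univ) fi_mod) D \<epsilon>. fi_projective_resolution R V P D \<epsilon>"
proof -
  obtain Q0 :: "('k, ('k, 'a) fi_univ) fi_mod" and \<epsilon> where Q0: "fi_projective R Q0" "fi_map R Q0 V \<epsilon>" "fi_surj Q0 V \<epsilon>"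
    using ex_projective_cover[OF R V, of "wrap :: 'a \<Rightarrow> ('k, 'a) fi_univ"] inj_wrap by blast
  define good where "good W Q p \<longleftrightarrow> fi_projective R Q \<and> fi_map R Q W p \<and> fi_surj Q W p"
    for W Q :: "('k, ('k, 'a) fi_univ) fi_mod" and p
  define cov where "cov W = (SOME Qp. good W (fst Qp) (snd Qp))" for W
  have cov: "good W (fst (cov W)) (snd (cov W))" if "fi_module R W" for W
  proof -
    have "\<exists>Qp. good W (fst Qp) (snd Qp)"
      using ex_projective_cover[OF R that, of "\<lambda>x. x"] by (auto simp: good_def)
    then show ?thesis
      unfolding cov_def by (rule someI_ex)
  qed
  define S where "S = rec_nat (fi_sub Q0 (fi_ker Q0 V \<epsilon>)) (\<lambda>_ W. fi_sub (fst (cov W)) (fi_ker (fst (cov W)) W (snd (cov W))))"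
  have S0: "S 0 = fi_sub Q0 (fi_ker Q0 V \<epsilon>)"
    and SS: "S (Suc n) = fi_sub (fst (cov (S n))) (fi_ker (fst (cov (S n))) (S n) (snd (cov (S n))))" for n
    by (simp_all add: S_def)
  have Q0m: "fi_module R Q0"
    using Q0(1) by (simp add: fi_projective_def)
  have Sm: "fi_module R (S n)" for n
  proof (induct n)
    case 0
    show ?case
      unfolding S0 by (rule fi_sub_ker_module[OF Q0m V Q0(2)])
  next
    case (Suc n)
    show ?case
      unfolding SS
    proof (rule fi_sub_ker_module[OF _ Suc])
      show "fi_module R (fst (cov (S n)))" "fi_map R (fst (cov (S n))) (S n) (snd (cov (S n)))"
        using cov[OF Suc] unfolding good_def fi_projective_def by blast+
    qed
  qed
  define P where "P n = (case n of 0 \<Rightarrow> Q0 | Suc m \<Rightarrow> fst (cov (S m)))" for n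
  define D where "D n = snd (cov (S n))" for n
  have P0: "P 0 = Q0" and PS: "P (Suc n) = fst (cov (S n))" for n
    by (simp_all add: P_def)
  have cS: "fi_projective R (P (Suc n))" "fi_map R (P (Suc n)) (S n) (D n)" "fi_surj (P (Suc n)) (S n) (D n)" for n
    using cov[OF Sm[of n]] by (simp_all add: good_def PS D_def)
  \<comment> \<open>The covers map onto kernels; the same functions are read as maps into the whole
    terms of the resolution.\<close>
  have sub_map: "fi_map R A B f" if "fi_map R A (fi_sub B K) f" "\<And>X. K X \<subseteq> carrier (obj B X)"
    for A :: "('k, ('k, 'a) fi_univ) fi_mod" and B :: "('k, ('k, 'a) fi_univ) fi_mod" and K f
    using that unfolding fi_map_def module_hom_def fi_sub_def by (auto simp: Pi_iff subset_iff)
  have kc: "fi_ker A B f X \<subseteq> carrier (obj A X)" for A :: "('k, 'x) fi_mod" and B :: "('k, 'y) fi_mod" and f X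
    by (auto simp: fi_ker_def a_kernel_def')
  have SP: "S n = fi_sub (P n) (case n of 0 \<Rightarrow> fi_ker Q0 V \<epsilon> | Suc m \<Rightarrow> fi_ker (P (Suc m)) (S m) (D m))" for n
    by (cases n) (simp_all add: S0 SS P0 PS D_def)
  have Dmap: "fi_map R (P (Suc n)) (P n) (D n)" for n
    by (rule sub_map[OF cS(2)[of n, unfolded SP[of n]]]) (cases n; simp add: P0 kc)
  have im: "fi_im (P (Suc n)) (D n) X = carrier (obj (S n) X)" if "finite X" for n X
    using cS(3)[of n] that by (simp add: fi_surj_def)
  have zero: "\<zero>\<^bsub>obj (S n) X\<^esub> = \<zero>\<^bsub>obj (P n) X\<^esub>" for n X
    by (simp add: SP[of n] fi_sub_def)
  have "fi_projective_resolution R V P D \<epsilon>"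
    unfolding fi_projective_resolution_def
  proof (intro conjI allI)
    show "fi_projective R (P n)" for n
      by (cases n) (simp_all add: P0 Q0 cS(1))
    show "fi_map R (P (Suc n)) (P n) (D n)" for n
      by (rule Dmap)
    show "fi_map R (P 0) V \<epsilon>" "fi_surj (P 0) V \<epsilon>"
      by (simp_all add: P0 Q0)
    show "fi_exact (P (Suc 0)) (P 0) V (D 0) \<epsilon>"
      unfolding fi_exact_def using im[of _ 0] by (simp add: S0 P0 fi_sub_def)
    show "fi_exact (P (Suc (Suc n))) (P (Suc n)) (P n) (D (Suc n)) (D n)" for n
      unfolding fi_exact_def
    proof (intro allI impI)
      fix X :: "nat set" assume "finite X"
      then have "fi_im (P (Suc (Suc n))) (D (Suc n)) X = fi_ker (P (Suc n)) (S n) (D n) X"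
        using im[of X "Suc n"] by (simp add: SP[of "Suc n"] fi_sub_def)
      then show "fi_im (P (Suc (Suc n))) (D (Suc n)) X = fi_ker (P (Suc n)) (P n) (D n) X"
        by (simp add: fi_ker_def a_kernel_def' zero)
    qed
  qed
  then show ?thesis by blast
qed

text \<open>The resolution in \<open>fi_H\<close> is a choice; since resolutions exist, the chosen
  one is a resolution, and the comparison holds whichever it is.\<close>

theorem fi_H_trivial_iff:
  fixes V :: "('k, 'a) fi_mod"
  assumes R: "cring R" and V: "fi_module R V" and X: "finite X"
  shows "carrier (obj (fi_H R a V) X) = {\<zero>\<^bsub>obj (fi_H R a V) X\<^esub>} \<longleftrightarrow> fi_koszul_zero V (whole_sub V) (zero_sub V) a X"
proof -
  obtain P D where PD: "fi_resolution R V = (P, D)"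
    by (metis prod.exhaust)
  have "\<exists>PD. case PD of (P, D) \<Rightarrow> \<exists>\<epsilon>. fi_projective_resolution R V (P :: nat \<Rightarrow> ('k, ('k, 'a) fi_univ) fi_mod) D \<epsilon>"
    using ex_projective_resolution[OF R V] by auto
  from someI_ex[OF this] have "\<exists>\<epsilon>. fi_projective_resolution R V P D \<epsilon>"
    using PD unfolding fi_resolution_def by simp
  then obtain \<epsilon> where res: "fi_projective_resolution R V P D \<epsilon>"
    by blast
  then have proj: "\<And>n. fi_projective R (P n)"
    unfolding fi_projective_resolution_def by blast
  have acyc: "fi_koszul_zero (P n) (whole_sub (P n)) (zero_sub (P n)) (Suc a) X" if "finite X" for n a X
    by (rule projective_acyclic[OF R proj that])
  show ?thesis
    using fi_H_0_trivial_iff[OF V res PD acyc X] fi_H_Suc_trivial_iff[OF V res PD acyc X] by (cases a) auto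
qed

section \<open>Degrees of FI-homology\<close>

lemma sg_image:
  assumes p: "strict_mono_on X p" and x: "x \<in> X" and T: "T \<subseteq> X"
  shows "sg (p x) (p ` T) v = sg x T v"
proof -
  have inj: "inj_on p X"
    by (rule strict_mono_on_imp_inj_on[OF p])
  have "{t \<in> p ` T. t < p x} = p ` {t \<in> T. t < x}"
    using strict_mono_on_less[OF p _ x] T by auto
  moreover have "card (p ` {t \<in> T. t < x}) = card {t \<in> T. t < x}"
    using T by (intro card_image inj_on_subset[OF inj]) auto
  ultimately show ?thesis
    by (simp add: sg_def)
qed

text \<open>A monotone relabelling keeps the rank of a point among the removed ones, hence the
  signs; the differentials then agree term by term.\<close>

lemma koszul_bd_relabel:
  assumes p: "strict_mono_on X p" and T: "T \<subseteq> X"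
  shows "koszul_bd (\<lambda>A B. i (p ` A) (p ` B)) X (\<lambda>T. c (p ` T)) T = koszul_bd i (p ` X) c (p ` T)"
proof -
  have inj: "inj_on p X"
    by (rule strict_mono_on_imp_inj_on[OF p])
  have d: "p ` (X - S) = p ` X - p ` S" if "S \<subseteq> X" for S
    by (rule inj_on_image_set_diff[OF inj]) (use that in auto)
  have "koszul_bd i (p ` X) c (p ` T) = (\<Sum>y\<in>p ` (X - T). sg y (p ` T) (i (p ` X - insert y (p ` T)) (p ` X - p ` T) (c (insert y (p ` T)))))"
    by (simp add: koszul_bd_def d[OF T])
  also have "\<dots> = (\<Sum>x\<in>X - T. sg (p x) (p ` T) (i (p ` X - insert (p x) (p ` T)) (p ` X - p ` T) (c (insert (p x) (p ` T)))))"
    by (subst sum.reindex) (auto intro: inj_on_subset[OF inj])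
  also have "\<dots> = koszul_bd (\<lambda>A B. i (p ` A) (p ` B)) X (\<lambda>T. c (p ` T)) T"
    unfolding koszul_bd_def
  proof (rule sum.cong[OF refl])
    fix x assume x: "x \<in> X - T"
    then have "p ` (X - insert x T) = p ` X - insert (p x) (p ` T)"
      using d[of "insert x T"] T by simp
    then show "sg (p x) (p ` T) (i (p ` X - insert (p x) (p ` T)) (p ` X - p ` T) (c (insert (p x) (p ` T)))) =
        sg x T (i (p ` (X - insert x T)) (p ` (X - T)) (c (p ` insert x T)))"
      using sg_image[OF p _ T, of x] x d[OF T] by simp
  qed
  finally show ?thesis by simp
qed

lemma chain_relabel:
  assumes inj: "inj_on p X"
  shows "chain (\<lambda>A. F (p ` A)) a X (\<lambda>T. c (p ` T)) \<longleftrightarrow> chain F a (p ` X) c"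
proof
  have d: "p ` (X - S) = p ` X - p ` S" if "S \<subseteq> X" for S
    by (rule inj_on_image_set_diff[OF inj]) (use that in auto)
  have k: "card (p ` S) = card S" if "S \<subseteq> X" for S
    by (rule card_image[OF inj_on_subset[OF inj that]])
  {
    assume c: "chain F a (p ` X) c"
    show "chain (\<lambda>A. F (p ` A)) a X (\<lambda>T. c (p ` T))"
    proof (rule chainI)
      fix T assume T: "T \<subseteq> X" "card T = a"
      show "c (p ` T) \<in> F (p ` (X - T))"
        using chainD[OF c image_mono[OF T(1)]] T k d by simp
    qed
  next
    assume c: "chain (\<lambda>A. F (p ` A)) a X (\<lambda>T. c (p ` T))"
    show "chain F a (p ` X) c"
    proof (rule chainI)
      fix S assume S: "S \<subseteq> p ` X" "card S = a"
      then obtain T where T: "T \<subseteq> X" "S = p ` T"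
        by (auto simp: subset_image_iff)
      then show "c S \<in> F (p ` X - S)"
        using chainD[OF c T(1)] S k d by simp
    qed
  }
qed

lemma koszul_zero_relabel:
  assumes p: "strict_mono_on X p" and k: "koszul_zero (\<lambda>A B. i (p ` A) (p ` B)) (\<lambda>A. L (p ` A)) (\<lambda>A. N (p ` A)) a X"
  shows "koszul_zero i L N a (p ` X)"
proof (rule koszul_zeroI)
  have inj: "inj_on p X"
    by (rule strict_mono_on_imp_inj_on[OF p])
  let ?i = "\<lambda>A B. i (p ` A) (p ` B)"
  fix c assume c: "chain L a (p ` X) c" and cyc: "\<And>b. a = Suc b \<Longrightarrow> chain N b (p ` X) (koszul_bd i (p ` X) c)"
  have koszul_bd: "koszul_bd ?i X (\<lambda>T. e (p ` T)) T = koszul_bd i (p ` X) e (p ` T)" if "T \<subseteq> X" for T e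
    by (rule koszul_bd_relabel[OF p that])
  have "chain (\<lambda>A. N (p ` A)) b X (koszul_bd ?i X (\<lambda>T. c (p ` T)))" if "a = Suc b" for b
    using cyc[OF that] unfolding chain_relabel[OF inj, symmetric] by (simp add: chain_def koszul_bd)
  moreover have "chain (\<lambda>A. L (p ` A)) a X (\<lambda>T. c (p ` T))"
    using c unfolding chain_relabel[OF inj, symmetric] .
  ultimately obtain e' where e': "chain (\<lambda>A. L (p ` A)) (Suc a) X e'"
    "chain (\<lambda>A. N (p ` A)) a X (\<lambda>T. c (p ` T) - koszul_bd ?i X e' T)"
    using koszul_zeroE[OF k] by blast
  \<comment> \<open>The filling \<open>e'\<close> is indexed by subsets of \<open>X\<close>;
    preimages under \<open>p\<close> turn it into one indexed by subsets of the image.\<close>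
  define e where "e S = e' (p -` S \<inter> X)" for S
  have ep: "e (p ` T) = e' T" if "T \<subseteq> X" for T
  proof -
    have "p -` (p ` T) \<inter> X = T"
      using inj that by (auto simp: inj_on_def)
    then show ?thesis
      by (simp add: e_def)
  qed
  have "koszul_bd ?i X e' T = koszul_bd i (p ` X) e (p ` T)" if T: "T \<subseteq> X" for T
  proof -
    have "koszul_bd ?i X (\<lambda>T. e (p ` T)) T = koszul_bd ?i X e' T"
      unfolding koszul_bd_def
    proof (rule sum.cong[OF refl])
      fix x assume "x \<in> X - T"
      then have "insert x T \<subseteq> X"
        using T by auto
      then show "sg x T (i (p ` (X - insert x T)) (p ` (X - T)) (e (p ` insert x T))) =
          sg x T (i (p ` (X - insert x T)) (p ` (X - T)) (e' (insert x T)))"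
        by (simp only: ep)
    qed
    then show ?thesis
      by (simp add: koszul_bd[OF T])
  qed
  then have "chain (\<lambda>A. N (p ` A)) a X (\<lambda>T. c (p ` T) - koszul_bd i (p ` X) e (p ` T))"
    using e'(2) by (simp add: chain_def)
  then have "chain N a (p ` X) (\<lambda>S. c S - koszul_bd i (p ` X) e S)"
    using chain_relabel[OF inj, of N a "\<lambda>S. c S - koszul_bd i (p ` X) e S"] by simp
  moreover have "chain L (Suc a) (p ` X) e"
    using e'(1) unfolding chain_relabel[OF inj, symmetric] by (simp add: chain_def ep)
  ultimately show "\<exists>e. chain L (Suc a) (p ` X) e \<and> chain N a (p ` X) (\<lambda>T. c T - koszul_bd i (p ` X) e T)"
    by blast
qed

lemma restrict_FI_mor: "inj_on p Z \<Longrightarrow> restrict p Z \<in> FI_mor Z (p ` Z)"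
  by (auto simp: FI_mor_def inj_on_def)

lemma compose_restrict_inc:
  "Y \<subseteq> Z \<Longrightarrow> compose Y (restrict p Z) (inc Y) = restrict p Y"
  "compose Y (inc (p ` Y)) (restrict p Y) = restrict p Y"
  by (auto simp: compose_def fun_eq_iff)

lemma mor_restrict_natural:
  assumes V: "fi_module R V" and Z: "finite Z" "Y \<subseteq> Z" "inj_on p Z" and v: "v \<in> carrier (obj V Y)"
  shows "mor V Z (p ` Z) (restrict p Z) (mor V Y Z (inc Y) v) =
    mor V (p ` Y) (p ` Z) (inc (p ` Y)) (mor V Y (p ` Y) (restrict p Y) v)"
proof -
  have fY: "finite Y"
    using Z finite_subset by blast
  note pZ = restrict_FI_mor[OF Z(3)] and pY = restrict_FI_mor[OF inj_on_subset[OF Z(3,2)]]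
  have "mor V Y (p ` Z) (compose Y (restrict p Z) (inc Y)) v = mor V Z (p ` Z) (restrict p Z) (mor V Y Z (inc Y) v)"
    by (rule fi_moduleD(4)[OF V fY Z(1) finite_imageI[OF Z(1)] inc_FI_mor[OF Z(2)] pZ v])
  moreover have "mor V Y (p ` Z) (compose Y (inc (p ` Y)) (restrict p Y)) v =
      mor V (p ` Y) (p ` Z) (inc (p ` Y)) (mor V Y (p ` Y) (restrict p Y) v)"
    by (rule fi_moduleD(4)[OF V fY finite_imageI[OF fY] finite_imageI[OF Z(1)] pY inc_FI_mor[OF image_mono[OF Z(2)]] v])
  ultimately show ?thesis
    by (simp only: compose_restrict_inc(1)[OF Z(2)] compose_restrict_inc(2))
qed

lemma mor_restrict_inverse:
  assumes V: "fi_module R V" and Z: "finite Z" "inj_on p Z"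
  shows "v \<in> carrier (obj V Z) \<Longrightarrow>
      mor V (p ` Z) Z (restrict (inv_into Z p) (p ` Z)) (mor V Z (p ` Z) (restrict p Z) v) = v"
    and "w \<in> carrier (obj V (p ` Z)) \<Longrightarrow>
      mor V Z (p ` Z) (restrict p Z) (mor V (p ` Z) Z (restrict (inv_into Z p) (p ` Z)) w) = w"
    and "w \<in> carrier (obj V (p ` Z)) \<Longrightarrow> mor V (p ` Z) Z (restrict (inv_into Z p) (p ` Z)) w \<in> carrier (obj V Z)"
proof -
  note f = restrict_FI_mor[OF Z(2)]
  have g: "restrict (inv_into Z p) (p ` Z) \<in> FI_mor (p ` Z) Z"
    using Z(2) by (auto simp: FI_mor_def inj_on_def)
  have "compose Z (restrict (inv_into Z p) (p ` Z)) (restrict p Z) = inc Z"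
    "compose (p ` Z) (restrict p Z) (restrict (inv_into Z p) (p ` Z)) = inc (p ` Z)"
    using Z(2) by (auto simp: compose_def fun_eq_iff)
  then show "v \<in> carrier (obj V Z) \<Longrightarrow>
      mor V (p ` Z) Z (restrict (inv_into Z p) (p ` Z)) (mor V Z (p ` Z) (restrict p Z) v) = v"
    and "w \<in> carrier (obj V (p ` Z)) \<Longrightarrow>
      mor V Z (p ` Z) (restrict p Z) (mor V (p ` Z) Z (restrict (inv_into Z p) (p ` Z)) w) = w"
    using fi_moduleD(4)[OF V Z(1) finite_imageI[OF Z(1)] Z(1) f g] fi_moduleD(3)[OF V Z(1)]
      fi_moduleD(4)[OF V finite_imageI[OF Z(1)] Z(1) finite_imageI[OF Z(1)] g f] fi_moduleD(3)[OF V finite_imageI[OF Z(1)]]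
    by simp_all
  show "w \<in> carrier (obj V (p ` Z)) \<Longrightarrow> mor V (p ` Z) Z (restrict (inv_into Z p) (p ` Z)) w \<in> carrier (obj V Z)"
    by (rule module_homD(1)[OF fi_moduleD(2)[OF V finite_imageI[OF Z(1)] Z(1) g]])
qed

text \<open>An FI-module is functorial along the bijection from each \<open>Z\<close> to its image,
  so the values at corresponding sets are isomorphic, naturally along inclusions. Monotonicity of
  \<open>p\<close> takes care of the signs.\<close>

lemma fi_koszul_zero_relabel:
  assumes V: "fi_module R V" and X: "finite X" and p: "strict_mono_on X p"
    and k: "fi_koszul_zero V (whole_sub V) (zero_sub V) a X"
  shows "fi_koszul_zero V (whole_sub V) (zero_sub V) a (p ` X)"
proof -
  have inj: "inj_on p Z" if "Z \<subseteq> X" for Z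
    by (rule inj_on_subset[OF strict_mono_on_imp_inj_on[OF p] that])
  have fin: "finite Z" if "Z \<subseteq> X" for Z
    using that X finite_subset by blast
  define f where "f Z = mor V Z (p ` Z) (restrict p Z)" for Z
  have f: "module_hom R (obj V Z) (obj V (p ` Z)) (f Z)" if "Z \<subseteq> X" for Z
    unfolding f_def by (rule fi_moduleD(2)[OF V fin[OF that] finite_imageI[OF fin[OF that]] restrict_FI_mor[OF inj[OF that]]])
  define r where "r Z u v \<longleftrightarrow> u \<in> fset (carrier (obj V Z)) \<and> v \<in> fset (carrier (obj V (p ` Z))) \<and>
      f Z (frag_eval (obj V Z) u) = frag_eval (obj V (p ` Z)) v" for Z u v
  have ab: "abelian_group (obj V Z)" "abelian_group (obj V (p ` Z))" if "Z \<subseteq> X" for Z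
    using fi_module_abelian[OF V] fin[OF that] by auto
  have m: "Module.module R (obj V Z)" "Module.module R (obj V (p ` Z))" if "Z \<subseteq> X" for Z
    using fi_moduleD(1)[OF V] fin[OF that] by auto
  have "koszul_zero (\<lambda>A B. frag_map V (p ` A) (p ` B)) (\<lambda>A. frag_over V (whole_sub V) (p ` A)) (\<lambda>A. frag_over V (zero_sub V) (p ` A)) a X"
  proof (rule koszul_zero_iso[OF k[unfolded fi_koszul_zero_def] X, where r = r])
    fix Z assume Z: "Z \<subseteq> X"
    note fZ = fin[OF Z] and fpZ = finite_imageI[OF fin[OF Z], of p]
    note hz = module_hom_zero[OF m[OF Z] f[OF Z]]
    show "r Z 0 0"
      using hz by (simp add: r_def frag_eval_zero[OF ab(1)[OF Z]] frag_eval_zero[OF ab(2)[OF Z]])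
    show "r Z (u - u') (v - v')" if "r Z u v" "r Z u' v'" for u v u' v'
      using that fset_diff[of u _ u'] fset_diff[of v _ v'] module_hom_minus[OF m[OF Z] f[OF Z]]
      by (simp add: r_def frag_eval_diff[OF ab(1)[OF Z]] frag_eval_diff[OF ab(2)[OF Z]] frag_eval_closed[OF ab(1)[OF Z]])
    show "r Z (frag_map V Y Z u) (frag_map V (p ` Y) (p ` Z) v)" if "Y \<subseteq> Z" "r Y u v" for Y u v
    proof -
      have u: "u \<in> fset (carrier (obj V Y))" and v: "v \<in> fset (carrier (obj V (p ` Y)))"
        and e: "f Y (frag_eval (obj V Y) u) = frag_eval (obj V (p ` Y)) v"
        using that(2) by (simp_all only: r_def)
      have YX: "Y \<subseteq> X"
        using that Z by auto
      show ?thesis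
        using frag_map_evm[OF V fZ that(1) u] frag_map_evm[OF V fpZ image_mono[OF that(1)] v]
          mor_restrict_natural[OF V fZ that(1) inj[OF Z] frag_eval_closed[OF ab(1)[OF YX] u]] e
        by (simp add: r_def f_def)
    qed
    show "\<exists>v\<in>frag_over V (whole_sub V) (p ` Z). r Z u v" if "u \<in> frag_over V (whole_sub V) Z" for u
    proof -
      have u: "u \<in> fset (carrier (obj V Z))"
        using that by (simp add: frag_over_iff fZ)
      have "f Z (frag_eval (obj V Z) u) \<in> carrier (obj V (p ` Z))"
        by (rule module_homD(1)[OF f[OF Z] frag_eval_closed[OF ab(1)[OF Z] u]])
      then show ?thesis
        using u by (intro bexI[of _ "frag_of (f Z (frag_eval (obj V Z) u))"])
          (simp_all add: r_def frag_over_tot_iff[OF V fpZ] frag_eval(2)[OF ab(2)[OF Z]])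
    qed
    show "\<exists>u\<in>frag_over V (whole_sub V) Z. r Z u v" if "v \<in> frag_over V (whole_sub V) (p ` Z)" for v
    proof -
      have v: "v \<in> fset (carrier (obj V (p ` Z)))"
        using that by (simp add: frag_over_iff fpZ)
      let ?w = "mor V (p ` Z) Z (restrict (inv_into Z p) (p ` Z)) (frag_eval (obj V (p ` Z)) v)"
      note inv = mor_restrict_inverse(2,3)[OF V fZ inj[OF Z] frag_eval_closed[OF ab(2)[OF Z] v]]
      show ?thesis
        using inv v by (intro bexI[of _ "frag_of ?w"])
          (simp_all add: r_def f_def frag_over_tot_iff[OF V fZ] frag_eval(2)[OF ab(1)[OF Z]])
    qed
    show "u \<in> frag_over V (zero_sub V) Z \<longleftrightarrow> v \<in> frag_over V (zero_sub V) (p ` Z)" if "r Z u v" for u v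
    proof -
      have u: "u \<in> fset (carrier (obj V Z))" and v: "v \<in> fset (carrier (obj V (p ` Z)))"
        and e: "f Z (frag_eval (obj V Z) u) = frag_eval (obj V (p ` Z)) v"
        using that by (simp_all only: r_def)
      have "f Z w = \<zero>\<^bsub>obj V (p ` Z)\<^esub> \<longleftrightarrow> w = \<zero>\<^bsub>obj V Z\<^esub>" if w: "w \<in> carrier (obj V Z)" for w
      proof
        assume "f Z w = \<zero>\<^bsub>obj V (p ` Z)\<^esub>"
        moreover have "f Z \<zero>\<^bsub>obj V Z\<^esub> = \<zero>\<^bsub>obj V (p ` Z)\<^esub>"
          by (rule hz)
        moreover have "\<zero>\<^bsub>obj V Z\<^esub> \<in> carrier (obj V Z)"
          using fi_subsysD(1,2)[OF fi_subsys_triv[OF V] fZ] by auto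
        ultimately show "w = \<zero>\<^bsub>obj V Z\<^esub>"
          using mor_restrict_inverse(1)[OF V fZ inj[OF Z]] w unfolding f_def by metis
      qed (simp add: hz)
      then show ?thesis
        using u v e[symmetric] frag_eval_closed[OF ab(1)[OF Z] u] by (simp add: frag_over_iff fZ fpZ zero_sub_def)
    qed
  qed
  then show ?thesis
    unfolding fi_koszul_zero_def by (rule koszul_zero_relabel[OF p])
qed

text \<open>The element of a given rank in \<open>X\<close> goes to the element of the same rank in
  \<open>Y\<close>.\<close>

lemma ex_strict_mono_on:
  fixes X Y :: "nat set"
  assumes "finite X" "finite Y" "card X = card Y"
  shows "\<exists>p. strict_mono_on X p \<and> p ` X = Y"
proof -
  define p where "p x = sorted_list_of_set Y ! card {y \<in> X. y < x}" for x
  have rank: "card {y \<in> X. y < x} < card X" if "x \<in> X" for x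
    using assms(1) that by (intro psubset_card_mono) auto
  have mono: "strict_mono_on X p"
  proof (rule strict_mono_onI)
    fix a b assume ab: "a \<in> X" "b \<in> X" "a < b"
    have "card {y \<in> X. y < a} < card {y \<in> X. y < b}"
      using assms(1) ab by (intro psubset_card_mono) auto
    then show "p a < p b"
      unfolding p_def using rank[OF ab(2)] assms
      by (intro sorted_wrt_nth_less[OF strict_sorted_list_of_set]) auto
  qed
  have "p ` X \<subseteq> Y"
    unfolding p_def using rank assms nth_mem[of _ "sorted_list_of_set Y"] by auto
  moreover have "card (p ` X) = card Y"
    using card_image[OF strict_mono_on_imp_inj_on[OF mono]] assms by simp
  ultimately have "p ` X = Y"
    using assms(2) card_subset_eq by blast
  with mono show ?thesis by blast
qed

text \<open>This links \<open>fi_deg\<close>, which evaluates at the sets \<open>{1..n}\<close>,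
  with the cone arguments, which produce vanishing and non-vanishing at arbitrary finite
  sets.\<close>

lemma fi_koszul_zero_card_cong:
  assumes "fi_module R V" "finite X" "finite Y" "card X = card Y"
  shows "fi_koszul_zero V (whole_sub V) (zero_sub V) a X \<longleftrightarrow> fi_koszul_zero V (whole_sub V) (zero_sub V) a Y"
proof -
  obtain p where p: "strict_mono_on X p" "p ` X = Y"
    using ex_strict_mono_on[OF assms(2-4)] by blast
  obtain q where q: "strict_mono_on Y q" "q ` Y = X"
    using ex_strict_mono_on[OF assms(3,2) assms(4)[symmetric]] by blast
  show ?thesis
    using fi_koszul_zero_relabel[OF assms(1,2) p(1)] fi_koszul_zero_relabel[OF assms(1,3) q(1)] p q by auto
qed

section \<open>Transpositions acting on formal sums\<close>

definition frag_transp :: "('k, 'a) fi_mod \<Rightarrow> nat \<Rightarrow> nat \<Rightarrow> nat set \<Rightarrow> ('a \<Rightarrow>\<^sub>0 int) \<Rightarrow> ('a \<Rightarrow>\<^sub>0 int)" where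
  "frag_transp V x y Z = (if finite Z
     then frag_extend (frag_of \<circ> mor V Z (transpose x y ` Z) (restrict (transpose x y) Z)) else (\<lambda>_. 0))"

lemma frag_transp_evm:
  assumes V: "fi_module R V" and Z: "finite Z" and u: "u \<in> fset (carrier (obj V Z))"
  shows "frag_transp V x y Z u \<in> fset (carrier (obj V (transpose x y ` Z)))"
    and "frag_eval (obj V (transpose x y ` Z)) (frag_transp V x y Z u) =
      mor V Z (transpose x y ` Z) (restrict (transpose x y) Z) (frag_eval (obj V Z) u)"
  using frag_eval_hom[OF fi_moduleD(1)[OF V Z] fi_moduleD(1)[OF V finite_imageI[OF Z]]
      fi_moduleD(2)[OF V Z finite_imageI[OF Z] restrict_FI_mor[OF inj_on_transpose]] u] Z
  by (simp_all add: frag_transp_def)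

lemma transp_inv_swp:
  assumes V: "fi_module R V" and K: "fi_subsys V K"
  shows "transp_inv UNIV (frag_transp V) (frag_over V K)"
  unfolding transp_inv_def
proof (intro ballI impI allI)
  fix x y :: nat and Z u assume u: "u \<in> frag_over V K Z"
  show "frag_transp V x y Z u \<in> frag_over V K (transpose x y ` Z)"
  proof (cases "finite Z")
    case True
    have uc: "u \<in> fset (carrier (obj V Z))" "frag_eval (obj V Z) u \<in> K Z"
      using u by (simp_all add: frag_over_iff True)
    show ?thesis
      using frag_transp_evm[OF V True uc(1), of x y]
        fi_subsysD(4)[OF K True finite_imageI[OF True] restrict_FI_mor[OF inj_on_transpose] uc(2), of x y] True
      by (simp add: frag_over_iff)
  next
    case False
    moreover have "infinite (transpose x y ` Z)"
      using False by (simp add: finite_image_iff[OF inj_on_transpose])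
    ultimately show ?thesis
      by (simp add: frag_transp_def frag_over_def)
  qed
qed

lemma transp_action_swp:
  assumes V: "fi_module R V"
  shows "transp_action UNIV (frag_map V) (frag_transp V) (frag_over V (whole_sub V))"
  unfolding transp_action_def
proof (intro ballI impI conjI allI)
  fix x y :: nat assume xy: "x \<noteq> y"
  show "additive (frag_transp V x y Z)" for Z
    by (auto simp: frag_transp_def additive_frag_extend intro: additive.intro)
  show "frag_transp V x y Z u \<in> frag_over V (whole_sub V) (transpose x y ` Z)" if "u \<in> frag_over V (whole_sub V) Z" for Z u
    using transp_inv_swp[OF V fi_subsys_tot[OF V]] that xy unfolding transp_inv_def by blast
  show "frag_transp V x y X (frag_map V Y X u) = frag_map V (transpose x y ` Y) (transpose x y ` X) (frag_transp V x y Y u)"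
    if u: "u \<in> frag_over V (whole_sub V) Y" and YX: "Y \<subseteq> X" for X Y u
  proof (cases "finite X")
    case True
    have fY: "finite Y"
      using True YX finite_subset by blast
    have "frag_transp V x y X (frag_map V Y X u) =
        frag_extend ((frag_of \<circ> mor V X (transpose x y ` X) (restrict (transpose x y) X)) \<circ> mor V Y X (inc Y)) u"
      using True YX by (simp add: frag_transp_def frag_map_def frag_extend_compose)
    also have "\<dots> = frag_extend ((frag_of \<circ> mor V (transpose x y ` Y) (transpose x y ` X) (inc (transpose x y ` Y))) \<circ>
        mor V Y (transpose x y ` Y) (restrict (transpose x y) Y)) u"
    proof (rule frag_extend_eq)
      fix v assume "v \<in> Poly_Mapping.keys u"
      then have "v \<in> carrier (obj V Y)"
        using u by (auto simp: frag_over_iff fY)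
      then show "((frag_of \<circ> mor V X (transpose x y ` X) (restrict (transpose x y) X)) \<circ> mor V Y X (inc Y)) v =
          ((frag_of \<circ> mor V (transpose x y ` Y) (transpose x y ` X) (inc (transpose x y ` Y))) \<circ>
          mor V Y (transpose x y ` Y) (restrict (transpose x y) Y)) v"
        using mor_restrict_natural[OF V True YX inj_on_transpose] by simp
    qed
    also have "\<dots> = frag_map V (transpose x y ` Y) (transpose x y ` X) (frag_transp V x y Y u)"
      using True YX fY by (simp add: frag_transp_def frag_map_def frag_extend_compose image_mono)
    finally show ?thesis .
  next
    case False
    moreover have "infinite (transpose x y ` X)"
      using False by (simp add: finite_image_iff[OF inj_on_transpose])
    ultimately show ?thesis
      by (simp add: frag_transp_def frag_map_def)
  qed
  show "frag_transp V x y Z u = u" if u: "u \<in> frag_over V (whole_sub V) Z" and Z: "x \<notin> Z" "y \<notin> Z" for Z u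
  proof (cases "finite Z")
    case True
    have id: "transpose x y z = z" if "z \<in> Z" for z
      using that Z by (metis transpose_apply_other)
    then have "transpose x y ` Z = Z" "restrict (transpose x y) Z = inc Z"
      by (auto simp: fun_eq_iff)
    then show ?thesis
      using u fi_moduleD(3)[OF V True] True by (auto simp: frag_transp_def frag_over_iff intro!: frag_extend_of_id)
  next
    case False
    then show ?thesis
      using u by (simp add: frag_transp_def frag_over_def)
  qed
qed

section \<open>Degrees of homology in terms of Koszul vanishing\<close>

lemma fi_hd_le_iff:
  assumes "cring R" "fi_module R V"
  shows "fi_hd R a V \<le> ereal (real k) \<longleftrightarrow> (\<forall>X. finite X \<longrightarrow> k < card X \<longrightarrow> fi_koszul_zero V (whole_sub V) (zero_sub V) a X)"
proof -
  have "fi_hd R a V \<le> ereal (real k) \<longleftrightarrow> (\<forall>n. \<not> fi_koszul_zero V (whole_sub V) (zero_sub V) a {1..n} \<longrightarrow> n \<le> k)"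
    unfolding fi_hd_def fi_deg_def SUP_le_iff
    using fi_H_trivial_iff[OF assms, of "{1..n}" a for n] by auto
  also have "\<dots> \<longleftrightarrow> (\<forall>X. finite X \<longrightarrow> k < card X \<longrightarrow> fi_koszul_zero V (whole_sub V) (zero_sub V) a X)"
  proof
    assume L: "\<forall>n. \<not> fi_koszul_zero V (whole_sub V) (zero_sub V) a {1..n} \<longrightarrow> n \<le> k"
    show "\<forall>X. finite X \<longrightarrow> k < card X \<longrightarrow> fi_koszul_zero V (whole_sub V) (zero_sub V) a X"
    proof (intro allI impI)
      fix X :: "nat set" assume X: "finite X" "k < card X"
      then have "fi_koszul_zero V (whole_sub V) (zero_sub V) a {1..card X}"
        using L leD by blast
      then show "fi_koszul_zero V (whole_sub V) (zero_sub V) a X"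
        using fi_koszul_zero_card_cong[OF assms(2) X(1), of "{1..card X}" a] by simp
    qed
  next
    assume R: "\<forall>X. finite X \<longrightarrow> k < card X \<longrightarrow> fi_koszul_zero V (whole_sub V) (zero_sub V) a X"
    show "\<forall>n. \<not> fi_koszul_zero V (whole_sub V) (zero_sub V) a {1..n} \<longrightarrow> n \<le> k"
    proof (intro allI impI)
      fix n assume n: "\<not> fi_koszul_zero V (whole_sub V) (zero_sub V) a {1..n}"
      show "n \<le> k"
        using R[rule_format, of "{1..n}"] n by fastforce
    qed
  qed
  finally show ?thesis .
qed

lemma fi_hd_ge:
  assumes "cring R" "fi_module R V" "finite X" "\<not> fi_koszul_zero V (whole_sub V) (zero_sub V) a X"
  shows "ereal (real (card X)) \<le> fi_hd R a V"
proof -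
  have "\<not> fi_koszul_zero V (whole_sub V) (zero_sub V) a {1..card X}"
    using assms(4) fi_koszul_zero_card_cong[OF assms(2,3), of "{1..card X}" a] by simp
  then show ?thesis
    unfolding fi_hd_def fi_deg_def
    by (intro SUP_upper) (simp add: fi_H_trivial_iff[OF assms(1,2)])
qed

text \<open>For positive degree the cardinalities of sets with nonzero homology form a finite
  nonempty set, so the degree is attained, and at some strictly larger set the next homology is
  nonzero. V is treated as the quotient of P by the image \<open>K\<close> of W.\<close>

theorem theorem21:
  fixes R :: "('k, 'r) ring_scheme" and V :: "('k, 'a) fi_mod" and k d :: nat
  assumes "cring R"
    and "fi_module R V"
    and "fi_generated_related TYPE('p) TYPE('w) R V k d"
    and "\<not> fi_acyclic R V"
  shows "\<forall>a\<ge>1. fi_hd R a V < fi_hd R (Suc a) V"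
proof -
  obtain P :: "('k, 'p) fi_mod" and W :: "('k, 'w) fi_mod" and \<iota> \<pi>
    where ses: "fi_short_exact R W P V \<iota> \<pi>" and proj: "fi_projective R P"
      and genP: "fi_generated R P k" and genW: "fi_generated R W d"
    using assms(3) unfolding fi_generated_related_def by blast
  have P: "fi_module R P" and W: "fi_module R W" and i: "fi_map R W P \<iota>" and p: "fi_map R P V \<pi>"
    and inj: "\<And>X. finite X \<Longrightarrow> inj_on (\<iota> X) (carrier (obj W X))"
    and exact: "\<And>X. finite X \<Longrightarrow> \<iota> X ` carrier (obj W X) = fi_ker P V \<pi> X"
    and surj: "\<And>X. finite X \<Longrightarrow> \<pi> X ` carrier (obj P X) = carrier (obj V X)"
    using ses by (auto simp: fi_short_exact_def fi_inj_def fi_exact_def fi_surj_def fi_im_def)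
  note V = assms(2)
  define K where "K X = \<iota> X ` carrier (obj W X)" for X
  have K: "fi_subsys P K"
    using fi_subsys_image[OF W P i] by (simp add: K_def[abs_def])
  let ?i = "frag_map P" and ?L = "frag_over P (whole_sub P)" and ?N = "frag_over P (zero_sub P)" and ?M = "frag_over P K"
  have kV: "koszul_zero ?i ?L ?M a X \<longleftrightarrow> fi_koszul_zero V (whole_sub V) (zero_sub V) a X" if X: "finite X" for a X
    unfolding fi_koszul_zero_def[symmetric]
  proof (rule fi_koszul_zero_map[OF P V p fi_subsys_tot[OF P] fi_subsys_tot[OF V] X])
    fix Z :: "nat set" assume Z: "finite Z"
    show "\<pi> Z ` whole_sub P Z = whole_sub V Z"
      using surj[OF Z] by (simp add: whole_sub_def)
    show "\<pi> Z v \<in> zero_sub V Z \<longleftrightarrow> v \<in> K Z" if "v \<in> whole_sub P Z" for v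
      using exact[OF Z] that by (simp add: K_def zero_sub_def whole_sub_def fi_ker_def a_kernel_def')
    show "K Z \<subseteq> whole_sub P Z"
      using fi_subsysD(1)[OF K Z] by (simp add: whole_sub_def)
    show "zero_sub V Z \<subseteq> whole_sub V Z"
      using fi_subsysD(1)[OF fi_subsys_triv[OF V] Z] by (simp add: whole_sub_def)
  qed
  have kW: "fi_koszul_zero W (whole_sub W) (zero_sub W) a X \<longleftrightarrow> koszul_zero ?i ?M ?N a X" if X: "finite X" for a X
    unfolding fi_koszul_zero_def[symmetric, of P]
  proof (rule fi_koszul_zero_map[OF W P i fi_subsys_tot[OF W] K X])
    fix Z :: "nat set" assume Z: "finite Z"
    show "\<iota> Z ` whole_sub W Z = K Z"
      by (simp add: K_def whole_sub_def)
    note z = module_hom_zero[OF fi_moduleD(1)[OF W Z] fi_moduleD(1)[OF P Z] fi_mapD(1)[OF i Z]]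
    show "\<iota> Z v \<in> zero_sub P Z \<longleftrightarrow> v \<in> zero_sub W Z" if "v \<in> whole_sub W Z" for v
      using inj_on_eq_iff[OF inj[OF Z], of v "\<zero>\<^bsub>obj W Z\<^esub>"] that z fi_subsysD(1)[OF fi_subsys_triv[OF W] Z]
      by (simp add: zero_sub_def whole_sub_def)
    show "zero_sub W Z \<subseteq> whole_sub W Z"
      using fi_subsysD(1)[OF fi_subsys_triv[OF W] Z] by (simp add: whole_sub_def)
    show "zero_sub P Z \<subseteq> K Z"
      using fi_subsysD(2)[OF K Z] by (simp add: zero_sub_def)
  qed
  obtain q where q: "retractive UNIV ?i q ?L ?N"
    using projective_retractive[OF assms(1) proj] by blast
  note pN = functor_pair_lift[OF P fi_subsys_triv[OF P]] and pM = functor_pair_lift[OF P K]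
  have NM: "?N Y \<subseteq> ?M Y" for Y
    using fi_subsysD(2)[OF K] by (intro frag_over_mono) (auto simp: zero_sub_def)
  \<comment> \<open>The successors turn the bounds of \<open>fi_generated\<close>, which include the
    degree itself, into the strict ones of \<open>gen_below\<close>.\<close>
  have gP: "gen_below UNIV ?i ?L ?N (Suc k)"
    using genP fi_hd_le_iff[OF assms(1) P, of 0 k] by (simp add: gen_below_def fi_generated_def fi_koszul_zero_def Suc_le_eq)
  have gW: "gen_below UNIV ?i ?M ?N (Suc d)"
    using genW fi_hd_le_iff[OF assms(1) W, of 0 d] kW by (simp add: gen_below_def fi_generated_def Suc_le_eq)
  \<comment> \<open>The constant of \<open>nagpal\<close> for the strict bounds \<open>Suc k\<close>
    and \<open>Suc d\<close>.\<close>
  let ?n = "Suc k * Suc d"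
  have shifted: "koszul_zero (shift_map A ?i) (shift_obj A ?L) (shift_obj A ?M) (Suc a) X"
    if "finite A" "card A = ?n" "finite X" "A \<inter> X = {}" for A X a
    by (rule nagpal[OF pN functor_pairD(3)[OF pM] NM functor_pairD(4)[OF pM] q transp_action_swp[OF P] transp_inv_swp[OF P K] gP gW]) (use that in auto)
  have acyclic: "koszul_zero ?i ?L ?M (Suc a) X" if one: "\<And>X. finite X \<Longrightarrow> koszul_zero ?i ?L ?M (Suc 0) X" and X: "finite X" for a X
  proof -
    \<comment> \<open>V is its own shift by the empty set, which lacks \<open>?n\<close> points to
      an acyclic shift.\<close>
    have "koszul_zero (shift_map {} ?i) (shift_obj {} ?L) (shift_obj {} ?M) (Suc a) X"
    proof (rule koszul_zero_acyclic_shifted[where n = ?n and j = ?n, OF pM])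
      show "koszul_zero (shift_map A ?i) (shift_obj A ?L) (shift_obj A ?M) (Suc a) X"
        if "finite A" "card A = ?n" "finite X" "A \<inter> X = {}" for A X a
        by (rule shifted[OF that])
    qed (use one X in auto)
    then show ?thesis by simp
  qed
  have increase: "\<exists>Y. finite Y \<and> X \<subset> Y \<and> \<not> koszul_zero ?i ?L ?M (Suc (Suc a)) Y"
    if X: "finite X" "\<not> koszul_zero ?i ?L ?M (Suc a) X" for a X
  proof -
    have "\<exists>Y. finite Y \<and> X \<subset> Y \<and> {} \<inter> Y = {} \<and> \<not> koszul_zero (shift_map {} ?i) (shift_obj {} ?L) (shift_obj {} ?M) (Suc (Suc a)) Y"
    proof (rule koszul_zero_increase_shifted[where n = ?n and j = ?n, OF pM])
      show "koszul_zero (shift_map A ?i) (shift_obj A ?L) (shift_obj A ?M) (Suc a) X"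
        if "finite A" "card A = ?n" "finite X" "A \<inter> X = {}" for A X a
        by (rule shifted[OF that])
    qed (use X in auto)
    then show ?thesis by simp
  qed
  have increaseV: "\<exists>Y. finite Y \<and> X \<subset> Y \<and> \<not> fi_koszul_zero V (whole_sub V) (zero_sub V) (Suc (Suc a)) Y"
    if X: "finite X" "\<not> fi_koszul_zero V (whole_sub V) (zero_sub V) (Suc a) X" for a X
  proof -
    have "\<not> koszul_zero ?i ?L ?M (Suc a) X"
      using X(2) kV[OF X(1)] by simp
    from increase[OF X(1) this] obtain Y where Y: "finite Y" "X \<subset> Y" "\<not> koszul_zero ?i ?L ?M (Suc (Suc a)) Y"
      by (elim exE conjE)
    then have "\<not> fi_koszul_zero V (whole_sub V) (zero_sub V) (Suc (Suc a)) Y"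
      using kV[OF Y(1)] by simp
    with Y(1,2) show ?thesis
      by (intro exI conjI)
  qed
  have nonzero: "\<exists>X. finite X \<and> \<not> fi_koszul_zero V (whole_sub V) (zero_sub V) (Suc a) X" for a
  proof (induct a)
    case 0
    show ?case
    proof (rule ccontr)
      assume "\<not> ?case"
      then have V1: "koszul_zero ?i ?L ?M (Suc 0) X" if "finite X" for X
        using that kV by blast
      have all: "fi_koszul_zero V (whole_sub V) (zero_sub V) (Suc a) X" if "finite X" for a X
        using acyclic[OF V1 that] kV[OF that] by blast
      have "fi_acyclic R V"
        unfolding fi_acyclic_def
      proof (intro allI impI)
        fix a :: nat and X :: "nat set" assume "1 \<le> a" "finite X"
        then show "carrier (obj (fi_H R a V) X) = {\<zero>\<^bsub>obj (fi_H R a V) X\<^esub>}"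
          using all[of X "a - 1"] fi_H_trivial_iff[OF assms(1) V, of X a] by simp
      qed
      with assms(4) show False ..
    qed
  next
    case (Suc a)
    then obtain X where X: "finite X" "\<not> fi_koszul_zero V (whole_sub V) (zero_sub V) (Suc a) X"
      by blast
    then show ?case
      using increaseV[OF X] by blast
  qed
  have bounded: "\<exists>D. \<forall>X. finite X \<longrightarrow> D \<le> card X \<longrightarrow> fi_koszul_zero V (whole_sub V) (zero_sub V) (Suc a) X" for a
  proof -
    \<comment> \<open>H_1(V) embeds in H_0(W), since P is acyclic, and H_0(W) vanishes above degree
      \<open>d\<close>.\<close>
    have one: "koszul_zero ?i ?L ?M (Suc 0) X" if X: "finite X" "Suc d \<le> card X" for X
    proof (rule koszul_zero_les3[OF X(1) functor_pairD(1-3)[OF pM] functor_pairD(3)[OF pN] NM functor_pairD(4)[OF pM]])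
      show "koszul_zero ?i ?L ?N (Suc 0) X"
        by (rule koszul_zero_retractive[OF X(1) q pN]) simp
      show "koszul_zero ?i ?M ?N 0 X"
        using gW X by (simp add: gen_below_def)
    qed
    have "\<exists>D. \<forall>A. finite A \<longrightarrow> card A + ?n = ?n \<longrightarrow>
      (\<forall>X. finite X \<longrightarrow> A \<inter> X = {} \<longrightarrow> Suc d \<le> card X \<longrightarrow> koszul_zero (shift_map A ?i) (shift_obj A ?L) (shift_obj A ?M) (Suc 0) X) \<longrightarrow>
      (\<forall>X. finite X \<longrightarrow> A \<inter> X = {} \<longrightarrow> D \<le> card X \<longrightarrow> koszul_zero (shift_map A ?i) (shift_obj A ?L) (shift_obj A ?M) (Suc a) X)"
    proof (rule koszul_zero_bounded_shifted[where n = ?n and j = ?n and d = "Suc d" and a = a, OF pM])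
      show "koszul_zero (shift_map A ?i) (shift_obj A ?L) (shift_obj A ?M) (Suc a) X"
        if "finite A" "card A = ?n" "finite X" "A \<inter> X = {}" for A X a
        by (rule shifted[OF that])
    qed
    then obtain D where D: "\<forall>A. finite A \<longrightarrow> card A + ?n = ?n \<longrightarrow>
      (\<forall>X. finite X \<longrightarrow> A \<inter> X = {} \<longrightarrow> Suc d \<le> card X \<longrightarrow> koszul_zero (shift_map A ?i) (shift_obj A ?L) (shift_obj A ?M) (Suc 0) X) \<longrightarrow>
      (\<forall>X. finite X \<longrightarrow> A \<inter> X = {} \<longrightarrow> D \<le> card X \<longrightarrow> koszul_zero (shift_map A ?i) (shift_obj A ?L) (shift_obj A ?M) (Suc a) X)"
      by (elim exE)
    have "fi_koszul_zero V (whole_sub V) (zero_sub V) (Suc a) X" if "finite X" "D \<le> card X" for X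
      using D[THEN spec[of _ "{}"]] one that kV[OF that(1), of "Suc a"] by simp
    then show ?thesis
      by blast
  qed
  show ?thesis
  proof (intro allI impI)
    fix a :: nat assume "1 \<le> a"
    then obtain b where a: "a = Suc b"
      by (metis Suc_le_D One_nat_def)
    \<comment> \<open>The maximum of \<open>S\<close> is the degree of H_{b+1}, attained at some
      \<open>X\<close>; \<open>S\<close> is finite by \<open>bounded\<close> and nonempty by
      \<open>nonzero\<close>.\<close>
    define S where "S = {card X | X. finite X \<and> \<not> fi_koszul_zero V (whole_sub V) (zero_sub V) (Suc b) X}"
    obtain D where D: "\<And>X. finite X \<Longrightarrow> D \<le> card X \<Longrightarrow> fi_koszul_zero V (whole_sub V) (zero_sub V) (Suc b) X"
      using bounded by blast
    have "S \<subseteq> {..D}"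
      unfolding S_def using D nat_le_linear by fastforce
    then have fS: "finite S"
      by (rule finite_subset) simp
    have "S \<noteq> {}"
      using nonzero[of b] by (auto simp: S_def)
    then have "Max S \<in> S"
      using fS by simp
    moreover have "\<exists>X. finite X \<and> card X = m \<and> \<not> fi_koszul_zero V (whole_sub V) (zero_sub V) (Suc b) X" if "m \<in> S" for m
      using that by (auto simp: S_def)
    ultimately obtain X where X: "finite X" "card X = Max S" "\<not> fi_koszul_zero V (whole_sub V) (zero_sub V) (Suc b) X"
      by meson
    have "fi_hd R (Suc b) V \<le> ereal (real (Max S))"
      unfolding fi_hd_le_iff[OF assms(1) V]
    proof (intro allI impI, rule ccontr)
      fix Y :: "nat set" assume "finite Y" "Max S < card Y" "\<not> fi_koszul_zero V (whole_sub V) (zero_sub V) (Suc b) Y"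
      then have "card Y \<in> S"
        by (auto simp: S_def)
      from Max_ge[OF fS this] \<open>Max S < card Y\<close> show False
        by simp
    qed
    moreover obtain Y where Y: "finite Y" "X \<subset> Y" "\<not> fi_koszul_zero V (whole_sub V) (zero_sub V) (Suc (Suc b)) Y"
      using increaseV[OF X(1,3)] by blast
    moreover have "ereal (real (Max S)) < ereal (real (card Y))"
      using psubset_card_mono[OF Y(1,2)] X(2) by simp
    moreover have "ereal (real (card Y)) \<le> fi_hd R (Suc (Suc b)) V"
      by (rule fi_hd_ge[OF assms(1) V Y(1,3)])
    ultimately show "fi_hd R a V < fi_hd R (Suc a) V"
      unfolding a by (meson less_le_trans le_less_trans)
  qed
qed

end
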